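(* Let $G$ be either $G_a$ (the additive group) or $H_1$ (the Heisenberg group of $3\times3$ unipotent upper triangular matrices). Let $(k_i)$ be a sequence of fields of strictly increasing positive characteristic, fix a non-principal ultrafilter $\mathcal U$ on the index set, and let $k=\prod_{\mathcal U}k_i$ be the ultraproduct of the fields $k_i$. Then the height-restricted ultraproduct $\prod_H\mathrm{Rep}_{k_i}G$ is tensorially equivalent to $\mathrm{Rep}_kG^\infty$, where $G^\infty$ denotes a countable direct power of $G$. Similarly, for any $n\in\mathbb N$, $\prod_{H\le n}\mathrm{Rep}_{k_i}G$ is tensorially equivalent to $\mathrm{Rep}_kG^n$.
   Context: $\mathrm{Rep}_kG$ is the category of finite dimensional representations of $G$ over $k$. The Hopf algebra of $G_a$ is $k[x]$ with $\Delta(x)=1\otimes x+x\otimes1$; that of $H_1$ is $k[x,y,z]$ with $x,y$ primitive and $\Delta(z)=1\otimes z+x\otimes y+z\otimes1$. $G^\infty$ is the direct product of countably many copies of $G$, with Hopf algebra the infinite tensor power (a polynomial algebra in countably many variables). **Height.** Let $k$ have characteristic $p>0$ and write the Hopf algebra of $G$ as $k[x_1,\dots,x_r]$. The height of a representation $M$ of $G$ over $k$ is the largest $m$ such that, for some $j$, the monomial $x_j^{p^{m-1}}$ occurs in the matrix formula $(a_{ij})$ of $M$ (where $\rho(e_j)=\sum_ie_i\otimes a_{ij}$ in a basis); it is $0$ if no such monomial occurs. It does not depend on the basis. **Ultraproducts.** The ultraproduct $\prod_{\mathcal U}\mathrm{Rep}_{k_i}G$ has as objects and morphisms the classes $[X_i]$,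 $[\phi_i]$ of tuples of objects, resp. morphisms, modulo equality on a set in $\mathcal U$; composition, addition, tensor product and the associativity, commutativity and unit isomorphisms are componentwise. (The categories are taken to be small, up to tensor equivalence.) The restricted ultraproduct $\prod_R\mathrm{Rep}_{k_i}G$ is its full subcategory of objects $[X_i]$ with $\dim X_i$ bounded on a set in $\mathcal U$. The height of $[X_i]$ in $\prod_R\mathrm{Rep}_{k_i}G$ is the essential supremum (modulo $\mathcal U$) of the heights of the $X_i$. $\prod_H\mathrm{Rep}_{k_i}G$ is the full subcategory of $\prod_R\mathrm{Rep}_{k_i}G$ of objects of finite height, and $\prod_{H\le n}\mathrm{Rep}_{k_i}G$ is the full subcategory of objects of height at most $n$. "Tensorially equivalent" means there is an equivalence of $k$-linear abelian categories compatible with tensor products (a tensor functor that is an equivalence). *)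

theory Defs
  imports
    "HOL-Algebra.Indexed_Polynomials"
    "HOL-Algebra.Multiplicative_Group"
    "HOL-Library.Extended_Nat"
    "HOL-Library.Liminf_Limsup"
    "Jordan_Normal_Form.Matrix"
begin

text \<open>Otherwise the identifier \<open>X\<close> is the polynomial indeterminate of HOL-Algebra.\<close>

no_notation var (\<open>X\<index>\<close>)

section \<open>Linear tensor categories\<close>

text \<open>Categories are given by a set of objects and one global set of arrows, so that an arrow
  determines its domain and codomain. The associativity isomorphism goes
  from \<open>(X \<otimes> Y) \<otimes> Z\<close> to \<open>X \<otimes> (Y \<otimes> Z)\<close>, and \<open>Cmp C g f\<close> is \<open>g\<close> after \<open>f\<close>.\<close>

record ('o, 'm, 's) tcat =
  Ob :: "'o set"
  Ar :: "'m set"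
  Dm :: "'m \<Rightarrow> 'o"
  Cd :: "'m \<Rightarrow> 'o"
  Idt :: "'o \<Rightarrow> 'm"
  Cmp :: "'m \<Rightarrow> 'm \<Rightarrow> 'm"
  Zer :: "'o \<Rightarrow> 'o \<Rightarrow> 'm"
  Pls :: "'m \<Rightarrow> 'm \<Rightarrow> 'm"
  Scl :: "'s \<Rightarrow> 'm \<Rightarrow> 'm"
  TnO :: "'o \<Rightarrow> 'o \<Rightarrow> 'o"
  TnA :: "'m \<Rightarrow> 'm \<Rightarrow> 'm"
  Unt :: "'o"
  Asc :: "'o \<Rightarrow> 'o \<Rightarrow> 'o \<Rightarrow> 'm"
  Com :: "'o \<Rightarrow> 'o \<Rightarrow> 'm"
  Lun :: "'o \<Rightarrow> 'm"
  Run :: "'o \<Rightarrow> 'm"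

definition Hom :: "('o, 'm, 's) tcat \<Rightarrow> 'o \<Rightarrow> 'o \<Rightarrow> 'm set" where
  "Hom C X Y = {f \<in> Ar C. Dm C f = X \<and> Cd C f = Y}"

definition Isos :: "('o, 'm, 's) tcat \<Rightarrow> 'o \<Rightarrow> 'o \<Rightarrow> 'm set" where
  "Isos C X Y = {f \<in> Hom C X Y. \<exists>g \<in> Hom C Y X. Cmp C g f = Idt C X \<and> Cmp C f g = Idt C Y}"

text \<open>The \<open>mult\<close> and \<open>one\<close> fields play no role in the locale \<open>module\<close>.\<close>

definition hom_module :: "('o, 'm, 's) tcat \<Rightarrow> 'o \<Rightarrow> 'o \<Rightarrow> ('s, 'm) module" where
  "hom_module C X Y =
    \<lparr>carrier = Hom C X Y, monoid.mult = undefined, one = undefined,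
     zero = Zer C X Y, add = Pls C, smult = Scl C\<rparr>"

locale linear_category =
  fixes k :: "'s ring" and C :: "('o, 'm, 's) tcat"
  assumes Dm_closed: "f \<in> Ar C \<Longrightarrow> Dm C f \<in> Ob C"
    and Cd_closed: "f \<in> Ar C \<Longrightarrow> Cd C f \<in> Ob C"
    and Idt_closed: "X \<in> Ob C \<Longrightarrow> Idt C X \<in> Hom C X X"
    and Cmp_closed: "\<lbrakk>f \<in> Hom C X Y; g \<in> Hom C Y Z\<rbrakk> \<Longrightarrow> Cmp C g f \<in> Hom C X Z"
    and Cmp_assoc: "\<lbrakk>f \<in> Hom C W X; g \<in> Hom C X Y; h \<in> Hom C Y Z\<rbrakk> \<Longrightarrow>
      Cmp C h (Cmp C g f) = Cmp C (Cmp C h g) f"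
    and Cmp_Idt_left: "f \<in> Hom C X Y \<Longrightarrow> Cmp C (Idt C Y) f = f"
    and Cmp_Idt_right: "f \<in> Hom C X Y \<Longrightarrow> Cmp C f (Idt C X) = f"
    and Hom_module: "\<lbrakk>X \<in> Ob C; Y \<in> Ob C\<rbrakk> \<Longrightarrow> module k (hom_module C X Y)"
    and Cmp_Pls_left: "\<lbrakk>f \<in> Hom C X Y; g \<in> Hom C Y Z; g' \<in> Hom C Y Z\<rbrakk> \<Longrightarrow>
      Cmp C (Pls C g g') f = Pls C (Cmp C g f) (Cmp C g' f)"
    and Cmp_Pls_right: "\<lbrakk>f \<in> Hom C X Y; f' \<in> Hom C X Y; g \<in> Hom C Y Z\<rbrakk> \<Longrightarrow>
      Cmp C g (Pls C f f') = Pls C (Cmp C g f) (Cmp C g f')"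
    and Cmp_Scl_left: "\<lbrakk>c \<in> carrier k; f \<in> Hom C X Y; g \<in> Hom C Y Z\<rbrakk> \<Longrightarrow>
      Cmp C (Scl C c g) f = Scl C c (Cmp C g f)"
    and Cmp_Scl_right: "\<lbrakk>c \<in> carrier k; f \<in> Hom C X Y; g \<in> Hom C Y Z\<rbrakk> \<Longrightarrow>
      Cmp C g (Scl C c f) = Scl C c (Cmp C g f)"

locale linear_tensor_category = linear_category k C
  for k :: "'s ring" and C :: "('o, 'm, 's) tcat" +
  assumes Unt_closed: "Unt C \<in> Ob C"
    and TnO_closed: "\<lbrakk>X \<in> Ob C; Y \<in> Ob C\<rbrakk> \<Longrightarrow> TnO C X Y \<in> Ob C"
    and TnA_closed: "\<lbrakk>f \<in> Hom C X Y; g \<in> Hom C X' Y'\<rbrakk> \<Longrightarrow>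
      TnA C f g \<in> Hom C (TnO C X X') (TnO C Y Y')"
    and TnA_Idt: "\<lbrakk>X \<in> Ob C; Y \<in> Ob C\<rbrakk> \<Longrightarrow> TnA C (Idt C X) (Idt C Y) = Idt C (TnO C X Y)"
    and TnA_Cmp: "\<lbrakk>f \<in> Hom C X Y; g \<in> Hom C Y Z; f' \<in> Hom C X' Y'; g' \<in> Hom C Y' Z'\<rbrakk> \<Longrightarrow>
      TnA C (Cmp C g f) (Cmp C g' f') = Cmp C (TnA C g g') (TnA C f f')"
    and TnA_Pls_left: "\<lbrakk>f \<in> Hom C X Y; f' \<in> Hom C X Y; g \<in> Hom C X' Y'\<rbrakk> \<Longrightarrow>
      TnA C (Pls C f f') g = Pls C (TnA C f g) (TnA C f' g)"
    and TnA_Pls_right: "\<lbrakk>f \<in> Hom C X Y; g \<in> Hom C X' Y'; g' \<in> Hom C X' Y'\<rbrakk> \<Longrightarrow>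
      TnA C f (Pls C g g') = Pls C (TnA C f g) (TnA C f g')"
    and TnA_Scl_left: "\<lbrakk>c \<in> carrier k; f \<in> Hom C X Y; g \<in> Hom C X' Y'\<rbrakk> \<Longrightarrow>
      TnA C (Scl C c f) g = Scl C c (TnA C f g)"
    and TnA_Scl_right: "\<lbrakk>c \<in> carrier k; f \<in> Hom C X Y; g \<in> Hom C X' Y'\<rbrakk> \<Longrightarrow>
      TnA C f (Scl C c g) = Scl C c (TnA C f g)"
    and Asc_iso: "\<lbrakk>X \<in> Ob C; Y \<in> Ob C; Z \<in> Ob C\<rbrakk> \<Longrightarrow>
      Asc C X Y Z \<in> Isos C (TnO C (TnO C X Y) Z) (TnO C X (TnO C Y Z))"
    and Asc_natural: "\<lbrakk>f \<in> Hom C X X'; g \<in> Hom C Y Y'; h \<in> Hom C Z Z'\<rbrakk> \<Longrightarrow>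
      Cmp C (TnA C f (TnA C g h)) (Asc C X Y Z) = Cmp C (Asc C X' Y' Z') (TnA C (TnA C f g) h)"
    and Com_iso: "\<lbrakk>X \<in> Ob C; Y \<in> Ob C\<rbrakk> \<Longrightarrow> Com C X Y \<in> Isos C (TnO C X Y) (TnO C Y X)"
    and Com_natural: "\<lbrakk>f \<in> Hom C X X'; g \<in> Hom C Y Y'\<rbrakk> \<Longrightarrow>
      Cmp C (TnA C g f) (Com C X Y) = Cmp C (Com C X' Y') (TnA C f g)"
    and Lun_iso: "X \<in> Ob C \<Longrightarrow> Lun C X \<in> Isos C (TnO C (Unt C) X) X"
    and Lun_natural: "f \<in> Hom C X Y \<Longrightarrow>
      Cmp C f (Lun C X) = Cmp C (Lun C Y) (TnA C (Idt C (Unt C)) f)"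
    and Run_iso: "X \<in> Ob C \<Longrightarrow> Run C X \<in> Isos C (TnO C X (Unt C)) X"
    and Run_natural: "f \<in> Hom C X Y \<Longrightarrow>
      Cmp C f (Run C X) = Cmp C (Run C Y) (TnA C f (Idt C (Unt C)))"
    and pentagon: "\<lbrakk>W \<in> Ob C; X \<in> Ob C; Y \<in> Ob C; Z \<in> Ob C\<rbrakk> \<Longrightarrow>
      Cmp C (Asc C W X (TnO C Y Z)) (Asc C (TnO C W X) Y Z) =
      Cmp C (TnA C (Idt C W) (Asc C X Y Z))
        (Cmp C (Asc C W (TnO C X Y) Z) (TnA C (Asc C W X Y) (Idt C Z)))"
    and triangle: "\<lbrakk>X \<in> Ob C; Y \<in> Ob C\<rbrakk> \<Longrightarrow>
      Cmp C (TnA C (Idt C X) (Lun C Y)) (Asc C X (Unt C) Y) = TnA C (Run C X) (Idt C Y)"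
    and hexagon: "\<lbrakk>X \<in> Ob C; Y \<in> Ob C; Z \<in> Ob C\<rbrakk> \<Longrightarrow>
      Cmp C (Asc C Y Z X) (Cmp C (Com C X (TnO C Y Z)) (Asc C X Y Z)) =
      Cmp C (TnA C (Idt C Y) (Com C X Z))
        (Cmp C (Asc C Y X Z) (TnA C (Com C X Y) (Idt C Z)))"
    and symmetry: "\<lbrakk>X \<in> Ob C; Y \<in> Ob C\<rbrakk> \<Longrightarrow>
      Cmp C (Com C Y X) (Com C X Y) = Idt C (TnO C X Y)"

section \<open>Tensor equivalence\<close>

definition is_functor ::
  "('o, 'm, 's) tcat \<Rightarrow> ('p, 'n, 't) tcat \<Rightarrow> ('o \<Rightarrow> 'p) \<Rightarrow> ('m \<Rightarrow> 'n) \<Rightarrow> bool" where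
  "is_functor C D FO FA \<longleftrightarrow>
    (\<forall>X \<in> Ob C. FO X \<in> Ob D) \<and>
    (\<forall>f \<in> Ar C. FA f \<in> Hom D (FO (Dm C f)) (FO (Cd C f))) \<and>
    (\<forall>X \<in> Ob C. FA (Idt C X) = Idt D (FO X)) \<and>
    (\<forall>f \<in> Ar C. \<forall>g \<in> Ar C. Cd C f = Dm C g \<longrightarrow> FA (Cmp C g f) = Cmp D (FA g) (FA f))"

definition is_linear ::
  "'s ring \<Rightarrow> ('o, 'm, 's) tcat \<Rightarrow> ('p, 'n, 's) tcat \<Rightarrow> ('m \<Rightarrow> 'n) \<Rightarrow> bool" where
  "is_linear k C D FA \<longleftrightarrow>
    (\<forall>X \<in> Ob C. \<forall>Y \<in> Ob C. \<forall>f \<in> Hom C X Y. \<forall>g \<in> Hom C X Y. FA (Pls C f g) = Pls D (FA f) (FA g)) \<and>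
    (\<forall>c \<in> carrier k. \<forall>f \<in> Ar C. FA (Scl C c f) = Scl D c (FA f))"

definition natural_iso ::
  "('o, 'm, 's) tcat \<Rightarrow> ('p, 'n, 't) tcat \<Rightarrow> ('o \<Rightarrow> 'p) \<Rightarrow> ('m \<Rightarrow> 'n) \<Rightarrow>
   ('o \<Rightarrow> 'p) \<Rightarrow> ('m \<Rightarrow> 'n) \<Rightarrow> ('o \<Rightarrow> 'n) \<Rightarrow> bool" where
  "natural_iso C D FO FA GO GA \<tau> \<longleftrightarrow>
    (\<forall>X \<in> Ob C. \<tau> X \<in> Isos D (FO X) (GO X)) \<and>
    (\<forall>f \<in> Ar C. Cmp D (GA f) (\<tau> (Dm C f)) = Cmp D (\<tau> (Cd C f)) (FA f))"

definition is_equivalence ::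
  "('o, 'm, 's) tcat \<Rightarrow> ('p, 'n, 't) tcat \<Rightarrow> ('o \<Rightarrow> 'p) \<Rightarrow> ('m \<Rightarrow> 'n) \<Rightarrow> bool" where
  "is_equivalence C D FO FA \<longleftrightarrow> is_functor C D FO FA \<and>
    (\<exists>GO GA. is_functor D C GO GA \<and>
      (\<exists>\<sigma>. natural_iso C C id id (GO \<circ> FO) (GA \<circ> FA) \<sigma>) \<and>
      (\<exists>\<tau>. natural_iso D D (FO \<circ> GO) (FA \<circ> GA) id id \<tau>))"

text \<open>The tensor structure on a functor \<open>F\<close> consists of natural isomorphisms
  \<open>\<mu> X Y\<close> from \<open>F X \<otimes> F Y\<close> to \<open>F (X \<otimes> Y)\<close> and an isomorphism \<open>\<eta>\<close> from the unit object
  to the image of the unit object.\<close>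

definition is_tensor_functor ::
  "('o, 'm, 's) tcat \<Rightarrow> ('p, 'n, 't) tcat \<Rightarrow> ('o \<Rightarrow> 'p) \<Rightarrow> ('m \<Rightarrow> 'n) \<Rightarrow>
   ('o \<Rightarrow> 'o \<Rightarrow> 'n) \<Rightarrow> 'n \<Rightarrow> bool" where
  "is_tensor_functor C D FO FA \<mu> \<eta> \<longleftrightarrow> is_functor C D FO FA \<and>
    \<eta> \<in> Isos D (Unt D) (FO (Unt C)) \<and>
    (\<forall>X \<in> Ob C. \<forall>Y \<in> Ob C. \<mu> X Y \<in> Isos D (TnO D (FO X) (FO Y)) (FO (TnO C X Y))) \<and>
    (\<forall>f \<in> Ar C. \<forall>g \<in> Ar C.
      Cmp D (FA (TnA C f g)) (\<mu> (Dm C f) (Dm C g)) =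
      Cmp D (\<mu> (Cd C f) (Cd C g)) (TnA D (FA f) (FA g))) \<and>
    (\<forall>X \<in> Ob C. \<forall>Y \<in> Ob C. \<forall>Z \<in> Ob C.
      Cmp D (FA (Asc C X Y Z)) (Cmp D (\<mu> (TnO C X Y) Z) (TnA D (\<mu> X Y) (Idt D (FO Z)))) =
      Cmp D (\<mu> X (TnO C Y Z)) (Cmp D (TnA D (Idt D (FO X)) (\<mu> Y Z)) (Asc D (FO X) (FO Y) (FO Z)))) \<and>
    (\<forall>X \<in> Ob C. \<forall>Y \<in> Ob C.
      Cmp D (FA (Com C X Y)) (\<mu> X Y) = Cmp D (\<mu> Y X) (Com D (FO X) (FO Y))) \<and>
    (\<forall>X \<in> Ob C.
      Cmp D (FA (Lun C X)) (Cmp D (\<mu> (Unt C) X) (TnA D \<eta> (Idt D (FO X)))) = Lun D (FO X)) \<and>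
    (\<forall>X \<in> Ob C.
      Cmp D (FA (Run C X)) (Cmp D (\<mu> X (Unt C)) (TnA D (Idt D (FO X)) \<eta>)) = Run D (FO X))"

definition tensor_equivalent ::
  "'s ring \<Rightarrow> ('o, 'm, 's) tcat \<Rightarrow> ('p, 'n, 's) tcat \<Rightarrow> bool" where
  "tensor_equivalent k C D \<longleftrightarrow>
    linear_tensor_category k C \<and> linear_tensor_category k D \<and>
    (\<exists>FO FA \<mu> \<eta>. is_tensor_functor C D FO FA \<mu> \<eta> \<and> is_linear k C D FA \<and> is_equivalence C D FO FA)"

definition full_subcategory :: "('o, 'm, 's) tcat \<Rightarrow> 'o set \<Rightarrow> ('o, 'm, 's) tcat" where
  "full_subcategory C S =
    C\<lparr>Ob := Ob C \<inter> S, Ar := {f \<in> Ar C. Dm C f \<in> S \<and> Cd C f \<in> S}\<rparr>"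

section \<open>Ultraproducts\<close>

definition ultrafilter :: "'i filter \<Rightarrow> bool" where
  "ultrafilter U \<longleftrightarrow> U \<noteq> bot \<and> (\<forall>P. eventually P U \<or> eventually (\<lambda>i. \<not> P i) U)"

definition nonprincipal :: "'i filter \<Rightarrow> bool" where
  "nonprincipal U \<longleftrightarrow> (\<forall>i. U \<noteq> principal {i})"

text \<open>Classes are taken among all tuples, and membership in the components is imposed on the
  carrier of an ultraproduct. Hence \<open>lift\<close> of a componentwise operation never depends on the
  choice of representatives.\<close>

definition ucl :: "'i filter \<Rightarrow> ('i \<Rightarrow> 'b) \<Rightarrow> ('i \<Rightarrow> 'b) set" where
  "ucl U x = {y. eventually (\<lambda>i. y i = x i) U}"

definition urep :: "('i \<Rightarrow> 'b) set \<Rightarrow> 'i \<Rightarrow> 'b" where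
  "urep A = (SOME x. x \<in> A)"

definition uset :: "'i filter \<Rightarrow> ('i \<Rightarrow> 'b set) \<Rightarrow> ('i \<Rightarrow> 'b) set set" where
  "uset U S = {ucl U x | x. \<forall>i. x i \<in> S i}"

definition ulift1 :: "'i filter \<Rightarrow> ('i \<Rightarrow> 'b \<Rightarrow> 'c) \<Rightarrow> ('i \<Rightarrow> 'b) set \<Rightarrow> ('i \<Rightarrow> 'c) set" where
  "ulift1 U f A = ucl U (\<lambda>i. f i (urep A i))"

definition ulift2 :: "'i filter \<Rightarrow> ('i \<Rightarrow> 'b \<Rightarrow> 'c \<Rightarrow> 'd) \<Rightarrow>
    ('i \<Rightarrow> 'b) set \<Rightarrow> ('i \<Rightarrow> 'c) set \<Rightarrow> ('i \<Rightarrow> 'd) set" where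
  "ulift2 U f A B = ucl U (\<lambda>i. f i (urep A i) (urep B i))"

definition ulift3 :: "'i filter \<Rightarrow> ('i \<Rightarrow> 'b \<Rightarrow> 'c \<Rightarrow> 'd \<Rightarrow> 'e) \<Rightarrow>
    ('i \<Rightarrow> 'b) set \<Rightarrow> ('i \<Rightarrow> 'c) set \<Rightarrow> ('i \<Rightarrow> 'd) set \<Rightarrow> ('i \<Rightarrow> 'e) set" where
  "ulift3 U f A B D = ucl U (\<lambda>i. f i (urep A i) (urep B i) (urep D i))"

definition uprod_ring :: "'i filter \<Rightarrow> ('i \<Rightarrow> 'a ring) \<Rightarrow> ('i \<Rightarrow> 'a) set ring" where
  "uprod_ring U K =
    \<lparr>carrier = uset U (\<lambda>i. carrier (K i)),
     monoid.mult = ulift2 U (\<lambda>i x y. x \<otimes>\<^bsub>K i\<^esub> y),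
     one = ucl U (\<lambda>i. \<one>\<^bsub>K i\<^esub>),
     zero = ucl U (\<lambda>i. \<zero>\<^bsub>K i\<^esub>),
     add = ulift2 U (\<lambda>i x y. x \<oplus>\<^bsub>K i\<^esub> y)\<rparr>"

definition uprod_cat :: "'i filter \<Rightarrow> ('i \<Rightarrow> ('o, 'm, 's) tcat) \<Rightarrow>
    (('i \<Rightarrow> 'o) set, ('i \<Rightarrow> 'm) set, ('i \<Rightarrow> 's) set) tcat" where
  "uprod_cat U C =
    \<lparr>Ob = uset U (\<lambda>i. Ob (C i)),
     Ar = uset U (\<lambda>i. Ar (C i)),
     Dm = ulift1 U (\<lambda>i. Dm (C i)),
     Cd = ulift1 U (\<lambda>i. Cd (C i)),
     Idt = ulift1 U (\<lambda>i. Idt (C i)),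
     Cmp = ulift2 U (\<lambda>i. Cmp (C i)),
     Zer = ulift2 U (\<lambda>i. Zer (C i)),
     Pls = ulift2 U (\<lambda>i. Pls (C i)),
     Scl = ulift2 U (\<lambda>i. Scl (C i)),
     TnO = ulift2 U (\<lambda>i. TnO (C i)),
     TnA = ulift2 U (\<lambda>i. TnA (C i)),
     Unt = ucl U (\<lambda>i. Unt (C i)),
     Asc = ulift3 U (\<lambda>i. Asc (C i)),
     Com = ulift2 U (\<lambda>i. Com (C i)),
     Lun = ulift1 U (\<lambda>i. Lun (C i)),
     Run = ulift1 U (\<lambda>i. Run (C i))\<rparr>"

section \<open>Polynomial Hopf algebras\<close>

text \<open>Polynomials are those of \<open>Indexed_Polynomials\<close>: maps from monomials (multisets of
  variables) to coefficients. That theory only has multiplication by a variable; the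
  product below is the usual convolution.\<close>

definition mpoly_ring :: "'a ring \<Rightarrow> 'v set \<Rightarrow> ('v multiset \<Rightarrow> 'a) ring" where
  "mpoly_ring K V =
    \<lparr>carrier = ring.indexed_pset K V (carrier K),
     monoid.mult = (\<lambda>p q m. \<Oplus>\<^bsub>K\<^esub>l\<in>{l. l \<subseteq># m}. p l \<otimes>\<^bsub>K\<^esub> q (m - l)),
     one = ring.indexed_const K \<one>\<^bsub>K\<^esub>,
     zero = ring.indexed_const K \<zero>\<^bsub>K\<^esub>,
     add = ring.indexed_padd K\<rparr>"

text \<open>The \<open>K\<close>-algebra homomorphism into polynomials in \<open>W\<close> sending each variable \<open>v\<close> to \<open>\<sigma> v\<close>.\<close>

definition poly_subst :: "'a ring \<Rightarrow> 'w set \<Rightarrow> ('v \<Rightarrow> 'w multiset \<Rightarrow> 'a) \<Rightarrow>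
    ('v multiset \<Rightarrow> 'a) \<Rightarrow> ('w multiset \<Rightarrow> 'a)" where
  "poly_subst K W \<sigma> p =
    (\<Oplus>\<^bsub>mpoly_ring K W\<^esub>m\<in>{m. p m \<noteq> \<zero>\<^bsub>K\<^esub>}.
      ring.indexed_const K (p m) \<otimes>\<^bsub>mpoly_ring K W\<^esub>
      (\<Otimes>\<^bsub>mpoly_ring K W\<^esub>v\<in>set_mset m. \<sigma> v [^]\<^bsub>mpoly_ring K W\<^esub> count m v))"

text \<open>A Hopf algebra structure on the polynomial algebra \<open>A\<close> over \<open>base\<close> in the variables \<open>gens\<close>.
  The algebra \<open>A \<otimes> A\<close> is the polynomial algebra in \<open>gens <+> gens\<close>, where \<open>Inl v\<close>
  stands for \<open>v \<otimes> 1\<close> and \<open>Inr v\<close> for \<open>1 \<otimes> v\<close>; \<open>delta v\<close> is the coproduct of the variable \<open>v\<close>.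
  In all cases considered the counit maps every variable to zero. The antipode is not needed for
  representations and their tensor products.\<close>

record ('a, 'v) hopf =
  base :: "'a ring"
  gens :: "'v set"
  delta :: "'v \<Rightarrow> ('v + 'v) multiset \<Rightarrow> 'a"

abbreviation coord_ring :: "('a, 'v) hopf \<Rightarrow> ('v multiset \<Rightarrow> 'a) ring" where
  "coord_ring H \<equiv> mpoly_ring (base H) (gens H)"

abbreviation coord_ring2 :: "('a, 'v) hopf \<Rightarrow> (('v + 'v) multiset \<Rightarrow> 'a) ring" where
  "coord_ring2 H \<equiv> mpoly_ring (base H) (gens H <+> gens H)"

definition coproduct :: "('a, 'v) hopf \<Rightarrow> ('v multiset \<Rightarrow> 'a) \<Rightarrow> (('v + 'v) multiset \<Rightarrow> 'a)" where
  "coproduct H = poly_subst (base H) (gens H <+> gens H) (delta H)"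

definition counit :: "('a, 'v) hopf \<Rightarrow> ('v multiset \<Rightarrow> 'a) \<Rightarrow> 'a" where
  "counit H p = p {#}"

definition pure_tensor :: "('a, 'v) hopf \<Rightarrow>
    ('v multiset \<Rightarrow> 'a) \<Rightarrow> ('v multiset \<Rightarrow> 'a) \<Rightarrow> (('v + 'v) multiset \<Rightarrow> 'a)" where
  "pure_tensor H p q =
    poly_subst (base H) (gens H <+> gens H) (\<lambda>v. ring.indexed_var (base H) (Inl v)) p
    \<otimes>\<^bsub>coord_ring2 H\<^esub>
    poly_subst (base H) (gens H <+> gens H) (\<lambda>v. ring.indexed_var (base H) (Inr v)) q"

datatype coord = CX | CY | CZ

definition Ga :: "'a ring \<Rightarrow> ('a, coord) hopf" where
  "Ga K =
    \<lparr>base = K, gens = {CX},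
     delta = (\<lambda>v. ring.indexed_padd K (ring.indexed_var K (Inr v)) (ring.indexed_var K (Inl v)))\<rparr>"

definition H1 :: "'a ring \<Rightarrow> ('a, coord) hopf" where
  "H1 K =
    (let A2 = mpoly_ring K ({CX, CY, CZ} <+> {CX, CY, CZ}); x = ring.indexed_var K in
     \<lparr>base = K, gens = {CX, CY, CZ},
      delta = (\<lambda>v. case v of
          CX \<Rightarrow> x (Inr CX) \<oplus>\<^bsub>A2\<^esub> x (Inl CX)
        | CY \<Rightarrow> x (Inr CY) \<oplus>\<^bsub>A2\<^esub> x (Inl CY)
        | CZ \<Rightarrow> x (Inr CZ) \<oplus>\<^bsub>A2\<^esub> x (Inl CX) \<otimes>\<^bsub>A2\<^esub> x (Inr CY) \<oplus>\<^bsub>A2\<^esub> x (Inl CZ))\<rparr>)"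

datatype group_scheme = Additive | Heisenberg

fun hopf_of :: "group_scheme \<Rightarrow> 'a ring \<Rightarrow> ('a, coord) hopf" where
  "hopf_of Additive K = Ga K"
| "hopf_of Heisenberg K = H1 K"

text \<open>The Hopf algebra of the direct power with factors indexed by \<open>I\<close>: the variable \<open>(i, v)\<close> is
  the copy of \<open>v\<close> in the tensor factor \<open>i\<close>, and its coproduct is computed within that factor.\<close>

definition hopf_power :: "'i set \<Rightarrow> ('a, 'v) hopf \<Rightarrow> ('a, 'i \<times> 'v) hopf" where
  "hopf_power I H =
    \<lparr>base = base H, gens = I \<times> gens H,
     delta = (\<lambda>(i, v). poly_subst (base H) ((I \<times> gens H) <+> (I \<times> gens H))
       (\<lambda>w. ring.indexed_var (base H) (map_sum (Pair i) (Pair i) w)) (delta H v))\<rparr>"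

section \<open>Finite dimensional representations\<close>

text \<open>A representation on \<open>k\<^sup>n\<close> is given by the \<open>n \<times> n\<close> matrix \<open>(a i j)\<close>
  over the Hopf algebra with \<open>\<rho> (e j) = (\<Sum>i. e i \<otimes> a i j)\<close>; the last two
  conditions are coassociativity and counitality of \<open>\<rho>\<close> evaluated on basis vectors.\<close>

definition is_rep :: "('a, 'v) hopf \<Rightarrow> ('v multiset \<Rightarrow> 'a) mat \<Rightarrow> bool" where
  "is_rep H a \<longleftrightarrow> dim_col a = dim_row a \<and>
    (\<forall>i<dim_row a. \<forall>j<dim_row a. a $$ (i, j) \<in> carrier (coord_ring H)) \<and>
    (\<forall>i<dim_row a. \<forall>j<dim_row a. coproduct H (a $$ (i, j)) =
      (\<Oplus>\<^bsub>coord_ring2 H\<^esub>l\<in>{..<dim_row a}. pure_tensor H (a $$ (i, l)) (a $$ (l, j)))) \<and>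
    (\<forall>i<dim_row a. \<forall>j<dim_row a. counit H (a $$ (i, j)) =
      (if i = j then \<one>\<^bsub>base H\<^esub> else \<zero>\<^bsub>base H\<^esub>))"

abbreviation rep_dim :: "'b mat \<Rightarrow> nat" where
  "rep_dim a \<equiv> dim_row a"

text \<open>Linear maps commuting with the coactions, as matrices acting on column vectors.\<close>

definition is_rep_map ::
  "('a, 'v) hopf \<Rightarrow> ('v multiset \<Rightarrow> 'a) mat \<Rightarrow> ('v multiset \<Rightarrow> 'a) mat \<Rightarrow> 'a mat \<Rightarrow> bool" where
  "is_rep_map H a b \<phi> \<longleftrightarrow> \<phi> \<in> carrier_mat (rep_dim b) (rep_dim a) \<and>
    (\<forall>i<rep_dim b. \<forall>j<rep_dim a. \<phi> $$ (i, j) \<in> carrier (base H)) \<and>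
    (\<forall>i<rep_dim b. \<forall>j<rep_dim a.
      (\<Oplus>\<^bsub>coord_ring H\<^esub>l\<in>{..<rep_dim b}.
        b $$ (i, l) \<otimes>\<^bsub>coord_ring H\<^esub> ring.indexed_const (base H) (\<phi> $$ (l, j))) =
      (\<Oplus>\<^bsub>coord_ring H\<^esub>l\<in>{..<rep_dim a}.
        ring.indexed_const (base H) (\<phi> $$ (i, l)) \<otimes>\<^bsub>coord_ring H\<^esub> a $$ (l, j)))"

definition mat_comp :: "('a, 'b) ring_scheme \<Rightarrow> 'a mat \<Rightarrow> 'a mat \<Rightarrow> 'a mat" where
  "mat_comp R A B = mat (dim_row A) (dim_col B)
    (\<lambda>(i, j). \<Oplus>\<^bsub>R\<^esub>l\<in>{..<dim_col A}. A $$ (i, l) \<otimes>\<^bsub>R\<^esub> B $$ (l, j))"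

text \<open>The Kronecker product; the basis vector \<open>e i \<otimes> f j\<close> has index \<open>i * m + j\<close>, where \<open>m\<close> is the
  dimension of the second factor. With this numbering the associativity and unit isomorphisms are
  identity matrices.\<close>

definition mat_kron :: "('a, 'b) ring_scheme \<Rightarrow> 'a mat \<Rightarrow> 'a mat \<Rightarrow> 'a mat" where
  "mat_kron R A B = mat (dim_row A * dim_row B) (dim_col A * dim_col B)
    (\<lambda>(i, j). A $$ (i div dim_row B, j div dim_col B) \<otimes>\<^bsub>R\<^esub> B $$ (i mod dim_row B, j mod dim_col B))"

definition mat_id :: "('a, 'b) ring_scheme \<Rightarrow> nat \<Rightarrow> 'a mat" where
  "mat_id R n = mat n n (\<lambda>(i, j). if i = j then \<one>\<^bsub>R\<^esub> else \<zero>\<^bsub>R\<^esub>)"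

definition mat_swap :: "('a, 'b) ring_scheme \<Rightarrow> nat \<Rightarrow> nat \<Rightarrow> 'a mat" where
  "mat_swap R n m = mat (m * n) (n * m)
    (\<lambda>(i, j). if i div n = j mod m \<and> i mod n = j div m then \<one>\<^bsub>R\<^esub> else \<zero>\<^bsub>R\<^esub>)"

text \<open>A morphism is a triple of domain, codomain and matrix.\<close>

definition Rep :: "('a, 'v) hopf \<Rightarrow>
    (('v multiset \<Rightarrow> 'a) mat,
     ('v multiset \<Rightarrow> 'a) mat \<times> ('v multiset \<Rightarrow> 'a) mat \<times> 'a mat, 'a) tcat" where
  "Rep H = (let K = base H; A = coord_ring H; tens = mat_kron A; unit = mat_id A 1 in
    \<lparr>Ob = {a. is_rep H a},
     Ar = {(a, b, \<phi>). is_rep H a \<and> is_rep H b \<and> is_rep_map H a b \<phi>},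
     Dm = (\<lambda>(a, b, \<phi>). a),
     Cd = (\<lambda>(a, b, \<phi>). b),
     Idt = (\<lambda>a. (a, a, mat_id K (rep_dim a))),
     Cmp = (\<lambda>(b, c, \<psi>) (a, b', \<phi>). (a, c, mat_comp K \<psi> \<phi>)),
     Zer = (\<lambda>a b. (a, b, mat (rep_dim b) (rep_dim a) (\<lambda>_. \<zero>\<^bsub>K\<^esub>))),
     Pls = (\<lambda>(a, b, \<phi>) (a', b', \<psi>).
       (a, b, mat (rep_dim b) (rep_dim a) (\<lambda>ij. \<phi> $$ ij \<oplus>\<^bsub>K\<^esub> \<psi> $$ ij))),
     Scl = (\<lambda>c (a, b, \<phi>). (a, b, mat (rep_dim b) (rep_dim a) (\<lambda>ij. c \<otimes>\<^bsub>K\<^esub> \<phi> $$ ij))),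
     TnO = tens,
     TnA = (\<lambda>(a, b, \<phi>) (a', b', \<psi>). (tens a a', tens b b', mat_kron K \<phi> \<psi>)),
     Unt = unit,
     Asc = (\<lambda>a b c. (tens (tens a b) c, tens a (tens b c),
       mat_id K (rep_dim a * rep_dim b * rep_dim c))),
     Com = (\<lambda>a b. (tens a b, tens b a, mat_swap K (rep_dim a) (rep_dim b))),
     Lun = (\<lambda>a. (tens unit a, a, mat_id K (rep_dim a))),
     Run = (\<lambda>a. (tens a unit, a, mat_id K (rep_dim a)))\<rparr>)"

section \<open>Height and the restricted ultraproducts\<close>

text \<open>The additive order of one; \<open>group.ord\<close> is zero for elements of infinite order.\<close>

definition ring_char :: "'a ring \<Rightarrow> nat" where
  "ring_char K = group.ord (add_monoid K) \<one>\<^bsub>K\<^esub>"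

definition rep_height :: "('a, 'v) hopf \<Rightarrow> ('v multiset \<Rightarrow> 'a) mat \<Rightarrow> nat" where
  "rep_height H a = Max (insert 0
    {m. m \<ge> 1 \<and> (\<exists>v\<in>gens H. \<exists>i<rep_dim a. \<exists>j<rep_dim a.
      (a $$ (i, j)) (replicate_mset (ring_char (base H) ^ (m - 1)) v) \<noteq> \<zero>\<^bsub>base H\<^esub>)})"

definition uprod_R :: "'i filter \<Rightarrow> ('i \<Rightarrow> ('a, 'v) hopf) \<Rightarrow>
    (('i \<Rightarrow> ('v multiset \<Rightarrow> 'a) mat) set,
     ('i \<Rightarrow> ('v multiset \<Rightarrow> 'a) mat \<times> ('v multiset \<Rightarrow> 'a) mat \<times> 'a mat) set,
     ('i \<Rightarrow> 'a) set) tcat" where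
  "uprod_R U H = full_subcategory (uprod_cat U (\<lambda>i. Rep (H i)))
    {X. \<exists>d. eventually (\<lambda>i. rep_dim (urep X i) \<le> d) U}"

text \<open>\<open>Limsup\<close> along \<open>U\<close> is the infimum, over all members of \<open>U\<close>, of the supremum on that member,
  that is, the essential supremum modulo \<open>U\<close>.\<close>

definition uheight :: "'i filter \<Rightarrow> ('i \<Rightarrow> ('a, 'v) hopf) \<Rightarrow>
    ('i \<Rightarrow> ('v multiset \<Rightarrow> 'a) mat) set \<Rightarrow> enat" where
  "uheight U H X = Limsup U (\<lambda>i. enat (rep_height (H i) (urep X i)))"

definition uprod_H :: "'i filter \<Rightarrow> ('i \<Rightarrow> ('a, 'v) hopf) \<Rightarrow>
    (('i \<Rightarrow> ('v multiset \<Rightarrow> 'a) mat) set,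
     ('i \<Rightarrow> ('v multiset \<Rightarrow> 'a) mat \<times> ('v multiset \<Rightarrow> 'a) mat \<times> 'a mat) set,
     ('i \<Rightarrow> 'a) set) tcat" where
  "uprod_H U H = full_subcategory (uprod_R U H) {X. uheight U H X < \<infinity>}"

definition uprod_H_le :: "nat \<Rightarrow> 'i filter \<Rightarrow> ('i \<Rightarrow> ('a, 'v) hopf) \<Rightarrow>
    (('i \<Rightarrow> ('v multiset \<Rightarrow> 'a) mat) set,
     ('i \<Rightarrow> ('v multiset \<Rightarrow> 'a) mat \<times> ('v multiset \<Rightarrow> 'a) mat \<times> 'a mat) set,
     ('i \<Rightarrow> 'a) set) tcat" where
  "uprod_H_le n U H = full_subcategory (uprod_R U H) {X. uheight U H X \<le> enat n}"

end

theory Submission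
  imports Defs "HOL-Computational_Algebra.Primes"
begin

text \<open>The variable \<open>(j, v)\<close> of the Hopf algebra of \<open>G\<^sup>I\<close> corresponds to
  the tuple of powers \<open>v ^ p\<^sub>i ^ j\<close>, where \<open>p\<^sub>i\<close> is the characteristic
  of \<open>k\<^sub>i\<close>. Since \<open>p\<^sub>i\<close> tends to infinity along the ultrafilter,
  uniqueness of base \<open>p\<^sub>i\<close> digits shows that a finite set of monomials over
  \<open>k\<close> has distinct images in almost all components. The comultiplications are compatible because
  raising to the power \<open>p\<^sub>i ^ j\<close> is a ring homomorphism in characteristic
  \<open>p\<^sub>i\<close>. Thus a matrix over the Hopf algebra of \<open>G\<^sup>I\<close> is a
  representation iff almost all corresponding matrices over the \<open>k\<^sub>i\<close> are, and this
  identification is strictly compatible with all tensor operations.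

  It remains to see which tuples arise. In a representation over \<open>k\<^sub>i\<close> of dimension
  \<open>d\<close>, the coefficient matrices of the monomials in one coordinate \<open>v\<close> satisfy
  \<open>A\<^sub>r A\<^sub>s = (r + s choose r) A\<^sub>r\<^sub>+\<^sub>s\<close>, so they are products of the
  powers \<open>N\<^sub>l\<^sup>c\<close> up to units, where \<open>N\<^sub>l\<close> is the coefficient of
  \<open>v ^ p\<^sub>i ^ l\<close> and \<open>c\<close> runs over the base \<open>p\<^sub>i\<close> digits of
  the exponent; those of mixed monomials factor through these. The \<open>N\<^sub>l\<close> are nilpotent, so
  every digit is less than \<open>d\<close>, and it vanishes when \<open>l\<close> is at least the height. If
  dimension and height are bounded, only finitely many monomials over \<open>k\<close> are therefore
  needed.\<close>

section \<open>Polynomial rings in arbitrarily many variables\<close>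

text \<open>The obstacle is that the ultraproduct of the polynomial rings over the
  \<open>k_i\<close> is far larger than a polynomial ring over \<open>k\<close>, so most tuples have
  no counterpart. The comparison is therefore a relation, a tuple having a given polynomial as its
  limit, and it holds only when one finite set of monomials over \<open>k\<close> supports almost
  all components. Closure of this relation under the ring operations transfers polynomial and matrix
  identities in both directions. The tensor category axioms are not verified componentwise: they are
  carried over from the representations over \<open>k\<close> along the resulting bijection of
  objects and arrows.

  The finite support must not depend on the characteristic. Divided powers by themselves give only
  \<open>N_l^p = 0\<close>, where \<open>p\<close> grows with \<open>i\<close>; linear algebra in
  dimension \<open>d\<close> improves this to \<open>N_l^d = 0\<close>. For the Heisenberg group the
  mixed term of the comultiplication is avoided by restricting to products of coordinate subspaces
  on which it vanishes. A bounded dimension is constant on a member of the ultrafilter, which fixes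
  the size of the limit matrix.\<close>

lemma (in cring) finsum_single:
  assumes "finite S" "s \<in> S" "f s \<in> carrier R" "\<And>t. t \<in> S \<Longrightarrow> t \<noteq> s \<Longrightarrow> f t = \<zero>"
  shows "finsum R f S = f s"
proof -
  have "finsum R f S = finsum R f {s}"
    by (rule add.finprod_mono_neutral_cong_right) (use assms in \<open>auto simp: Pi_def, metis zero_closed\<close>)
  also have "\<dots> = f s" using assms by simp
  finally show ?thesis .
qed

lemma (in cring) finsum_all_zero: "(\<And>t. t \<in> S \<Longrightarrow> f t = \<zero>) \<Longrightarrow> finsum R f S = \<zero>"
  by (rule add.finprod_one_eqI)

text \<open>\<open>mpoly_ring\<close> takes a ring record without extension fields.\<close>

locale coeff_ring = cring K for K :: "'a ring" (structure)
begin

definition indexed_monom :: "'a \<Rightarrow> 'v multiset \<Rightarrow> 'v multiset \<Rightarrow> 'a" where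
  "indexed_monom c m = (\<lambda>n. if n = m then c else \<zero>)"

lemma indexed_const_monom: "indexed_const c = indexed_monom c {#}"
  by (simp add: indexed_const_def indexed_monom_def)

lemma indexed_var_monom: "indexed_var v = indexed_monom \<one> {#v#}"
proof (rule ext)
  fix m
  have "v \<in># m \<and> m - {#v#} = {#} \<longleftrightarrow> m = {#v#}"
    by (metis add_mset_remove_trivial insert_DiffM multi_member_last)
  then show "indexed_var v m = indexed_monom \<one> {#v#} m"
    by (auto simp: indexed_var_def indexed_pmult_def indexed_const_def indexed_monom_def)
qed

lemma mpoly_zero: "\<zero>\<^bsub>mpoly_ring K V\<^esub> = (\<lambda>_. \<zero>)"
  by (simp add: mpoly_ring_def indexed_const_def)

lemma mpoly_zero_apply [simp]: "\<zero>\<^bsub>mpoly_ring K V\<^esub> m = \<zero>"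
  by (simp add: mpoly_zero)

lemma mpoly_one: "\<one>\<^bsub>mpoly_ring K V\<^esub> = indexed_monom \<one> {#}"
  by (simp add: mpoly_ring_def indexed_const_monom)

lemma mpoly_add: "p \<oplus>\<^bsub>mpoly_ring K V\<^esub> q = (\<lambda>m. p m \<oplus> q m)"
  by (simp add: mpoly_ring_def indexed_padd_def)

lemma mpoly_add_apply [simp]: "(p \<oplus>\<^bsub>mpoly_ring K V\<^esub> q) m = p m \<oplus> q m"
  by (simp add: mpoly_add)

lemma mpoly_mult: "(p \<otimes>\<^bsub>mpoly_ring K V\<^esub> q) m = finsum K (\<lambda>l. p l \<otimes> q (m - l)) {l. l \<subseteq># m}"
  by (simp add: mpoly_ring_def)

text \<open>The carrier of \<open>mpoly_ring\<close> is an inductively generated set. This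
  description by finite support is the one in which cancellation of terms and bounds on the
  occurring monomials can be expressed.\<close>

definition is_mpoly :: "'v set \<Rightarrow> ('v multiset \<Rightarrow> 'a) \<Rightarrow> bool" where
  "is_mpoly V p \<longleftrightarrow> finite {m. p m \<noteq> \<zero>} \<and> (\<forall>m. p m \<in> carrier K) \<and>
    (\<forall>m. p m \<noteq> \<zero> \<longrightarrow> set_mset m \<subseteq> V)"

lemma is_mpoly_monom:
  "c \<in> carrier K \<Longrightarrow> set_mset m \<subseteq> V \<Longrightarrow> is_mpoly V (indexed_monom c m)"
  by (auto simp: is_mpoly_def indexed_monom_def)

lemma is_mpoly_add:
  assumes "is_mpoly V p" "is_mpoly V q"
  shows "is_mpoly V (\<lambda>m. p m \<oplus> q m)"
proof -
  have "{m. p m \<oplus> q m \<noteq> \<zero>} \<subseteq> {m. p m \<noteq> \<zero>} \<union> {m. q m \<noteq> \<zero>}"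
    by auto
  then have "finite {m. p m \<oplus> q m \<noteq> \<zero>}"
    by (rule finite_subset) (use assms in \<open>simp add: is_mpoly_def\<close>)
  moreover have "set_mset m \<subseteq> V" if "p m \<oplus> q m \<noteq> \<zero>" for m
    using that assms unfolding is_mpoly_def by (metis l_zero zero_closed)
  ultimately show ?thesis
    using assms by (simp add: is_mpoly_def)
qed

text \<open>Peeling off one term at a time reduces an additive statement to single terms, where a
  product only adds the monomials. Commutativity and associativity of the product and
  multiplicativity of substitution are obtained in this way.\<close>

lemma mpoly_induct [consumes 1, case_names monom add]:
  assumes p: "is_mpoly V p"
    and mon: "\<And>c m. c \<in> carrier K \<Longrightarrow> set_mset m \<subseteq> V \<Longrightarrow> P (indexed_monom c m)"
    and add: "\<And>p q. is_mpoly V p \<Longrightarrow> is_mpoly V q \<Longrightarrow> P p \<Longrightarrow> P q \<Longrightarrow> P (\<lambda>m. p m \<oplus> q m)"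
  shows "P p"
  using p
proof (induction "card {m. p m \<noteq> \<zero>}" arbitrary: p)
  case 0
  then have "p = indexed_monom \<zero> {#}"
    by (auto simp: is_mpoly_def indexed_monom_def)
  then show ?case using mon[of \<zero> "{#}"] by simp
next
  case (Suc n)
  then obtain m where m: "p m \<noteq> \<zero>"
    by (metis (mono_tags, lifting) Collect_empty_eq card.empty nat.distinct(1))
  define q where "q = p(m := \<zero>)"
  have supp: "{l. q l \<noteq> \<zero>} = {l. p l \<noteq> \<zero>} - {m}"
    by (auto simp: q_def)
  have q: "is_mpoly V q"
    using Suc(3) unfolding is_mpoly_def supp by (simp add: q_def)
  have "n = card {l. q l \<noteq> \<zero>}"
    using Suc(2,3) m by (simp add: supp is_mpoly_def)
  then have "P q" using Suc(1) q by blast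
  moreover have "P (indexed_monom (p m) m)" "is_mpoly V (indexed_monom (p m) m)"
    using mon is_mpoly_monom[of "p m" m V] Suc(3) m by (simp_all add: is_mpoly_def)
  ultimately have "P (\<lambda>l. q l \<oplus> indexed_monom (p m) m l)"
    using add q by blast
  moreover have "(\<lambda>l. q l \<oplus> indexed_monom (p m) m l) = p"
    using Suc(3) by (auto simp: q_def indexed_monom_def is_mpoly_def)
  ultimately show ?case by simp
qed

text \<open>For the converse inclusion, a single term arises from a constant by one multiplication
  per variable, and \<open>mpoly_induct\<close> adds the terms up.\<close>

lemma mpoly_carrier: "p \<in> carrier (mpoly_ring K V) \<longleftrightarrow> is_mpoly V p"
proof
  assume "p \<in> carrier (mpoly_ring K V)"
  then have "p \<in> indexed_pset V (carrier K)"
    by (simp add: mpoly_ring_def)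
  then show "is_mpoly V p"
  proof (induction rule: indexed_pset.induct)
    case (indexed_const k)
    then show ?case by (simp add: indexed_const_monom is_mpoly_monom)
  next
    case (indexed_padd P Q)
    then show ?case by (simp add: indexed_padd_def is_mpoly_add)
  next
    case (indexed_pmult P i)
    let ?q = "indexed_pmult P i"
    have "{m. ?q m \<noteq> \<zero>} \<subseteq> add_mset i ` {m. P m \<noteq> \<zero>}"
    proof
      fix m assume "m \<in> {m. ?q m \<noteq> \<zero>}"
      then have "i \<in># m" "P (m - {#i#}) \<noteq> \<zero>"
        by (auto simp: indexed_pmult_def split: if_splits)
      then show "m \<in> add_mset i ` {m. P m \<noteq> \<zero>}"
        by (intro image_eqI[of _ _ "m - {#i#}"]) auto
    qed
    then have "finite {m. ?q m \<noteq> \<zero>}"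
      by (rule finite_subset) (use indexed_pmult in \<open>simp add: is_mpoly_def\<close>)
    moreover have "set_mset m \<subseteq> V" if "?q m \<noteq> \<zero>" for m
    proof -
      have "i \<in># m" "set_mset (m - {#i#}) \<subseteq> V"
        using that indexed_pmult by (auto simp: is_mpoly_def indexed_pmult_def split: if_splits)
      then show ?thesis using indexed_pmult(2)
        by (metis insert_DiffM insert_subset set_mset_add_mset_insert)
    qed
    moreover have "?q m \<in> carrier K" for m
      using indexed_pmult by (simp add: is_mpoly_def indexed_pmult_def)
    ultimately show ?case
      by (simp add: is_mpoly_def)
  qed
next
  assume "is_mpoly V p"
  then have "p \<in> indexed_pset V (carrier K)"
  proof (induction rule: mpoly_induct)
    case (monom c m)
    from monom(2) show ?case
    proof (induction m)
      case empty
      then show ?case using monom(1) indexed_pset.indexed_const[of c "carrier K" V]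
        by (simp add: indexed_const_monom)
    next
      case (add v m)
      have "indexed_monom c (add_mset v m) = indexed_pmult (indexed_monom c m) v"
      proof (rule ext)
        fix n
        have "v \<in># n \<and> n - {#v#} = m \<longleftrightarrow> n = add_mset v m"
          by (metis add_mset_remove_trivial insert_DiffM union_single_eq_member add_mset_add_single)
        then show "indexed_monom c (add_mset v m) n = indexed_pmult (indexed_monom c m) v n"
          by (cases "n = add_mset v m") (auto simp: indexed_monom_def indexed_pmult_def)
      qed
      then show ?case using add indexed_pset.indexed_pmult by auto
    qed
  next
    case (add p q)
    then show ?case using indexed_pset.indexed_padd[of p V "carrier K" q]
      by (simp add: indexed_padd_def)
  qed
  then show "p \<in> carrier (mpoly_ring K V)"
    by (simp add: mpoly_ring_def)
qed

lemma is_mpoly_coeff: "is_mpoly V p \<Longrightarrow> p m \<in> carrier K"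
  by (simp add: is_mpoly_def)

lemma mpoly_coeff: "p \<in> carrier (mpoly_ring K V) \<Longrightarrow> p m \<in> carrier K"
  by (simp add: mpoly_carrier is_mpoly_coeff)

text \<open>Keeps the convolution sum in the product meaningful: \<open>finsum\<close> over an
  infinite index set is zero by convention.\<close>

lemma finite_submultisets: "finite {l. l \<subseteq># (m :: 'v multiset)}"
proof (induction m)
  case (add v m)
  have "{l. l \<subseteq># add_mset v m} \<subseteq> {l. l \<subseteq># m} \<union> add_mset v ` {l. l \<subseteq># m}"
  proof
    fix l assume l: "l \<in> {l. l \<subseteq># add_mset v m}"
    show "l \<in> {l. l \<subseteq># m} \<union> add_mset v ` {l. l \<subseteq># m}"
    proof (cases "v \<in># l")
      case True
      then have "l = add_mset v (l - {#v#})" "l - {#v#} \<subseteq># m"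
        using l by (auto simp: subset_eq_diff_conv)
      then show ?thesis by blast
    next
      case False
      then have "l \<subseteq># m" using l
        by (metis diff_single_trivial mem_Collect_eq subset_eq_diff_conv union_single_eq_member
            add_mset_add_single)
      then show ?thesis by blast
    qed
  qed
  then show ?case using add finite_subset by blast
qed auto

lemma monom_mult:
  assumes "c \<in> carrier K" "d \<in> carrier K"
  shows "indexed_monom c m \<otimes>\<^bsub>mpoly_ring K V\<^esub> indexed_monom d n = indexed_monom (c \<otimes> d) (m + n)"
proof (rule ext)
  fix l
  let ?f = "\<lambda>k. indexed_monom c m k \<otimes> indexed_monom d n (l - k)"
  show "(indexed_monom c m \<otimes>\<^bsub>mpoly_ring K V\<^esub> indexed_monom d n) l = indexed_monom (c \<otimes> d) (m + n) l"
  proof (cases "l = m + n")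
    case True
    have "finsum K ?f {k. k \<subseteq># l} = ?f m"
      using True assms by (intro finsum_single) (simp_all add: indexed_monom_def finite_submultisets)
    then show ?thesis using True by (simp add: mpoly_mult indexed_monom_def)
  next
    case False
    have "?f k = \<zero>" if "k \<subseteq># l" for k
    proof (cases "k = m \<and> l - k = n")
      case True
      with that False show ?thesis by (metis subset_mset.add_diff_inverse)
    next
      case nn: False
      then show ?thesis using assms by (auto simp only: indexed_monom_def if_False l_null r_null zero_closed split: if_split)
    qed
    then have "finsum K ?f {k. k \<subseteq># l} = \<zero>"
      by (intro finsum_all_zero) simp
    then show ?thesis using False by (simp add: mpoly_mult indexed_monom_def)
  qed
qed

lemma mpoly_mult_add_left:
  assumes "is_mpoly V p" "is_mpoly V q" "is_mpoly V r"
  shows "(\<lambda>m. p m \<oplus> q m) \<otimes>\<^bsub>mpoly_ring K V\<^esub> r =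
    (\<lambda>m. (p \<otimes>\<^bsub>mpoly_ring K V\<^esub> r) m \<oplus> (q \<otimes>\<^bsub>mpoly_ring K V\<^esub> r) m)"
  unfolding mpoly_mult fun_eq_iff using assms
  by (simp add: is_mpoly_coeff[of V] l_distr Pi_def)

lemma mpoly_mult_add_right:
  assumes "is_mpoly V p" "is_mpoly V q" "is_mpoly V r"
  shows "r \<otimes>\<^bsub>mpoly_ring K V\<^esub> (\<lambda>m. p m \<oplus> q m) =
    (\<lambda>m. (r \<otimes>\<^bsub>mpoly_ring K V\<^esub> p) m \<oplus> (r \<otimes>\<^bsub>mpoly_ring K V\<^esub> q) m)"
  unfolding mpoly_mult fun_eq_iff using assms
  by (simp add: is_mpoly_coeff[of V] r_distr Pi_def)

lemma is_mpoly_mult: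
  assumes p: "is_mpoly V p" and q: "is_mpoly V q"
  shows "is_mpoly V (p \<otimes>\<^bsub>mpoly_ring K V\<^esub> q)"
  using p
proof (induction rule: mpoly_induct)
  case (monom c m)
  note cm = monom
  show ?case using q
  proof (induction rule: mpoly_induct)
    case (monom d n)
    then show ?case using cm by (simp add: monom_mult is_mpoly_monom)
  next
    case (add p q)
    then show ?case using cm by (simp add: mpoly_mult_add_right is_mpoly_monom is_mpoly_add)
  qed
next
  case (add p q)
  then show ?case using assms by (simp add: mpoly_mult_add_left is_mpoly_add)
qed

lemma mpoly_mult_comm:
  assumes p: "is_mpoly V p" and q: "is_mpoly V q"
  shows "p \<otimes>\<^bsub>mpoly_ring K V\<^esub> q = q \<otimes>\<^bsub>mpoly_ring K V\<^esub> p"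
  using p
proof (induction rule: mpoly_induct)
  case (monom c m)
  note cm = monom
  show ?case using q
  proof (induction rule: mpoly_induct)
    case (monom d n)
    then show ?case using cm by (simp add: monom_mult m_comm[of c d] union_commute[of m n])
  next
    case (add p q)
    then show ?case using cm by (simp add: mpoly_mult_add_left mpoly_mult_add_right is_mpoly_monom)
  qed
next
  case (add p q)
  then show ?case using assms by (simp add: mpoly_mult_add_left mpoly_mult_add_right)
qed

lemma mpoly_mult_assoc:
  assumes p: "is_mpoly V p" and q: "is_mpoly V q" and r: "is_mpoly V r"
  shows "(p \<otimes>\<^bsub>mpoly_ring K V\<^esub> q) \<otimes>\<^bsub>mpoly_ring K V\<^esub> r =
    p \<otimes>\<^bsub>mpoly_ring K V\<^esub> (q \<otimes>\<^bsub>mpoly_ring K V\<^esub> r)"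
  using p
proof (induction rule: mpoly_induct)
  case (monom c m)
  note cm = monom
  show ?case using q
  proof (induction rule: mpoly_induct)
    case (monom d n)
    note dn = monom
    show ?case using r
    proof (induction rule: mpoly_induct)
      case (monom e l)
      then show ?case using cm dn by (simp add: monom_mult m_assoc union_assoc)
    next
      case (add p q)
      then show ?case using cm dn
        by (simp add: mpoly_mult_add_right is_mpoly_monom is_mpoly_mult)
    qed
  next
    case (add p q)
    then show ?case using cm r
      by (simp add: mpoly_mult_add_left mpoly_mult_add_right is_mpoly_monom is_mpoly_mult)
  qed
next
  case (add p q)
  then show ?case using assms by (simp add: mpoly_mult_add_left mpoly_mult_add_right is_mpoly_mult)
qed

lemma mpoly_const_mult:
  assumes "c \<in> carrier K" "is_mpoly V p"
  shows "indexed_const c \<otimes>\<^bsub>mpoly_ring K V\<^esub> p = (\<lambda>m. c \<otimes> p m)"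
proof (rule ext)
  fix m
  let ?f = "\<lambda>l. indexed_const c l \<otimes> p (m - l)"
  have "finsum K ?f {l. l \<subseteq># m} = ?f {#}"
    using assms by (intro finsum_single) (auto simp: indexed_const_def finite_submultisets is_mpoly_coeff[of V])
  then show "(indexed_const c \<otimes>\<^bsub>mpoly_ring K V\<^esub> p) m = c \<otimes> p m"
    by (simp add: mpoly_mult indexed_const_def)
qed

lemma cring_mpoly: "cring (mpoly_ring K V)"
proof (rule cringI)
  show "abelian_group (mpoly_ring K V)"
  proof (rule abelian_groupI)
    fix p assume p: "p \<in> carrier (mpoly_ring K V)"
    have "\<ominus> p m = \<zero> \<longleftrightarrow> p m = \<zero>" for m
      using mpoly_coeff[OF p, of m] by (metis minus_minus minus_zero)
    with p have "is_mpoly V (\<lambda>m. \<ominus> p m)"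
      by (simp add: mpoly_carrier is_mpoly_def)
    then show "\<exists>q\<in>carrier (mpoly_ring K V). q \<oplus>\<^bsub>mpoly_ring K V\<^esub> p = \<zero>\<^bsub>mpoly_ring K V\<^esub>"
      using p by (intro bexI[of _ "\<lambda>m. \<ominus> p m"])
        (simp_all add: mpoly_add mpoly_zero mpoly_carrier is_mpoly_coeff[of V] l_neg)
    show "\<zero>\<^bsub>mpoly_ring K V\<^esub> \<oplus>\<^bsub>mpoly_ring K V\<^esub> p = p"
      using mpoly_coeff[OF p] by (simp add: mpoly_add mpoly_zero)
  next
    show "\<zero>\<^bsub>mpoly_ring K V\<^esub> \<in> carrier (mpoly_ring K V)"
      by (simp add: mpoly_zero mpoly_carrier is_mpoly_def)
  next
    fix p q r assume "p \<in> carrier (mpoly_ring K V)" "q \<in> carrier (mpoly_ring K V)" "r \<in> carrier (mpoly_ring K V)"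
    then show "p \<oplus>\<^bsub>mpoly_ring K V\<^esub> q \<oplus>\<^bsub>mpoly_ring K V\<^esub> r = p \<oplus>\<^bsub>mpoly_ring K V\<^esub> (q \<oplus>\<^bsub>mpoly_ring K V\<^esub> r)"
      using mpoly_coeff[of _ V] by (simp add: mpoly_add a_assoc)
  next
    fix p q assume "p \<in> carrier (mpoly_ring K V)" "q \<in> carrier (mpoly_ring K V)"
    then show "p \<oplus>\<^bsub>mpoly_ring K V\<^esub> q = q \<oplus>\<^bsub>mpoly_ring K V\<^esub> p"
      using mpoly_coeff[of _ V] by (simp add: mpoly_add a_comm)
  qed (simp_all add: mpoly_add mpoly_carrier is_mpoly_add)
  show "comm_monoid (mpoly_ring K V)"
  proof (rule comm_monoidI)
    show "\<one>\<^bsub>mpoly_ring K V\<^esub> \<otimes>\<^bsub>mpoly_ring K V\<^esub> p = p" if "p \<in> carrier (mpoly_ring K V)" for p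
      using that mpoly_const_mult[of \<one> V p]
      by (simp add: mpoly_carrier mpoly_one indexed_const_monom is_mpoly_coeff[of V])
  next
    fix p q assume "p \<in> carrier (mpoly_ring K V)" "q \<in> carrier (mpoly_ring K V)"
    then show "p \<otimes>\<^bsub>mpoly_ring K V\<^esub> q = q \<otimes>\<^bsub>mpoly_ring K V\<^esub> p"
      by (intro mpoly_mult_comm) (simp_all add: mpoly_carrier)
  qed (simp_all add: mpoly_carrier mpoly_mult_assoc is_mpoly_mult mpoly_one is_mpoly_monom)
qed (simp add: mpoly_carrier mpoly_mult_add_left mpoly_add)

end

section \<open>Binomial expansion and the Frobenius map\<close>

lemma (in ring) add_pow_one_mult:
  "x \<in> carrier R \<Longrightarrow> add_pow R (n :: nat) x = add_pow R n \<one> \<otimes> x"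
  using add_pow_ldistr[of \<one> x n] by simp

lemma (in cring) binomial_expansion:
  assumes a: "a \<in> carrier R" and b: "b \<in> carrier R"
  shows "(a \<oplus> b) [^] (n :: nat) =
    finsum R (\<lambda>k. add_pow R (n choose k) (a [^] k \<otimes> b [^] (n - k))) {..n}"
proof (induction n)
  case 0
  then show ?case using a b by simp
next
  case (Suc n)
  let ?t = "\<lambda>n k. add_pow R (n choose k) (a [^] k \<otimes> b [^] (n - k))"
  have t: "?t n k \<in> carrier R" for n k
    using a b by simp
  have ta: "?t n k \<otimes> a = add_pow R (n choose k) (a [^] Suc k \<otimes> b [^] (Suc n - Suc k))" for k
    using a b by (simp add: add_pow_ldistr add_pow_rdistr m_ac)
  have tb: "?t n k \<otimes> b = add_pow R (n choose k) (a [^] k \<otimes> b [^] (Suc n - k))" if "k \<le> n" for k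
    using a b that by (simp add: add_pow_ldistr add_pow_rdistr m_ac Suc_diff_le)
  have "(a \<oplus> b) [^] Suc n = finsum R (?t n) {..n} \<otimes> a \<oplus> finsum R (?t n) {..n} \<otimes> b"
    using a b t by (simp add: Suc.IH r_distr)
  also have "finsum R (?t n) {..n} \<otimes> a =
      finsum R (\<lambda>k. add_pow R (n choose k) (a [^] Suc k \<otimes> b [^] (Suc n - Suc k))) {..n}"
    using t a by (subst finsum_ldistr) (auto simp: ta)
  \<comment> \<open>Reindexing by \<open>k = Suc j\<close> adds a vanishing term at
    \<open>k = 0\<close>, so that both halves run over \<open>{..Suc n}\<close> and Pascal's rule
    applies term by term.\<close>
  also have "\<dots> = finsum R (\<lambda>k. add_pow R (case k of 0 \<Rightarrow> 0 | Suc j \<Rightarrow> n choose j) (a [^] k \<otimes> b [^] (Suc n - k))) {..Suc n}"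
    (is "?A = finsum R ?f _")
    using a b by (subst finsum_Suc2) (auto simp del: nat_pow_Suc)
  also have "finsum R (?t n) {..n} \<otimes> b =
      finsum R (\<lambda>k. add_pow R (n choose k) (a [^] k \<otimes> b [^] (Suc n - k))) {..n}"
    using t b a by (subst finsum_ldistr) (auto intro!: add.finprod_cong' simp: tb)
  also have "\<dots> = finsum R (\<lambda>k. add_pow R (n choose k) (a [^] k \<otimes> b [^] (Suc n - k))) {..Suc n}"
    (is "?B = finsum R ?g _")
    using a b by (subst finsum_Suc) (auto simp: binomial_eq_0)
  also have "finsum R ?f {..Suc n} \<oplus> finsum R ?g {..Suc n} = finsum R (\<lambda>k. ?f k \<oplus> ?g k) {..Suc n}"
    using a b by (subst finsum_addf) auto
  also have "\<dots> = finsum R (?t (Suc n)) {..Suc n}"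
  proof (rule finsum_cong')
    fix k
    show "?f k \<oplus> ?g k = ?t (Suc n) k"
      using a b by (cases k) (simp_all add: add.nat_pow_mult)
  qed (use t in auto)
  finally show ?case .
qed

text \<open>The inner binomial coefficients of row \<open>p\<close> are divisible by
  \<open>p\<close>, and the case of \<open>p ^ j\<close> iterates this. The characteristic enters
  only through \<open>add_pow R p \<one> = \<zero>\<close>, because the lemma is applied to
  polynomial rings and not to the coefficient field.\<close>

lemma (in cring) frobenius_add:
  assumes p: "Factorial_Ring.prime p" "add_pow R p \<one> = \<zero>"
    and a: "a \<in> carrier R" and b: "b \<in> carrier R"
  shows "(a \<oplus> b) [^] (p ^ j :: nat) = a [^] (p ^ j) \<oplus> b [^] (p ^ j)"
proof (induction j)
  case 0
  then show ?case using a b by simp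
next
  case (Suc j)
  have step: "(c \<oplus> d) [^] p = c [^] p \<oplus> d [^] p" if c: "c \<in> carrier R" and d: "d \<in> carrier R" for c d
  proof -
    let ?t = "\<lambda>k. add_pow R (p choose k) (c [^] k \<otimes> d [^] (p - k))"
    have p0: "p > 0" using p(1) prime_gt_0_nat by blast
    have z: "?t k = \<zero>" if "k \<in> {..p} - {0, p}" for k
    proof -
      have "p dvd p choose k"
        using that p(1) by (intro dvd_choose_prime) auto
      then obtain r where "p choose k = p * r" by (rule dvdE)
      moreover have "add_pow R (p * r) \<one> = \<zero>"
        using p(2) by (metis add.nat_pow_one add.nat_pow_pow one_closed)
      ultimately show ?thesis
        using c d add_pow_one_mult[of "c [^] k \<otimes> d [^] (p - k)" "p * r"] by simp
    qed
    have "(c \<oplus> d) [^] p = finsum R ?t {..p}"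
      using c d by (rule binomial_expansion)
    also have "\<dots> = finsum R ?t {0, p}"
      by (rule add.finprod_mono_neutral_cong_right) (use z c d in auto)
    also have "\<dots> = c [^] p \<oplus> d [^] p"
      using c d p0 by (simp add: a_comm)
    finally show ?thesis .
  qed
  have "(a \<oplus> b) [^] (p ^ Suc j) = ((a \<oplus> b) [^] (p ^ j)) [^] p"
    using a b by (simp add: nat_pow_pow mult.commute)
  also have "\<dots> = (a [^] (p ^ j)) [^] p \<oplus> (b [^] (p ^ j)) [^] p"
    using a b by (simp add: Suc.IH step)
  finally show ?case
    using a b by (simp add: nat_pow_pow mult.commute)
qed

section \<open>Substitution homomorphisms, renaming and truncation\<close>

context coeff_ring
begin

lemma finsum_mpoly_apply:
  assumes "f \<in> S \<rightarrow> carrier (mpoly_ring K V)"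
  shows "finsum (mpoly_ring K V) f S m = finsum K (\<lambda>s. f s m) S"
proof -
  interpret V: cring "mpoly_ring K V" by (rule cring_mpoly)
  show ?thesis using assms
  proof (induction S rule: infinite_finite_induct)
    case (insert s S)
    then have "(\<lambda>s. f s m) \<in> S \<rightarrow> carrier K" "f s m \<in> carrier K"
      using mpoly_coeff by blast+
    then show ?case using insert by simp
  qed simp_all
qed

lemma add_pow_mpoly_apply:
  "p \<in> carrier (mpoly_ring K V) \<Longrightarrow> add_pow (mpoly_ring K V) (n :: nat) p m = add_pow K n (p m)"
proof (induction n)
  case 0
  then show ?case by (simp add: add_pow_def nat_pow_def)
next
  case (Suc n)
  interpret V: cring "mpoly_ring K V" by (rule cring_mpoly)
  show ?case using Suc by simp
qed

lemma const_closed: "c \<in> carrier K \<Longrightarrow> indexed_const c \<in> carrier (mpoly_ring K V)"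
  by (simp add: mpoly_carrier indexed_const_monom is_mpoly_monom)

lemma var_closed: "v \<in> V \<Longrightarrow> indexed_var v \<in> carrier (mpoly_ring K V)"
  by (simp add: mpoly_carrier indexed_var_monom is_mpoly_monom)

lemma const_mult:
  "c \<in> carrier K \<Longrightarrow> d \<in> carrier K \<Longrightarrow>
    indexed_const (c \<otimes> d) = indexed_const c \<otimes>\<^bsub>mpoly_ring K V\<^esub> indexed_const d"
  by (simp add: indexed_const_monom monom_mult)

lemma const_add: "indexed_const (c \<oplus> d) = indexed_const c \<oplus>\<^bsub>mpoly_ring K V\<^esub> indexed_const d"
  by (simp add: mpoly_ring_def indexed_padd_const)

lemma const_one: "indexed_const \<one> = \<one>\<^bsub>mpoly_ring K V\<^esub>"
  by (simp add: mpoly_ring_def)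

lemma const_zero: "indexed_const \<zero> = \<zero>\<^bsub>mpoly_ring K V\<^esub>"
  by (simp add: mpoly_ring_def)

lemma monom_pow:
  "indexed_monom \<one> m [^]\<^bsub>mpoly_ring K V\<^esub> (n :: nat) = indexed_monom \<one> (repeat_mset n m)"
  by (induction n) (simp_all add: mpoly_one monom_mult union_commute)

definition subst_monom :: "'w set \<Rightarrow> ('v \<Rightarrow> 'w multiset \<Rightarrow> 'a) \<Rightarrow> 'v multiset \<Rightarrow> 'w multiset \<Rightarrow> 'a" where
  "subst_monom W \<sigma> m =
    finprod (mpoly_ring K W) (\<lambda>v. \<sigma> v [^]\<^bsub>mpoly_ring K W\<^esub> count m v) (set_mset m)"

lemma subst_monom_closed:
  assumes "\<sigma> \<in> set_mset m \<rightarrow> carrier (mpoly_ring K W)"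
  shows "subst_monom W \<sigma> m \<in> carrier (mpoly_ring K W)"
proof -
  interpret W: cring "mpoly_ring K W" by (rule cring_mpoly)
  show ?thesis using assms unfolding subst_monom_def
    by (intro W.finprod_closed) (auto intro: W.nat_pow_closed)
qed

text \<open>Variables outside \<open>m\<close> contribute a zeroth power. Two monomials can thus be
  multiplied over one common index set.\<close>

lemma subst_monom_superset:
  assumes "\<sigma> \<in> S \<rightarrow> carrier (mpoly_ring K W)" "finite S" "set_mset m \<subseteq> S"
  shows "subst_monom W \<sigma> m =
    finprod (mpoly_ring K W) (\<lambda>v. \<sigma> v [^]\<^bsub>mpoly_ring K W\<^esub> count m v) S"
proof -
  interpret W: cring "mpoly_ring K W" by (rule cring_mpoly)
  show ?thesis unfolding subst_monom_def
    by (rule W.finprod_mono_neutral_cong_left)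
      (use assms in \<open>auto simp: not_in_iff Pi_iff\<close>)
qed

lemma subst_monom_empty: "subst_monom W \<sigma> {#} = \<one>\<^bsub>mpoly_ring K W\<^esub>"
proof -
  interpret W: cring "mpoly_ring K W" by (rule cring_mpoly)
  show ?thesis by (simp add: subst_monom_def)
qed

lemma subst_monom_add:
  assumes "\<sigma> \<in> set_mset m \<rightarrow> carrier (mpoly_ring K W)" "\<sigma> \<in> set_mset n \<rightarrow> carrier (mpoly_ring K W)"
  shows "subst_monom W \<sigma> (m + n) = subst_monom W \<sigma> m \<otimes>\<^bsub>mpoly_ring K W\<^esub> subst_monom W \<sigma> n"
proof -
  interpret W: cring "mpoly_ring K W" by (rule cring_mpoly)
  let ?S = "set_mset m \<union> set_mset n"
  have s: "\<sigma> \<in> ?S \<rightarrow> carrier (mpoly_ring K W)" "finite ?S" using assms by auto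
  have "subst_monom W \<sigma> (m + n) =
      finprod (mpoly_ring K W) (\<lambda>v. \<sigma> v [^]\<^bsub>mpoly_ring K W\<^esub> count m v \<otimes>\<^bsub>mpoly_ring K W\<^esub>
        \<sigma> v [^]\<^bsub>mpoly_ring K W\<^esub> count n v) ?S"
    unfolding subst_monom_superset[OF s, of "m + n", simplified]
    by (rule W.finprod_cong') (use s in \<open>auto simp: W.nat_pow_mult Pi_iff\<close>)
  also have "\<dots> = finprod (mpoly_ring K W) (\<lambda>v. \<sigma> v [^]\<^bsub>mpoly_ring K W\<^esub> count m v) ?S \<otimes>\<^bsub>mpoly_ring K W\<^esub>
     finprod (mpoly_ring K W) (\<lambda>v. \<sigma> v [^]\<^bsub>mpoly_ring K W\<^esub> count n v) ?S"
    by (rule W.finprod_multf) (use s in auto)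
  finally show ?thesis
    by (simp add: subst_monom_superset[OF s])
qed

lemma subst_monom_single:
  assumes "\<sigma> v \<in> carrier (mpoly_ring K W)"
  shows "subst_monom W \<sigma> {#v#} = \<sigma> v"
proof -
  interpret W: cring "mpoly_ring K W" by (rule cring_mpoly)
  show ?thesis using assms by (simp add: subst_monom_def)
qed

lemma subst_monom_add_mset:
  assumes "\<sigma> v \<in> carrier (mpoly_ring K W)" "\<sigma> \<in> set_mset n \<rightarrow> carrier (mpoly_ring K W)"
  shows "subst_monom W \<sigma> (add_mset v n) = \<sigma> v \<otimes>\<^bsub>mpoly_ring K W\<^esub> subst_monom W \<sigma> n"
  using subst_monom_add[of \<sigma> "{#v#}" W n] assms by (simp add: subst_monom_single)

lemma subst_monom_replicate:
  assumes "\<sigma> v \<in> carrier (mpoly_ring K W)"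
  shows "subst_monom W \<sigma> (replicate_mset n v) = \<sigma> v [^]\<^bsub>mpoly_ring K W\<^esub> n"
proof -
  interpret W: cring "mpoly_ring K W" by (rule cring_mpoly)
  show ?thesis using assms
    by (induction n) (simp_all add: subst_monom_empty subst_monom_add_mset Pi_iff W.m_comm)
qed

lemma subst_monom_vars:
  assumes "f ` set_mset m \<subseteq> W"
  shows "subst_monom W (\<lambda>v. indexed_var (f v)) m = indexed_monom \<one> (image_mset f m)"
  using assms
proof (induction m)
  case empty
  then show ?case by (simp add: subst_monom_empty mpoly_one)
next
  case (add v m)
  have "subst_monom W (\<lambda>v. indexed_var (f v)) (add_mset v m) =
      indexed_var (f v) \<otimes>\<^bsub>mpoly_ring K W\<^esub> subst_monom W (\<lambda>v. indexed_var (f v)) m"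
    using add.prems by (intro subst_monom_add_mset) (auto simp: var_closed)
  then show ?case using add by (simp add: indexed_var_monom monom_mult)
qed

text \<open>The support of a sum can shrink by cancellation. A fixed finite superset
  \<open>S\<close> makes the sums for \<open>p\<close>, for \<open>q\<close> and for their sum
  comparable; it is cut down to monomials in \<open>V\<close> because \<open>\<sigma>\<close> is
  controlled only there.\<close>

lemma poly_subst_eq:
  assumes p: "is_mpoly V p" and s: "\<sigma> \<in> V \<rightarrow> carrier (mpoly_ring K W)"
    and S: "finite S" "\<And>m. p m \<noteq> \<zero> \<Longrightarrow> m \<in> S"
  shows "poly_subst K W \<sigma> p = finsum (mpoly_ring K W)
    (\<lambda>m. indexed_const (p m) \<otimes>\<^bsub>mpoly_ring K W\<^esub> subst_monom W \<sigma> m) {m\<in>S. set_mset m \<subseteq> V}"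
proof -
  interpret W: cring "mpoly_ring K W" by (rule cring_mpoly)
  have c: "subst_monom W \<sigma> m \<in> carrier (mpoly_ring K W)" if "set_mset m \<subseteq> V" for m
    using s that by (intro subst_monom_closed) auto
  have pc: "indexed_const (p m) \<in> carrier (mpoly_ring K W)" for m
    using p by (simp add: const_closed is_mpoly_coeff[of V])
  have z: "indexed_const \<zero> = \<zero>\<^bsub>mpoly_ring K W\<^esub>"
    by (simp add: mpoly_ring_def)
  show ?thesis
    unfolding poly_subst_def subst_monom_def[symmetric]
    by (rule W.add.finprod_mono_neutral_cong_left)
      (use p S c pc in \<open>auto simp: is_mpoly_def z\<close>)
qed

lemma poly_subst_monom:
  assumes c: "c \<in> carrier K" and m: "set_mset m \<subseteq> V"
    and s: "\<sigma> \<in> V \<rightarrow> carrier (mpoly_ring K W)"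
  shows "poly_subst K W \<sigma> (indexed_monom c m) =
    indexed_const c \<otimes>\<^bsub>mpoly_ring K W\<^esub> subst_monom W \<sigma> m"
proof -
  interpret W: cring "mpoly_ring K W" by (rule cring_mpoly)
  have "subst_monom W \<sigma> m \<in> carrier (mpoly_ring K W)"
    using s m by (intro subst_monom_closed) auto
  moreover have "poly_subst K W \<sigma> (indexed_monom c m) = finsum (mpoly_ring K W)
      (\<lambda>n. indexed_const (indexed_monom c m n) \<otimes>\<^bsub>mpoly_ring K W\<^esub> subst_monom W \<sigma> n)
      {n\<in>{m}. set_mset n \<subseteq> V}"
    using is_mpoly_monom[OF c m] s
  proof (rule poly_subst_eq)
    show "n \<in> {m}" if "indexed_monom c m n \<noteq> \<zero>" for n
      using that by (simp add: indexed_monom_def split: if_splits)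
  qed simp
  moreover have "{n\<in>{m}. set_mset n \<subseteq> V} = {m}" using m by auto
  moreover have "indexed_monom c m m = c" by (simp add: indexed_monom_def)
  ultimately show ?thesis
    using const_closed[OF c, of W] by simp
qed

lemma poly_subst_add:
  assumes p: "is_mpoly V p" and q: "is_mpoly V q" and s: "\<sigma> \<in> V \<rightarrow> carrier (mpoly_ring K W)"
  shows "poly_subst K W \<sigma> (\<lambda>m. p m \<oplus> q m) =
    poly_subst K W \<sigma> p \<oplus>\<^bsub>mpoly_ring K W\<^esub> poly_subst K W \<sigma> q"
proof -
  interpret W: cring "mpoly_ring K W" by (rule cring_mpoly)
  let ?S = "{m. p m \<noteq> \<zero>} \<union> {m. q m \<noteq> \<zero>}"
  let ?T = "{m\<in>?S. set_mset m \<subseteq> V}"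
  have S: "finite ?S" using p q by (simp add: is_mpoly_def)
  have c: "subst_monom W \<sigma> m \<in> carrier (mpoly_ring K W)" if "set_mset m \<subseteq> V" for m
    using s that by (intro subst_monom_closed) auto
  have pc: "p m \<in> carrier K" "q m \<in> carrier K" for m
    using p q by (simp_all add: is_mpoly_coeff[of V])
  have "poly_subst K W \<sigma> (\<lambda>m. p m \<oplus> q m) = finsum (mpoly_ring K W)
    (\<lambda>m. indexed_const (p m \<oplus> q m) \<otimes>\<^bsub>mpoly_ring K W\<^esub> subst_monom W \<sigma> m) ?T"
    by (rule poly_subst_eq[OF is_mpoly_add[OF p q] s S]) auto
  also have "\<dots> = finsum (mpoly_ring K W)
    (\<lambda>m. indexed_const (p m) \<otimes>\<^bsub>mpoly_ring K W\<^esub> subst_monom W \<sigma> m \<oplus>\<^bsub>mpoly_ring K W\<^esub>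
      indexed_const (q m) \<otimes>\<^bsub>mpoly_ring K W\<^esub> subst_monom W \<sigma> m) ?T"
    by (rule W.finsum_cong')
      (use c pc in \<open>auto simp: const_add[of _ _ W] const_closed W.l_distr\<close>)
  also have "\<dots> = poly_subst K W \<sigma> p \<oplus>\<^bsub>mpoly_ring K W\<^esub> poly_subst K W \<sigma> q"
    using c pc p q s S
    by (subst W.finsum_addf) (auto simp: const_closed poly_subst_eq[where S = ?S and V = V])
  finally show ?thesis .
qed

lemma poly_subst_closed:
  assumes "is_mpoly V p" "\<sigma> \<in> V \<rightarrow> carrier (mpoly_ring K W)"
  shows "poly_subst K W \<sigma> p \<in> carrier (mpoly_ring K W)"
proof -
  interpret W: cring "mpoly_ring K W" by (rule cring_mpoly)
  show ?thesis using assms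
  proof (induction rule: mpoly_induct)
    case (monom c m)
    then have "subst_monom W \<sigma> m \<in> carrier (mpoly_ring K W)"
      by (intro subst_monom_closed) auto
    then show ?case using monom by (simp add: poly_subst_monom const_closed)
  qed (simp add: poly_subst_add)
qed

lemma poly_subst_mult:
  assumes p: "is_mpoly V p" and q: "is_mpoly V q" and s: "\<sigma> \<in> V \<rightarrow> carrier (mpoly_ring K W)"
  shows "poly_subst K W \<sigma> (p \<otimes>\<^bsub>mpoly_ring K V\<^esub> q) =
    poly_subst K W \<sigma> p \<otimes>\<^bsub>mpoly_ring K W\<^esub> poly_subst K W \<sigma> q"
proof -
  interpret W: cring "mpoly_ring K W" by (rule cring_mpoly)
  have c: "subst_monom W \<sigma> m \<in> carrier (mpoly_ring K W)" if "set_mset m \<subseteq> V" for m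
    using s that by (intro subst_monom_closed) auto
  show ?thesis using p
  proof (induction rule: mpoly_induct)
    case (monom c m)
    note cm = monom
    show ?case using q
    proof (induction rule: mpoly_induct)
      case (monom d n)
      have "subst_monom W \<sigma> (m + n) = subst_monom W \<sigma> m \<otimes>\<^bsub>mpoly_ring K W\<^esub> subst_monom W \<sigma> n"
        using s cm monom by (intro subst_monom_add) auto
      then show ?case
        using cm monom s
        by (simp add: monom_mult poly_subst_monom[where V = V] const_mult[of _ _ W] const_closed c W.m_ac)
    next
      case (add p q)
      have "is_mpoly V (indexed_monom c m \<otimes>\<^bsub>mpoly_ring K V\<^esub> p)"
        "is_mpoly V (indexed_monom c m \<otimes>\<^bsub>mpoly_ring K V\<^esub> q)"
        using add cm by (simp_all add: is_mpoly_mult is_mpoly_monom)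
      note sum = poly_subst_add[OF this s]
      have "poly_subst K W \<sigma> p \<in> carrier (mpoly_ring K W)" "poly_subst K W \<sigma> q \<in> carrier (mpoly_ring K W)"
        "poly_subst K W \<sigma> (indexed_monom c m) \<in> carrier (mpoly_ring K W)"
        using poly_subst_closed[OF _ s] add(1,2) is_mpoly_monom[OF cm] by blast+
      then have distr: "poly_subst K W \<sigma> (indexed_monom c m) \<otimes>\<^bsub>mpoly_ring K W\<^esub>
          (poly_subst K W \<sigma> p \<oplus>\<^bsub>mpoly_ring K W\<^esub> poly_subst K W \<sigma> q) =
          poly_subst K W \<sigma> (indexed_monom c m) \<otimes>\<^bsub>mpoly_ring K W\<^esub> poly_subst K W \<sigma> p \<oplus>\<^bsub>mpoly_ring K W\<^esub>
          poly_subst K W \<sigma> (indexed_monom c m) \<otimes>\<^bsub>mpoly_ring K W\<^esub> poly_subst K W \<sigma> q"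
        by (rule W.r_distr)
      show ?case
        apply (subst mpoly_mult_add_right[OF add(1,2) is_mpoly_monom[OF cm]])
        apply (subst sum)
        apply (subst poly_subst_add[OF add(1,2) s])
        apply (subst add(3))
        apply (subst add(4))
        by (rule distr[symmetric])
    qed
  next
    case (add p' q')
    have "is_mpoly V (p' \<otimes>\<^bsub>mpoly_ring K V\<^esub> q)" "is_mpoly V (q' \<otimes>\<^bsub>mpoly_ring K V\<^esub> q)"
      using add q by (simp_all add: is_mpoly_mult)
    note sum = poly_subst_add[OF this s]
    have "poly_subst K W \<sigma> p' \<in> carrier (mpoly_ring K W)" "poly_subst K W \<sigma> q' \<in> carrier (mpoly_ring K W)"
      "poly_subst K W \<sigma> q \<in> carrier (mpoly_ring K W)"
      using poly_subst_closed[OF _ s] add(1,2) q by blast+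
    then have distr: "(poly_subst K W \<sigma> p' \<oplus>\<^bsub>mpoly_ring K W\<^esub> poly_subst K W \<sigma> q')
        \<otimes>\<^bsub>mpoly_ring K W\<^esub> poly_subst K W \<sigma> q =
        poly_subst K W \<sigma> p' \<otimes>\<^bsub>mpoly_ring K W\<^esub> poly_subst K W \<sigma> q \<oplus>\<^bsub>mpoly_ring K W\<^esub>
        poly_subst K W \<sigma> q' \<otimes>\<^bsub>mpoly_ring K W\<^esub> poly_subst K W \<sigma> q"
      by (rule W.l_distr)
    show ?case
      apply (subst mpoly_mult_add_left[OF add(1,2) q])
      apply (subst sum)
      apply (subst poly_subst_add[OF add(1,2) s])
      apply (subst add(3))
      apply (subst add(4))
      by (rule distr[symmetric])
  qed
qed

lemma poly_subst_const:
  assumes "c \<in> carrier K"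
  shows "poly_subst K W \<sigma> (indexed_const c) = indexed_const c"
proof -
  interpret W: cring "mpoly_ring K W" by (rule cring_mpoly)
  show ?thesis
    using assms poly_subst_monom[of c "{#}" "{}" \<sigma> W]
    by (simp add: indexed_const_monom[symmetric] subst_monom_empty const_closed)
qed

lemma poly_subst_var:
  assumes "\<sigma> v \<in> carrier (mpoly_ring K W)"
  shows "poly_subst K W \<sigma> (indexed_var v) = \<sigma> v"
proof -
  interpret W: cring "mpoly_ring K W" by (rule cring_mpoly)
  have "indexed_const \<one> = \<one>\<^bsub>mpoly_ring K W\<^esub>"
    by (simp add: mpoly_one indexed_const_monom)
  then show ?thesis
    using assms poly_subst_monom[of \<one> "{#v#}" "{v}" \<sigma> W]
    by (simp add: indexed_var_monom subst_monom_single)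
qed

lemma poly_subst_hom:
  assumes "\<sigma> \<in> V \<rightarrow> carrier (mpoly_ring K W)"
  shows "poly_subst K W \<sigma> \<in> Ring.ring_hom (mpoly_ring K V) (mpoly_ring K W)"
proof (rule Ring.ring_hom_memI)
  show "poly_subst K W \<sigma> \<one>\<^bsub>mpoly_ring K V\<^esub> = \<one>\<^bsub>mpoly_ring K W\<^esub>"
    using poly_subst_const[of \<one> W \<sigma>] by (simp add: mpoly_one indexed_const_monom)
next
  fix p q assume "p \<in> carrier (mpoly_ring K V)" "q \<in> carrier (mpoly_ring K V)"
  then have pq: "is_mpoly V p" "is_mpoly V q" by (simp_all add: mpoly_carrier)
  show "poly_subst K W \<sigma> p \<in> carrier (mpoly_ring K W)"
    using pq(1) assms by (rule poly_subst_closed)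
  show "poly_subst K W \<sigma> (p \<otimes>\<^bsub>mpoly_ring K V\<^esub> q) =
      poly_subst K W \<sigma> p \<otimes>\<^bsub>mpoly_ring K W\<^esub> poly_subst K W \<sigma> q"
    using pq assms by (rule poly_subst_mult)
  show "poly_subst K W \<sigma> (p \<oplus>\<^bsub>mpoly_ring K V\<^esub> q) =
      poly_subst K W \<sigma> p \<oplus>\<^bsub>mpoly_ring K W\<^esub> poly_subst K W \<sigma> q"
    unfolding mpoly_add[of V p q] using pq assms by (rule poly_subst_add)
qed

lemma poly_subst_apply:
  assumes p: "is_mpoly V p" and s: "\<sigma> \<in> V \<rightarrow> carrier (mpoly_ring K W)"
    and S: "finite S" "\<And>m. p m \<noteq> \<zero> \<Longrightarrow> m \<in> S" "\<And>m. m \<in> S \<Longrightarrow> set_mset m \<subseteq> V"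
  shows "poly_subst K W \<sigma> p l = finsum K (\<lambda>m. p m \<otimes> subst_monom W \<sigma> m l) S"
proof -
  interpret W: cring "mpoly_ring K W" by (rule cring_mpoly)
  have T: "{m\<in>S. set_mset m \<subseteq> V} = S" using S(3) by auto
  have c: "is_mpoly W (subst_monom W \<sigma> m)" if "m \<in> S" for m
    using subst_monom_closed[of \<sigma> m W] s S(3) that by (auto simp: mpoly_carrier)
  have pc: "p m \<in> carrier K" for m
    using p by (simp add: is_mpoly_coeff[of V])
  have "poly_subst K W \<sigma> p = finsum (mpoly_ring K W)
      (\<lambda>m. indexed_const (p m) \<otimes>\<^bsub>mpoly_ring K W\<^esub> subst_monom W \<sigma> m) S"
    using poly_subst_eq[of V p \<sigma> W S] p s S(1,2) unfolding T by blast
  then have "poly_subst K W \<sigma> p l = finsum K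
      (\<lambda>m. (indexed_const (p m) \<otimes>\<^bsub>mpoly_ring K W\<^esub> subst_monom W \<sigma> m) l) S"
    using c pc by (simp add: finsum_mpoly_apply const_closed mpoly_carrier[symmetric])
  also have "\<dots> = finsum K (\<lambda>m. p m \<otimes> subst_monom W \<sigma> m l) S"
    by (rule finsum_cong') (use c pc in \<open>auto simp: mpoly_const_mult is_mpoly_coeff[of W]\<close>)
  finally show ?thesis .
qed

text \<open>Applied with \<open>Inl\<close> and \<open>Inr\<close>, this reads off the coefficients
  of \<open>p \<otimes> 1\<close> and \<open>1 \<otimes> q\<close> in the tensor square.\<close>

lemma poly_subst_rename:
  assumes p: "is_mpoly V p" and f: "f ` V \<subseteq> W" "inj f"
  shows "poly_subst K W (\<lambda>v. indexed_var (f v)) p (image_mset f m) = p m"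
    and "l \<notin> range (image_mset f) \<Longrightarrow> poly_subst K W (\<lambda>v. indexed_var (f v)) p l = \<zero>"
proof -
  let ?S = "{m. p m \<noteq> \<zero>}"
  have s: "(\<lambda>v. indexed_var (f v)) \<in> V \<rightarrow> carrier (mpoly_ring K W)"
    using f by (auto simp: var_closed)
  have S: "finite ?S" "\<And>n. n \<in> ?S \<Longrightarrow> set_mset n \<subseteq> V"
    using p by (auto simp: is_mpoly_def)
  have pc: "p m \<in> carrier K" for m
    using p by (simp add: is_mpoly_coeff[of V])
  have sm: "subst_monom W (\<lambda>v. indexed_var (f v)) n = indexed_monom \<one> (image_mset f n)" if "n \<in> ?S" for n
    using S(2)[OF that] f by (intro subst_monom_vars) auto
  have eq: "poly_subst K W (\<lambda>v. indexed_var (f v)) p l =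
      finsum K (\<lambda>n. p n \<otimes> indexed_monom \<one> (image_mset f n) l) ?S" for l
    using poly_subst_apply[OF p s S(1), of l] S(2) pc
    by (auto simp: sm indexed_monom_def intro!: finsum_cong')
  have inj: "image_mset f n = image_mset f n' \<longleftrightarrow> n = n'" for n n'
    using f(2) by (metis inj_def multiset.inj_map)
  show "poly_subst K W (\<lambda>v. indexed_var (f v)) p (image_mset f m) = p m"
  proof (cases "p m = \<zero>")
    case True
    then show ?thesis unfolding eq
      by (subst finsum_all_zero) (use pc True inj in \<open>auto simp: indexed_monom_def\<close>)
  next
    case False
    then have "finsum K (\<lambda>n. p n \<otimes> indexed_monom \<one> (image_mset f n) (image_mset f m)) ?S =
      (\<lambda>n. p n \<otimes> indexed_monom \<one> (image_mset f n) (image_mset f m)) m"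
      using S pc by (intro finsum_single) (auto simp: indexed_monom_def inj)
    then show ?thesis unfolding eq using pc by (simp add: indexed_monom_def)
  qed
  show "poly_subst K W (\<lambda>v. indexed_var (f v)) p l = \<zero>" if "l \<notin> range (image_mset f)"
    unfolding eq by (rule finsum_all_zero) (use pc that in \<open>auto simp: indexed_monom_def\<close>)
qed

text \<open>Restriction of a function to the coordinate subspace of \<open>S\<close>, that is, all
  other variables are set to zero. Being a ring homomorphism, it can be applied to the
  comultiplication of each variable before powers are expanded.\<close>

definition mpoly_trunc :: "'v set \<Rightarrow> ('v multiset \<Rightarrow> 'a) \<Rightarrow> 'v multiset \<Rightarrow> 'a" where
  "mpoly_trunc S p = (\<lambda>m. if set_mset m \<subseteq> S then p m else \<zero>)"

lemma mpoly_trunc_monom: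
  "mpoly_trunc S (indexed_monom c m) = (if set_mset m \<subseteq> S then indexed_monom c m else (\<lambda>_. \<zero>))"
  by (cases "set_mset m \<subseteq> S") (auto simp: mpoly_trunc_def indexed_monom_def fun_eq_iff)

lemma is_mpoly_trunc: "is_mpoly V p \<Longrightarrow> is_mpoly V (mpoly_trunc S p)"
  unfolding is_mpoly_def mpoly_trunc_def
  by (auto elim!: rev_finite_subset)

text \<open>A product of monomials uses only variables from \<open>S\<close> iff both factors
  do.\<close>

lemma mpoly_trunc_mult:
  assumes p: "is_mpoly V p" and q: "is_mpoly V q"
  shows "mpoly_trunc S (p \<otimes>\<^bsub>mpoly_ring K V\<^esub> q) =
    mpoly_trunc S p \<otimes>\<^bsub>mpoly_ring K V\<^esub> mpoly_trunc S q"
proof (rule ext)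
  fix m
  have pc: "p l \<in> carrier K" "q l \<in> carrier K" for l
    using p q by (simp_all add: is_mpoly_coeff[of V])
  show "mpoly_trunc S (p \<otimes>\<^bsub>mpoly_ring K V\<^esub> q) m =
      (mpoly_trunc S p \<otimes>\<^bsub>mpoly_ring K V\<^esub> mpoly_trunc S q) m"
  proof (cases "set_mset m \<subseteq> S")
    case True
    have "set_mset l \<subseteq> S \<and> set_mset (m - l) \<subseteq> S" if "l \<subseteq># m" for l
      using True that set_mset_mono[OF that] set_mset_mono[OF diff_subset_eq_self[of m l]] by auto
    then show ?thesis
      unfolding mpoly_mult mpoly_trunc_def using True pc
      by (auto simp: mpoly_mult intro!: finsum_cong')
  next
    case False
    have "\<not> (set_mset l \<subseteq> S \<and> set_mset (m - l) \<subseteq> S)" if "l \<subseteq># m" for l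
      using False that by (metis Un_least set_mset_union subset_mset.add_diff_inverse)
    then have "finsum K (\<lambda>l. mpoly_trunc S p l \<otimes> mpoly_trunc S q (m - l)) {l. l \<subseteq># m} = \<zero>"
      using pc by (intro finsum_all_zero) (auto simp: mpoly_trunc_def)
    then show ?thesis using False by (simp add: mpoly_mult) (simp add: mpoly_trunc_def)
  qed
qed

lemma mpoly_trunc_hom: "mpoly_trunc S \<in> Ring.ring_hom (mpoly_ring K V) (mpoly_ring K V)"
proof (rule Ring.ring_hom_memI)
  show "mpoly_trunc S \<one>\<^bsub>mpoly_ring K V\<^esub> = \<one>\<^bsub>mpoly_ring K V\<^esub>"
    by (simp add: mpoly_one mpoly_trunc_monom)
qed (simp_all add: mpoly_carrier is_mpoly_trunc mpoly_trunc_mult, auto simp: mpoly_trunc_def mpoly_add)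

lemma mpoly_trunc_subst_monom:
  assumes s: "\<sigma> \<in> set_mset m \<rightarrow> carrier (mpoly_ring K W)"
  shows "mpoly_trunc S (subst_monom W \<sigma> m) = subst_monom W (\<lambda>v. mpoly_trunc S (\<sigma> v)) m"
  using assms
proof (induction m)
  case empty
  then show ?case by (simp add: subst_monom_empty mpoly_one mpoly_trunc_monom)
next
  case (add v m)
  have "subst_monom W (\<lambda>v. mpoly_trunc S (\<sigma> v)) (add_mset v m) =
     mpoly_trunc S (\<sigma> v) \<otimes>\<^bsub>mpoly_ring K W\<^esub> subst_monom W (\<lambda>v. mpoly_trunc S (\<sigma> v)) m"
    using add.prems by (intro subst_monom_add_mset) (auto simp: mpoly_carrier Pi_iff intro!: is_mpoly_trunc)
  moreover have "subst_monom W \<sigma> (add_mset v m) = \<sigma> v \<otimes>\<^bsub>mpoly_ring K W\<^esub> subst_monom W \<sigma> m"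
    using add.prems by (intro subst_monom_add_mset) auto
  moreover have "is_mpoly W (\<sigma> v)" "is_mpoly W (subst_monom W \<sigma> m)"
    using add.prems subst_monom_closed[of \<sigma> m W] by (auto simp: mpoly_carrier)
  ultimately show ?case using add by (simp add: mpoly_trunc_mult)
qed

text \<open>With \<open>l\<close> and \<open>r\<close> the two copies of one coordinate, this is
  where the binomial coefficients of the divided power relation come from.\<close>

lemma two_var_power_coeff:
  assumes "l \<in> V" "r \<in> V" "l \<noteq> r"
  shows "((indexed_var l \<oplus>\<^bsub>mpoly_ring K V\<^esub> indexed_var r) [^]\<^bsub>mpoly_ring K V\<^esub> (n :: nat))
      (replicate_mset s l + replicate_mset t r) =
    (if s + t = n then add_pow K (n choose s) \<one> else \<zero>)"
proof -
  interpret V: cring "mpoly_ring K V" by (rule cring_mpoly)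
  define M where "M = replicate_mset s l + replicate_mset t r"
  define N where "N k = replicate_mset k l + replicate_mset (n - k) r" for k
  have mc: "indexed_monom \<one> (N k) \<in> carrier (mpoly_ring K V)" for k
    using assms by (auto simp: mpoly_carrier N_def intro!: is_mpoly_monom split: if_splits)
  have M_eq: "M = N k \<longleftrightarrow> s = k \<and> t = n - k" for k
  proof
    assume "M = N k"
    then have "count M l = count (N k) l" "count M r = count (N k) r" by simp_all
    then show "s = k \<and> t = n - k" using assms(3) by (simp add: M_def N_def)
  qed (simp add: M_def N_def)
  have "(indexed_var l \<oplus>\<^bsub>mpoly_ring K V\<^esub> indexed_var r) [^]\<^bsub>mpoly_ring K V\<^esub> n =
    finsum (mpoly_ring K V) (\<lambda>k. add_pow (mpoly_ring K V) (n choose k) (indexed_monom \<one> (N k))) {..n}"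
    using assms V.binomial_expansion[of "indexed_var l" "indexed_var r" n]
    by (simp add: var_closed) (simp add: indexed_var_monom monom_pow monom_mult N_def)
  moreover have "finsum (mpoly_ring K V) (\<lambda>k. add_pow (mpoly_ring K V) (n choose k) (indexed_monom \<one> (N k))) {..n} M =
      finsum K (\<lambda>k. add_pow (mpoly_ring K V) (n choose k) (indexed_monom \<one> (N k)) M) {..n}"
    using mc by (intro finsum_mpoly_apply) auto
  ultimately have eq: "((indexed_var l \<oplus>\<^bsub>mpoly_ring K V\<^esub> indexed_var r) [^]\<^bsub>mpoly_ring K V\<^esub> n) M =
     finsum K (\<lambda>k. add_pow K (n choose k) (indexed_monom \<one> (N k) M)) {..n}"
    using mc by (simp add: add_pow_mpoly_apply)
  show ?thesis
  proof (cases "s + t = n")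
    case True
    have "finsum K (\<lambda>k. add_pow K (n choose k) (indexed_monom \<one> (N k) M)) {..n} =
       (\<lambda>k. add_pow K (n choose k) (indexed_monom \<one> (N k) M)) s"
      using True by (intro finsum_single) (auto simp: indexed_monom_def M_eq)
    moreover have "M = N s" using True M_eq by auto
    ultimately show ?thesis using True eq by (simp add: indexed_monom_def M_def)
  next
    case False
    have "finsum K (\<lambda>k. add_pow K (n choose k) (indexed_monom \<one> (N k) M)) {..n} = \<zero>"
      using False by (intro finsum_all_zero) (auto simp: indexed_monom_def M_eq)
    then show ?thesis using False eq by (simp add: M_def)
  qed
qed

end

section \<open>Matrices\<close>

lemma mod_less_of_less_mult: "i < a * b \<Longrightarrow> i mod b < (b :: nat)"
  by (cases b) auto

lemma pair_index_less:
  assumes "a < p" "b < (q :: nat)"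
  shows "a * q + b < p * q"
proof -
  have "a * q + b < Suc a * q" using assms by simp
  also have "\<dots> \<le> p * q" using assms(1) by (intro mult_le_mono1) simp
  finally show ?thesis .
qed

lemma mod_mult_div: "(i :: nat) mod (b * c) div c = i div c mod b"
  by (cases "c = 0") (simp_all add: mult.commute[of b c] mod_mult2_eq)

lemma eq_mult_add_iff:
  assumes "r < (n :: nat)"
  shows "i = q * n + r \<longleftrightarrow> i div n = q \<and> i mod n = r"
proof
  assume "i div n = q \<and> i mod n = r"
  then show "i = q * n + r" using div_mult_mod_eq[of i n] by simp
qed (use assms in simp)

definition mat_over :: "('a, 'b) ring_scheme \<Rightarrow> 'a mat \<Rightarrow> bool" where
  "mat_over R A \<longleftrightarrow> (\<forall>i<dim_row A. \<forall>j<dim_col A. A $$ (i, j) \<in> carrier R)"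

lemma mat_overD: "mat_over R A \<Longrightarrow> i < dim_row A \<Longrightarrow> j < dim_col A \<Longrightarrow> A $$ (i, j) \<in> carrier R"
  by (simp add: mat_over_def)

text \<open>The matrix of the map sending the basis vector \<open>j\<close> to the basis vector
  \<open>f j\<close>. Identities and swaps have this form, so their compositions, Kronecker products
  and images under ring homomorphisms reduce to computations with index functions.\<close>

definition fun_mat :: "('a, 'b) ring_scheme \<Rightarrow> nat \<Rightarrow> nat \<Rightarrow> (nat \<Rightarrow> nat) \<Rightarrow> 'a mat" where
  "fun_mat R n n' f = mat n' n (\<lambda>(i, j). if i = f j then \<one>\<^bsub>R\<^esub> else \<zero>\<^bsub>R\<^esub>)"

lemma mat_comp_dim [simp]: "dim_row (mat_comp R A B) = dim_row A" "dim_col (mat_comp R A B) = dim_col B"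
  by (simp_all add: mat_comp_def)

lemma mat_kron_dim [simp]:
  "dim_row (mat_kron R A B) = dim_row A * dim_row B" "dim_col (mat_kron R A B) = dim_col A * dim_col B"
  by (simp_all add: mat_kron_def)

lemma mat_id_dim [simp]: "dim_row (mat_id R n) = n" "dim_col (mat_id R n) = n"
  by (simp_all add: mat_id_def)

lemma fun_mat_dim [simp]: "dim_row (fun_mat R n n' f) = n'" "dim_col (fun_mat R n n' f) = n"
  by (simp_all add: fun_mat_def)

lemma mat_swap_dim [simp]: "dim_row (mat_swap R n m) = m * n" "dim_col (mat_swap R n m) = n * m"
  by (simp_all add: mat_swap_def)

lemma mat_comp_index [simp]:
  "i < dim_row A \<Longrightarrow> j < dim_col B \<Longrightarrow> mat_comp R A B $$ (i, j) =
    finsum R (\<lambda>l. A $$ (i, l) \<otimes>\<^bsub>R\<^esub> B $$ (l, j)) {..<dim_col A}"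
  by (simp add: mat_comp_def)

lemma mat_kron_index [simp]:
  "i < dim_row A * dim_row B \<Longrightarrow> j < dim_col A * dim_col B \<Longrightarrow> mat_kron R A B $$ (i, j) =
    A $$ (i div dim_row B, j div dim_col B) \<otimes>\<^bsub>R\<^esub> B $$ (i mod dim_row B, j mod dim_col B)"
  by (simp add: mat_kron_def)

lemma mat_id_fun_mat: "mat_id R n = fun_mat R n n (\<lambda>j. j)"
  by (simp add: mat_id_def fun_mat_def)

text \<open>If \<open>j\<close> numbers \<open>e a \<otimes> f b\<close>, with dimensions
  \<open>n\<close> and \<open>m\<close> of the factors, then this is the number of
  \<open>f b \<otimes> e a\<close>.\<close>

definition swap_index :: "nat \<Rightarrow> nat \<Rightarrow> nat \<Rightarrow> nat" where
  "swap_index n m j = (j mod m) * n + j div m"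

lemma swap_index_less: "j < n * m \<Longrightarrow> swap_index n m j < m * n"
  unfolding swap_index_def
  by (intro pair_index_less mod_less_of_less_mult less_mult_imp_div_less) auto

lemma swap_index_swap:
  assumes "j < n * m"
  shows "swap_index m n (swap_index n m j) = j"
proof -
  have "j div m < n" using assms by (rule less_mult_imp_div_less)
  then show ?thesis by (simp add: swap_index_def)
qed

lemma swap_index_div_mod:
  assumes "j < n * m"
  shows "swap_index n m j div n = j mod m" "swap_index n m j mod n = j div m"
proof -
  have "j div m < n" using assms by (rule less_mult_imp_div_less)
  then show "swap_index n m j div n = j mod m" "swap_index n m j mod n = j div m"
    by (simp_all add: swap_index_def)
qed

lemma mat_swap_fun_mat: "mat_swap R n m = fun_mat R (n * m) (m * n) (swap_index n m)"
proof (rule eq_matI)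
  fix i j assume "i < dim_row (fun_mat R (n * m) (m * n) (swap_index n m))"
    "j < dim_col (fun_mat R (n * m) (m * n) (swap_index n m))"
  then have ij: "i < m * n" "j < n * m" by simp_all
  have "i div n = j mod m \<and> i mod n = j div m \<longleftrightarrow> i = swap_index n m j"
    unfolding swap_index_def using ij(2)
    by (intro eq_mult_add_iff[symmetric]) (simp add: less_mult_imp_div_less)
  then show "mat_swap R n m $$ (i, j) = fun_mat R (n * m) (m * n) (swap_index n m) $$ (i, j)"
    using ij by (simp add: mat_swap_def fun_mat_def)
qed simp_all

context cring
begin

lemma finsum_single_nat:
  assumes "s < n" "f s \<in> carrier R" "\<And>t. t < n \<Longrightarrow> t \<noteq> s \<Longrightarrow> f t = \<zero>"
  shows "finsum R f {..<n :: nat} = f s"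
  using assms by (intro finsum_single) auto

text \<open>Splits an index of a tensor product into its two components, following the numbering
  \<open>a * q + b\<close> of \<open>mat_kron\<close>.\<close>

lemma finsum_lessThan_mult:
  assumes "\<And>l. l < p * (q :: nat) \<Longrightarrow> f l \<in> carrier R"
  shows "finsum R f {..<p * q} = finsum R (\<lambda>a. finsum R (\<lambda>b. f (a * q + b)) {..<q}) {..<p}"
  using assms
proof (induction p)
  case (Suc p)
  have eq: "{..<Suc p * q} = {..<p * q} \<union> (\<lambda>b. p * q + b) ` {..<q}"
  proof -
    have "(\<lambda>b. p * q + b) ` {..<q} = {p * q..<p * q + q}"
      using image_add_atLeastLessThan[of "p * q" 0 q] by (simp add: lessThan_atLeast0 add.commute)
    then show ?thesis by auto
  qed
  have "finsum R f {..<Suc p * q} = finsum R f {..<p * q} \<oplus> finsum R f ((\<lambda>b. p * q + b) ` {..<q})"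
    unfolding eq by (rule finsum_Un_disjoint) (use Suc.prems in auto)
  also have "finsum R f ((\<lambda>b. p * q + b) ` {..<q}) = finsum R (\<lambda>b. f (p * q + b)) {..<q}"
    by (rule finsum_reindex) (use Suc.prems in \<open>auto simp: inj_on_def\<close>)
  also have "finsum R f {..<p * q} = finsum R (\<lambda>a. finsum R (\<lambda>b. f (a * q + b)) {..<q}) {..<p}"
    using Suc by simp
  finally have "finsum R f {..<Suc p * q} =
    finsum R (\<lambda>a. finsum R (\<lambda>b. f (a * q + b)) {..<q}) {..<p} \<oplus> finsum R (\<lambda>b. f (p * q + b)) {..<q}" .
  moreover have "f (a * q + b) \<in> carrier R" if "a \<le> p" "b < q" for a b
    using Suc.prems pair_index_less[of a "Suc p" b q] that by simp
  then have "(\<lambda>a. finsum R (\<lambda>b. f (a * q + b)) {..<q}) \<in> {..<p} \<rightarrow> carrier R"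
    "finsum R (\<lambda>b. f (p * q + b)) {..<q} \<in> carrier R"
    by (auto intro!: finsum_closed)
  ultimately show ?case by (simp add: lessThan_Suc a_comm)
qed simp

lemma finsum_swap:
  assumes "finite A" "finite B" "\<And>a b. a \<in> A \<Longrightarrow> b \<in> B \<Longrightarrow> f a b \<in> carrier R"
  shows "finsum R (\<lambda>a. finsum R (f a) B) A = finsum R (\<lambda>b. finsum R (\<lambda>a. f a b) A) B"
  using assms(1,3)
proof (induction A)
  case (insert a A)
  have "finsum R (\<lambda>a. finsum R (f a) B) (insert a A) =
      finsum R (f a) B \<oplus> finsum R (\<lambda>b. finsum R (\<lambda>a. f a b) A) B"
    using insert by (subst finsum_insert) (auto intro!: finsum_closed)
  also have "\<dots> = finsum R (\<lambda>b. f a b \<oplus> finsum R (\<lambda>a. f a b) A) B"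
    using insert by (subst finsum_addf) (auto intro!: finsum_closed)
  also have "\<dots> = finsum R (\<lambda>b. finsum R (\<lambda>a. f a b) (insert a A)) B"
    by (rule finsum_cong') (use insert in \<open>auto intro!: finsum_closed\<close>)
  finally show ?case .
qed simp

lemma mat_over_comp:
  assumes "mat_over R A" "mat_over R B" "dim_col A = dim_row B"
  shows "mat_over R (mat_comp R A B)"
  using assms by (auto simp: mat_over_def intro!: finsum_closed)

lemma mat_over_kron:
  assumes "mat_over R A" "mat_over R B"
  shows "mat_over R (mat_kron R A B)"
  using assms mod_less_of_less_mult[of _ "dim_row A" "dim_row B"] mod_less_of_less_mult[of _ "dim_col A" "dim_col B"]
  by (auto simp: mat_over_def intro!: m_closed less_mult_imp_div_less)

lemma mat_over_fun_mat: "mat_over R (fun_mat R n n' f)"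
  by (simp add: mat_over_def fun_mat_def)

lemma mat_over_id: "mat_over R (mat_id R n)"
  by (simp add: mat_id_fun_mat mat_over_fun_mat)

lemma mat_comp_assoc:
  assumes A: "mat_over R A" and B: "mat_over R B" and C: "mat_over R C"
    and d: "dim_col A = dim_row B" "dim_col B = dim_row C"
  shows "mat_comp R A (mat_comp R B C) = mat_comp R (mat_comp R A B) C"
proof (rule eq_matI)
  fix i j assume "i < dim_row (mat_comp R (mat_comp R A B) C)" "j < dim_col (mat_comp R (mat_comp R A B) C)"
  then have ij: "i < dim_row A" "j < dim_col C" by simp_all
  note cl = mat_overD[OF A] mat_overD[OF B] mat_overD[OF C]
  have "mat_comp R A (mat_comp R B C) $$ (i, j) =
    finsum R (\<lambda>l. finsum R (\<lambda>k. A $$ (i, l) \<otimes> (B $$ (l, k) \<otimes> C $$ (k, j))) {..<dim_col B}) {..<dim_col A}"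
    using ij cl d by (auto simp: finsum_rdistr intro!: finsum_cong' finsum_closed)
  also have "\<dots> = finsum R (\<lambda>k. finsum R (\<lambda>l. A $$ (i, l) \<otimes> (B $$ (l, k) \<otimes> C $$ (k, j))) {..<dim_col A}) {..<dim_col B}"
    by (rule finsum_swap) (use ij cl d in auto)
  also have "\<dots> = mat_comp R (mat_comp R A B) C $$ (i, j)"
    using ij cl d by (auto simp: finsum_ldistr m_assoc intro!: finsum_cong' finsum_closed)
  finally show "mat_comp R A (mat_comp R B C) $$ (i, j) = mat_comp R (mat_comp R A B) C $$ (i, j)" .
qed simp_all

text \<open>The sum over the tensor basis becomes a double sum whose terms separate, by
  commutativity, into a factor from \<open>A\<close> and \<open>B\<close> and a factor from
  \<open>C\<close> and \<open>D\<close>. This interchange law yields both the functoriality of the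
  tensor product and the fact that tensor products of representations are representations.\<close>

lemma mat_kron_comp:
  assumes A: "mat_over R A" and B: "mat_over R B" and C: "mat_over R C" and D: "mat_over R D"
    and d: "dim_col A = dim_row B" "dim_col C = dim_row D"
  shows "mat_kron R (mat_comp R A B) (mat_comp R C D) = mat_comp R (mat_kron R A C) (mat_kron R B D)"
proof (rule eq_matI)
  fix i j assume "i < dim_row (mat_comp R (mat_kron R A C) (mat_kron R B D))"
    "j < dim_col (mat_comp R (mat_kron R A C) (mat_kron R B D))"
  then have ij: "i < dim_row A * dim_row C" "j < dim_col B * dim_col D" by simp_all
  define i1 i2 j1 j2 where "i1 = i div dim_row C" "i2 = i mod dim_row C" "j1 = j div dim_col D" "j2 = j mod dim_col D"
  have lt: "i1 < dim_row A" "i2 < dim_row C" "j1 < dim_col B" "j2 < dim_col D"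
    using ij by (simp_all add: i1_i2_j1_j2_def less_mult_imp_div_less mod_less_of_less_mult)
  note cl = mat_overD[OF A] mat_overD[OF B, folded d(1)] mat_overD[OF C] mat_overD[OF D, folded d(2)]
  let ?p = "dim_col A" and ?q = "dim_col C"
  have split: "mat_kron R A C $$ (i, a * ?q + b) \<otimes> mat_kron R B D $$ (a * ?q + b, j) =
     (A $$ (i1, a) \<otimes> B $$ (a, j1)) \<otimes> (C $$ (i2, b) \<otimes> D $$ (b, j2))" if ab: "a < ?p" "b < ?q" for a b
  proof -
    have "a * ?q + b < ?p * ?q" using ab by (rule pair_index_less)
    then show ?thesis using ij ab lt cl
      by (simp add: i1_i2_j1_j2_def[symmetric] d[symmetric] m_ac)
  qed
  have "mat_comp R (mat_kron R A C) (mat_kron R B D) $$ (i, j) =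
    finsum R (\<lambda>l. mat_kron R A C $$ (i, l) \<otimes> mat_kron R B D $$ (l, j)) {..<?p * ?q}"
    using ij by (subst mat_comp_index) simp_all
  also have "\<dots> = finsum R (\<lambda>a. finsum R (\<lambda>b. mat_kron R A C $$ (i, a * ?q + b) \<otimes> mat_kron R B D $$ (a * ?q + b, j)) {..<?q}) {..<?p}"
    using ij mat_overD[OF mat_over_kron[OF A C]] mat_overD[OF mat_over_kron[OF B D]] d
    by (intro finsum_lessThan_mult m_closed) simp_all
  also have "\<dots> = finsum R (\<lambda>a. finsum R (\<lambda>b. (A $$ (i1, a) \<otimes> B $$ (a, j1)) \<otimes> (C $$ (i2, b) \<otimes> D $$ (b, j2))) {..<?q}) {..<?p}"
    using lt cl by (intro finsum_cong') (auto simp: split intro!: finsum_closed finsum_cong')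
  also have "\<dots> = finsum R (\<lambda>a. (A $$ (i1, a) \<otimes> B $$ (a, j1)) \<otimes> finsum R (\<lambda>b. C $$ (i2, b) \<otimes> D $$ (b, j2)) {..<?q}) {..<?p}"
    using lt cl by (intro finsum_cong') (auto intro!: finsum_rdistr[symmetric] finsum_closed)
  also have "\<dots> = finsum R (\<lambda>a. A $$ (i1, a) \<otimes> B $$ (a, j1)) {..<?p} \<otimes> finsum R (\<lambda>b. C $$ (i2, b) \<otimes> D $$ (b, j2)) {..<?q}"
    using lt cl by (intro finsum_ldistr[symmetric]) (auto intro!: finsum_closed)
  also have "\<dots> = mat_kron R (mat_comp R A B) (mat_comp R C D) $$ (i, j)"
    using ij lt by (simp add: i1_i2_j1_j2_def)
  finally show "mat_kron R (mat_comp R A B) (mat_comp R C D) $$ (i, j) =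
    mat_comp R (mat_kron R A C) (mat_kron R B D) $$ (i, j)" ..
qed simp_all

lemma mat_comp_fun_mat_right:
  assumes A: "mat_over R A" and f: "\<And>j. j < n \<Longrightarrow> f j < dim_col A" and i: "i < dim_row A" and j: "j < n"
  shows "mat_comp R A (fun_mat R n (dim_col A) f) $$ (i, j) = A $$ (i, f j)"
proof -
  have "finsum R (\<lambda>l. A $$ (i, l) \<otimes> fun_mat R n (dim_col A) f $$ (l, j)) {..<dim_col A} =
     (\<lambda>l. A $$ (i, l) \<otimes> fun_mat R n (dim_col A) f $$ (l, j)) (f j)"
    by (rule finsum_single_nat) (use A f[OF j] i j in \<open>simp_all add: mat_overD fun_mat_def\<close>)
  then show ?thesis using A f[OF j] i j by (simp add: mat_overD fun_mat_def)
qed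

lemma mat_comp_fun_mat_left:
  assumes A: "mat_over R A" and f: "inj_on f {..<dim_row A}" and j: "j < dim_col A"
    and l: "l < dim_row A" "f l < n"
  shows "mat_comp R (fun_mat R (dim_row A) n f) A $$ (f l, j) = A $$ (l, j)"
proof -
  have "finsum R (\<lambda>k. fun_mat R (dim_row A) n f $$ (f l, k) \<otimes> A $$ (k, j)) {..<dim_row A} =
     (\<lambda>k. fun_mat R (dim_row A) n f $$ (f l, k) \<otimes> A $$ (k, j)) l"
    by (rule finsum_single_nat)
      (use A f l j in \<open>auto simp: mat_overD fun_mat_def inj_on_def\<close>)
  then show ?thesis using A l j by (simp add: mat_overD fun_mat_def)
qed

lemma mat_comp_id_right: "mat_over R A \<Longrightarrow> dim_col A = n \<Longrightarrow> mat_comp R A (mat_id R n) = A"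
  unfolding mat_id_fun_mat by (rule eq_matI) (auto simp: mat_comp_fun_mat_right simp del: mat_comp_index)

lemma mat_comp_id_left:
  assumes "mat_over R A" "dim_row A = n"
  shows "mat_comp R (mat_id R n) A = A"
proof (rule eq_matI)
  fix i j assume "i < dim_row A" "j < dim_col A"
  then show "mat_comp R (mat_id R n) A $$ (i, j) = A $$ (i, j)"
    using mat_comp_fun_mat_left[of A "\<lambda>j. j" j i n] assms
    by (simp add: mat_id_fun_mat del: mat_comp_index)
qed (use assms in auto)

lemma fun_mat_comp:
  assumes "\<And>j. j < n \<Longrightarrow> f j < n'"
  shows "mat_comp R (fun_mat R n' n'' g) (fun_mat R n n' f) = fun_mat R n n'' (\<lambda>j. g (f j))"
proof (rule eq_matI)
  fix i j assume "i < dim_row (fun_mat R n n'' (\<lambda>j. g (f j)))" "j < dim_col (fun_mat R n n'' (\<lambda>j. g (f j)))"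
  then show "mat_comp R (fun_mat R n' n'' g) (fun_mat R n n' f) $$ (i, j) = fun_mat R n n'' (\<lambda>j. g (f j)) $$ (i, j)"
    using assms mat_comp_fun_mat_right[of "fun_mat R n' n'' g" n f i j]
    by (simp add: mat_over_fun_mat del: mat_comp_index) (simp add: fun_mat_def)
qed simp_all

lemma fun_mat_kron:
  assumes f: "\<And>j. j < n \<Longrightarrow> f j < n'" and g: "\<And>j. j < m \<Longrightarrow> g j < m'"
  shows "mat_kron R (fun_mat R n n' f) (fun_mat R m m' g) =
    fun_mat R (n * m) (n' * m') (\<lambda>j. f (j div m) * m' + g (j mod m))"
proof (rule eq_matI)
  fix i j assume "i < dim_row (fun_mat R (n * m) (n' * m') (\<lambda>j. f (j div m) * m' + g (j mod m)))"
    "j < dim_col (fun_mat R (n * m) (n' * m') (\<lambda>j. f (j div m) * m' + g (j mod m)))"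
  then have ij: "i < n' * m'" "j < n * m" by simp_all
  have lt: "i div m' < n'" "i mod m' < m'" "j div m < n" "j mod m < m"
    using ij by (simp_all add: less_mult_imp_div_less mod_less_of_less_mult)
  have "i = f (j div m) * m' + g (j mod m) \<longleftrightarrow> i div m' = f (j div m) \<and> i mod m' = g (j mod m)"
    using g[OF lt(4)] by (rule eq_mult_add_iff)
  then show "mat_kron R (fun_mat R n n' f) (fun_mat R m m' g) $$ (i, j) =
      fun_mat R (n * m) (n' * m') (\<lambda>j. f (j div m) * m' + g (j mod m)) $$ (i, j)"
    using ij lt by (simp add: fun_mat_def)
qed simp_all

lemma fun_mat_cong: "(\<And>j. j < n \<Longrightarrow> f j = g j) \<Longrightarrow> fun_mat R n n' f = fun_mat R n n' g"
  by (rule eq_matI) (auto simp: fun_mat_def)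

lemma mat_kron_id: "mat_kron R (mat_id R n) (mat_id R m) = mat_id R (n * m)"
  unfolding mat_id_fun_mat by (subst fun_mat_kron) simp_all

lemma mat_kron_assoc:
  assumes A: "mat_over R A" and B: "mat_over R B" and C: "mat_over R C"
  shows "mat_kron R (mat_kron R A B) C = mat_kron R A (mat_kron R B C)"
proof (rule eq_matI)
  fix i j assume "i < dim_row (mat_kron R A (mat_kron R B C))" "j < dim_col (mat_kron R A (mat_kron R B C))"
  then have ij: "i < dim_row A * (dim_row B * dim_row C)" "j < dim_col A * (dim_col B * dim_col C)" by simp_all
  have ij': "i < (dim_row A * dim_row B) * dim_row C" "j < (dim_col A * dim_col B) * dim_col C"
    using ij by (simp_all add: mult.assoc)
  have lt: "i div dim_row C < dim_row A * dim_row B" "j div dim_col C < dim_col A * dim_col B"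
    "i mod (dim_row B * dim_row C) < dim_row B * dim_row C" "j mod (dim_col B * dim_col C) < dim_col B * dim_col C"
    using ij ij' less_mult_imp_div_less mod_less_of_less_mult by blast+
  have e: "i div dim_row C div dim_row B = i div (dim_row B * dim_row C)"
    "j div dim_col C div dim_col B = j div (dim_col B * dim_col C)"
    by (metis div_mult2_eq mult.commute)+
  have "i div (dim_row B * dim_row C) < dim_row A" "j div (dim_col B * dim_col C) < dim_col A"
    "i div dim_row C mod dim_row B < dim_row B" "j div dim_col C mod dim_col B < dim_col B"
    "i mod dim_row C < dim_row C" "j mod dim_col C < dim_col C"
    using ij ij' lt less_mult_imp_div_less mod_less_of_less_mult by blast+
  then show "mat_kron R (mat_kron R A B) C $$ (i, j) = mat_kron R A (mat_kron R B C) $$ (i, j)"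
    using ij ij' lt mat_overD[OF A] mat_overD[OF B] mat_overD[OF C]
    by (simp add: e mod_mult_div mod_mod_cancel m_assoc)
qed (simp_all add: mult.assoc)

lemma mat_kron_unit_left: "mat_over R A \<Longrightarrow> mat_kron R (mat_id R 1) A = A"
  by (rule eq_matI) (auto simp: mat_id_def mat_overD)

lemma mat_kron_unit_right: "mat_over R A \<Longrightarrow> mat_kron R A (mat_id R 1) = A"
  by (rule eq_matI) (auto simp: mat_id_def mat_overD)

lemma mat_swap_natural:
  assumes A: "mat_over R A" and B: "mat_over R B"
  shows "mat_comp R (mat_kron R B A) (mat_swap R (dim_col A) (dim_col B)) =
    mat_comp R (mat_swap R (dim_row A) (dim_row B)) (mat_kron R A B)"
proof (rule eq_matI)
  fix i j assume "i < dim_row (mat_comp R (mat_swap R (dim_row A) (dim_row B)) (mat_kron R A B))"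
    "j < dim_col (mat_comp R (mat_swap R (dim_row A) (dim_row B)) (mat_kron R A B))"
  then have ij: "i < dim_row B * dim_row A" "j < dim_col A * dim_col B" by simp_all
  \<comment> \<open>Row \<open>i\<close> is the image of row \<open>?l\<close> under the swap, which
    is the form in which \<open>mat_comp_fun_mat_left\<close> evaluates the right-hand side.\<close>
  let ?l = "swap_index (dim_row B) (dim_row A) i"
  have l: "?l < dim_row A * dim_row B" "swap_index (dim_row A) (dim_row B) ?l = i"
    using ij by (simp_all add: swap_index_less swap_index_swap)
  have inj: "inj_on (swap_index (dim_row A) (dim_row B)) {..<dim_row A * dim_row B}"
    by (rule inj_on_inverseI[of _ "swap_index (dim_row B) (dim_row A)"]) (simp add: swap_index_swap)
  have lt: "i div dim_row A < dim_row B" "i mod dim_row A < dim_row A" "j div dim_col B < dim_col A" "j mod dim_col B < dim_col B"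
    using ij by (simp_all add: less_mult_imp_div_less mod_less_of_less_mult)
  have "mat_comp R (mat_kron R B A) (mat_swap R (dim_col A) (dim_col B)) $$ (i, j) =
      mat_kron R B A $$ (i, swap_index (dim_col A) (dim_col B) j)"
    using mat_comp_fun_mat_right[OF mat_over_kron[OF B A], of "dim_col A * dim_col B" "swap_index (dim_col A) (dim_col B)" i j] ij
    by (simp add: mat_swap_fun_mat swap_index_less del: mat_comp_index)
  also have "\<dots> = mat_kron R A B $$ (?l, j)"
    using ij l lt mat_overD[OF A] mat_overD[OF B]
    by (simp add: swap_index_less swap_index_div_mod m_comm)
  also have "\<dots> = mat_comp R (mat_swap R (dim_row A) (dim_row B)) (mat_kron R A B) $$ (i, j)"
    using mat_comp_fun_mat_left[OF mat_over_kron[OF A B], of "swap_index (dim_row A) (dim_row B)" j ?l "dim_row B * dim_row A"] ij l inj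
    by (simp add: mat_swap_fun_mat del: mat_comp_index)
  finally show "mat_comp R (mat_kron R B A) (mat_swap R (dim_col A) (dim_col B)) $$ (i, j) =
    mat_comp R (mat_swap R (dim_row A) (dim_row B)) (mat_kron R A B) $$ (i, j)" .
qed simp_all

lemma mat_swap_swap: "mat_comp R (mat_swap R m n) (mat_swap R n m) = mat_id R (n * m)"
  unfolding mat_swap_fun_mat mat_id_fun_mat
  by (subst fun_mat_comp) (auto simp: swap_index_less swap_index_swap intro!: fun_mat_cong)

text \<open>The associators are identity matrices, so the hexagon is an identity between
  permutations: moving the first of three factors past a product is moving it past one factor and
  then past the other.\<close>

lemma mat_swap_hexagon:
  "mat_swap R n (m * l) =
    mat_comp R (mat_kron R (mat_id R m) (mat_swap R n l)) (mat_kron R (mat_swap R n m) (mat_id R l))"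
proof -
  let ?\<alpha> = "\<lambda>j. (j div (n * l)) * (l * n) + swap_index n l (j mod (n * l))"
  let ?\<beta> = "\<lambda>j. swap_index n m (j div l) * l + j mod l"
  have 1: "mat_kron R (mat_id R m) (mat_swap R n l) = fun_mat R (m * (n * l)) (m * (l * n)) ?\<alpha>"
    unfolding mat_swap_fun_mat mat_id_fun_mat by (rule fun_mat_kron) (simp_all add: swap_index_less)
  have 2: "mat_kron R (mat_swap R n m) (mat_id R l) = fun_mat R (n * m * l) (m * n * l) ?\<beta>"
    unfolding mat_swap_fun_mat mat_id_fun_mat by (rule fun_mat_kron) (simp_all add: swap_index_less)
  have lt: "j div l div m < n" "j div l mod m < m" "j mod l < l" if "j < n * m * l" for j
  proof -
    have "j div l < n * m" using that by (rule less_mult_imp_div_less)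
    then show "j div l div m < n" "j div l mod m < m"
      by (rule less_mult_imp_div_less, rule mod_less_of_less_mult)
    show "j mod l < l" using that by (rule mod_less_of_less_mult)
  qed
  have \<beta>: "?\<beta> j = (j div l mod m) * (n * l) + ((j div l div m) * l + j mod l)" for j
    by (simp add: swap_index_def algebra_simps)
  have \<beta>_lt: "(j div l div m) * l + j mod l < n * l" if "j < n * m * l" for j
    using lt(1)[OF that] lt(3)[OF that] by (rule pair_index_less)
  have "mat_comp R (mat_kron R (mat_id R m) (mat_swap R n l)) (mat_kron R (mat_swap R n m) (mat_id R l)) =
      fun_mat R (n * m * l) (m * (l * n)) (\<lambda>j. ?\<alpha> (?\<beta> j))"
    unfolding 1 2 mult.assoc[of m n l]
  proof (rule fun_mat_comp)
    fix j assume j: "j < n * m * l"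
    show "?\<beta> j < m * (n * l)"
      unfolding \<beta> using lt(2)[OF j] \<beta>_lt[OF j] by (rule pair_index_less)
  qed
  also have "\<dots> = fun_mat R (n * m * l) (m * (l * n)) (swap_index n (m * l))"
  proof (rule fun_mat_cong)
    fix j assume j: "j < n * m * l"
    \<comment> \<open>These are the three components of the index \<open>j\<close> of a basis vector
      of the triple tensor product.\<close>
    let ?a = "j div l div m" and ?b = "j div l mod m" and ?c = "j mod l"
    have "?\<beta> j div (n * l) = ?b" "?\<beta> j mod (n * l) = ?a * l + ?c"
      using eq_mult_add_iff[OF \<beta>_lt[OF j], of "?\<beta> j" ?b, THEN iffD1, OF \<beta>[of j]] by blast+
    moreover have "(?a * l + ?c) div l = ?a" "(?a * l + ?c) mod l = ?c"
      using lt(3)[OF j] by auto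
    ultimately have "?\<alpha> (?\<beta> j) = ?b * (l * n) + (?c * n + ?a)"
      by (simp add: swap_index_def)
    moreover have "j div (m * l) = ?a" "j mod (m * l) = l * ?b + ?c"
      by (simp_all only: mult.commute[of m l] div_mult2_eq mod_mult2_eq)
    ultimately show "?\<alpha> (?\<beta> j) = swap_index n (m * l) j"
      by (simp add: swap_index_def algebra_simps)
  qed
  finally show ?thesis by (simp add: mat_swap_fun_mat mult.assoc)
qed

end

lemma map_mat_comp:
  assumes "cring R" "cring S" "h \<in> Ring.ring_hom R S" "mat_over R A" "mat_over R B" "dim_col A = dim_row B"
  shows "map_mat h (mat_comp R A B) = mat_comp S (map_mat h A) (map_mat h B)"
proof (rule eq_matI)
  interpret h: ring_hom_cring R S h
    using assms by (simp add: ring_hom_cring_def ring_hom_cring_axioms_def)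
  fix i j assume "i < dim_row (mat_comp S (map_mat h A) (map_mat h B))"
    "j < dim_col (mat_comp S (map_mat h A) (map_mat h B))"
  then have ij: "i < dim_row A" "j < dim_col B" by simp_all
  have "h (finsum R (\<lambda>l. A $$ (i, l) \<otimes>\<^bsub>R\<^esub> B $$ (l, j)) {..<dim_col A}) =
      finsum S (h \<circ> (\<lambda>l. A $$ (i, l) \<otimes>\<^bsub>R\<^esub> B $$ (l, j))) {..<dim_col A}"
    using ij assms(4-6) by (intro h.hom_finsum) (auto simp: mat_overD)
  also have "\<dots> = finsum S (\<lambda>l. map_mat h A $$ (i, l) \<otimes>\<^bsub>S\<^esub> map_mat h B $$ (l, j)) {..<dim_col A}"
    using ij assms(4-6) by (intro h.S.finsum_cong') (auto simp: mat_overD)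
  finally show "map_mat h (mat_comp R A B) $$ (i, j) = mat_comp S (map_mat h A) (map_mat h B) $$ (i, j)"
    using ij by simp
qed simp_all

lemma map_mat_kron:
  assumes "h \<in> Ring.ring_hom R S" "mat_over R A" "mat_over R B"
  shows "map_mat h (mat_kron R A B) = mat_kron S (map_mat h A) (map_mat h B)"
  by (rule eq_matI)
    (use assms in \<open>auto simp: mat_overD Ring.ring_hom_mult[OF assms(1)] less_mult_imp_div_less mod_less_of_less_mult\<close>)

lemma map_mat_fun_mat:
  assumes "cring R" "cring S" "h \<in> Ring.ring_hom R S"
  shows "map_mat h (fun_mat R n n' f) = fun_mat S n n' f"
proof -
  interpret h: ring_hom_cring R S h
    using assms by (simp add: ring_hom_cring_def ring_hom_cring_axioms_def)
  show ?thesis by (rule eq_matI) (auto simp: fun_mat_def)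
qed

lemma mat_over_map_mat:
  assumes "h \<in> Ring.ring_hom R S" "mat_over R A"
  shows "mat_over S (map_mat h A)"
  using assms by (auto simp: mat_over_def Ring.ring_hom_closed)

section \<open>Linear structure on matrices of a fixed size\<close>

definition mat_add :: "('a, 'b) ring_scheme \<Rightarrow> nat \<Rightarrow> nat \<Rightarrow> 'a mat \<Rightarrow> 'a mat \<Rightarrow> 'a mat" where
  "mat_add R n m A B = mat n m (\<lambda>ij. A $$ ij \<oplus>\<^bsub>R\<^esub> B $$ ij)"

definition mat_scl :: "('a, 'b) ring_scheme \<Rightarrow> nat \<Rightarrow> nat \<Rightarrow> 'a \<Rightarrow> 'a mat \<Rightarrow> 'a mat" where
  "mat_scl R n m c A = mat n m (\<lambda>ij. c \<otimes>\<^bsub>R\<^esub> A $$ ij)"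

definition mat_zero :: "('a, 'b) ring_scheme \<Rightarrow> nat \<Rightarrow> nat \<Rightarrow> 'a mat" where
  "mat_zero R n m = mat n m (\<lambda>_. \<zero>\<^bsub>R\<^esub>)"

lemma mat_add_dim [simp]: "dim_row (mat_add R n m A B) = n" "dim_col (mat_add R n m A B) = m"
  by (simp_all add: mat_add_def)

lemma mat_scl_dim [simp]: "dim_row (mat_scl R n m c A) = n" "dim_col (mat_scl R n m c A) = m"
  by (simp_all add: mat_scl_def)

lemma mat_zero_dim [simp]: "dim_row (mat_zero R n m) = n" "dim_col (mat_zero R n m) = m"
  by (simp_all add: mat_zero_def)

lemma mat_add_index [simp]:
  "i < n \<Longrightarrow> j < m \<Longrightarrow> mat_add R n m A B $$ (i, j) = A $$ (i, j) \<oplus>\<^bsub>R\<^esub> B $$ (i, j)"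
  by (simp add: mat_add_def)

lemma mat_scl_index [simp]:
  "i < n \<Longrightarrow> j < m \<Longrightarrow> mat_scl R n m c A $$ (i, j) = c \<otimes>\<^bsub>R\<^esub> A $$ (i, j)"
  by (simp add: mat_scl_def)

lemma mat_zero_index [simp]: "i < n \<Longrightarrow> j < m \<Longrightarrow> mat_zero R n m $$ (i, j) = \<zero>\<^bsub>R\<^esub>"
  by (simp add: mat_zero_def)

context cring
begin

definition mats :: "nat \<Rightarrow> nat \<Rightarrow> 'a mat set" where
  "mats n m = {A. mat_over R A \<and> dim_row A = n \<and> dim_col A = m}"

lemma matsD:
  assumes "A \<in> mats n m"
  shows "mat_over R A" "dim_row A = n" "dim_col A = m"
    "\<And>i j. i < n \<Longrightarrow> j < m \<Longrightarrow> A $$ (i, j) \<in> carrier R"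
  using assms by (auto simp: mats_def mat_overD)

lemma matsI:
  "dim_row A = n \<Longrightarrow> dim_col A = m \<Longrightarrow> (\<And>i j. i < n \<Longrightarrow> j < m \<Longrightarrow> A $$ (i, j) \<in> carrier R) \<Longrightarrow>
    A \<in> mats n m"
  by (auto simp: mats_def mat_over_def)

lemma mats_eqI:
  "A \<in> mats n m \<Longrightarrow> B \<in> mats n m \<Longrightarrow> (\<And>i j. i < n \<Longrightarrow> j < m \<Longrightarrow> A $$ (i, j) = B $$ (i, j)) \<Longrightarrow> A = B"
  by (rule eq_matI) (auto simp: mats_def)

lemma mats_comp: "A \<in> mats n m \<Longrightarrow> B \<in> mats m l \<Longrightarrow> mat_comp R A B \<in> mats n l"
  by (simp add: mats_def mat_over_comp)

lemma mats_kron: "A \<in> mats n m \<Longrightarrow> B \<in> mats k l \<Longrightarrow> mat_kron R A B \<in> mats (n * k) (m * l)"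
  by (simp add: mats_def mat_over_kron)

lemma mats_id: "mat_id R n \<in> mats n n"
  by (simp add: mats_def mat_over_id)

lemma mats_swap: "mat_swap R n m \<in> mats (m * n) (n * m)"
  by (simp add: mats_def mat_swap_fun_mat mat_over_fun_mat)

lemma mats_add: "A \<in> mats n m \<Longrightarrow> B \<in> mats n m \<Longrightarrow> mat_add R n m A B \<in> mats n m"
  using matsD by (intro matsI) auto

lemma mats_scl: "c \<in> carrier R \<Longrightarrow> A \<in> mats n m \<Longrightarrow> mat_scl R n m c A \<in> mats n m"
  using matsD by (intro matsI) auto

lemma mats_zero: "mat_zero R n m \<in> mats n m"
  by (intro matsI) auto

lemma comp_add_left:
  assumes A: "A \<in> mats n m" and B: "B \<in> mats n m" and C: "C \<in> mats m l"
  shows "mat_comp R (mat_add R n m A B) C = mat_add R n l (mat_comp R A C) (mat_comp R B C)"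
proof (rule mats_eqI[OF mats_comp[OF mats_add[OF A B] C] mats_add[OF mats_comp[OF A C] mats_comp[OF B C]]])
  fix i j assume ij: "i < n" "j < l"
  note cl = matsD(2-)[OF A] matsD(2-)[OF B] matsD(2-)[OF C]
  have "finsum R (\<lambda>k. (A $$ (i, k) \<oplus> B $$ (i, k)) \<otimes> C $$ (k, j)) {..<m} =
      finsum R (\<lambda>k. A $$ (i, k) \<otimes> C $$ (k, j) \<oplus> B $$ (i, k) \<otimes> C $$ (k, j)) {..<m}"
    using ij cl by (intro finsum_cong') (auto simp: l_distr)
  then show "mat_comp R (mat_add R n m A B) C $$ (i, j) = mat_add R n l (mat_comp R A C) (mat_comp R B C) $$ (i, j)"
    using ij cl by (simp add: Pi_def cong: finsum_cong)
qed

lemma comp_add_right: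
  assumes A: "A \<in> mats m l" and B: "B \<in> mats m l" and C: "C \<in> mats n m"
  shows "mat_comp R C (mat_add R m l A B) = mat_add R n l (mat_comp R C A) (mat_comp R C B)"
proof (rule mats_eqI[OF mats_comp[OF C mats_add[OF A B]] mats_add[OF mats_comp[OF C A] mats_comp[OF C B]]])
  fix i j assume ij: "i < n" "j < l"
  note cl = matsD(2-)[OF A] matsD(2-)[OF B] matsD(2-)[OF C]
  have "finsum R (\<lambda>k. C $$ (i, k) \<otimes> (A $$ (k, j) \<oplus> B $$ (k, j))) {..<m} =
      finsum R (\<lambda>k. C $$ (i, k) \<otimes> A $$ (k, j) \<oplus> C $$ (i, k) \<otimes> B $$ (k, j)) {..<m}"
    using ij cl by (intro finsum_cong') (auto simp: r_distr)
  then show "mat_comp R C (mat_add R m l A B) $$ (i, j) = mat_add R n l (mat_comp R C A) (mat_comp R C B) $$ (i, j)"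
    using ij cl by (simp add: Pi_def cong: finsum_cong)
qed

lemma comp_scl_left:
  assumes c: "c \<in> carrier R" and A: "A \<in> mats n m" and C: "C \<in> mats m l"
  shows "mat_comp R (mat_scl R n m c A) C = mat_scl R n l c (mat_comp R A C)"
proof (rule mats_eqI[OF mats_comp[OF mats_scl[OF c A] C] mats_scl[OF c mats_comp[OF A C]]])
  fix i j assume ij: "i < n" "j < l"
  note cl = matsD(2-)[OF A] matsD(2-)[OF C]
  have "finsum R (\<lambda>k. (c \<otimes> A $$ (i, k)) \<otimes> C $$ (k, j)) {..<m} =
      c \<otimes> finsum R (\<lambda>k. A $$ (i, k) \<otimes> C $$ (k, j)) {..<m}"
    using ij cl c by (subst finsum_rdistr) (auto intro!: finsum_cong' simp: m_assoc)
  then show "mat_comp R (mat_scl R n m c A) C $$ (i, j) = mat_scl R n l c (mat_comp R A C) $$ (i, j)"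
    using ij cl c by (simp add: Pi_def cong: finsum_cong)
qed

lemma comp_scl_right:
  assumes c: "c \<in> carrier R" and A: "A \<in> mats m l" and C: "C \<in> mats n m"
  shows "mat_comp R C (mat_scl R m l c A) = mat_scl R n l c (mat_comp R C A)"
proof (rule mats_eqI[OF mats_comp[OF C mats_scl[OF c A]] mats_scl[OF c mats_comp[OF C A]]])
  fix i j assume ij: "i < n" "j < l"
  note cl = matsD(2-)[OF A] matsD(2-)[OF C]
  have "finsum R (\<lambda>k. C $$ (i, k) \<otimes> (c \<otimes> A $$ (k, j))) {..<m} =
      c \<otimes> finsum R (\<lambda>k. C $$ (i, k) \<otimes> A $$ (k, j)) {..<m}"
    using ij cl c by (subst finsum_rdistr) (auto intro!: finsum_cong' simp: m_lcomm)
  then show "mat_comp R C (mat_scl R m l c A) $$ (i, j) = mat_scl R n l c (mat_comp R C A) $$ (i, j)"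
    using ij cl c by (simp add: Pi_def cong: finsum_cong)
qed

lemma comp_zero_right: "C \<in> mats n m \<Longrightarrow> mat_comp R C (mat_zero R m l) = mat_zero R n l"
  by (rule eq_matI) (auto simp: matsD intro!: finsum_all_zero)

lemma comp_zero_left: "C \<in> mats m l \<Longrightarrow> mat_comp R (mat_zero R n m) C = mat_zero R n l"
  by (rule eq_matI) (auto simp: matsD intro!: finsum_all_zero)

lemma kron_add_left:
  assumes A: "A \<in> mats n m" and B: "B \<in> mats n m" and C: "C \<in> mats k l"
  shows "mat_kron R (mat_add R n m A B) C = mat_add R (n * k) (m * l) (mat_kron R A C) (mat_kron R B C)"
  by (rule mats_eqI[OF mats_kron[OF mats_add[OF A B] C] mats_add[OF mats_kron[OF A C] mats_kron[OF B C]]])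
    (simp add: matsD(2-)[OF A] matsD(2-)[OF B] matsD(2-)[OF C] less_mult_imp_div_less
      mod_less_of_less_mult[of _ n k] mod_less_of_less_mult[of _ m l] l_distr)

lemma kron_add_right:
  assumes A: "A \<in> mats n m" and B: "B \<in> mats n m" and C: "C \<in> mats k l"
  shows "mat_kron R C (mat_add R n m A B) = mat_add R (k * n) (l * m) (mat_kron R C A) (mat_kron R C B)"
  by (rule mats_eqI[OF mats_kron[OF C mats_add[OF A B]] mats_add[OF mats_kron[OF C A] mats_kron[OF C B]]])
    (simp add: matsD(2-)[OF A] matsD(2-)[OF B] matsD(2-)[OF C] less_mult_imp_div_less
      mod_less_of_less_mult[of _ k n] mod_less_of_less_mult[of _ l m] r_distr)

lemma kron_scl_left:
  assumes c: "c \<in> carrier R" and A: "A \<in> mats n m" and C: "C \<in> mats k l"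
  shows "mat_kron R (mat_scl R n m c A) C = mat_scl R (n * k) (m * l) c (mat_kron R A C)"
  by (rule mats_eqI[OF mats_kron[OF mats_scl[OF c A] C] mats_scl[OF c mats_kron[OF A C]]])
    (simp add: c matsD(2-)[OF A] matsD(2-)[OF C] less_mult_imp_div_less
      mod_less_of_less_mult[of _ n k] mod_less_of_less_mult[of _ m l] m_assoc)

lemma kron_scl_right:
  assumes c: "c \<in> carrier R" and A: "A \<in> mats n m" and C: "C \<in> mats k l"
  shows "mat_kron R C (mat_scl R n m c A) = mat_scl R (k * n) (l * m) c (mat_kron R C A)"
  by (rule mats_eqI[OF mats_kron[OF C mats_scl[OF c A]] mats_scl[OF c mats_kron[OF C A]]])
    (simp add: c matsD(2-)[OF A] matsD(2-)[OF C] less_mult_imp_div_less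
      mod_less_of_less_mult[of _ k n] mod_less_of_less_mult[of _ l m] m_lcomm)

end

section \<open>The category of representations\<close>

locale rep_category =
  fixes H :: "('a, 'v) hopf"
  assumes base_cring: "cring (base H)"
    and delta_closed: "\<And>v. v \<in> gens H \<Longrightarrow> delta H v \<in> carrier (coord_ring2 H)"
begin

abbreviation "K \<equiv> base H"
abbreviation "A \<equiv> coord_ring H"
abbreviation "A2 \<equiv> coord_ring2 H"

sublocale K: coeff_ring K
  using base_cring by (simp add: coeff_ring_def)

sublocale A: cring A
  by (rule K.cring_mpoly)

sublocale A2: cring A2
  by (rule K.cring_mpoly)

definition cmat :: "'a mat \<Rightarrow> ('v multiset \<Rightarrow> 'a) mat" where
  "cmat = map_mat (ring.indexed_const K)"

text \<open>The algebra maps \<open>p \<mapsto> p \<otimes> 1\<close> and, in the next definition,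
  \<open>q \<mapsto> 1 \<otimes> q\<close>.\<close>

definition left_incl :: "('v multiset \<Rightarrow> 'a) \<Rightarrow> (('v + 'v) multiset \<Rightarrow> 'a)" where
  "left_incl = poly_subst K (gens H <+> gens H) (\<lambda>v. ring.indexed_var K (Inl v))"

definition right_incl :: "('v multiset \<Rightarrow> 'a) \<Rightarrow> (('v + 'v) multiset \<Rightarrow> 'a)" where
  "right_incl = poly_subst K (gens H <+> gens H) (\<lambda>v. ring.indexed_var K (Inr v))"

lemma const_hom: "ring.indexed_const K \<in> Ring.ring_hom K A"
  by (rule Ring.ring_hom_memI) (simp_all add: K.const_closed K.const_mult K.const_add K.const_one)

lemma left_incl_hom: "left_incl \<in> Ring.ring_hom A A2"
  unfolding left_incl_def by (rule K.poly_subst_hom) (auto intro: K.var_closed)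

lemma right_incl_hom: "right_incl \<in> Ring.ring_hom A A2"
  unfolding right_incl_def by (rule K.poly_subst_hom) (auto intro: K.var_closed)

lemma coproduct_hom: "coproduct H \<in> Ring.ring_hom A A2"
  unfolding coproduct_def by (rule K.poly_subst_hom) (auto intro: delta_closed)

lemma counit_hom: "counit H \<in> Ring.ring_hom A K"
proof (rule Ring.ring_hom_memI)
  fix p q assume pq: "p \<in> carrier A" "q \<in> carrier A"
  then show "counit H p \<in> carrier K"
    by (simp add: counit_def K.mpoly_coeff)
  have "{l :: 'v multiset. l \<subseteq># {#}} = {{#}}" by auto
  then show "counit H (p \<otimes>\<^bsub>A\<^esub> q) = counit H p \<otimes>\<^bsub>K\<^esub> counit H q"
    using pq by (simp add: counit_def K.mpoly_mult K.mpoly_coeff)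
  show "counit H (p \<oplus>\<^bsub>A\<^esub> q) = counit H p \<oplus>\<^bsub>K\<^esub> counit H q"
    by (simp add: counit_def)
qed (simp add: counit_def K.mpoly_one K.indexed_monom_def)

lemma pure_tensor_eq: "pure_tensor H p q = left_incl p \<otimes>\<^bsub>A2\<^esub> right_incl q"
  by (simp add: pure_tensor_def left_incl_def right_incl_def)

text \<open>The conditions on a comodule as matrix equations: the coproduct of \<open>a\<close> is
  the product of \<open>a \<otimes> 1\<close> and \<open>1 \<otimes> a\<close>, and its counit is
  the identity. In this form they follow for tensor products from the interchange law and pass to
  limits of tuples by closure properties alone.\<close>

lemma is_rep_iff:
  "is_rep H a \<longleftrightarrow> (\<exists>n. a \<in> A.mats n n \<and>
    map_mat (coproduct H) a = mat_comp A2 (map_mat left_incl a) (map_mat right_incl a) \<and>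
    map_mat (counit H) a = mat_id K n)" (is "?L \<longleftrightarrow> ?R")
proof -
  have fs: "finsum A2 (\<lambda>l. pure_tensor H (a $$ (i, l)) (a $$ (l, j))) {..<dim_row a} =
      finsum A2 (\<lambda>l. map_mat left_incl a $$ (i, l) \<otimes>\<^bsub>A2\<^esub> map_mat right_incl a $$ (l, j)) {..<dim_row a}"
    if "a \<in> A.mats n n" "i < n" "j < n" for i j n
    using that A.matsD[OF that(1)] Ring.ring_hom_closed[OF left_incl_hom] Ring.ring_hom_closed[OF right_incl_hom]
    by (intro A2.finsum_cong') (auto simp: pure_tensor_eq)
  show ?thesis
  proof
    assume L: ?L
    then have a: "a \<in> A.mats (dim_row a) (dim_row a)"
      by (intro A.matsI) (auto simp: is_rep_def)
    show ?R
      using L a fs[OF a]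
      by (intro exI[of _ "dim_row a"]) (auto simp: is_rep_def mat_eq_iff mat_id_def)
  next
    assume ?R
    then obtain n where a: "a \<in> A.mats n n"
      and 1: "map_mat (coproduct H) a = mat_comp A2 (map_mat left_incl a) (map_mat right_incl a)"
      and 2: "map_mat (counit H) a = mat_id K n" by blast
    note d = A.matsD(2-)[OF a]
    have "coproduct H (a $$ (i, j)) = finsum A2 (\<lambda>l. pure_tensor H (a $$ (i, l)) (a $$ (l, j))) {..<dim_row a}"
      "counit H (a $$ (i, j)) = (if i = j then \<one>\<^bsub>K\<^esub> else \<zero>\<^bsub>K\<^esub>)"
      if ij: "i < n" "j < n" for i j
    proof -
      have "map_mat (coproduct H) a $$ (i, j) = mat_comp A2 (map_mat left_incl a) (map_mat right_incl a) $$ (i, j)"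
        "map_mat (counit H) a $$ (i, j) = mat_id K n $$ (i, j)"
        by (simp_all only: 1 2)
      then show "coproduct H (a $$ (i, j)) = finsum A2 (\<lambda>l. pure_tensor H (a $$ (i, l)) (a $$ (l, j))) {..<dim_row a}"
        "counit H (a $$ (i, j)) = (if i = j then \<one>\<^bsub>K\<^esub> else \<zero>\<^bsub>K\<^esub>)"
        using ij d fs[OF a ij] by (simp_all add: mat_id_def)
    qed
    then show ?L using d by (simp add: is_rep_def)
  qed
qed

lemma rep_mats: "is_rep H a \<Longrightarrow> a \<in> A.mats (rep_dim a) (rep_dim a)"
  by (auto simp: is_rep_iff A.matsD)

lemma is_rep_map_iff:
  assumes a: "a \<in> A.mats n n" and b: "b \<in> A.mats m m"
  shows "is_rep_map H a b \<phi> \<longleftrightarrow> \<phi> \<in> K.mats m n \<and> mat_comp A b (cmat \<phi>) = mat_comp A (cmat \<phi>) a"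
proof -
  note d = A.matsD(2-)[OF a] A.matsD(2-)[OF b]
  have eq: "finsum A (\<lambda>l. b $$ (i, l) \<otimes>\<^bsub>A\<^esub> ring.indexed_const K (\<phi> $$ (l, j))) {..<m} =
      mat_comp A b (cmat \<phi>) $$ (i, j)"
     "finsum A (\<lambda>l. ring.indexed_const K (\<phi> $$ (i, l)) \<otimes>\<^bsub>A\<^esub> a $$ (l, j)) {..<n} =
      mat_comp A (cmat \<phi>) a $$ (i, j)" if "\<phi> \<in> K.mats m n" "i < m" "j < n" for i j
    using that d K.matsD(2-)[OF that(1)] Ring.ring_hom_closed[OF const_hom]
    by (auto simp: cmat_def intro!: A.finsum_cong')
  show ?thesis
  proof
    assume L: "is_rep_map H a b \<phi>"
    then have \<phi>: "\<phi> \<in> K.mats m n"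
      using d by (intro K.matsI) (auto simp: is_rep_map_def)
    have "mat_comp A b (cmat \<phi>) = mat_comp A (cmat \<phi>) a"
    proof (rule eq_matI)
      fix i j assume "i < dim_row (mat_comp A (cmat \<phi>) a)" "j < dim_col (mat_comp A (cmat \<phi>) a)"
      then have "i < m" "j < n" using d K.matsD[OF \<phi>] by (simp_all add: cmat_def)
      then show "mat_comp A b (cmat \<phi>) $$ (i, j) = mat_comp A (cmat \<phi>) a $$ (i, j)"
        using L d eq[OF \<phi>] by (simp add: is_rep_map_def)
    qed (use d K.matsD[OF \<phi>] in \<open>simp_all add: cmat_def\<close>)
    with \<phi> show "\<phi> \<in> K.mats m n \<and> mat_comp A b (cmat \<phi>) = mat_comp A (cmat \<phi>) a" by blast
  next
    assume R: "\<phi> \<in> K.mats m n \<and> mat_comp A b (cmat \<phi>) = mat_comp A (cmat \<phi>) a"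
    then show "is_rep_map H a b \<phi>"
      using d K.matsD[of \<phi> m n] eq by (auto simp: is_rep_map_def intro!: carrier_matI)
  qed
qed

lemma cmat_mats: "\<phi> \<in> K.mats m n \<Longrightarrow> cmat \<phi> \<in> A.mats m n"
  unfolding cmat_def K.mats_def A.mats_def using mat_over_map_mat[OF const_hom] by auto

lemma cmat_comp: "\<phi> \<in> K.mats m n \<Longrightarrow> \<psi> \<in> K.mats n l \<Longrightarrow>
    cmat (mat_comp K \<phi> \<psi>) = mat_comp A (cmat \<phi>) (cmat \<psi>)"
  unfolding cmat_def
  by (rule map_mat_comp[OF K.is_cring A.is_cring const_hom]) (auto simp: K.mats_def)

lemma cmat_kron: "\<phi> \<in> K.mats m n \<Longrightarrow> \<psi> \<in> K.mats k l \<Longrightarrow>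
    cmat (mat_kron K \<phi> \<psi>) = mat_kron A (cmat \<phi>) (cmat \<psi>)"
  unfolding cmat_def by (rule map_mat_kron[OF const_hom]) (auto simp: K.mats_def)

lemma cmat_id: "cmat (mat_id K n) = mat_id A n"
  unfolding cmat_def mat_id_fun_mat by (rule map_mat_fun_mat[OF K.is_cring A.is_cring const_hom])

lemma cmat_swap: "cmat (mat_swap K n m) = mat_swap A n m"
  unfolding cmat_def mat_swap_fun_mat by (rule map_mat_fun_mat[OF K.is_cring A.is_cring const_hom])

lemma cmat_add: "\<phi> \<in> K.mats m n \<Longrightarrow> \<psi> \<in> K.mats m n \<Longrightarrow>
    cmat (mat_add K m n \<phi> \<psi>) = mat_add A m n (cmat \<phi>) (cmat \<psi>)"
  by (rule eq_matI) (auto simp: cmat_def K.matsD K.const_add)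

lemma cmat_scl: "c \<in> carrier K \<Longrightarrow> \<phi> \<in> K.mats m n \<Longrightarrow>
    cmat (mat_scl K m n c \<phi>) = mat_scl A m n (ring.indexed_const K c) (cmat \<phi>)"
  by (rule eq_matI) (auto simp: cmat_def K.matsD K.const_mult)

lemma cmat_zero: "cmat (mat_zero K m n) = mat_zero A m n"
  by (rule eq_matI) (auto simp: cmat_def K.const_zero)

lemma rep_mapD:
  assumes "is_rep H a" "is_rep H b" "is_rep_map H a b \<phi>"
  shows "\<phi> \<in> K.mats (rep_dim b) (rep_dim a)" "mat_comp A b (cmat \<phi>) = mat_comp A (cmat \<phi>) a"
  using assms is_rep_map_iff[OF rep_mats rep_mats] by blast+

lemma rep_mapI:
  assumes "is_rep H a" "is_rep H b" "\<phi> \<in> K.mats (rep_dim b) (rep_dim a)"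
    "mat_comp A b (cmat \<phi>) = mat_comp A (cmat \<phi>) a"
  shows "is_rep_map H a b \<phi>"
  using assms is_rep_map_iff[OF rep_mats rep_mats] by blast

lemma rep_map_id: "is_rep H a \<Longrightarrow> is_rep_map H a a (mat_id K (rep_dim a))"
  using A.matsD[OF rep_mats]
  by (intro rep_mapI) (simp_all add: K.mats_id cmat_id A.mat_comp_id_left A.mat_comp_id_right)

lemma rep_map_comp:
  assumes a: "is_rep H a" and b: "is_rep H b" and c: "is_rep H c"
    and \<phi>: "is_rep_map H a b \<phi>" and \<psi>: "is_rep_map H b c \<psi>"
  shows "is_rep_map H a c (mat_comp K \<psi> \<phi>)"
proof (rule rep_mapI[OF a c])
  note p = rep_mapD[OF a b \<phi>] and q = rep_mapD[OF b c \<psi>]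
  note am = rep_mats[OF a] and bm = rep_mats[OF b] and cm = rep_mats[OF c]
  note pm = cmat_mats[OF p(1)] and qm = cmat_mats[OF q(1)]
  show "mat_comp K \<psi> \<phi> \<in> K.mats (rep_dim c) (rep_dim a)"
    using q(1) p(1) by (rule K.mats_comp)
  have "mat_comp A c (mat_comp A (cmat \<psi>) (cmat \<phi>)) = mat_comp A (mat_comp A c (cmat \<psi>)) (cmat \<phi>)"
    using A.matsD[OF cm] A.matsD[OF pm] A.matsD[OF qm] by (intro A.mat_comp_assoc) simp_all
  also have "\<dots> = mat_comp A (mat_comp A (cmat \<psi>) b) (cmat \<phi>)" by (simp only: q(2))
  also have "\<dots> = mat_comp A (cmat \<psi>) (mat_comp A b (cmat \<phi>))"
    using A.matsD[OF bm] A.matsD[OF pm] A.matsD[OF qm] by (intro A.mat_comp_assoc[symmetric]) simp_all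
  also have "\<dots> = mat_comp A (cmat \<psi>) (mat_comp A (cmat \<phi>) a)" by (simp only: p(2))
  also have "\<dots> = mat_comp A (mat_comp A (cmat \<psi>) (cmat \<phi>)) a"
    using A.matsD[OF am] A.matsD[OF pm] A.matsD[OF qm] by (intro A.mat_comp_assoc) simp_all
  finally show "mat_comp A c (cmat (mat_comp K \<psi> \<phi>)) = mat_comp A (cmat (mat_comp K \<psi> \<phi>)) a"
    by (simp only: cmat_comp[OF q(1) p(1)])
qed

lemma rep_map_zero:
  assumes a: "is_rep H a" and b: "is_rep H b"
  shows "is_rep_map H a b (mat_zero K (rep_dim b) (rep_dim a))"
  using rep_mats[OF a] rep_mats[OF b]
  by (intro rep_mapI a b) (simp_all add: K.mats_zero cmat_zero A.comp_zero_left A.comp_zero_right)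

lemma rep_map_add:
  assumes a: "is_rep H a" and b: "is_rep H b" and \<phi>: "is_rep_map H a b \<phi>" and \<psi>: "is_rep_map H a b \<psi>"
  shows "is_rep_map H a b (mat_add K (rep_dim b) (rep_dim a) \<phi> \<psi>)"
proof (rule rep_mapI[OF a b])
  note p = rep_mapD[OF a b \<phi>] and q = rep_mapD[OF a b \<psi>]
  show "mat_add K (rep_dim b) (rep_dim a) \<phi> \<psi> \<in> K.mats (rep_dim b) (rep_dim a)"
    using p(1) q(1) by (rule K.mats_add)
  show "mat_comp A b (cmat (mat_add K (rep_dim b) (rep_dim a) \<phi> \<psi>)) =
      mat_comp A (cmat (mat_add K (rep_dim b) (rep_dim a) \<phi> \<psi>)) a"
    by (simp only: cmat_add[OF p(1) q(1)] p(2) q(2)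
        A.comp_add_left[OF cmat_mats[OF p(1)] cmat_mats[OF q(1)] rep_mats[OF a]]
        A.comp_add_right[OF cmat_mats[OF p(1)] cmat_mats[OF q(1)] rep_mats[OF b]])
qed

lemma rep_map_scl:
  assumes c: "c \<in> carrier K" and a: "is_rep H a" and b: "is_rep H b" and \<phi>: "is_rep_map H a b \<phi>"
  shows "is_rep_map H a b (mat_scl K (rep_dim b) (rep_dim a) c \<phi>)"
proof (rule rep_mapI[OF a b])
  note p = rep_mapD[OF a b \<phi>]
  have c': "ring.indexed_const K c \<in> carrier A" using c by (rule K.const_closed)
  show "mat_scl K (rep_dim b) (rep_dim a) c \<phi> \<in> K.mats (rep_dim b) (rep_dim a)"
    using c p(1) by (rule K.mats_scl)
  show "mat_comp A b (cmat (mat_scl K (rep_dim b) (rep_dim a) c \<phi>)) =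
      mat_comp A (cmat (mat_scl K (rep_dim b) (rep_dim a) c \<phi>)) a"
    by (simp only: cmat_scl[OF c p(1)] p(2)
        A.comp_scl_left[OF c' cmat_mats[OF p(1)] rep_mats[OF a]]
        A.comp_scl_right[OF c' cmat_mats[OF p(1)] rep_mats[OF b]])
qed

lemma rep_unit: "is_rep H (mat_id A 1)"
  unfolding is_rep_iff
proof (intro exI conjI)
  show "mat_id A 1 \<in> A.mats 1 1" by (rule A.mats_id)
  show "map_mat (counit H) (mat_id A 1) = mat_id K 1"
    unfolding mat_id_fun_mat by (rule map_mat_fun_mat[OF A.is_cring K.is_cring counit_hom])
  have "map_mat h (mat_id A 1) = mat_id A2 1" if "h \<in> Ring.ring_hom A A2" for h
    unfolding mat_id_fun_mat by (rule map_mat_fun_mat[OF A.is_cring A2.is_cring that])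
  then show "map_mat (coproduct H) (mat_id A 1) =
      mat_comp A2 (map_mat left_incl (mat_id A 1)) (map_mat right_incl (mat_id A 1))"
    using left_incl_hom right_incl_hom coproduct_hom by (simp add: A2.mat_comp_id_left A2.mat_over_id)
qed

text \<open>Ring homomorphisms commute with Kronecker products. The coproduct of
  \<open>mat_kron A a b\<close> is hence a Kronecker product of two matrix products, and the
  interchange law over the commutative ring \<open>A2\<close> regroups it.\<close>

lemma rep_kron:
  assumes a: "is_rep H a" and b: "is_rep H b"
  shows "is_rep H (mat_kron A a b)"
proof -
  obtain n where n: "a \<in> A.mats n n"
      "map_mat (coproduct H) a = mat_comp A2 (map_mat left_incl a) (map_mat right_incl a)"
      "map_mat (counit H) a = mat_id K n" using a unfolding is_rep_iff by blast
  obtain m where m: "b \<in> A.mats m m"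
      "map_mat (coproduct H) b = mat_comp A2 (map_mat left_incl b) (map_mat right_incl b)"
      "map_mat (counit H) b = mat_id K m" using b unfolding is_rep_iff by blast
  note ad = A.matsD[OF n(1)] and bd = A.matsD[OF m(1)]
  have kr: "map_mat h (mat_kron A a b) = mat_kron A2 (map_mat h a) (map_mat h b)" if "h \<in> Ring.ring_hom A A2" for h
    using that ad(1) bd(1) by (rule map_mat_kron)
  have cl: "mat_over A2 (map_mat h a)" "mat_over A2 (map_mat h b)" if "h \<in> Ring.ring_hom A A2" for h
    using mat_over_map_mat[OF that] ad(1) bd(1) by blast+
  show ?thesis unfolding is_rep_iff
  proof (intro exI conjI)
    show "mat_kron A a b \<in> A.mats (n * m) (n * m)" using n(1) m(1) by (rule A.mats_kron)
    show "map_mat (counit H) (mat_kron A a b) = mat_id K (n * m)"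
      by (simp add: map_mat_kron[OF counit_hom ad(1) bd(1)] n(3) m(3) K.mat_kron_id)
    show "map_mat (coproduct H) (mat_kron A a b) =
        mat_comp A2 (map_mat left_incl (mat_kron A a b)) (map_mat right_incl (mat_kron A a b))"
      unfolding kr[OF coproduct_hom] kr[OF left_incl_hom] kr[OF right_incl_hom] n(2) m(2)
      using cl left_incl_hom right_incl_hom ad bd by (intro A2.mat_kron_comp) simp_all
  qed
qed

lemma rep_map_kron:
  assumes a: "is_rep H a" and b: "is_rep H b" and a': "is_rep H a'" and b': "is_rep H b'"
    and \<phi>: "is_rep_map H a b \<phi>" and \<psi>: "is_rep_map H a' b' \<psi>"
  shows "is_rep_map H (mat_kron A a a') (mat_kron A b b') (mat_kron K \<phi> \<psi>)"
proof (rule rep_mapI[OF rep_kron[OF a a'] rep_kron[OF b b']])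
  note p = rep_mapD[OF a b \<phi>] and q = rep_mapD[OF a' b' \<psi>]
  note pd = A.matsD[OF cmat_mats[OF p(1)]] and qd = A.matsD[OF cmat_mats[OF q(1)]]
  note ad = A.matsD[OF rep_mats[OF a]] and bd = A.matsD[OF rep_mats[OF b]]
  note ad' = A.matsD[OF rep_mats[OF a']] and bd' = A.matsD[OF rep_mats[OF b']]
  show "mat_kron K \<phi> \<psi> \<in> K.mats (rep_dim (mat_kron A b b')) (rep_dim (mat_kron A a a'))"
    using K.mats_kron[OF p(1) q(1)] by simp
  have "mat_comp A (mat_kron A b b') (mat_kron A (cmat \<phi>) (cmat \<psi>)) =
      mat_kron A (mat_comp A b (cmat \<phi>)) (mat_comp A b' (cmat \<psi>))"
    using pd qd bd bd' by (intro A.mat_kron_comp[symmetric]) simp_all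
  also have "\<dots> = mat_kron A (mat_comp A (cmat \<phi>) a) (mat_comp A (cmat \<psi>) a')"
    by (simp only: p(2) q(2))
  also have "\<dots> = mat_comp A (mat_kron A (cmat \<phi>) (cmat \<psi>)) (mat_kron A a a')"
    using pd qd ad ad' by (intro A.mat_kron_comp) simp_all
  finally show "mat_comp A (mat_kron A b b') (cmat (mat_kron K \<phi> \<psi>)) =
      mat_comp A (cmat (mat_kron K \<phi> \<psi>)) (mat_kron A a a')"
    by (simp only: cmat_kron[OF p(1) q(1)])
qed

lemma rep_map_swap:
  assumes a: "is_rep H a" and b: "is_rep H b"
  shows "is_rep_map H (mat_kron A a b) (mat_kron A b a) (mat_swap K (rep_dim a) (rep_dim b))"
proof (rule rep_mapI[OF rep_kron[OF a b] rep_kron[OF b a]])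
  show "mat_swap K (rep_dim a) (rep_dim b) \<in> K.mats (rep_dim (mat_kron A b a)) (rep_dim (mat_kron A a b))"
    using K.mats_swap by simp
  show "mat_comp A (mat_kron A b a) (cmat (mat_swap K (rep_dim a) (rep_dim b))) =
      mat_comp A (cmat (mat_swap K (rep_dim a) (rep_dim b))) (mat_kron A a b)"
    using A.mat_swap_natural[of a b] A.matsD[OF rep_mats[OF a]] A.matsD[OF rep_mats[OF b]]
    by (simp add: cmat_swap)
qed

lemma rep_kron_assoc:
  "is_rep H a \<Longrightarrow> is_rep H b \<Longrightarrow> is_rep H c \<Longrightarrow>
    mat_kron A (mat_kron A a b) c = mat_kron A a (mat_kron A b c)"
  by (simp add: A.mat_kron_assoc A.matsD[OF rep_mats])

lemma rep_kron_unit: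
  "is_rep H a \<Longrightarrow> mat_kron A (mat_id A 1) a = a" "is_rep H a \<Longrightarrow> mat_kron A a (mat_id A 1) = a"
  using A.mat_kron_unit_left[OF A.matsD(1)[OF rep_mats]] A.mat_kron_unit_right[OF A.matsD(1)[OF rep_mats]]
  by blast+


section \<open>The axioms of a linear tensor category for representations\<close>

lemma Hom_Rep: "f \<in> Hom (Rep H) X Y \<longleftrightarrow>
    (\<exists>\<phi>. f = (X, Y, \<phi>) \<and> is_rep H X \<and> is_rep H Y \<and> is_rep_map H X Y \<phi>)"
  by (auto simp: Hom_def Rep_def Let_def)

lemma Hom_RepE:
  assumes "f \<in> Hom (Rep H) X Y"
  obtains \<phi> where "f = (X, Y, \<phi>)" "is_rep H X" "is_rep H Y" "is_rep_map H X Y \<phi>"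
    "\<phi> \<in> K.mats (rep_dim Y) (rep_dim X)"
  using assms rep_mapD(1) unfolding Hom_Rep by blast

lemma Ob_Rep: "X \<in> Ob (Rep H) \<longleftrightarrow> is_rep H X"
  by (simp add: Rep_def Let_def)

lemma Ar_Rep: "f \<in> Ar (Rep H) \<longleftrightarrow> (\<exists>a b \<phi>. f = (a, b, \<phi>) \<and> is_rep H a \<and> is_rep H b \<and> is_rep_map H a b \<phi>)"
  by (auto simp: Rep_def Let_def)

lemma Rep_fields [simp]:
  "Dm (Rep H) (a, b, \<phi>) = a" "Cd (Rep H) (a, b, \<phi>) = b"
  "Idt (Rep H) a = (a, a, mat_id K (rep_dim a))"
  "Cmp (Rep H) (b', c, \<psi>) (a, b, \<phi>) = (a, c, mat_comp K \<psi> \<phi>)"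
  "Zer (Rep H) a b = (a, b, mat_zero K (rep_dim b) (rep_dim a))"
  "Pls (Rep H) (a, b, \<phi>) (a', c, \<psi>) = (a, b, mat_add K (rep_dim b) (rep_dim a) \<phi> \<psi>)"
  "Scl (Rep H) s (a, b, \<phi>) = (a, b, mat_scl K (rep_dim b) (rep_dim a) s \<phi>)"
  "TnO (Rep H) a b = mat_kron A a b"
  "TnA (Rep H) (a, b, \<phi>) (a', c, \<psi>) = (mat_kron A a a', mat_kron A b c, mat_kron K \<phi> \<psi>)"
  "Unt (Rep H) = mat_id A 1"
  "Asc (Rep H) a b c = (mat_kron A (mat_kron A a b) c, mat_kron A a (mat_kron A b c),
    mat_id K (rep_dim a * rep_dim b * rep_dim c))"
  "Com (Rep H) a b = (mat_kron A a b, mat_kron A b a, mat_swap K (rep_dim a) (rep_dim b))"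
  "Lun (Rep H) a = (mat_kron A (mat_id A 1) a, a, mat_id K (rep_dim a))"
  "Run (Rep H) a = (mat_kron A a (mat_id A 1), a, mat_id K (rep_dim a))"
  by (simp_all add: Rep_def Let_def mat_zero_def mat_add_def mat_scl_def)

lemma mat_add_assoc:
  "\<phi> \<in> K.mats n m \<Longrightarrow> \<psi> \<in> K.mats n m \<Longrightarrow> \<chi> \<in> K.mats n m \<Longrightarrow>
    mat_add K n m (mat_add K n m \<phi> \<psi>) \<chi> = mat_add K n m \<phi> (mat_add K n m \<psi> \<chi>)"
  by (rule eq_matI) (auto simp: K.matsD K.a_assoc)

lemma mat_add_comm:
  "\<phi> \<in> K.mats n m \<Longrightarrow> \<psi> \<in> K.mats n m \<Longrightarrow> mat_add K n m \<phi> \<psi> = mat_add K n m \<psi> \<phi>"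
  by (rule eq_matI) (auto simp: K.matsD K.a_comm)

lemma mat_add_zero: "\<phi> \<in> K.mats n m \<Longrightarrow> mat_add K n m (mat_zero K n m) \<phi> = \<phi>"
  by (rule eq_matI) (auto simp: K.matsD)

lemma mat_add_neg:
  "\<phi> \<in> K.mats n m \<Longrightarrow> mat_add K n m (mat_scl K n m (\<ominus>\<^bsub>K\<^esub> \<one>\<^bsub>K\<^esub>) \<phi>) \<phi> = mat_zero K n m"
  by (rule eq_matI) (auto simp: K.matsD K.l_minus K.l_neg)

lemma mat_scl_one: "\<phi> \<in> K.mats n m \<Longrightarrow> mat_scl K n m \<one>\<^bsub>K\<^esub> \<phi> = \<phi>"
  by (rule eq_matI) (auto simp: K.matsD)

lemma mat_scl_add_left:
  "\<phi> \<in> K.mats n m \<Longrightarrow> c \<in> carrier K \<Longrightarrow> d \<in> carrier K \<Longrightarrow>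
    mat_scl K n m (c \<oplus>\<^bsub>K\<^esub> d) \<phi> = mat_add K n m (mat_scl K n m c \<phi>) (mat_scl K n m d \<phi>)"
  by (rule eq_matI) (auto simp: K.matsD K.l_distr)

lemma mat_scl_add_right:
  "\<phi> \<in> K.mats n m \<Longrightarrow> \<psi> \<in> K.mats n m \<Longrightarrow> c \<in> carrier K \<Longrightarrow>
    mat_scl K n m c (mat_add K n m \<phi> \<psi>) = mat_add K n m (mat_scl K n m c \<phi>) (mat_scl K n m c \<psi>)"
  by (rule eq_matI) (auto simp: K.matsD K.r_distr)

lemma mat_scl_mult:
  "\<phi> \<in> K.mats n m \<Longrightarrow> c \<in> carrier K \<Longrightarrow> d \<in> carrier K \<Longrightarrow>
    mat_scl K n m (c \<otimes>\<^bsub>K\<^esub> d) \<phi> = mat_scl K n m c (mat_scl K n m d \<phi>)"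
  by (rule eq_matI) (auto simp: K.matsD K.m_assoc)

lemma rep_hom_module:
  assumes X: "is_rep H X" and Y: "is_rep H Y"
  shows "module K (hom_module (Rep H) X Y)"
proof -
  have e: "f \<in> carrier (hom_module (Rep H) X Y) \<longleftrightarrow> (\<exists>\<phi>. f = (X, Y, \<phi>) \<and> is_rep_map H X Y \<phi>)" for f
    using X Y by (auto simp: hom_module_def Hom_Rep)
  have f: "add (hom_module (Rep H) X Y) = Pls (Rep H)" "zero (hom_module (Rep H) X Y) = Zer (Rep H) X Y"
    "smult (hom_module (Rep H) X Y) = Scl (Rep H)"
    by (simp_all add: hom_module_def)
  note m = rep_mapD(1)[OF X Y]
  show ?thesis
  proof (rule moduleI)
    show "cring K" by (rule K.is_cring)
    show "abelian_group (hom_module (Rep H) X Y)"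
    proof (rule abelian_groupI)
      fix f assume "f \<in> carrier (hom_module (Rep H) X Y)"
      then obtain \<phi> where p: "f = (X, Y, \<phi>)" "is_rep_map H X Y \<phi>" unfolding e by blast
      have "is_rep_map H X Y (mat_scl K (rep_dim Y) (rep_dim X) (\<ominus>\<^bsub>K\<^esub> \<one>\<^bsub>K\<^esub>) \<phi>)"
        using X Y p(2) by (intro rep_map_scl) simp_all
      then show "\<exists>g\<in>carrier (hom_module (Rep H) X Y).
          g \<oplus>\<^bsub>hom_module (Rep H) X Y\<^esub> f = \<zero>\<^bsub>hom_module (Rep H) X Y\<^esub>"
        using mat_add_neg[OF m[OF p(2)]]
        by (intro bexI[of _ "(X, Y, mat_scl K (rep_dim Y) (rep_dim X) (\<ominus>\<^bsub>K\<^esub> \<one>\<^bsub>K\<^esub>) \<phi>)"])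
          (auto simp: e f p(1))
    qed (use X Y in \<open>auto simp: e f rep_map_add rep_map_zero m mat_add_assoc mat_add_zero intro!: mat_add_comm\<close>)
  qed (use X Y in \<open>auto simp: e f rep_map_scl m mat_scl_one mat_scl_add_left mat_scl_add_right mat_scl_mult\<close>)
qed

lemma Isos_Rep_I:
  assumes "is_rep H X" "is_rep H Y" "is_rep_map H X Y \<phi>" "is_rep_map H Y X \<psi>"
    "mat_comp K \<psi> \<phi> = mat_id K (rep_dim X)" "mat_comp K \<phi> \<psi> = mat_id K (rep_dim Y)"
  shows "(X, Y, \<phi>) \<in> Isos (Rep H) X Y"
  unfolding Isos_def using assms by (auto simp: Hom_Rep intro!: bexI[of _ "(Y, X, \<psi>)"])

lemma Isos_Rep_id:
  assumes "is_rep H X" "X = Y" "n = rep_dim X"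
  shows "(X, Y, mat_id K n) \<in> Isos (Rep H) X Y"
  using assms rep_map_id[OF assms(1)]
  by (auto intro!: Isos_Rep_I simp: K.mat_comp_id_left K.mat_over_id)

text \<open>With the chosen numbering of tensor bases, associators and unit constraints are identity
  matrices between equal objects. Among the coherence conditions only those for the swap require a
  computation.\<close>

lemma rep_linear_tensor_category: "linear_tensor_category K (Rep H)"
proof (intro linear_tensor_category.intro linear_category.intro linear_tensor_category_axioms.intro)
  fix f assume "f \<in> Ar (Rep H)"
  then show "Dm (Rep H) f \<in> Ob (Rep H)" "Cd (Rep H) f \<in> Ob (Rep H)"
    by (auto simp: Ar_Rep Ob_Rep)
next
  fix X assume "X \<in> Ob (Rep H)"
  then show "Idt (Rep H) X \<in> Hom (Rep H) X X"
    by (simp add: Ob_Rep Hom_Rep rep_map_id)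
next
  fix f g X Y Z assume "f \<in> Hom (Rep H) X Y" "g \<in> Hom (Rep H) Y Z"
  then show "Cmp (Rep H) g f \<in> Hom (Rep H) X Z"
    by (auto simp: Hom_Rep intro: rep_map_comp)
next
  fix f g h W X Y Z assume "f \<in> Hom (Rep H) W X" "g \<in> Hom (Rep H) X Y" "h \<in> Hom (Rep H) Y Z"
  then show "Cmp (Rep H) h (Cmp (Rep H) g f) = Cmp (Rep H) (Cmp (Rep H) h g) f"
    by (elim Hom_RepE) (simp add: K.mat_comp_assoc K.matsD)
next
  fix f X Y assume "f \<in> Hom (Rep H) X Y"
  then show "Cmp (Rep H) (Idt (Rep H) Y) f = f" "Cmp (Rep H) f (Idt (Rep H) X) = f"
    by (elim Hom_RepE, simp add: K.mat_comp_id_left K.mat_comp_id_right K.matsD)+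
next
  fix X Y assume "X \<in> Ob (Rep H)" "Y \<in> Ob (Rep H)"
  then show "module K (hom_module (Rep H) X Y)"
    by (simp add: Ob_Rep rep_hom_module)
next
  fix f g g' X Y Z assume "f \<in> Hom (Rep H) X Y" "g \<in> Hom (Rep H) Y Z" "g' \<in> Hom (Rep H) Y Z"
  then show "Cmp (Rep H) (Pls (Rep H) g g') f = Pls (Rep H) (Cmp (Rep H) g f) (Cmp (Rep H) g' f)"
    by (elim Hom_RepE) (simp add: K.comp_add_left)
next
  fix f f' g X Y Z assume "f \<in> Hom (Rep H) X Y" "f' \<in> Hom (Rep H) X Y" "g \<in> Hom (Rep H) Y Z"
  then show "Cmp (Rep H) g (Pls (Rep H) f f') = Pls (Rep H) (Cmp (Rep H) g f) (Cmp (Rep H) g f')"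
    by (elim Hom_RepE) (simp add: K.comp_add_right)
next
  fix c f g X Y Z assume "c \<in> carrier K" "f \<in> Hom (Rep H) X Y" "g \<in> Hom (Rep H) Y Z"
  then show "Cmp (Rep H) (Scl (Rep H) c g) f = Scl (Rep H) c (Cmp (Rep H) g f)"
    "Cmp (Rep H) g (Scl (Rep H) c f) = Scl (Rep H) c (Cmp (Rep H) g f)"
    by (elim Hom_RepE, simp add: K.comp_scl_left K.comp_scl_right)+
next
  show "Unt (Rep H) \<in> Ob (Rep H)"
    using rep_unit by (simp add: Ob_Rep)
next
  fix X Y assume "X \<in> Ob (Rep H)" "Y \<in> Ob (Rep H)"
  then show "TnO (Rep H) X Y \<in> Ob (Rep H)"
    by (simp add: Ob_Rep rep_kron)
next
  fix f g X Y X' Y' assume "f \<in> Hom (Rep H) X Y" "g \<in> Hom (Rep H) X' Y'"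
  then show "TnA (Rep H) f g \<in> Hom (Rep H) (TnO (Rep H) X X') (TnO (Rep H) Y Y')"
    by (auto simp: Hom_Rep rep_kron rep_map_kron)
next
  fix X Y assume "X \<in> Ob (Rep H)" "Y \<in> Ob (Rep H)"
  then show "TnA (Rep H) (Idt (Rep H) X) (Idt (Rep H) Y) = Idt (Rep H) (TnO (Rep H) X Y)"
    by (simp add: K.mat_kron_id)
next
  fix f g f' g' X Y Z X' Y' Z'
  assume "f \<in> Hom (Rep H) X Y" "g \<in> Hom (Rep H) Y Z" "f' \<in> Hom (Rep H) X' Y'" "g' \<in> Hom (Rep H) Y' Z'"
  then show "TnA (Rep H) (Cmp (Rep H) g f) (Cmp (Rep H) g' f') = Cmp (Rep H) (TnA (Rep H) g g') (TnA (Rep H) f f')"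
    by (elim Hom_RepE) (simp add: K.mat_kron_comp K.matsD)
next
  fix f f' g X Y X' Y'
  assume "f \<in> Hom (Rep H) X Y" "f' \<in> Hom (Rep H) X Y" "g \<in> Hom (Rep H) X' Y'"
  then show "TnA (Rep H) (Pls (Rep H) f f') g = Pls (Rep H) (TnA (Rep H) f g) (TnA (Rep H) f' g)"
    by (elim Hom_RepE) (simp add: K.kron_add_left)
next
  fix f g g' X Y X' Y'
  assume "f \<in> Hom (Rep H) X Y" "g \<in> Hom (Rep H) X' Y'" "g' \<in> Hom (Rep H) X' Y'"
  then show "TnA (Rep H) f (Pls (Rep H) g g') = Pls (Rep H) (TnA (Rep H) f g) (TnA (Rep H) f g')"
    by (elim Hom_RepE) (simp add: K.kron_add_right)
next
  fix c f g X Y X' Y' assume "c \<in> carrier K" "f \<in> Hom (Rep H) X Y" "g \<in> Hom (Rep H) X' Y'"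
  then show "TnA (Rep H) (Scl (Rep H) c f) g = Scl (Rep H) c (TnA (Rep H) f g)"
    "TnA (Rep H) f (Scl (Rep H) c g) = Scl (Rep H) c (TnA (Rep H) f g)"
    by (elim Hom_RepE, simp add: K.kron_scl_left K.kron_scl_right)+
next
  fix X Y Z assume "X \<in> Ob (Rep H)" "Y \<in> Ob (Rep H)" "Z \<in> Ob (Rep H)"
  then show "Asc (Rep H) X Y Z \<in> Isos (Rep H) (TnO (Rep H) (TnO (Rep H) X Y) Z) (TnO (Rep H) X (TnO (Rep H) Y Z))"
    by (auto simp: Ob_Rep rep_kron rep_kron_assoc intro!: Isos_Rep_id)
next
  fix f g h X X' Y Y' Z Z'
  assume "f \<in> Hom (Rep H) X X'" "g \<in> Hom (Rep H) Y Y'" "h \<in> Hom (Rep H) Z Z'"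
  then show "Cmp (Rep H) (TnA (Rep H) f (TnA (Rep H) g h)) (Asc (Rep H) X Y Z) =
      Cmp (Rep H) (Asc (Rep H) X' Y' Z') (TnA (Rep H) (TnA (Rep H) f g) h)"
    by (elim Hom_RepE)
      (simp add: K.mat_kron_assoc[symmetric] K.mat_comp_id_left K.mat_comp_id_right K.mat_over_kron K.matsD)
next
  fix X Y assume XY: "X \<in> Ob (Rep H)" "Y \<in> Ob (Rep H)"
  then show "Com (Rep H) X Y \<in> Isos (Rep H) (TnO (Rep H) X Y) (TnO (Rep H) Y X)"
    by (auto simp: Ob_Rep rep_kron rep_map_swap K.mat_swap_swap
        intro!: Isos_Rep_I[where \<psi> = "mat_swap K (rep_dim Y) (rep_dim X)"])
  show "Cmp (Rep H) (Com (Rep H) Y X) (Com (Rep H) X Y) = Idt (Rep H) (TnO (Rep H) X Y)"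
    by (simp add: K.mat_swap_swap)
next
  fix f g X X' Y Y' assume "f \<in> Hom (Rep H) X X'" "g \<in> Hom (Rep H) Y Y'"
  then show "Cmp (Rep H) (TnA (Rep H) g f) (Com (Rep H) X Y) = Cmp (Rep H) (Com (Rep H) X' Y') (TnA (Rep H) f g)"
  proof (elim Hom_RepE)
    fix \<phi> \<psi> assume "f = (X, X', \<phi>)" "g = (Y, Y', \<psi>)"
      and m: "\<phi> \<in> K.mats (rep_dim X') (rep_dim X)" "\<psi> \<in> K.mats (rep_dim Y') (rep_dim Y)"
    then show ?thesis
      using K.mat_swap_natural[of \<phi> \<psi>] by (simp add: K.matsD[OF m(1)] K.matsD[OF m(2)])
  qed
next
  fix X assume "X \<in> Ob (Rep H)"
  then show "Lun (Rep H) X \<in> Isos (Rep H) (TnO (Rep H) (Unt (Rep H)) X) X"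
    "Run (Rep H) X \<in> Isos (Rep H) (TnO (Rep H) X (Unt (Rep H))) X"
    using rep_kron_unit[of X] by (auto simp: Ob_Rep intro!: Isos_Rep_id)
next
  fix f X Y assume "f \<in> Hom (Rep H) X Y"
  then show "Cmp (Rep H) f (Lun (Rep H) X) = Cmp (Rep H) (Lun (Rep H) Y) (TnA (Rep H) (Idt (Rep H) (Unt (Rep H))) f)"
    "Cmp (Rep H) f (Run (Rep H) X) = Cmp (Rep H) (Run (Rep H) Y) (TnA (Rep H) f (Idt (Rep H) (Unt (Rep H))))"
    by (elim Hom_RepE, simp add: K.mat_comp_id_left K.mat_comp_id_right K.matsD
        K.mat_kron_unit_left[unfolded One_nat_def] K.mat_kron_unit_right[unfolded One_nat_def])+
next
  fix W X Y Z assume "W \<in> Ob (Rep H)" "X \<in> Ob (Rep H)" "Y \<in> Ob (Rep H)" "Z \<in> Ob (Rep H)"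
  then show "Cmp (Rep H) (Asc (Rep H) W X (TnO (Rep H) Y Z)) (Asc (Rep H) (TnO (Rep H) W X) Y Z) =
    Cmp (Rep H) (TnA (Rep H) (Idt (Rep H) W) (Asc (Rep H) X Y Z))
      (Cmp (Rep H) (Asc (Rep H) W (TnO (Rep H) X Y) Z) (TnA (Rep H) (Asc (Rep H) W X Y) (Idt (Rep H) Z)))"
    by (simp add: K.mat_kron_id K.mat_comp_id_left K.mat_over_id mult.assoc)
next
  fix X Y assume "X \<in> Ob (Rep H)" "Y \<in> Ob (Rep H)"
  then show "Cmp (Rep H) (TnA (Rep H) (Idt (Rep H) X) (Lun (Rep H) Y)) (Asc (Rep H) X (Unt (Rep H)) Y) =
      TnA (Rep H) (Run (Rep H) X) (Idt (Rep H) Y)"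
    by (simp add: K.mat_kron_id K.mat_comp_id_left K.mat_over_id)
next
  fix X Y Z assume "X \<in> Ob (Rep H)" "Y \<in> Ob (Rep H)" "Z \<in> Ob (Rep H)"
  moreover have "mat_comp K (mat_id K (rep_dim Y * rep_dim Z * rep_dim X))
      (mat_comp K (mat_swap K (rep_dim X) (rep_dim Y * rep_dim Z))
        (mat_id K (rep_dim X * rep_dim Y * rep_dim Z))) = mat_swap K (rep_dim X) (rep_dim Y * rep_dim Z)"
    using K.matsD[OF K.mats_swap] by (simp add: K.mat_comp_id_left K.mat_comp_id_right mult.assoc)
  moreover have "mat_comp K (mat_id K (rep_dim Y * rep_dim X * rep_dim Z))
      (mat_kron K (mat_swap K (rep_dim X) (rep_dim Y)) (mat_id K (rep_dim Z))) =
      mat_kron K (mat_swap K (rep_dim X) (rep_dim Y)) (mat_id K (rep_dim Z))"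
    using K.matsD[OF K.mats_swap] by (simp add: K.mat_comp_id_left K.mat_over_kron K.mat_over_id)
  ultimately show "Cmp (Rep H) (Asc (Rep H) Y Z X) (Cmp (Rep H) (Com (Rep H) X (TnO (Rep H) Y Z)) (Asc (Rep H) X Y Z)) =
    Cmp (Rep H) (TnA (Rep H) (Idt (Rep H) Y) (Com (Rep H) X Z))
      (Cmp (Rep H) (Asc (Rep H) Y X Z) (TnA (Rep H) (Com (Rep H) X Y) (Idt (Rep H) Z)))"
    using K.mat_swap_hexagon[of "rep_dim X" "rep_dim Y" "rep_dim Z"] by simp
qed

end

section \<open>Transport of structure along a strict isomorphism\<close>

text \<open>Nothing is assumed about \<open>C\<close> beyond strict compatibility of its operations
  with those of \<open>D\<close>; the axioms for \<open>C\<close> are derived from those of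
  \<open>D\<close>. In the application \<open>C\<close> is a subcategory of an ultraproduct, whose
  axioms are obtained in this way, and \<open>D\<close> is the category of representations over
  \<open>k\<close>.\<close>

locale tcat_iso = D: linear_tensor_category k D
  for k :: "'s ring" and D :: "('o, 'm, 's) tcat" +
  fixes C :: "('p, 'n, 's) tcat" and GO :: "'o \<Rightarrow> 'p" and GA :: "'m \<Rightarrow> 'n"
  assumes GO_image: "GO ` Ob D = Ob C" and GO_inj: "inj_on GO (Ob D)"
    and GA_image: "GA ` Ar D = Ar C" and GA_inj: "inj_on GA (Ar D)"
    and G_Dm: "f \<in> Ar D \<Longrightarrow> Dm C (GA f) = GO (Dm D f)"
    and G_Cd: "f \<in> Ar D \<Longrightarrow> Cd C (GA f) = GO (Cd D f)"
    and G_Idt: "x \<in> Ob D \<Longrightarrow> Idt C (GO x) = GA (Idt D x)"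
    and G_Cmp: "\<lbrakk>f \<in> Ar D; g \<in> Ar D; Cd D f = Dm D g\<rbrakk> \<Longrightarrow> Cmp C (GA g) (GA f) = GA (Cmp D g f)"
    and G_Zer: "\<lbrakk>x \<in> Ob D; y \<in> Ob D\<rbrakk> \<Longrightarrow> Zer C (GO x) (GO y) = GA (Zer D x y)"
    and G_Pls: "\<lbrakk>f \<in> Ar D; g \<in> Ar D; Dm D f = Dm D g; Cd D f = Cd D g\<rbrakk> \<Longrightarrow>
      Pls C (GA f) (GA g) = GA (Pls D f g)"
    and G_Scl: "\<lbrakk>c \<in> carrier k; f \<in> Ar D\<rbrakk> \<Longrightarrow> Scl C c (GA f) = GA (Scl D c f)"
    and G_TnO: "\<lbrakk>x \<in> Ob D; y \<in> Ob D\<rbrakk> \<Longrightarrow> TnO C (GO x) (GO y) = GO (TnO D x y)"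
    and G_TnA: "\<lbrakk>f \<in> Ar D; g \<in> Ar D\<rbrakk> \<Longrightarrow> TnA C (GA f) (GA g) = GA (TnA D f g)"
    and G_Unt: "Unt C = GO (Unt D)"
    and G_Asc: "\<lbrakk>x \<in> Ob D; y \<in> Ob D; z \<in> Ob D\<rbrakk> \<Longrightarrow> Asc C (GO x) (GO y) (GO z) = GA (Asc D x y z)"
    and G_Com: "\<lbrakk>x \<in> Ob D; y \<in> Ob D\<rbrakk> \<Longrightarrow> Com C (GO x) (GO y) = GA (Com D x y)"
    and G_Lun: "x \<in> Ob D \<Longrightarrow> Lun C (GO x) = GA (Lun D x)"
    and G_Run: "x \<in> Ob D \<Longrightarrow> Run C (GO x) = GA (Run D x)"
begin

lemmas G_simps = G_Dm G_Cd G_Idt G_Cmp G_Zer G_Pls G_Scl G_TnO G_TnA G_Unt G_Asc G_Com G_Lun G_Run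

text \<open>The same condition as membership in \<open>Hom D x y\<close>, spelled out with the
  endpoints in \<open>Ob D\<close>, so that the side conditions of the transport rules become
  available to the simplifier.\<close>

definition arrow :: "'m \<Rightarrow> 'o \<Rightarrow> 'o \<Rightarrow> bool" where
  "arrow f x y \<longleftrightarrow> f \<in> Ar D \<and> Dm D f = x \<and> Cd D f = y \<and> x \<in> Ob D \<and> y \<in> Ob D"

lemma Hom_arrow: "f \<in> Hom D x y \<longleftrightarrow> arrow f x y"
  using D.Dm_closed D.Cd_closed by (auto simp: Hom_def arrow_def)

lemma arrowD:
  assumes "arrow f x y"
  shows "f \<in> Ar D" "Dm D f = x" "Cd D f = y" "x \<in> Ob D" "y \<in> Ob D"
  using assms by (auto simp: arrow_def)

lemma arrow_Pls: "f \<in> Hom D x y \<Longrightarrow> g \<in> Hom D x y \<Longrightarrow> Pls D f g \<in> Hom D x y"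
  and arrow_Scl: "c \<in> carrier k \<Longrightarrow> f \<in> Hom D x y \<Longrightarrow> Scl D c f \<in> Hom D x y"
  and arrow_Zer: "x \<in> Ob D \<Longrightarrow> y \<in> Ob D \<Longrightarrow> Zer D x y \<in> Hom D x y"
proof -
  have m: "module k (hom_module D x y)" if "x \<in> Ob D" "y \<in> Ob D" using that by (rule D.Hom_module)
  show "Pls D f g \<in> Hom D x y" if "f \<in> Hom D x y" "g \<in> Hom D x y"
  proof -
    interpret module k "hom_module D x y" using m that(1) by (auto simp: Hom_arrow arrow_def)
    show ?thesis using M.a_closed[of f g] that by (simp add: hom_module_def)
  qed
  show "Scl D c f \<in> Hom D x y" if "c \<in> carrier k" "f \<in> Hom D x y"
  proof -
    interpret module k "hom_module D x y" using m that(2) by (auto simp: Hom_arrow arrow_def)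
    show ?thesis using smult_closed[of c f] that by (simp add: hom_module_def)
  qed
  show "Zer D x y \<in> Hom D x y" if "x \<in> Ob D" "y \<in> Ob D"
  proof -
    interpret module k "hom_module D x y" using m that by blast
    show ?thesis using M.zero_closed by (simp add: hom_module_def)
  qed
qed

lemma Isos_Hom: "f \<in> Isos D x y \<Longrightarrow> f \<in> Hom D x y"
  by (simp add: Isos_def)

lemmas D_Hom = D.Idt_closed D.Cmp_closed arrow_Pls arrow_Scl arrow_Zer D.TnA_closed
  D.Asc_iso[THEN Isos_Hom] D.Com_iso[THEN Isos_Hom] D.Lun_iso[THEN Isos_Hom] D.Run_iso[THEN Isos_Hom]

lemmas D_arrow = D_Hom[unfolded Hom_arrow]

lemma arrow_conj: "arrow f x y \<Longrightarrow> f \<in> Ar D \<and> Dm D f = x \<and> Cd D f = y"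
  by (simp add: arrow_def)

lemma arrow_iff: "f \<in> Ar D \<Longrightarrow> arrow f x y \<longleftrightarrow> Dm D f = x \<and> Cd D f = y"
  using D.Dm_closed D.Cd_closed by (auto simp: arrow_def)

lemma D_arrow_simps:
  "x \<in> Ob D \<Longrightarrow> Idt D x \<in> Ar D \<and> Dm D (Idt D x) = x \<and> Cd D (Idt D x) = x"
  "f \<in> Ar D \<Longrightarrow> g \<in> Ar D \<Longrightarrow> Cd D f = Dm D g \<Longrightarrow>
    Cmp D g f \<in> Ar D \<and> Dm D (Cmp D g f) = Dm D f \<and> Cd D (Cmp D g f) = Cd D g"
  "f \<in> Ar D \<Longrightarrow> g \<in> Ar D \<Longrightarrow> Dm D f = Dm D g \<Longrightarrow> Cd D f = Cd D g \<Longrightarrow>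
    Pls D f g \<in> Ar D \<and> Dm D (Pls D f g) = Dm D g \<and> Cd D (Pls D f g) = Cd D g"
  "c \<in> carrier k \<Longrightarrow> f \<in> Ar D \<Longrightarrow> Scl D c f \<in> Ar D \<and> Dm D (Scl D c f) = Dm D f \<and> Cd D (Scl D c f) = Cd D f"
  "x \<in> Ob D \<Longrightarrow> y \<in> Ob D \<Longrightarrow> Zer D x y \<in> Ar D \<and> Dm D (Zer D x y) = x \<and> Cd D (Zer D x y) = y"
  "f \<in> Ar D \<Longrightarrow> g \<in> Ar D \<Longrightarrow> TnA D f g \<in> Ar D \<and>
    Dm D (TnA D f g) = TnO D (Dm D f) (Dm D g) \<and> Cd D (TnA D f g) = TnO D (Cd D f) (Cd D g)"
  "x \<in> Ob D \<Longrightarrow> y \<in> Ob D \<Longrightarrow> z \<in> Ob D \<Longrightarrow> Asc D x y z \<in> Ar D \<and>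
    Dm D (Asc D x y z) = TnO D (TnO D x y) z \<and> Cd D (Asc D x y z) = TnO D x (TnO D y z)"
  "x \<in> Ob D \<Longrightarrow> y \<in> Ob D \<Longrightarrow> Com D x y \<in> Ar D \<and>
    Dm D (Com D x y) = TnO D x y \<and> Cd D (Com D x y) = TnO D y x"
  "x \<in> Ob D \<Longrightarrow> Lun D x \<in> Ar D \<and> Dm D (Lun D x) = TnO D (Unt D) x \<and> Cd D (Lun D x) = x"
  "x \<in> Ob D \<Longrightarrow> Run D x \<in> Ar D \<and> Dm D (Run D x) = TnO D x (Unt D) \<and> Cd D (Run D x) = x"
proof -
  note I = arrow_conj[OF D_arrow(1)] arrow_conj[OF D_arrow(2)] arrow_conj[OF D_arrow(3)]
    arrow_conj[OF D_arrow(4)] arrow_conj[OF D_arrow(5)] arrow_conj[OF D_arrow(6)]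
  show "Cmp D g f \<in> Ar D \<and> Dm D (Cmp D g f) = Dm D f \<and> Cd D (Cmp D g f) = Cd D g"
    if "f \<in> Ar D" "g \<in> Ar D" "Cd D f = Dm D g"
    using that by (intro I(2)[of f "Dm D f" "Dm D g" g "Cd D g"]) (simp_all add: arrow_iff)
  show "Pls D f g \<in> Ar D \<and> Dm D (Pls D f g) = Dm D g \<and> Cd D (Pls D f g) = Cd D g"
    if "f \<in> Ar D" "g \<in> Ar D" "Dm D f = Dm D g" "Cd D f = Cd D g"
    using that by (intro I(3)) (simp_all add: arrow_iff)
  show "Scl D c f \<in> Ar D \<and> Dm D (Scl D c f) = Dm D f \<and> Cd D (Scl D c f) = Cd D f"
    if "c \<in> carrier k" "f \<in> Ar D"
    using that by (intro I(4)) (simp_all add: arrow_iff)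
  show "TnA D f g \<in> Ar D \<and>
      Dm D (TnA D f g) = TnO D (Dm D f) (Dm D g) \<and> Cd D (TnA D f g) = TnO D (Cd D f) (Cd D g)"
    if "f \<in> Ar D" "g \<in> Ar D"
    using that by (intro I(6)) (simp_all add: arrow_iff)
qed (intro arrow_conj D_arrow(1,5,7-10); assumption)+

lemmas D_ar = D_arrow_simps[THEN conjunct1]
lemmas D_dm = D_arrow_simps[THEN conjunct2, THEN conjunct1]
lemmas D_cd = D_arrow_simps[THEN conjunct2, THEN conjunct2]

lemmas G_all = G_simps D_ar D_dm D_cd D.TnO_closed D.Unt_closed

lemma ObE:
  assumes "X \<in> Ob C" obtains x where "x \<in> Ob D" "X = GO x"
  using assms GO_image by blast

lemma GO_eq_iff: "x \<in> Ob D \<Longrightarrow> y \<in> Ob D \<Longrightarrow> GO x = GO y \<longleftrightarrow> x = y"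
  using GO_inj by (auto dest: inj_onD)

lemma GO_closed: "x \<in> Ob D \<Longrightarrow> GO x \<in> Ob C"
  using GO_image by blast

lemma GA_closed: "f \<in> Ar D \<Longrightarrow> GA f \<in> Ar C"
  using GA_image by blast

lemma ArE:
  assumes "f \<in> Ar C" obtains f' where "f' \<in> Ar D" "f = GA f'" "Dm D f' \<in> Ob D" "Cd D f' \<in> Ob D"
  using assms GA_image D.Dm_closed D.Cd_closed by blast

lemma Hom_Ob: "f \<in> Hom C X Y \<Longrightarrow> X \<in> Ob C \<and> Y \<in> Ob C"
  by (auto simp: Hom_def G_Dm G_Cd GO_closed elim!: ArE)

lemma HomE:
  assumes "f \<in> Hom C (GO x) (GO y)" "x \<in> Ob D" "y \<in> Ob D"
  obtains f' where "arrow f' x y" "f = GA f'"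
proof -
  obtain f' where "f' \<in> Ar D" "f = GA f'" "Dm D f' \<in> Ob D" "Cd D f' \<in> Ob D"
    using assms(1) by (auto simp: Hom_def elim: ArE)
  moreover from this have "Dm D f' = x" "Cd D f' = y"
    using assms by (auto simp: Hom_def G_Dm G_Cd GO_eq_iff)
  ultimately show thesis using that assms by (auto simp: arrow_def)
qed

lemma GA_Hom: "arrow f x y \<Longrightarrow> GA f \<in> Hom C (GO x) (GO y)"
  by (auto simp: arrow_def Hom_def G_Dm G_Cd GA_closed)

lemma GA_Isos:
  assumes "f \<in> Isos D x y"
  shows "GA f \<in> Isos C (GO x) (GO y)"
proof -
  obtain g where f: "arrow f x y" and g: "arrow g y x" "Cmp D g f = Idt D x" "Cmp D f g = Idt D y"
    using assms by (auto simp: Isos_def Hom_arrow)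
  have "Cmp C (GA g) (GA f) = Idt C (GO x)" "Cmp C (GA f) (GA g) = Idt C (GO y)"
    using arrowD[OF f] arrowD[OF g(1)] g(2,3) by (simp_all add: G_Cmp G_Idt)
  then show ?thesis using GA_Hom[OF f] GA_Hom[OF g(1)] by (auto simp: Isos_def)
qed

lemma module_transport:
  assumes x: "x \<in> Ob D" and y: "y \<in> Ob D"
  shows "module k (hom_module C (GO x) (GO y))"
proof -
  interpret module k "hom_module D x y" using x y by (rule D.Hom_module)
  have e: "f \<in> carrier (hom_module C (GO x) (GO y)) \<longleftrightarrow> (\<exists>f'\<in>carrier (hom_module D x y). f = GA f')" for f
  proof
    assume "f \<in> carrier (hom_module C (GO x) (GO y))"
    then obtain f' where "arrow f' x y" "f = GA f'"
      using x y by (auto simp: hom_module_def elim!: HomE)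
    then show "\<exists>f'\<in>carrier (hom_module D x y). f = GA f'"
      by (auto simp: hom_module_def Hom_arrow)
  qed (auto simp: hom_module_def Hom_arrow GA_Hom)
  have cl: "f \<in> carrier (hom_module D x y) \<longleftrightarrow> arrow f x y" for f
    by (simp add: hom_module_def Hom_arrow)
  have add: "GA f \<oplus>\<^bsub>hom_module C (GO x) (GO y)\<^esub> GA g = GA (f \<oplus>\<^bsub>hom_module D x y\<^esub> g)"
    if "f \<in> carrier (hom_module D x y)" "g \<in> carrier (hom_module D x y)" for f g
    using that by (simp add: cl) (simp add: hom_module_def arrow_def G_Pls)
  have scl: "c \<odot>\<^bsub>hom_module C (GO x) (GO y)\<^esub> GA f = GA (c \<odot>\<^bsub>hom_module D x y\<^esub> f)"
    if "c \<in> carrier k" "f \<in> carrier (hom_module D x y)" for c f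
    using that by (simp add: cl) (simp add: hom_module_def arrow_def G_Scl)
  have zer: "\<zero>\<^bsub>hom_module C (GO x) (GO y)\<^esub> = GA \<zero>\<^bsub>hom_module D x y\<^esub>"
    using x y by (simp add: hom_module_def G_Zer)
  show ?thesis
  proof (rule moduleI)
    show "cring k" by (rule R.is_cring)
    show "abelian_group (hom_module C (GO x) (GO y))"
    proof (rule abelian_groupI)
      fix f assume "f \<in> carrier (hom_module C (GO x) (GO y))"
      then obtain f' where f': "f' \<in> carrier (hom_module D x y)" "f = GA f'" unfolding e by blast
      then have "GA (\<ominus>\<^bsub>hom_module D x y\<^esub> f') \<oplus>\<^bsub>hom_module C (GO x) (GO y)\<^esub> f = \<zero>\<^bsub>hom_module C (GO x) (GO y)\<^esub>"
        by (simp add: add zer M.l_neg)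
      then show "\<exists>g\<in>carrier (hom_module C (GO x) (GO y)).
          g \<oplus>\<^bsub>hom_module C (GO x) (GO y)\<^esub> f = \<zero>\<^bsub>hom_module C (GO x) (GO y)\<^esub>"
        using f' e M.a_inv_closed by blast
    qed (auto simp: e add zer M.a_ac)
  qed (auto simp: e add scl smult_l_distr smult_r_distr smult_assoc1)
qed

lemma transported_linear_tensor_category: "linear_tensor_category k C"
proof (intro linear_tensor_category.intro linear_category.intro linear_tensor_category_axioms.intro)
  fix f assume "f \<in> Ar C"
  then show "Dm C f \<in> Ob C" "Cd C f \<in> Ob C"
    by (auto simp: G_Dm G_Cd GO_closed elim!: ArE)
next
  fix X assume "X \<in> Ob C"
  then show "Idt C X \<in> Hom C X X"
    by (auto simp: G_Idt intro!: GA_Hom D_arrow elim!: ObE)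
next
  fix f g X Y Z assume f: "f \<in> Hom C X Y" and g: "g \<in> Hom C Y Z"
  obtain x y z where xyz: "X = GO x" "Y = GO y" "Z = GO z" "x \<in> Ob D" "y \<in> Ob D" "z \<in> Ob D"
    using Hom_Ob[OF f] Hom_Ob[OF g] by (auto elim!: ObE)
  obtain f' g' where fg: "arrow f' x y" "f = GA f'" "arrow g' y z" "g = GA g'"
    using f g xyz by (auto elim!: HomE)
  note simps = fg(2,4) xyz arrowD[OF fg(1)] arrowD[OF fg(3)] G_all
  have "arrow (Cmp D g' f') x z" using fg(1,3) by (rule D_arrow(2))
  then show "Cmp C g f \<in> Hom C X Z"
    using GA_Hom by (simp add: simps)
next
  fix f g h W X Y Z assume f: "f \<in> Hom C W X" and g: "g \<in> Hom C X Y" and h: "h \<in> Hom C Y Z"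
  obtain w x y z where xyz: "W = GO w" "X = GO x" "Y = GO y" "Z = GO z" "w \<in> Ob D" "x \<in> Ob D" "y \<in> Ob D" "z \<in> Ob D"
    using Hom_Ob[OF f] Hom_Ob[OF g] Hom_Ob[OF h] by (auto elim!: ObE)
  obtain f' g' h' where fg: "arrow f' w x" "f = GA f'" "arrow g' x y" "g = GA g'" "arrow h' y z" "h = GA h'"
    using f g h xyz by (auto elim!: HomE)
  note simps = fg(2,4,6) xyz arrowD[OF fg(1)] arrowD[OF fg(3)] arrowD[OF fg(5)] G_all
  show "Cmp C h (Cmp C g f) = Cmp C (Cmp C h g) f"
    using D.Cmp_assoc[unfolded Hom_arrow, OF fg(1,3,5)] by (simp add: simps)
next
  fix f X Y assume f: "f \<in> Hom C X Y"
  obtain x y where xyz: "X = GO x" "Y = GO y" "x \<in> Ob D" "y \<in> Ob D"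
    using Hom_Ob[OF f] by (auto elim!: ObE)
  obtain f' where fg: "arrow f' x y" "f = GA f'"
    using f xyz by (auto elim!: HomE)
  note simps = fg(2) xyz arrowD[OF fg(1)] G_all
  show "Cmp C (Idt C Y) f = f" "Cmp C f (Idt C X) = f"
    using D.Cmp_Idt_left[unfolded Hom_arrow, OF fg(1)] D.Cmp_Idt_right[unfolded Hom_arrow, OF fg(1)]
    by (simp_all add: simps)
  show "Cmp C f (Lun C X) = Cmp C (Lun C Y) (TnA C (Idt C (Unt C)) f)"
    "Cmp C f (Run C X) = Cmp C (Run C Y) (TnA C f (Idt C (Unt C)))"
    using D.Lun_natural[unfolded Hom_arrow, OF fg(1)] D.Run_natural[unfolded Hom_arrow, OF fg(1)]
    by (simp_all add: simps)
next
  fix X Y assume "X \<in> Ob C" "Y \<in> Ob C"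
  then show "module k (hom_module C X Y)" "TnO C X Y \<in> Ob C"
    "TnA C (Idt C X) (Idt C Y) = Idt C (TnO C X Y)"
    "Com C X Y \<in> Isos C (TnO C X Y) (TnO C Y X)"
    "Cmp C (Com C Y X) (Com C X Y) = Idt C (TnO C X Y)"
    "Cmp C (TnA C (Idt C X) (Lun C Y)) (Asc C X (Unt C) Y) = TnA C (Run C X) (Idt C Y)"
    using module_transport D.TnA_Idt D.symmetry D.triangle GA_Isos[OF D.Com_iso]
    by (auto simp: G_all GO_closed elim!: ObE)
next
  fix f g g' X Y Z assume f: "f \<in> Hom C X Y" and g: "g \<in> Hom C Y Z" and h: "g' \<in> Hom C Y Z"
  obtain x y z where xyz: "X = GO x" "Y = GO y" "Z = GO z" "x \<in> Ob D" "y \<in> Ob D" "z \<in> Ob D"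
    using Hom_Ob[OF f] Hom_Ob[OF g] by (auto elim!: ObE)
  obtain f1 g1 h1 where fg: "arrow f1 x y" "f = GA f1" "arrow g1 y z" "g = GA g1" "arrow h1 y z" "g' = GA h1"
    using f g h xyz by (auto elim!: HomE)
  note simps = fg(2,4,6) xyz arrowD[OF fg(1)] arrowD[OF fg(3)] arrowD[OF fg(5)] G_all
  show "Cmp C (Pls C g g') f = Pls C (Cmp C g f) (Cmp C g' f)"
    using D.Cmp_Pls_left[unfolded Hom_arrow, OF fg(1,3,5)] by (simp add: simps)
next
  fix f f' g X Y Z assume f: "f \<in> Hom C X Y" and h: "f' \<in> Hom C X Y" and g: "g \<in> Hom C Y Z"
  obtain x y z where xyz: "X = GO x" "Y = GO y" "Z = GO z" "x \<in> Ob D" "y \<in> Ob D" "z \<in> Ob D"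
    using Hom_Ob[OF f] Hom_Ob[OF g] by (auto elim!: ObE)
  obtain f1 g1 h1 where fg: "arrow f1 x y" "f = GA f1" "arrow h1 x y" "f' = GA h1" "arrow g1 y z" "g = GA g1"
    using f g h xyz by (auto elim!: HomE)
  note simps = fg(2,4,6) xyz arrowD[OF fg(1)] arrowD[OF fg(3)] arrowD[OF fg(5)] G_all
  show "Cmp C g (Pls C f f') = Pls C (Cmp C g f) (Cmp C g f')"
    using D.Cmp_Pls_right[unfolded Hom_arrow, OF fg(1,3,5)] by (simp add: simps)
next
  fix c f g X Y Z assume c: "c \<in> carrier k" and f: "f \<in> Hom C X Y" and g: "g \<in> Hom C Y Z"
  obtain x y z where xyz: "X = GO x" "Y = GO y" "Z = GO z" "x \<in> Ob D" "y \<in> Ob D" "z \<in> Ob D"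
    using Hom_Ob[OF f] Hom_Ob[OF g] by (auto elim!: ObE)
  obtain f' g' where fg: "arrow f' x y" "f = GA f'" "arrow g' y z" "g = GA g'"
    using f g xyz by (auto elim!: HomE)
  note simps = c fg(2,4) xyz arrowD[OF fg(1)] arrowD[OF fg(3)] G_all
  show "Cmp C (Scl C c g) f = Scl C c (Cmp C g f)" "Cmp C g (Scl C c f) = Scl C c (Cmp C g f)"
    using D.Cmp_Scl_left[unfolded Hom_arrow, OF c fg(1,3)] D.Cmp_Scl_right[unfolded Hom_arrow, OF c fg(1,3)]
    by (simp_all add: simps)
next
  show "Unt C \<in> Ob C"
    by (simp add: G_Unt GO_closed D.Unt_closed)
next
  fix f g X Y X' Y' assume f: "f \<in> Hom C X Y" and g: "g \<in> Hom C X' Y'"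
  obtain x y x' y' where xyz: "X = GO x" "Y = GO y" "X' = GO x'" "Y' = GO y'" "x \<in> Ob D" "y \<in> Ob D" "x' \<in> Ob D" "y' \<in> Ob D"
    using Hom_Ob[OF f] Hom_Ob[OF g] by (auto elim!: ObE)
  obtain f' g' where fg: "arrow f' x y" "f = GA f'" "arrow g' x' y'" "g = GA g'"
    using f g xyz by (auto elim!: HomE)
  note simps = fg(2,4) xyz arrowD[OF fg(1)] arrowD[OF fg(3)] G_all
  have "arrow (TnA D f' g') (TnO D x x') (TnO D y y')"
    using D.TnA_closed[unfolded Hom_arrow, OF fg(1,3)] .
  then show "TnA C f g \<in> Hom C (TnO C X X') (TnO C Y Y')"
    using GA_Hom by (simp add: simps)
  show "Cmp C (TnA C g f) (Com C X X') = Cmp C (Com C Y Y') (TnA C f g)"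
    using D.Com_natural[unfolded Hom_arrow, OF fg(1,3)] by (simp add: simps)
  fix c assume c: "c \<in> carrier k"
  show "TnA C (Scl C c f) g = Scl C c (TnA C f g)" "TnA C f (Scl C c g) = Scl C c (TnA C f g)"
    using D.TnA_Scl_left[unfolded Hom_arrow, OF c fg(1,3)] D.TnA_Scl_right[unfolded Hom_arrow, OF c fg(1,3)] c
    by (simp_all add: simps)
next
  fix f g f' g' X Y Z X' Y' Z'
  assume f: "f \<in> Hom C X Y" and g: "g \<in> Hom C Y Z" and f': "f' \<in> Hom C X' Y'" and g': "g' \<in> Hom C Y' Z'"
  obtain x y z x' y' z' where xyz: "X = GO x" "Y = GO y" "Z = GO z" "X' = GO x'" "Y' = GO y'" "Z' = GO z'"
    "x \<in> Ob D" "y \<in> Ob D" "z \<in> Ob D" "x' \<in> Ob D" "y' \<in> Ob D" "z' \<in> Ob D"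
    using Hom_Ob[OF f] Hom_Ob[OF g] Hom_Ob[OF f'] Hom_Ob[OF g'] by (auto elim!: ObE)
  obtain f1 g1 f2 g2 where fg: "arrow f1 x y" "f = GA f1" "arrow g1 y z" "g = GA g1"
     "arrow f2 x' y'" "f' = GA f2" "arrow g2 y' z'" "g' = GA g2"
    using f g f' g' xyz by (auto elim!: HomE)
  note simps = fg(2,4,6,8) xyz arrowD[OF fg(1)] arrowD[OF fg(3)] arrowD[OF fg(5)] arrowD[OF fg(7)] G_all
  show "TnA C (Cmp C g f) (Cmp C g' f') = Cmp C (TnA C g g') (TnA C f f')"
    using D.TnA_Cmp[unfolded Hom_arrow, OF fg(1,3,5,7)] by (simp add: simps)
next
  fix f g h X Y X' Y'
  assume f: "f \<in> Hom C X Y" and h: "h \<in> Hom C X Y" and g: "g \<in> Hom C X' Y'"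
  obtain x y x' y' where xyz: "X = GO x" "Y = GO y" "X' = GO x'" "Y' = GO y'" "x \<in> Ob D" "y \<in> Ob D" "x' \<in> Ob D" "y' \<in> Ob D"
    using Hom_Ob[OF f] Hom_Ob[OF g] by (auto elim!: ObE)
  obtain f1 h1 g1 where fg: "arrow f1 x y" "f = GA f1" "arrow h1 x y" "h = GA h1" "arrow g1 x' y'" "g = GA g1"
    using f g h xyz by (auto elim!: HomE)
  note simps = fg(2,4,6) xyz arrowD[OF fg(1)] arrowD[OF fg(3)] arrowD[OF fg(5)] G_all
  show "TnA C (Pls C f h) g = Pls C (TnA C f g) (TnA C h g)"
    using D.TnA_Pls_left[unfolded Hom_arrow, OF fg(1,3,5)] by (simp add: simps)
next
  fix f g h X Y X' Y'
  assume g: "g \<in> Hom C X' Y'" and f: "f \<in> Hom C X Y" and h: "h \<in> Hom C X Y"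
  obtain x y x' y' where xyz: "X = GO x" "Y = GO y" "X' = GO x'" "Y' = GO y'" "x \<in> Ob D" "y \<in> Ob D" "x' \<in> Ob D" "y' \<in> Ob D"
    using Hom_Ob[OF f] Hom_Ob[OF g] by (auto elim!: ObE)
  obtain f1 h1 g1 where fg: "arrow g1 x' y'" "g = GA g1" "arrow f1 x y" "f = GA f1" "arrow h1 x y" "h = GA h1"
    using f g h xyz by (auto elim!: HomE)
  note simps = fg(2,4,6) xyz arrowD[OF fg(1)] arrowD[OF fg(3)] arrowD[OF fg(5)] G_all
  show "TnA C g (Pls C f h) = Pls C (TnA C g f) (TnA C g h)"
    using D.TnA_Pls_right[unfolded Hom_arrow, OF fg(1,3,5)] by (simp add: simps)
next
  fix X Y Z assume "X \<in> Ob C" "Y \<in> Ob C" "Z \<in> Ob C"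
  then show "Asc C X Y Z \<in> Isos C (TnO C (TnO C X Y) Z) (TnO C X (TnO C Y Z))"
    "Cmp C (Asc C Y Z X) (Cmp C (Com C X (TnO C Y Z)) (Asc C X Y Z)) =
      Cmp C (TnA C (Idt C Y) (Com C X Z)) (Cmp C (Asc C Y X Z) (TnA C (Com C X Y) (Idt C Z)))"
    using D.hexagon GA_Isos[OF D.Asc_iso] by (auto simp: G_all elim!: ObE)
next
  fix f g h X X' Y Y' Z Z'
  assume f: "f \<in> Hom C X X'" and g: "g \<in> Hom C Y Y'" and h: "h \<in> Hom C Z Z'"
  obtain x y z x' y' z' where xyz: "X = GO x" "Y = GO y" "Z = GO z" "X' = GO x'" "Y' = GO y'" "Z' = GO z'"
    "x \<in> Ob D" "y \<in> Ob D" "z \<in> Ob D" "x' \<in> Ob D" "y' \<in> Ob D" "z' \<in> Ob D"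
    using Hom_Ob[OF f] Hom_Ob[OF g] Hom_Ob[OF h] by (auto elim!: ObE)
  obtain f1 g1 h1 where fg: "arrow f1 x x'" "f = GA f1" "arrow g1 y y'" "g = GA g1" "arrow h1 z z'" "h = GA h1"
    using f g h xyz by (auto elim!: HomE)
  note simps = fg(2,4,6) xyz arrowD[OF fg(1)] arrowD[OF fg(3)] arrowD[OF fg(5)] G_all
  show "Cmp C (TnA C f (TnA C g h)) (Asc C X Y Z) = Cmp C (Asc C X' Y' Z') (TnA C (TnA C f g) h)"
    using D.Asc_natural[unfolded Hom_arrow, OF fg(1,3,5)] by (simp add: simps)
next
  fix X assume "X \<in> Ob C"
  then show "Lun C X \<in> Isos C (TnO C (Unt C) X) X" "Run C X \<in> Isos C (TnO C X (Unt C)) X"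
    using GA_Isos[OF D.Lun_iso] GA_Isos[OF D.Run_iso] by (auto simp: G_all elim!: ObE)
next
  fix W X Y Z assume "W \<in> Ob C" "X \<in> Ob C" "Y \<in> Ob C" "Z \<in> Ob C"
  then show "Cmp C (Asc C W X (TnO C Y Z)) (Asc C (TnO C W X) Y Z) =
    Cmp C (TnA C (Idt C W) (Asc C X Y Z)) (Cmp C (Asc C W (TnO C X Y) Z) (TnA C (Asc C W X Y) (Idt C Z)))"
    using D.pentagon by (auto simp: G_all elim!: ObE)
qed

definition FO :: "'p \<Rightarrow> 'o" where "FO = inv_into (Ob D) GO"

definition FA :: "'n \<Rightarrow> 'm" where "FA = inv_into (Ar D) GA"

lemma FO_GO [simp]: "x \<in> Ob D \<Longrightarrow> FO (GO x) = x"
  by (simp add: FO_def GO_inj)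

lemma FA_GA [simp]: "f \<in> Ar D \<Longrightarrow> FA (GA f) = f"
  by (simp add: FA_def GA_inj)

lemma Idt_Isos: "x \<in> Ob D \<Longrightarrow> Idt D x \<in> Isos D x x"
  using D.Idt_closed D.Cmp_Idt_left by (auto simp: Isos_def)

lemma tensor_equivalent_iso: "tensor_equivalent k C D"
proof -
  have id_left: "Cmp D (Idt D y) f = f" if "f \<in> Ar D" "Cd D f = y" for f y
    using that D.Cmp_Idt_left[of f "Dm D f" y] by (simp add: Hom_def)
  have id_right: "Cmp D f (Idt D x) = f" if "f \<in> Ar D" "Dm D f = x" for f x
    using that D.Cmp_Idt_right[of f x "Cd D f"] by (simp add: Hom_def)
  note ids = id_left id_right D.TnA_Idt
  have F: "is_functor C D FO FA"
    unfolding is_functor_def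
    by (auto simp: G_all Hom_def GO_eq_iff elim!: ObE ArE)
  \<comment> \<open>As the isomorphism preserves the tensor operations strictly, both structure
    isomorphisms of the tensor functor can be taken to be identities.\<close>
  have T: "is_tensor_functor C D FO FA (\<lambda>X Y. Idt D (TnO D (FO X) (FO Y))) (Idt D (Unt D))"
    unfolding is_tensor_functor_def
  proof (intro conjI ballI)
    show "is_functor C D FO FA" by (rule F)
  qed (auto simp: G_all ids Idt_Isos elim!: ObE ArE)
  have L: "is_linear k C D FA"
    unfolding is_linear_def
  proof (intro conjI ballI)
    fix X Y f g assume XY: "X \<in> Ob C" "Y \<in> Ob C" and fg: "f \<in> Hom C X Y" "g \<in> Hom C X Y"
    obtain x y where "X = GO x" "Y = GO y" "x \<in> Ob D" "y \<in> Ob D" using XY by (auto elim!: ObE)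
    then obtain f' g' where "arrow f' x y" "f = GA f'" "arrow g' x y" "g = GA g'"
      using fg by (auto elim!: HomE)
    then show "FA (Pls C f g) = Pls D (FA f) (FA g)"
      by (auto simp: G_all arrow_def)
  qed (auto simp: G_all elim!: ArE)
  have G: "is_functor D C GO GA"
    unfolding is_functor_def
    by (auto simp: G_all Hom_def GO_closed GA_closed GO_eq_iff)
  interpret C: linear_tensor_category k C by (rule transported_linear_tensor_category)
  have "natural_iso C C id id (GO \<circ> FO) (GA \<circ> FA) (Idt C)"
    unfolding natural_iso_def
    by (auto simp: G_all ids Idt_Isos GA_Isos D.Dm_closed D.Cd_closed elim!: ObE ArE)
  moreover have "natural_iso D D (FO \<circ> GO) (FA \<circ> GA) id id (Idt D)"
    unfolding natural_iso_def
    by (auto simp: ids Idt_Isos D.Dm_closed D.Cd_closed)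
  ultimately have "is_equivalence C D FO FA"
    unfolding is_equivalence_def using F G by blast
  then show ?thesis
    unfolding tensor_equivalent_def
    using C.linear_tensor_category_axioms D.linear_tensor_category_axioms T L by blast
qed

end

section \<open>Ultraproducts\<close>

lemma ucl_self: "x \<in> ucl U x"
  by (simp add: ucl_def)

lemma ucl_eq_iff: "ucl U x = ucl U y \<longleftrightarrow> eventually (\<lambda>i. x i = y i) U"
proof
  assume "ucl U x = ucl U y"
  then have "x \<in> ucl U y" using ucl_self[of x U] by simp
  then show "eventually (\<lambda>i. x i = y i) U" by (simp add: ucl_def)
next
  assume e: "eventually (\<lambda>i. x i = y i) U"
  have "eventually (\<lambda>i. z i = x i) U \<longleftrightarrow> eventually (\<lambda>i. z i = y i) U" for z
    using e by (auto elim: eventually_elim2)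
  then show "ucl U x = ucl U y" by (simp add: ucl_def)
qed

lemma urep_ucl: "eventually (\<lambda>i. urep (ucl U x) i = x i) U"
proof -
  have "urep (ucl U x) \<in> ucl U x"
    unfolding urep_def by (rule someI[where P = "\<lambda>z. z \<in> ucl U x"], rule ucl_self)
  then show ?thesis by (simp add: ucl_def)
qed

lemma ulift1_ucl: "ulift1 U f (ucl U x) = ucl U (\<lambda>i. f i (x i))"
  unfolding ulift1_def ucl_eq_iff using urep_ucl[of U x] by eventually_elim simp

lemma ulift2_ucl: "ulift2 U f (ucl U x) (ucl U y) = ucl U (\<lambda>i. f i (x i) (y i))"
  unfolding ulift2_def ucl_eq_iff using urep_ucl[of U x] urep_ucl[of U y] by eventually_elim simp

lemma ulift3_ucl: "ulift3 U f (ucl U x) (ucl U y) (ucl U z) = ucl U (\<lambda>i. f i (x i) (y i) (z i))"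
  unfolding ulift3_def ucl_eq_iff using urep_ucl[of U x] urep_ucl[of U y] urep_ucl[of U z]
  by eventually_elim simp

lemma usetE:
  assumes "X \<in> uset U S" obtains x where "X = ucl U x" "\<And>i. x i \<in> S i"
  using assms by (auto simp: uset_def)

text \<open>A member of \<open>uset\<close> has a representative lying in \<open>S i\<close> for
  every \<open>i\<close>. A tuple that does so only almost everywhere is repaired by arbitrary
  elements at the exceptional indices, which exist because no \<open>S i\<close> is empty.\<close>

lemma ucl_in_uset:
  assumes "\<And>i. S i \<noteq> {}"
  shows "ucl U x \<in> uset U S \<longleftrightarrow> eventually (\<lambda>i. x i \<in> S i) U"
proof
  assume "ucl U x \<in> uset U S"
  then obtain y where "ucl U x = ucl U y" "\<And>i. y i \<in> S i" by (auto elim: usetE)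
  then show "eventually (\<lambda>i. x i \<in> S i) U"
    unfolding ucl_eq_iff by (auto elim: eventually_mono)
next
  assume e: "eventually (\<lambda>i. x i \<in> S i) U"
  define y where "y i = (if x i \<in> S i then x i else SOME z. z \<in> S i)" for i
  have "y i \<in> S i" for i
    using assms[of i] by (auto simp: y_def some_in_eq)
  moreover have "ucl U x = ucl U y"
    unfolding ucl_eq_iff using e by eventually_elim (simp add: y_def)
  ultimately show "ucl U x \<in> uset U S" by (auto simp: uset_def)
qed

section \<open>Ultraproduct rings and limits of tuples\<close>

lemma uprod_ring_carrier: "carrier (uprod_ring U K) = uset U (\<lambda>i. carrier (K i))"
  by (simp add: uprod_ring_def)

lemma uprod_ring_ops:
  "ucl U x \<oplus>\<^bsub>uprod_ring U K\<^esub> ucl U y = ucl U (\<lambda>i. x i \<oplus>\<^bsub>K i\<^esub> y i)"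
  "ucl U x \<otimes>\<^bsub>uprod_ring U K\<^esub> ucl U y = ucl U (\<lambda>i. x i \<otimes>\<^bsub>K i\<^esub> y i)"
  "\<zero>\<^bsub>uprod_ring U K\<^esub> = ucl U (\<lambda>i. \<zero>\<^bsub>K i\<^esub>)"
  "\<one>\<^bsub>uprod_ring U K\<^esub> = ucl U (\<lambda>i. \<one>\<^bsub>K i\<^esub>)"
  by (simp_all add: uprod_ring_def ulift2_ucl)

lemma cring_uprod_ring:
  assumes K: "\<And>i. cring (K i)"
  shows "cring (uprod_ring U K)"
proof -
  have ring: "ring (K i)" for i using K by (rule cring.axioms)
  have ne: "carrier (K i) \<noteq> {}" for i
    using ring.ring_simprules(2)[OF ring[of i]] by auto
  have in_carrier: "ucl U x \<in> uset U (\<lambda>i. carrier (K i))" if "\<And>i. x i \<in> carrier (K i)" for x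
    using that by (auto simp: uset_def)
  note s = uprod_ring_carrier uprod_ring_ops
  note r = cring.cring_simprules[OF K] monoid.r_one[OF ring.is_monoid[OF ring]]
  show ?thesis
  proof (rule cringI)
    show "abelian_group (uprod_ring U K)"
    proof (rule abelian_groupI)
      fix X assume "X \<in> carrier (uprod_ring U K)"
      then obtain x where x: "X = ucl U x" "\<And>i. x i \<in> carrier (K i)"
        unfolding s by (auto elim: usetE)
      show "\<exists>Y\<in>carrier (uprod_ring U K). Y \<oplus>\<^bsub>uprod_ring U K\<^esub> X = \<zero>\<^bsub>uprod_ring U K\<^esub>"
        by (rule bexI[of _ "ucl U (\<lambda>i. \<ominus>\<^bsub>K i\<^esub> x i)"])
          (simp_all add: s x r in_carrier)
    qed (auto simp: s r in_carrier elim!: usetE)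
    show "comm_monoid (uprod_ring U K)"
      by (rule comm_monoidI) (auto simp: s r in_carrier elim!: usetE)
  qed (auto simp: s r elim!: usetE)
qed

text \<open>Read \<open>rel P p\<close> as: the tuple \<open>P\<close> has the limit
  \<open>p\<close>. A tuple need not have a limit, but every element of \<open>S\<close> is one, and
  by \<open>rel_eq_iff\<close> equations between limits are exactly equations that hold almost
  everywhere. The instances are the scalars, the coordinate ring and its tensor square.\<close>

locale ultra_ring =
  fixes U :: "'i filter" and R :: "'i \<Rightarrow> 'x ring" and S :: "'y ring"
    and rel :: "('i \<Rightarrow> 'x) \<Rightarrow> 'y \<Rightarrow> bool"
  assumes U_proper: "U \<noteq> bot"
    and R_cring: "\<And>i. cring (R i)" and S_cring: "cring S"
    and rel_closed: "rel P p \<Longrightarrow> p \<in> carrier S"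
      "rel P p \<Longrightarrow> eventually (\<lambda>i. P i \<in> carrier (R i)) U"
    and rel_cong: "rel P p \<Longrightarrow> eventually (\<lambda>i. Q i = P i) U \<Longrightarrow> rel Q p"
    and rel_eq_iff: "rel P p \<Longrightarrow> rel Q q \<Longrightarrow> p = q \<longleftrightarrow> eventually (\<lambda>i. P i = Q i) U"
    and rel_total: "p \<in> carrier S \<Longrightarrow> \<exists>P. rel P p"
    and rel_add: "rel P p \<Longrightarrow> rel Q q \<Longrightarrow> rel (\<lambda>i. P i \<oplus>\<^bsub>R i\<^esub> Q i) (p \<oplus>\<^bsub>S\<^esub> q)"
    and rel_mult: "rel P p \<Longrightarrow> rel Q q \<Longrightarrow> rel (\<lambda>i. P i \<otimes>\<^bsub>R i\<^esub> Q i) (p \<otimes>\<^bsub>S\<^esub> q)"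
    and rel_zero: "rel (\<lambda>i. \<zero>\<^bsub>R i\<^esub>) \<zero>\<^bsub>S\<^esub>"
    and rel_one: "rel (\<lambda>i. \<one>\<^bsub>R i\<^esub>) \<one>\<^bsub>S\<^esub>"
begin

sublocale S: cring S by (rule S_cring)

lemma rel_finsum:
  assumes "finite A" "\<And>s. s \<in> A \<Longrightarrow> rel (\<lambda>i. f i s) (g s)"
  shows "rel (\<lambda>i. finsum (R i) (f i) A) (finsum S g A)"
  using assms
proof (induction A)
  case empty
  have "finsum (R i) (f i) {} = \<zero>\<^bsub>R i\<^esub>" for i
    using R_cring[of i] by (simp add: abelian_monoid.finsum_empty cring.axioms ring.axioms abelian_group.axioms)
  then show ?case using rel_zero by simp
next
  case (insert a A)
  have "finsum S g (insert a A) = g a \<oplus>\<^bsub>S\<^esub> finsum S g A"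
    using insert by (intro S.finsum_insert) (auto intro: rel_closed)
  moreover have "rel (\<lambda>i. f i a \<oplus>\<^bsub>R i\<^esub> finsum (R i) (f i) A) (g a \<oplus>\<^bsub>S\<^esub> finsum S g A)"
    using insert by (intro rel_add) auto
  \<comment> \<open>The summands lie in the carriers only on a member of \<open>U\<close>, so the
    recursion for \<open>finsum\<close> holds only there; \<open>rel_cong\<close> absorbs the
    exceptional indices.\<close>
  moreover have "eventually (\<lambda>i. finsum (R i) (f i) (insert a A) = f i a \<oplus>\<^bsub>R i\<^esub> finsum (R i) (f i) A) U"
  proof -
    have "eventually (\<lambda>i. \<forall>s\<in>insert a A. f i s \<in> carrier (R i)) U"
      using insert rel_closed(2) by (intro eventually_ball_finite) auto
    then show ?thesis
    proof eventually_elim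
      case (elim i)
      interpret cring "R i" by (rule R_cring)
      show ?case using elim insert(1,2) by (intro finsum_insert) auto
    qed
  qed
  ultimately show ?case by (auto intro: rel_cong)
qed

definition mrel :: "('i \<Rightarrow> 'x mat) \<Rightarrow> 'y mat \<Rightarrow> bool" where
  "mrel A a \<longleftrightarrow> eventually (\<lambda>i. dim_row (A i) = dim_row a \<and> dim_col (A i) = dim_col a) U \<and>
    (\<forall>r<dim_row a. \<forall>c<dim_col a. rel (\<lambda>i. A i $$ (r, c)) (a $$ (r, c)))"

lemma mrel_dim: "mrel A a \<Longrightarrow> eventually (\<lambda>i. dim_row (A i) = dim_row a \<and> dim_col (A i) = dim_col a) U"
  by (simp add: mrel_def)

lemma mrel_index: "mrel A a \<Longrightarrow> r < dim_row a \<Longrightarrow> c < dim_col a \<Longrightarrow> rel (\<lambda>i. A i $$ (r, c)) (a $$ (r, c))"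
  by (simp add: mrel_def)

text \<open>\<open>B\<close> is an explicit formula for the entries. It has to agree with the tuple
  only almost everywhere, where also the dimensions are the expected ones, so the indices with
  matrices of another size do no harm.\<close>

lemma mrelI:
  assumes "eventually (\<lambda>i. dim_row (A i) = dim_row a \<and> dim_col (A i) = dim_col a \<and>
      (\<forall>r<dim_row a. \<forall>c<dim_col a. A i $$ (r, c) = B r c i)) U"
    "\<And>r c. r < dim_row a \<Longrightarrow> c < dim_col a \<Longrightarrow> rel (B r c) (a $$ (r, c))"
  shows "mrel A a"
  unfolding mrel_def
proof (intro conjI allI impI)
  show "eventually (\<lambda>i. dim_row (A i) = dim_row a \<and> dim_col (A i) = dim_col a) U"
    using assms(1) by eventually_elim simp
  fix r c assume rc: "r < dim_row a" "c < dim_col a"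
  have "eventually (\<lambda>i. A i $$ (r, c) = B r c i) U"
    using assms(1) by eventually_elim (use rc in simp)
  then show "rel (\<lambda>i. A i $$ (r, c)) (a $$ (r, c))"
    by (rule rel_cong[OF assms(2)[OF rc]])
qed

lemma mrel_cong:
  assumes "mrel A a" "eventually (\<lambda>i. B i = A i) U"
  shows "mrel B a"
proof (rule mrelI)
  show "eventually (\<lambda>i. dim_row (B i) = dim_row a \<and> dim_col (B i) = dim_col a \<and>
      (\<forall>r<dim_row a. \<forall>c<dim_col a. B i $$ (r, c) = A i $$ (r, c))) U"
    using mrel_dim[OF assms(1)] assms(2) by eventually_elim simp
qed (use assms(1) in \<open>rule mrel_index\<close>)

text \<open>There are finitely many entries, so finitely many members of \<open>U\<close> have to be
  intersected. The converse also compares sizes, and a relation between constants that holds almost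
  everywhere holds because \<open>U\<close> is proper.\<close>

lemma mrel_eq_iff:
  assumes A: "mrel A a" and B: "mrel B b"
  shows "a = b \<longleftrightarrow> eventually (\<lambda>i. A i = B i) U"
proof
  assume ab: "a = b"
  have "eventually (\<lambda>i. A i $$ (r, c) = B i $$ (r, c)) U" if "r < dim_row a" "c < dim_col a" for r c
    using rel_eq_iff[OF mrel_index[OF A that] mrel_index[OF B]] that ab by blast
  then have "eventually (\<lambda>i. \<forall>r\<in>{..<dim_row a}. \<forall>c\<in>{..<dim_col a}. A i $$ (r, c) = B i $$ (r, c)) U"
    by (intro eventually_ball_finite ballI) auto
  then show "eventually (\<lambda>i. A i = B i) U"
    using mrel_dim[OF A] mrel_dim[OF B] by eventually_elim (auto simp: ab intro!: eq_matI)
next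
  assume e: "eventually (\<lambda>i. A i = B i) U"
  then have "eventually (\<lambda>i. dim_row a = dim_row b \<and> dim_col a = dim_col b) U"
    using mrel_dim[OF A] mrel_dim[OF B] by eventually_elim simp
  then have d: "dim_row a = dim_row b" "dim_col a = dim_col b"
    using U_proper by (simp_all add: eventually_const)
  show "a = b"
  proof (rule eq_matI)
    fix r c assume rc: "r < dim_row b" "c < dim_col b"
    have "eventually (\<lambda>i. A i $$ (r, c) = B i $$ (r, c)) U"
      using e by eventually_elim simp
    then show "a $$ (r, c) = b $$ (r, c)"
      using rel_eq_iff[OF mrel_index[OF A] mrel_index[OF B], of r c r c] rc d by simp
  qed (rule d)+
qed

lemma mrel_over:
  assumes "mrel A a"
  shows "mat_over S a" "eventually (\<lambda>i. mat_over (R i) (A i)) U"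
proof -
  show "mat_over S a"
    using mrel_index[OF assms] rel_closed(1) by (auto simp: mat_over_def)
  have "eventually (\<lambda>i. \<forall>r\<in>{..<dim_row a}. \<forall>c\<in>{..<dim_col a}. A i $$ (r, c) \<in> carrier (R i)) U"
    using mrel_index[OF assms] rel_closed(2) by (intro eventually_ball_finite ballI) auto
  then show "eventually (\<lambda>i. mat_over (R i) (A i)) U"
    using mrel_dim[OF assms] by eventually_elim (auto simp: mat_over_def)
qed

lemma mrel_total:
  assumes "mat_over S a"
  shows "\<exists>A. mrel A a \<and> (\<forall>i. dim_row (A i) = dim_row a \<and> dim_col (A i) = dim_col a)"
proof -
  define B where "B r c = (SOME P. rel P (a $$ (r, c)))" for r c
  have B: "rel (B r c) (a $$ (r, c))" if "r < dim_row a" "c < dim_col a" for r c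
    unfolding B_def using rel_total[OF mat_overD[OF assms that]] by (rule someI_ex)
  have "mrel (\<lambda>i. mat (dim_row a) (dim_col a) (\<lambda>(r, c). B r c i)) a"
    by (rule mrelI[where B = B]) (auto simp: B)
  then show ?thesis by (intro exI[of _ "\<lambda>i. mat (dim_row a) (dim_col a) (\<lambda>(r, c). B r c i)"]) simp
qed

lemma mrel_comp:
  assumes A: "mrel A a" and B: "mrel B b" and d: "dim_col a = dim_row b"
  shows "mrel (\<lambda>i. mat_comp (R i) (A i) (B i)) (mat_comp S a b)"
proof (rule mrelI)
  show "eventually (\<lambda>i. dim_row (mat_comp (R i) (A i) (B i)) = dim_row (mat_comp S a b) \<and>
      dim_col (mat_comp (R i) (A i) (B i)) = dim_col (mat_comp S a b) \<and>
      (\<forall>r<dim_row (mat_comp S a b). \<forall>c<dim_col (mat_comp S a b). mat_comp (R i) (A i) (B i) $$ (r, c) =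
        finsum (R i) (\<lambda>l. A i $$ (r, l) \<otimes>\<^bsub>R i\<^esub> B i $$ (l, c)) {..<dim_col a})) U"
    using mrel_dim[OF A] mrel_dim[OF B] by eventually_elim simp
  fix r c assume "r < dim_row (mat_comp S a b)" "c < dim_col (mat_comp S a b)"
  then show "rel (\<lambda>i. finsum (R i) (\<lambda>l. A i $$ (r, l) \<otimes>\<^bsub>R i\<^esub> B i $$ (l, c)) {..<dim_col a}) (mat_comp S a b $$ (r, c))"
    using mrel_index[OF A] mrel_index[OF B] d by (auto intro!: rel_finsum rel_mult)
qed

lemma mrel_kron:
  assumes A: "mrel A a" and B: "mrel B b"
  shows "mrel (\<lambda>i. mat_kron (R i) (A i) (B i)) (mat_kron S a b)"
proof (rule mrelI)
  show "eventually (\<lambda>i. dim_row (mat_kron (R i) (A i) (B i)) = dim_row (mat_kron S a b) \<and>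
      dim_col (mat_kron (R i) (A i) (B i)) = dim_col (mat_kron S a b) \<and>
      (\<forall>r<dim_row (mat_kron S a b). \<forall>c<dim_col (mat_kron S a b). mat_kron (R i) (A i) (B i) $$ (r, c) =
        A i $$ (r div dim_row b, c div dim_col b) \<otimes>\<^bsub>R i\<^esub> B i $$ (r mod dim_row b, c mod dim_col b))) U"
    using mrel_dim[OF A] mrel_dim[OF B] by eventually_elim simp
  fix r c assume "r < dim_row (mat_kron S a b)" "c < dim_col (mat_kron S a b)"
  then have rc: "r < dim_row a * dim_row b" "c < dim_col a * dim_col b" by simp_all
  then show "rel (\<lambda>i. A i $$ (r div dim_row b, c div dim_col b) \<otimes>\<^bsub>R i\<^esub> B i $$ (r mod dim_row b, c mod dim_col b))
      (mat_kron S a b $$ (r, c))"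
    using mrel_index[OF A] mrel_index[OF B] mod_less_of_less_mult[OF rc(1)] mod_less_of_less_mult[OF rc(2)]
    by (auto intro!: rel_mult simp: less_mult_imp_div_less)
qed

lemma mrel_fun_mat: "mrel (\<lambda>i. fun_mat (R i) n n' f) (fun_mat S n n' f)"
  by (rule mrelI[where B = "\<lambda>r c i. if r = f c then \<one>\<^bsub>R i\<^esub> else \<zero>\<^bsub>R i\<^esub>"])
    (auto simp: fun_mat_def rel_one rel_zero)

lemma mrel_id: "mrel (\<lambda>i. mat_id (R i) n) (mat_id S n)"
  unfolding mat_id_fun_mat by (rule mrel_fun_mat)

lemma mrel_swap: "mrel (\<lambda>i. mat_swap (R i) n m) (mat_swap S n m)"
  unfolding mat_swap_fun_mat by (rule mrel_fun_mat)

lemma mrel_add: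
  assumes "mrel A a" "mrel B b" "dim_row a = n" "dim_col a = m" "dim_row b = n" "dim_col b = m"
  shows "mrel (\<lambda>i. mat_add (R i) n m (A i) (B i)) (mat_add S n m a b)"
  by (rule mrelI[where B = "\<lambda>r c i. A i $$ (r, c) \<oplus>\<^bsub>R i\<^esub> B i $$ (r, c)"])
    (use assms in \<open>auto intro!: rel_add mrel_index\<close>)

lemma mrel_scl:
  assumes "rel C c" "mrel A a" "dim_row a = n" "dim_col a = m"
  shows "mrel (\<lambda>i. mat_scl (R i) n m (C i) (A i)) (mat_scl S n m c a)"
  by (rule mrelI[where B = "\<lambda>r d i. C i \<otimes>\<^bsub>R i\<^esub> A i $$ (r, d)"])
    (use assms in \<open>auto intro!: rel_mult mrel_index\<close>)

lemma mrel_zero: "mrel (\<lambda>i. mat_zero (R i) n m) (mat_zero S n m)"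
  by (rule mrelI[where B = "\<lambda>r d i. \<zero>\<^bsub>R i\<^esub>"]) (auto intro: rel_zero)

end

lemma mrel_map:
  assumes "ultra_ring U R S r" "ultra_ring U R' S' r'"
    and "\<And>P p. r P p \<Longrightarrow> r' (\<lambda>i. h i (P i)) (h' p)" and "ultra_ring.mrel U r A a"
  shows "ultra_ring.mrel U r' (\<lambda>i. map_mat (h i) (A i)) (map_mat h' a)"
proof -
  interpret R: ultra_ring U R S r by fact
  interpret R': ultra_ring U R' S' r' by fact
  show ?thesis
  proof (rule R'.mrelI)
    show "eventually (\<lambda>i. dim_row (map_mat (h i) (A i)) = dim_row (map_mat h' a) \<and>
      dim_col (map_mat (h i) (A i)) = dim_col (map_mat h' a) \<and>
      (\<forall>r<dim_row (map_mat h' a). \<forall>c<dim_col (map_mat h' a). map_mat (h i) (A i) $$ (r, c) = h i (A i $$ (r, c)))) U"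
      using R.mrel_dim[OF assms(4)] by eventually_elim simp
  qed (use R.mrel_index[OF assms(4)] assms(3) in simp)
qed

text \<open>For scalars the limit of a tuple is simply its class.\<close>

definition srel :: "'i filter \<Rightarrow> ('i \<Rightarrow> 'a ring) \<Rightarrow> ('i \<Rightarrow> 'a) \<Rightarrow> ('i \<Rightarrow> 'a) set \<Rightarrow> bool" where
  "srel U K c \<gamma> \<longleftrightarrow> \<gamma> = ucl U c \<and> eventually (\<lambda>i. c i \<in> carrier (K i)) U"

lemma carrier_nonempty: "cring K \<Longrightarrow> carrier K \<noteq> {}"
  using cring.cring_simprules(2) by blast

lemma ultra_ring_scalars:
  assumes "U \<noteq> bot" "\<And>i. cring (K i)"
  shows "ultra_ring U K (uprod_ring U K) (srel U K)"
proof (rule ultra_ring.intro)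
  note s = srel_def uprod_ring_carrier uprod_ring_ops ucl_eq_iff
    ucl_in_uset[OF carrier_nonempty[OF assms(2)]] cring.cring_simprules[OF assms(2)]
  show "U \<noteq> bot" "cring (K i)" "cring (uprod_ring U K)" for i
    using assms cring_uprod_ring by auto
  show "srel U K (\<lambda>i. \<zero>\<^bsub>K i\<^esub>) \<zero>\<^bsub>uprod_ring U K\<^esub>" "srel U K (\<lambda>i. \<one>\<^bsub>K i\<^esub>) \<one>\<^bsub>uprod_ring U K\<^esub>"
    by (simp_all add: s)
  fix P Q p q
  show "\<exists>P. srel U K P p" if "p \<in> carrier (uprod_ring U K)"
    using that by (auto simp: srel_def uprod_ring_carrier elim!: usetE)
  assume P: "srel U K P p"
  then show "p \<in> carrier (uprod_ring U K)" "eventually (\<lambda>i. P i \<in> carrier (K i)) U"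
    by (simp_all add: s)
  show "srel U K Q p" if "eventually (\<lambda>i. Q i = P i) U"
    using P that by (auto simp: s elim: eventually_elim2)
  assume Q: "srel U K Q q"
  show "p = q \<longleftrightarrow> eventually (\<lambda>i. P i = Q i) U"
    using P Q by (simp add: s)
  have "eventually (\<lambda>i. P i \<in> carrier (K i) \<and> Q i \<in> carrier (K i)) U"
    using P Q by (simp add: srel_def eventually_conj)
  then have "eventually (\<lambda>i. P i \<oplus>\<^bsub>K i\<^esub> Q i \<in> carrier (K i)) U" "eventually (\<lambda>i. P i \<otimes>\<^bsub>K i\<^esub> Q i \<in> carrier (K i)) U"
    by (eventually_elim, simp add: cring.cring_simprules[OF assms(2)])+
  then show "srel U K (\<lambda>i. P i \<oplus>\<^bsub>K i\<^esub> Q i) (p \<oplus>\<^bsub>uprod_ring U K\<^esub> q)"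
    "srel U K (\<lambda>i. P i \<otimes>\<^bsub>K i\<^esub> Q i) (p \<otimes>\<^bsub>uprod_ring U K\<^esub> q)"
    using P Q by (simp_all add: srel_def uprod_ring_ops)
qed

section \<open>Frobenius substitutions\<close>

text \<open>A variable \<open>w\<close> of the target stands for the power \<open>\<pi> w ^ q i w\<close>: a target monomial \<open>M\<close>
  corresponds to the tuple of monomials \<open>fr i M\<close>.\<close>

locale frobenius_corr =
  fixes U :: "'i filter" and K :: "'i \<Rightarrow> 'a ring" and W :: "'w set" and V :: "'v set"
    and fr :: "'i \<Rightarrow> 'w multiset \<Rightarrow> 'v multiset"
  assumes proper: "U \<noteq> bot" and K_cring: "\<And>i. cring (K i)"
    and fr_empty: "fr i {#} = {#}" and fr_add: "fr i (M + N) = fr i M + fr i N"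
    and fr_range: "set_mset M \<subseteq> W \<Longrightarrow> set_mset (fr i M) \<subseteq> V"
    and fr_inj: "finite B \<Longrightarrow> \<forall>M\<in>B. set_mset M \<subseteq> W \<Longrightarrow> eventually (\<lambda>i. inj_on (fr i) B) U"
begin

abbreviation "k \<equiv> uprod_ring U K"

lemma K_coeff: "coeff_ring (K i)"
  by (simp add: coeff_ring_def K_cring)

lemma k_cring: "cring k"
  using K_cring by (rule cring_uprod_ring)

sublocale k: coeff_ring k
  using k_cring by (simp add: coeff_ring_def)

text \<open>One finite set \<open>B\<close> of target monomials serves almost all components. This
  uniformity is what distinguishes the tuples with a polynomial limit among all tuples of
  polynomials.\<close>

definition supported :: "('i \<Rightarrow> 'v multiset \<Rightarrow> 'a) \<Rightarrow> 'w multiset set \<Rightarrow> bool" where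
  "supported P B \<longleftrightarrow> finite B \<and> (\<forall>M\<in>B. set_mset M \<subseteq> W) \<and>
    eventually (\<lambda>i. (\<forall>m. P i m \<noteq> \<zero>\<^bsub>K i\<^esub> \<longrightarrow> m \<in> fr i ` B) \<and> (\<forall>m. P i m \<in> carrier (K i))) U"

text \<open>The coefficient of the limit at \<open>M\<close> is the class of the coefficients at
  \<open>fr i M\<close>. The value zero outside \<open>W\<close> makes the limit a polynomial in the
  variables \<open>W\<close>, as \<open>supported\<close> says nothing about such monomials.\<close>

definition prel :: "('i \<Rightarrow> 'v multiset \<Rightarrow> 'a) \<Rightarrow> ('w multiset \<Rightarrow> ('i \<Rightarrow> 'a) set) \<Rightarrow> bool" where
  "prel P p \<longleftrightarrow> (\<exists>B. supported P B) \<and>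
    (\<forall>M. p M = (if set_mset M \<subseteq> W then ucl U (\<lambda>i. P i (fr i M)) else \<zero>\<^bsub>k\<^esub>))"

lemma prelI:
  assumes "supported P B" "\<And>M. set_mset M \<subseteq> W \<Longrightarrow> p M = ucl U (\<lambda>i. P i (fr i M))"
    "\<And>M. \<not> set_mset M \<subseteq> W \<Longrightarrow> p M = \<zero>\<^bsub>k\<^esub>"
  shows "prel P p"
  using assms by (auto simp: prel_def)

lemma supportedD:
  assumes "supported P B"
  shows "finite B" "\<And>M. M \<in> B \<Longrightarrow> set_mset M \<subseteq> W"
    "eventually (\<lambda>i. (\<forall>m. P i m \<noteq> \<zero>\<^bsub>K i\<^esub> \<longrightarrow> m \<in> fr i ` B) \<and> (\<forall>m. P i m \<in> carrier (K i))) U"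
    "\<forall>M\<in>B. set_mset M \<subseteq> W"
  using assms by (auto simp: supported_def)

lemma supported_is_mpoly:
  assumes "supported P B"
  shows "eventually (\<lambda>i. P i \<in> carrier (mpoly_ring (K i) V)) U"
  using supportedD(3)[OF assms]
proof eventually_elim
  case (elim i)
  have "{m. P i m \<noteq> \<zero>\<^bsub>K i\<^esub>} \<subseteq> fr i ` B" using elim by auto
  then have "finite {m. P i m \<noteq> \<zero>\<^bsub>K i\<^esub>}"
    by (rule finite_subset) (use supportedD(1)[OF assms] in simp)
  moreover have "set_mset m \<subseteq> V" if "P i m \<noteq> \<zero>\<^bsub>K i\<^esub>" for m
    using that elim fr_range supportedD(2)[OF assms] by blast
  ultimately show ?case
    using elim by (simp add: coeff_ring.mpoly_carrier[OF K_coeff] coeff_ring.is_mpoly_def[OF K_coeff])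
qed

text \<open>Almost every \<open>fr i\<close> is injective on \<open>insert M B\<close>, and then
  \<open>fr i M\<close> lies outside the image of \<open>B\<close>. The exceptional indices depend
  on \<open>M\<close>, so this cannot be asserted for all \<open>M\<close> at once.\<close>

lemma supported_vanish:
  assumes B: "supported P B" and M: "set_mset M \<subseteq> W" "M \<notin> B"
  shows "eventually (\<lambda>i. P i (fr i M) = \<zero>\<^bsub>K i\<^esub>) U"
proof -
  have "eventually (\<lambda>i. inj_on (fr i) (insert M B)) U"
    using supportedD(1,2)[OF B] M by (intro fr_inj) auto
  then show ?thesis
    using supportedD(3)[OF B]
  proof eventually_elim
    case (elim i)
    then have "fr i M \<notin> fr i ` B" using M by auto
    then show ?case using elim by blast
  qed
qed

lemma prel_apply: "prel P p \<Longrightarrow> set_mset M \<subseteq> W \<Longrightarrow> p M = ucl U (\<lambda>i. P i (fr i M))"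
  by (simp add: prel_def)

lemma prel_closed:
  assumes "prel P p"
  shows "p \<in> carrier (mpoly_ring k W)"
proof -
  obtain B where B: "supported P B" using assms by (auto simp: prel_def)
  have "p M \<in> carrier k" for M
  proof (cases "set_mset M \<subseteq> W")
    case True
    have "eventually (\<lambda>i. P i (fr i M) \<in> carrier (K i)) U"
      using supportedD(3)[OF B] by eventually_elim simp
    then show ?thesis
      using True by (simp add: prel_apply[OF assms] uprod_ring_carrier ucl_in_uset carrier_nonempty K_cring)
  next
    case False
    then show ?thesis using assms by (simp add: prel_def)
  qed
  moreover have "{M. p M \<noteq> \<zero>\<^bsub>k\<^esub>} \<subseteq> B"
  proof
    fix M assume "M \<in> {M. p M \<noteq> \<zero>\<^bsub>k\<^esub>}"
    then have pM: "p M \<noteq> \<zero>\<^bsub>k\<^esub>" by simp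
    then have M: "set_mset M \<subseteq> W" using assms by (auto simp: prel_def split: if_splits)
    show "M \<in> B"
    proof (rule ccontr)
      assume "M \<notin> B"
      then show False using supported_vanish[OF B M] pM
        by (simp add: prel_apply[OF assms M] uprod_ring_ops ucl_eq_iff)
    qed
  qed
  ultimately show ?thesis
    using supportedD(1,2)[OF B]
    by (auto simp: k.mpoly_carrier k.is_mpoly_def intro: finite_subset)
qed

lemma prel_cong:
  assumes "prel P p" "eventually (\<lambda>i. Q i = P i) U"
  shows "prel Q p"
proof -
  obtain B where B: "supported P B" using assms by (auto simp: prel_def)
  have "supported Q B"
    unfolding supported_def
  proof (intro conjI ballI)
    show "eventually (\<lambda>i. (\<forall>m. Q i m \<noteq> \<zero>\<^bsub>K i\<^esub> \<longrightarrow> m \<in> fr i ` B) \<and> (\<forall>m. Q i m \<in> carrier (K i))) U"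
      using supportedD(3)[OF B] assms(2) by eventually_elim simp
  qed (use supportedD(1,2)[OF B] in auto)
  moreover have "ucl U (\<lambda>i. Q i (fr i M)) = ucl U (\<lambda>i. P i (fr i M))" for M
    unfolding ucl_eq_iff using assms(2) by eventually_elim simp
  ultimately show ?thesis using assms(1) by (auto simp: prel_def)
qed

text \<open>Equality of the limits gives equality of coefficients at each monomial on a member of
  \<open>U\<close> depending on that monomial. Both tuples are carried by the finite set
  \<open>B \<union> B'\<close>, so finitely many of these members suffice.\<close>

lemma prel_eq_iff:
  assumes P: "prel P p" and Q: "prel Q q"
  shows "p = q \<longleftrightarrow> eventually (\<lambda>i. P i = Q i) U"
proof
  assume "eventually (\<lambda>i. P i = Q i) U"
  then have "ucl U (\<lambda>i. P i (fr i M)) = ucl U (\<lambda>i. Q i (fr i M))" for M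
    unfolding ucl_eq_iff by eventually_elim simp
  then show "p = q" using P Q by (simp add: prel_def fun_eq_iff)
next
  assume pq: "p = q"
  obtain B B' where B: "supported P B" and B': "supported Q B'" using P Q by (auto simp: prel_def)
  have "eventually (\<lambda>i. P i (fr i M) = Q i (fr i M)) U" if "M \<in> B \<union> B'" for M
  proof -
    have "set_mset M \<subseteq> W" using that supportedD(2)[OF B] supportedD(2)[OF B'] by auto
    then have "ucl U (\<lambda>i. P i (fr i M)) = ucl U (\<lambda>i. Q i (fr i M))"
      using pq prel_apply[OF P] prel_apply[OF Q] by simp
    then show ?thesis unfolding ucl_eq_iff .
  qed
  then have "eventually (\<lambda>i. \<forall>M\<in>B \<union> B'. P i (fr i M) = Q i (fr i M)) U"
    using supportedD(1)[OF B] supportedD(1)[OF B'] by (intro eventually_ball_finite) auto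
  then show "eventually (\<lambda>i. P i = Q i) U"
    using supportedD(3)[OF B] supportedD(3)[OF B']
  proof eventually_elim
    case (elim i)
    show ?case
    proof (rule ext)
      fix m show "P i m = Q i m"
      proof (cases "m \<in> fr i ` (B \<union> B')")
        case True
        then show ?thesis using elim(1) by auto
      next
        case False
        then have "P i m = \<zero>\<^bsub>K i\<^esub>" "Q i m = \<zero>\<^bsub>K i\<^esub>" using elim(2,3) by blast+
        then show ?thesis by simp
      qed
    qed
  qed
qed

lemma prel_total:
  assumes p: "p \<in> carrier (mpoly_ring k W)"
  shows "\<exists>P. prel P p"
proof -
  define B where "B = {M. p M \<noteq> \<zero>\<^bsub>k\<^esub>}"
  have B: "finite B" "\<forall>M\<in>B. set_mset M \<subseteq> W" and pc: "\<And>M. p M \<in> carrier k"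
    using p by (auto simp: B_def k.mpoly_carrier k.is_mpoly_def)
  have "\<exists>c. p M = ucl U c \<and> (\<forall>i. c i \<in> carrier (K i))" for M
    using pc[of M] unfolding uprod_ring_carrier by (elim usetE) blast
  then have "\<exists>c. \<forall>M. p M = ucl U (c M) \<and> (\<forall>i. c M i \<in> carrier (K i))" by (intro choice) blast
  then obtain c where c: "\<And>M. p M = ucl U (c M)" "\<And>M i. c M i \<in> carrier (K i)" by blast
  \<comment> \<open>Where \<open>fr i\<close> fails to be injective on \<open>B\<close>,
    \<open>inv_into\<close> picks some preimage; for almost all \<open>i\<close> it is the true
    inverse.\<close>
  define P where "P i m = (if m \<in> fr i ` B then c (inv_into B (fr i) m) i else \<zero>\<^bsub>K i\<^esub>)" for i m
  have sup: "supported P B"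
    unfolding supported_def
  proof (intro conjI ballI)
    have "(\<forall>m. P i m \<noteq> \<zero>\<^bsub>K i\<^esub> \<longrightarrow> m \<in> fr i ` B) \<and> (\<forall>m. P i m \<in> carrier (K i))" for i
      using c(2) cring.cring_simprules(2)[OF K_cring] by (auto simp: P_def)
    then show "eventually (\<lambda>i. (\<forall>m. P i m \<noteq> \<zero>\<^bsub>K i\<^esub> \<longrightarrow> m \<in> fr i ` B) \<and> (\<forall>m. P i m \<in> carrier (K i))) U"
      by simp
  qed (use B in auto)
  moreover have "p M = ucl U (\<lambda>i. P i (fr i M))" if M: "set_mset M \<subseteq> W" for M
  proof (cases "M \<in> B")
    case True
    have "eventually (\<lambda>i. c M i = P i (fr i M)) U"
      using fr_inj[OF B] by eventually_elim (use True in \<open>simp add: P_def\<close>)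
    then show ?thesis by (simp add: c(1) ucl_eq_iff)
  next
    case False
    then have "p M = \<zero>\<^bsub>k\<^esub>" by (simp add: B_def)
    then show ?thesis using supported_vanish[OF sup M False]
      by (simp add: uprod_ring_ops ucl_eq_iff eq_commute)
  qed
  moreover have "p M = \<zero>\<^bsub>k\<^esub>" if "\<not> set_mset M \<subseteq> W" for M
    using that B(2) by (auto simp: B_def)
  ultimately have "prel P p"
    by (rule prelI)
  then show ?thesis by blast
qed

lemma prel_monom:
  assumes c: "srel U K c \<gamma>" and M: "set_mset M \<subseteq> W"
  shows "prel (\<lambda>i. coeff_ring.indexed_monom (K i) (c i) (fr i M)) (k.indexed_monom \<gamma> M)"
proof -
  have "supported (\<lambda>i. coeff_ring.indexed_monom (K i) (c i) (fr i M)) {M}"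
    unfolding supported_def
  proof (intro conjI ballI)
    have "eventually (\<lambda>i. c i \<in> carrier (K i)) U" using c by (simp add: srel_def)
    then show "eventually (\<lambda>i. (\<forall>m. coeff_ring.indexed_monom (K i) (c i) (fr i M) m \<noteq> \<zero>\<^bsub>K i\<^esub> \<longrightarrow> m \<in> fr i ` {M}) \<and>
        (\<forall>m. coeff_ring.indexed_monom (K i) (c i) (fr i M) m \<in> carrier (K i))) U"
      by eventually_elim
        (simp add: coeff_ring.indexed_monom_def[OF K_coeff] cring.cring_simprules(2)[OF K_cring])
  qed (use M in auto)
  moreover have "k.indexed_monom \<gamma> M N = ucl U (\<lambda>i. coeff_ring.indexed_monom (K i) (c i) (fr i M) (fr i N))"
    if N: "set_mset N \<subseteq> W" for N
  proof (cases "N = M")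
    case True
    then show ?thesis using c by (simp add: k.indexed_monom_def coeff_ring.indexed_monom_def[OF K_coeff] srel_def)
  next
    case False
    have "eventually (\<lambda>i. inj_on (fr i) {M, N}) U" using M N by (intro fr_inj) auto
    then have "eventually (\<lambda>i. coeff_ring.indexed_monom (K i) (c i) (fr i M) (fr i N) = \<zero>\<^bsub>K i\<^esub>) U"
      by eventually_elim (use False in \<open>auto simp: coeff_ring.indexed_monom_def[OF K_coeff]\<close>)
    then show ?thesis using False
      by (simp add: k.indexed_monom_def uprod_ring_ops ucl_eq_iff eq_commute)
  qed
  moreover have "k.indexed_monom \<gamma> M N = \<zero>\<^bsub>k\<^esub>" if "\<not> set_mset N \<subseteq> W" for N
    using that M by (auto simp: k.indexed_monom_def)
  ultimately show ?thesis by (rule prelI)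
qed

lemma prel_add:
  assumes P: "prel P p" and Q: "prel Q q"
  shows "prel (\<lambda>i. P i \<oplus>\<^bsub>mpoly_ring (K i) V\<^esub> Q i) (p \<oplus>\<^bsub>mpoly_ring k W\<^esub> q)"
proof -
  obtain B B' where B: "supported P B" and B': "supported Q B'" using P Q by (auto simp: prel_def)
  note add = coeff_ring.mpoly_add_apply[OF K_coeff]
  have "supported (\<lambda>i. P i \<oplus>\<^bsub>mpoly_ring (K i) V\<^esub> Q i) (B \<union> B')"
    unfolding supported_def
  proof (intro conjI ballI)
    show "eventually (\<lambda>i. (\<forall>m. (P i \<oplus>\<^bsub>mpoly_ring (K i) V\<^esub> Q i) m \<noteq> \<zero>\<^bsub>K i\<^esub> \<longrightarrow> m \<in> fr i ` (B \<union> B')) \<and>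
        (\<forall>m. (P i \<oplus>\<^bsub>mpoly_ring (K i) V\<^esub> Q i) m \<in> carrier (K i))) U"
      using supportedD(3)[OF B] supportedD(3)[OF B']
    proof eventually_elim
      case (elim i)
      interpret cring "K i" by (rule K_cring)
      show ?case
      proof (intro conjI allI impI)
        fix m assume "(P i \<oplus>\<^bsub>mpoly_ring (K i) V\<^esub> Q i) m \<noteq> \<zero>\<^bsub>K i\<^esub>"
        then have "P i m \<noteq> \<zero>\<^bsub>K i\<^esub> \<or> Q i m \<noteq> \<zero>\<^bsub>K i\<^esub>" by (auto simp: add)
        then show "m \<in> fr i ` (B \<union> B')" using elim by blast
      qed (use elim in \<open>simp add: add\<close>)
    qed
  qed (use supportedD(1,2)[OF B] supportedD(1,2)[OF B'] in auto)
  then show ?thesis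
  proof (rule prelI)
    fix M assume "set_mset M \<subseteq> W"
    then show "(p \<oplus>\<^bsub>mpoly_ring k W\<^esub> q) M = ucl U (\<lambda>i. (P i \<oplus>\<^bsub>mpoly_ring (K i) V\<^esub> Q i) (fr i M))"
      using prel_apply[OF P] prel_apply[OF Q] by (simp add: add uprod_ring_ops)
  next
    fix M assume "\<not> set_mset M \<subseteq> W"
    then have "p M = \<zero>\<^bsub>k\<^esub>" "q M = \<zero>\<^bsub>k\<^esub>" using P Q by (simp_all add: prel_def)
    then show "(p \<oplus>\<^bsub>mpoly_ring k W\<^esub> q) M = \<zero>\<^bsub>k\<^esub>" by simp
  qed
qed

lemma fr_mono: "N \<subseteq># M \<Longrightarrow> fr i N \<subseteq># fr i M \<and> fr i (M - N) = fr i M - fr i N"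
  by (metis fr_add mset_subset_eq_add_left subset_mset.add_diff_inverse add_diff_cancel_left')

text \<open>The difficulty is that \<open>fr i M0\<close> can have divisors that do not come from
  divisors of \<open>M0\<close>: a variable over \<open>v\<close> may become a high power of
  \<open>v\<close>, which has many divisors. Such divisors contribute nothing, since a nonzero
  product of coefficients comes from monomials \<open>M\<close> and \<open>N\<close> of the two
  supports, and injectivity then forces \<open>M0 = M + N\<close>.\<close>

lemma prel_mult:
  assumes P: "prel P p" and Q: "prel Q q"
  shows "prel (\<lambda>i. P i \<otimes>\<^bsub>mpoly_ring (K i) V\<^esub> Q i) (p \<otimes>\<^bsub>mpoly_ring k W\<^esub> q)"
proof -
  obtain B B' where B: "supported P B" and B': "supported Q B'" using P Q by (auto simp: prel_def)
  note mult = coeff_ring.mpoly_mult[OF K_coeff]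
  let ?R = "\<lambda>i. P i \<otimes>\<^bsub>mpoly_ring (K i) V\<^esub> Q i"
  define C where "C = (\<lambda>(M, N). M + N) ` (B \<times> B')"
  have C: "finite C" "\<forall>M\<in>C. set_mset M \<subseteq> W"
    using supportedD(1,4)[OF B] supportedD(1,4)[OF B'] by (simp_all add: C_def ball_Un)
  have coeff: "eventually (\<lambda>i. \<forall>m l. l \<subseteq># m \<longrightarrow> P i l \<otimes>\<^bsub>K i\<^esub> Q i (m - l) \<noteq> \<zero>\<^bsub>K i\<^esub> \<longrightarrow>
      (\<exists>M\<in>B. \<exists>N\<in>B'. l = fr i M \<and> m - l = fr i N \<and> m = fr i (M + N))) U"
    using supportedD(3)[OF B] supportedD(3)[OF B']
  proof eventually_elim
    case (elim i)
    interpret cring "K i" by (rule K_cring)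
    show ?case
    proof (intro allI impI)
      fix m l assume l: "l \<subseteq># m" and "P i l \<otimes>\<^bsub>K i\<^esub> Q i (m - l) \<noteq> \<zero>\<^bsub>K i\<^esub>"
      then have "P i l \<noteq> \<zero>\<^bsub>K i\<^esub>" "Q i (m - l) \<noteq> \<zero>\<^bsub>K i\<^esub>"
        using elim by auto
      then obtain M N where MN: "M \<in> B" "N \<in> B'" "l = fr i M" "m - l = fr i N" using elim by blast
      moreover have "m = fr i (M + N)"
        using subset_mset.add_diff_inverse[OF l] MN(3,4) by (simp add: fr_add)
      ultimately show "\<exists>M\<in>B. \<exists>N\<in>B'. l = fr i M \<and> m - l = fr i N \<and> m = fr i (M + N)" by blast
    qed
  qed
  have "supported ?R C"
    unfolding supported_def
  proof (intro conjI ballI)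
    show "eventually (\<lambda>i. (\<forall>m. ?R i m \<noteq> \<zero>\<^bsub>K i\<^esub> \<longrightarrow> m \<in> fr i ` C) \<and> (\<forall>m. ?R i m \<in> carrier (K i))) U"
      using coeff supportedD(3)[OF B] supportedD(3)[OF B']
    proof eventually_elim
      case (elim i)
      interpret cring "K i" by (rule K_cring)
      show ?case
      proof (intro conjI allI impI)
        fix m assume nz: "?R i m \<noteq> \<zero>\<^bsub>K i\<^esub>"
        have "\<exists>l. l \<subseteq># m \<and> P i l \<otimes>\<^bsub>K i\<^esub> Q i (m - l) \<noteq> \<zero>\<^bsub>K i\<^esub>"
        proof (rule ccontr)
          assume "\<not> ?thesis"
          then have "?R i m = \<zero>\<^bsub>K i\<^esub>" unfolding mult by (intro finsum_all_zero) auto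
          then show False using nz by simp
        qed
        then obtain M N where "M \<in> B" "N \<in> B'" "m = fr i (M + N)" using elim(1) by blast
        then show "m \<in> fr i ` C" by (auto simp: C_def)
      next
        fix m show "?R i m \<in> carrier (K i)"
          unfolding mult using elim by (intro finsum_closed) auto
      qed
    qed
  qed (use C in auto)
  moreover have "(p \<otimes>\<^bsub>mpoly_ring k W\<^esub> q) M0 = ucl U (\<lambda>i. ?R i (fr i M0))" if M0: "set_mset M0 \<subseteq> W" for M0
  proof -
    interpret scalars: ultra_ring U K k "srel U K"
      using proper K_cring by (rule ultra_ring_scalars)
    let ?S = "{L. L \<subseteq># M0}"
    have S: "finite ?S" "\<And>L. L \<in> ?S \<Longrightarrow> set_mset L \<subseteq> W" "\<And>L. L \<in> ?S \<Longrightarrow> set_mset (M0 - L) \<subseteq> W"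
      using M0 k.finite_submultisets[of M0] set_mset_mono[of _ M0] set_mset_mono[OF diff_subset_eq_self[of M0]]
      by blast+
    have sP: "srel U K (\<lambda>i. P i (fr i L)) (p L)" "srel U K (\<lambda>i. Q i (fr i L)) (q L)" if "set_mset L \<subseteq> W" for L
      using supportedD(3)[OF B] supportedD(3)[OF B'] prel_apply[OF P that] prel_apply[OF Q that]
      by (auto simp: srel_def elim: eventually_mono)
    have 1: "srel U K (\<lambda>i. finsum (K i) (\<lambda>L. P i (fr i L) \<otimes>\<^bsub>K i\<^esub> Q i (fr i (M0 - L))) ?S) ((p \<otimes>\<^bsub>mpoly_ring k W\<^esub> q) M0)"
      unfolding k.mpoly_mult using S by (intro scalars.rel_finsum scalars.rel_mult sP) auto
    \<comment> \<open>Injectivity is used twice: on the divisors of \<open>M0\<close> to reindex the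
      sum, and on \<open>M0\<close> together with the products in \<open>C\<close> to exclude the
      other divisors of \<open>fr i M0\<close>.\<close>
    have "eventually (\<lambda>i. inj_on (fr i) (insert M0 (C \<union> ?S))) U"
      using S(1,2) C M0 by (intro fr_inj) (simp_all add: ball_Un)
    then have "eventually (\<lambda>i. finsum (K i) (\<lambda>L. P i (fr i L) \<otimes>\<^bsub>K i\<^esub> Q i (fr i (M0 - L))) ?S = ?R i (fr i M0)) U"
      using coeff supportedD(3)[OF B] supportedD(3)[OF B']
    proof eventually_elim
      case (elim i)
      interpret cring "K i" by (rule K_cring)
      let ?f = "\<lambda>l. P i l \<otimes>\<^bsub>K i\<^esub> Q i (fr i M0 - l)"
      have "finsum (K i) (\<lambda>L. P i (fr i L) \<otimes>\<^bsub>K i\<^esub> Q i (fr i (M0 - L))) ?S = finsum (K i) (\<lambda>L. ?f (fr i L)) ?S"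
        using elim by (intro finsum_cong') (auto simp: fr_mono)
      also have "\<dots> = finsum (K i) ?f (fr i ` ?S)"
        using elim by (intro finsum_reindex[symmetric]) (auto intro: inj_on_subset)
      also have "\<dots> = finsum (K i) ?f {l. l \<subseteq># fr i M0}"
      proof (rule add.finprod_mono_neutral_cong_left)
        show "finite {l. l \<subseteq># fr i M0}" by (rule k.finite_submultisets)
        show "fr i ` ?S \<subseteq> {l. l \<subseteq># fr i M0}" by (auto simp: fr_mono)
        show "?f \<in> {l. l \<subseteq># fr i M0} \<rightarrow> carrier (K i)" using elim by auto
        fix l assume l: "l \<in> {l. l \<subseteq># fr i M0} - fr i ` ?S"
        show "?f l = \<zero>\<^bsub>K i\<^esub>"
        proof (rule ccontr)
          assume "?f l \<noteq> \<zero>\<^bsub>K i\<^esub>"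
          then obtain M N where MN: "M \<in> B" "N \<in> B'" "l = fr i M" "fr i M0 = fr i (M + N)"
            using elim(2) l by blast
          then have "M + N \<in> C" by (auto simp: C_def)
          then have "M0 = M + N" using elim(1) MN(4) by (auto dest: inj_onD)
          then show False using l MN(3) by auto
        qed
      qed simp
      finally show ?case unfolding mult .
    qed
    then show ?thesis using 1 by (simp add: srel_def ucl_eq_iff)
  qed
  moreover have "(p \<otimes>\<^bsub>mpoly_ring k W\<^esub> q) M0 = \<zero>\<^bsub>k\<^esub>" if "\<not> set_mset M0 \<subseteq> W" for M0
  proof -
    have "k.is_mpoly W (p \<otimes>\<^bsub>mpoly_ring k W\<^esub> q)"
      using prel_closed[OF P] prel_closed[OF Q] unfolding k.mpoly_carrier by (rule k.is_mpoly_mult)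
    then show ?thesis using that unfolding k.is_mpoly_def by blast
  qed
  ultimately show ?thesis by (rule prelI)
qed

lemma prel_const: "srel U K c \<gamma> \<Longrightarrow> prel (\<lambda>i. ring.indexed_const (K i) (c i)) (ring.indexed_const k \<gamma>)"
  using prel_monom[of c \<gamma> "{#}"] by (simp add: coeff_ring.indexed_const_monom[OF K_coeff] k.indexed_const_monom fr_empty)

lemma ultra_ring_poly: "ultra_ring U (\<lambda>i. mpoly_ring (K i) V) (mpoly_ring k W) prel"
proof (rule ultra_ring.intro)
  interpret scalars: ultra_ring U K k "srel U K"
    using proper K_cring by (rule ultra_ring_scalars)
  show "U \<noteq> bot" "cring (mpoly_ring (K i) V)" "cring (mpoly_ring k W)" for i
    by (simp_all add: proper coeff_ring.cring_mpoly[OF K_coeff] k.cring_mpoly)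
  show "prel (\<lambda>i. \<zero>\<^bsub>mpoly_ring (K i) V\<^esub>) \<zero>\<^bsub>mpoly_ring k W\<^esub>"
    using prel_const[OF scalars.rel_zero] by (simp add: mpoly_ring_def)
  show "prel (\<lambda>i. \<one>\<^bsub>mpoly_ring (K i) V\<^esub>) \<one>\<^bsub>mpoly_ring k W\<^esub>"
    using prel_const[OF scalars.rel_one] by (simp add: mpoly_ring_def)
  fix P Q p q
  show "\<exists>P. prel P p" if "p \<in> carrier (mpoly_ring k W)"
    using that by (rule prel_total)
  assume P: "prel P p"
  then show "p \<in> carrier (mpoly_ring k W)" by (rule prel_closed)
  obtain B where "supported P B" using P by (auto simp: prel_def)
  then show "eventually (\<lambda>i. P i \<in> carrier (mpoly_ring (K i) V)) U" by (rule supported_is_mpoly)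
  show "prel Q p" if "eventually (\<lambda>i. Q i = P i) U"
    using P that by (rule prel_cong)
  assume Q: "prel Q q"
  show "p = q \<longleftrightarrow> eventually (\<lambda>i. P i = Q i) U"
    using P Q by (rule prel_eq_iff)
  show "prel (\<lambda>i. P i \<oplus>\<^bsub>mpoly_ring (K i) V\<^esub> Q i) (p \<oplus>\<^bsub>mpoly_ring k W\<^esub> q)"
    using P Q by (rule prel_add)
  show "prel (\<lambda>i. P i \<otimes>\<^bsub>mpoly_ring (K i) V\<^esub> Q i) (p \<otimes>\<^bsub>mpoly_ring k W\<^esub> q)"
    using P Q by (rule prel_mult)
qed

text \<open>A target variable \<open>w\<close> stands for the \<open>q i w\<close>-th power of
  \<open>\<pi> w\<close>, so it has to be sent to the limit of that power of the image of
  \<open>\<pi> w\<close>. Closure of limits under products and sums does the rest. The coproduct and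
  both inclusions into the tensor square are substitutions of this kind.\<close>

lemma prel_poly_subst:
  fixes W' :: "'x set" and V' :: "'y set" and \<sigma> :: "'i \<Rightarrow> 'v \<Rightarrow> 'y multiset \<Rightarrow> 'a"
    and \<sigma>' :: "'w \<Rightarrow> 'x multiset \<Rightarrow> ('i \<Rightarrow> 'a) set" and q :: "'i \<Rightarrow> 'w \<Rightarrow> nat" and \<pi> :: "'w \<Rightarrow> 'v"
  assumes corr: "frobenius_corr U K W' V' fr'"
    and fr_single: "\<And>i w. fr i {#w#} = replicate_mset (q i w) (\<pi> w)"
    and \<pi>: "\<pi> ` W \<subseteq> V"
    and \<sigma>: "\<And>i v. v \<in> V \<Longrightarrow> \<sigma> i v \<in> carrier (mpoly_ring (K i) V')"
    and var: "\<And>w. w \<in> W \<Longrightarrow>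
      frobenius_corr.prel U K W' fr' (\<lambda>i. \<sigma> i (\<pi> w) [^]\<^bsub>mpoly_ring (K i) V'\<^esub> q i w) (\<sigma>' w)"
    and P: "prel P p"
  shows "frobenius_corr.prel U K W' fr' (\<lambda>i. poly_subst (K i) V' (\<sigma> i) (P i)) (poly_subst k W' \<sigma>' p)"
proof -
  interpret T: frobenius_corr U K W' V' fr' by fact
  interpret R: ultra_ring U "\<lambda>i. mpoly_ring (K i) V'" "mpoly_ring k W'" T.prel
    by (rule T.ultra_ring_poly)
  obtain B where B: "supported P B" using P by (auto simp: prel_def)
  have \<sigma>': "\<sigma>' \<in> W \<rightarrow> carrier (mpoly_ring k W')"
    using var T.prel_closed by blast
  have mon: "T.prel (\<lambda>i. coeff_ring.subst_monom (K i) V' (\<sigma> i) (fr i M)) (k.subst_monom W' \<sigma>' M)"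
    if "set_mset M \<subseteq> W" for M
    using that
  proof (induction M)
    case empty
    then show ?case
      using R.rel_one by (simp add: fr_empty coeff_ring.subst_monom_empty[OF K_coeff] k.subst_monom_empty)
  next
    case (add w M)
    have w: "w \<in> W" "\<pi> w \<in> V" "set_mset M \<subseteq> W" using add.prems \<pi> by auto
    have "coeff_ring.subst_monom (K i) V' (\<sigma> i) (fr i (add_mset w M)) =
        \<sigma> i (\<pi> w) [^]\<^bsub>mpoly_ring (K i) V'\<^esub> q i w \<otimes>\<^bsub>mpoly_ring (K i) V'\<^esub> coeff_ring.subst_monom (K i) V' (\<sigma> i) (fr i M)" for i
    proof -
      interpret coeff_ring "K i" by (rule K_coeff)
      have s: "\<sigma> i \<in> set_mset (fr i N) \<rightarrow> carrier (mpoly_ring (K i) V')" if "set_mset N \<subseteq> W" for N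
        using fr_range[OF that, of i] \<sigma> by auto
      have "fr i (add_mset w M) = fr i {#w#} + fr i M" using fr_add[of i "{#w#}" M] by simp
      then have "subst_monom V' (\<sigma> i) (fr i (add_mset w M)) =
          subst_monom V' (\<sigma> i) (fr i {#w#}) \<otimes>\<^bsub>mpoly_ring (K i) V'\<^esub> subst_monom V' (\<sigma> i) (fr i M)"
        using s[of "{#w#}"] s[of M] w by (simp add: subst_monom_add)
      then show ?thesis
        using \<sigma>[OF w(2), of i] by (simp add: fr_single subst_monom_replicate)
    qed
    moreover have "k.subst_monom W' \<sigma>' (add_mset w M) = \<sigma>' w \<otimes>\<^bsub>mpoly_ring k W'\<^esub> k.subst_monom W' \<sigma>' M"
      using w \<sigma>' by (intro k.subst_monom_add_mset) auto
    ultimately show ?case using R.rel_mult[OF var[OF w(1)] add.IH[OF w(3)]] by simp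
  qed
  let ?g = "\<lambda>M. ring.indexed_const k (p M) \<otimes>\<^bsub>mpoly_ring k W'\<^esub> k.subst_monom W' \<sigma>' M"
  let ?f = "\<lambda>i M. ring.indexed_const (K i) (P i (fr i M)) \<otimes>\<^bsub>mpoly_ring (K i) V'\<^esub> coeff_ring.subst_monom (K i) V' (\<sigma> i) (fr i M)"
  have "T.prel (\<lambda>i. finsum (mpoly_ring (K i) V') (?f i) B) (finsum (mpoly_ring k W') ?g B)"
  proof (rule R.rel_finsum)
    show "finite B" using B by (rule supportedD)
    fix M assume M: "M \<in> B"
    have "eventually (\<lambda>i. P i (fr i M) \<in> carrier (K i)) U"
      using supportedD(3)[OF B] by eventually_elim simp
    then have "srel U K (\<lambda>i. P i (fr i M)) (p M)"
      using prel_apply[OF P supportedD(2)[OF B M]] by (simp add: srel_def)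
    then show "T.prel (\<lambda>i. ?f i M) (?g M)"
      using M supportedD(2)[OF B] by (intro R.rel_mult T.prel_const mon) auto
  qed
  moreover have "finsum (mpoly_ring k W') ?g B = poly_subst k W' \<sigma>' p"
  proof -
    have "M \<in> B" if pM: "p M \<noteq> \<zero>\<^bsub>k\<^esub>" for M
    proof (rule ccontr)
      assume "M \<notin> B"
      moreover have M: "set_mset M \<subseteq> W" using pM P by (auto simp: prel_def split: if_splits)
      ultimately show False using supported_vanish[OF B M] pM
        by (simp add: prel_apply[OF P M] uprod_ring_ops ucl_eq_iff)
    qed
    then have "poly_subst k W' \<sigma>' p = finsum (mpoly_ring k W') ?g {M \<in> B. set_mset M \<subseteq> W}"
      using prel_closed[OF P] \<sigma>' supportedD(1)[OF B]
      by (intro k.poly_subst_eq) (simp_all add: k.mpoly_carrier)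
    moreover have "{M \<in> B. set_mset M \<subseteq> W} = B" using supportedD(2)[OF B] by auto
    ultimately show ?thesis by simp
  qed
  moreover have "eventually (\<lambda>i. poly_subst (K i) V' (\<sigma> i) (P i) = finsum (mpoly_ring (K i) V') (?f i) B) U"
    using supported_is_mpoly[OF B] supportedD(3)[OF B] fr_inj[OF supportedD(1,4)[OF B]]
  proof eventually_elim
    case (elim i)
    interpret coeff_ring "K i" by (rule K_coeff)
    interpret T': cring "mpoly_ring (K i) V'" by (rule cring_mpoly)
    let ?h = "\<lambda>m. ring.indexed_const (K i) (P i m) \<otimes>\<^bsub>mpoly_ring (K i) V'\<^esub> subst_monom V' (\<sigma> i) m"
    have "poly_subst (K i) V' (\<sigma> i) (P i) = finsum (mpoly_ring (K i) V') ?h {m \<in> fr i ` B. set_mset m \<subseteq> V}"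
      using elim \<sigma> supportedD(1)[OF B] by (intro poly_subst_eq) (auto simp: mpoly_carrier)
    also have "{m \<in> fr i ` B. set_mset m \<subseteq> V} = fr i ` B"
      using fr_range supportedD(2)[OF B] by auto
    also have "finsum (mpoly_ring (K i) V') ?h (fr i ` B) = finsum (mpoly_ring (K i) V') (?f i) B"
    proof (rule T'.finsum_reindex)
      have "subst_monom V' (\<sigma> i) (fr i M) \<in> carrier (mpoly_ring (K i) V')" if "M \<in> B" for M
        using fr_range[OF supportedD(2)[OF B that], of i] \<sigma> by (intro subst_monom_closed) auto
      then show "?h \<in> fr i ` B \<rightarrow> carrier (mpoly_ring (K i) V')"
        using elim by (auto intro!: T'.m_closed const_closed)
    qed (use elim in auto)
    finally show ?case .
  qed
  ultimately show ?thesis by (auto intro: R.rel_cong)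
qed

end

section \<open>Divided power sequences of matrices\<close>

text \<open>Gaussian elimination, by induction on the number of coordinates: a vector with nonzero
  last coordinate clears this coordinate from the remaining vectors, of which there are still too
  many.\<close>

lemma (in field) linear_dependence:
  assumes "finite T" "n < card T" "\<And>s i. s \<in> T \<Longrightarrow> i < n \<Longrightarrow> u s i \<in> carrier R"
  shows "\<exists>l. (\<forall>s\<in>T. l s \<in> carrier R) \<and> (\<exists>s\<in>T. l s \<noteq> \<zero>) \<and>
    (\<forall>i<n. finsum R (\<lambda>s. l s \<otimes> u s i) T = \<zero>)"
  using assms
proof (induction n arbitrary: T u)
  case 0
  then have "T \<noteq> {}" by auto
  then show ?case by (intro exI[of _ "\<lambda>_. \<one>"]) auto
next
  case (Suc n)
  show ?case
  proof (cases "\<forall>s\<in>T. u s n = \<zero>")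
    case True
    obtain l where l: "\<forall>s\<in>T. l s \<in> carrier R" "\<exists>s\<in>T. l s \<noteq> \<zero>" "\<forall>i<n. finsum R (\<lambda>s. l s \<otimes> u s i) T = \<zero>"
      using Suc.IH[of T u] Suc.prems by auto
    have "finsum R (\<lambda>s. l s \<otimes> u s n) T = \<zero>"
      using True l(1) by (intro finsum_all_zero) simp
    then show ?thesis using l by (intro exI[of _ l]) (auto simp: less_Suc_eq)
  next
    case False
    then obtain t where t: "t \<in> T" "u t n \<noteq> \<zero>" by blast
    define w where "w = u t n"
    have w: "w \<in> carrier R" "w \<noteq> \<zero>" using t Suc.prems by (simp_all add: w_def)
    then have "w \<in> Units R" by (simp add: field_Units)
    then have wi: "inv w \<in> carrier R" "inv w \<otimes> w = \<one>" by simp_all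
    \<comment> \<open>The vector of \<open>t\<close> is the pivot; subtracting \<open>m s\<close>
      times the pivot annihilates the last coordinate of the vector of \<open>s\<close>.\<close>
    define m where "m s = u s n \<otimes> inv w" for s
    define T' where "T' = T - {t}"
    have T': "finite T'" "T = insert t T'" "t \<notin> T'" "n < card T'"
      using Suc.prems(1,2) t(1) by (auto simp: T'_def)
    have uc: "u s i \<in> carrier R" if "s \<in> T" "i \<le> n" for s i using Suc.prems(3) that by simp
    have mc: "m s \<in> carrier R" if "s \<in> T" for s using uc[OF that, of n] wi by (simp add: m_def)
    have mw: "m s \<otimes> w = u s n" if "s \<in> T" for s
      using uc[OF that, of n] wi w by (simp add: m_def m_assoc)
    have "\<exists>l. (\<forall>s\<in>T'. l s \<in> carrier R) \<and> (\<exists>s\<in>T'. l s \<noteq> \<zero>) \<and>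
        (\<forall>i<n. finsum R (\<lambda>s. l s \<otimes> (u s i \<ominus> m s \<otimes> u t i)) T' = \<zero>)"
      using T' uc mc t(1) by (intro Suc.IH) auto
    then obtain l where l: "\<And>s. s \<in> T' \<Longrightarrow> l s \<in> carrier R" "\<exists>s\<in>T'. l s \<noteq> \<zero>"
      "\<And>i. i < n \<Longrightarrow> finsum R (\<lambda>s. l s \<otimes> (u s i \<ominus> m s \<otimes> u t i)) T' = \<zero>" by blast
    \<comment> \<open>The coefficient of the pivot collects all the multiples of it that were
      subtracted from the other vectors.\<close>
    define c where "c = \<ominus> finsum R (\<lambda>s. l s \<otimes> m s) T'"
    have lm: "(\<lambda>s. l s \<otimes> m s) \<in> T' \<rightarrow> carrier R" using l(1) mc T'(2) by auto
    then have fc: "finsum R (\<lambda>s. l s \<otimes> m s) T' \<in> carrier R" by (rule finsum_closed)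
    then have c: "c \<in> carrier R" by (simp add: c_def)
    define l' where "l' s = (if s = t then c else l s)" for s
    have l'_T': "l' s = l s" if "s \<in> T'" for s using that T'(3) by (auto simp: l'_def)
    have "finsum R (\<lambda>s. l' s \<otimes> u s i) T = \<zero>" if i: "i < Suc n" for i
    proof -
      have ut: "u t i \<in> carrier R" using uc[OF t(1)] i by simp
      have us: "u s i \<in> carrier R" "m s \<in> carrier R" "l s \<in> carrier R" if "s \<in> T'" for s
        using uc mc l(1) i that T'(2) by auto
      have z: "finsum R (\<lambda>s. l s \<otimes> (u s i \<ominus> m s \<otimes> u t i)) T' = \<zero>"
      proof (cases "i < n")
        case False
        then have "i = n" using i by simp
        then have "l s \<otimes> (u s i \<ominus> m s \<otimes> u t i) = \<zero>" if "s \<in> T'" for s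
          using us[OF that] mw[of s] that T'(2) by (simp add: w_def[symmetric] minus_eq r_neg)
        then show ?thesis by (intro finsum_all_zero) simp
      qed (rule l(3))
      have "finsum R (\<lambda>s. l' s \<otimes> u s i) T = c \<otimes> u t i \<oplus> finsum R (\<lambda>s. l s \<otimes> u s i) T'"
        unfolding T'(2) using T' us ut c l'_T'
        by (subst finsum_insert) (auto simp: l'_def intro!: arg_cong2[where f = "(\<oplus>)"] finsum_cong')
      also have "finsum R (\<lambda>s. l s \<otimes> u s i) T' =
          finsum R (\<lambda>s. l s \<otimes> (u s i \<ominus> m s \<otimes> u t i) \<oplus> l s \<otimes> m s \<otimes> u t i) T'"
      proof (rule finsum_cong')
        fix s assume "s \<in> T'"
        note [simp] = us[OF this] ut
        have "l s \<otimes> (u s i \<ominus> m s \<otimes> u t i) \<oplus> l s \<otimes> m s \<otimes> u t i =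
            l s \<otimes> ((u s i \<ominus> m s \<otimes> u t i) \<oplus> m s \<otimes> u t i)" by (simp add: r_distr m_assoc)
        also have "(u s i \<ominus> m s \<otimes> u t i) \<oplus> m s \<otimes> u t i = u s i"
          by (simp add: minus_eq a_assoc l_neg)
        finally show "l s \<otimes> u s i = l s \<otimes> (u s i \<ominus> m s \<otimes> u t i) \<oplus> l s \<otimes> m s \<otimes> u t i" by simp
      qed (use us ut in auto)
      also have "\<dots> = finsum R (\<lambda>s. l s \<otimes> (u s i \<ominus> m s \<otimes> u t i)) T' \<oplus> finsum R (\<lambda>s. l s \<otimes> m s \<otimes> u t i) T'"
        using us ut by (intro finsum_addf) auto
      also have "\<dots> = finsum R (\<lambda>s. l s \<otimes> m s) T' \<otimes> u t i"
        using z ut lm T'(1) by (subst finsum_ldistr) (auto intro!: finsum_closed simp: us)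
      also have "c \<otimes> u t i \<oplus> \<dots> = \<zero>"
        using fc ut by (simp add: c_def l_minus l_neg)
      finally show ?thesis .
    qed
    moreover have "\<forall>s\<in>T. l' s \<in> carrier R" using l(1) c T'(2) by (auto simp: l'_def)
    moreover have "\<exists>s\<in>T. l' s \<noteq> \<zero>" using l(2) l'_T' T'(2) by auto
    ultimately show ?thesis by (intro exI[of _ l']) blast
  qed
qed

primrec mat_power :: "('a, 'b) ring_scheme \<Rightarrow> nat \<Rightarrow> 'a mat \<Rightarrow> nat \<Rightarrow> 'a mat" where
  "mat_power R d N 0 = mat_id R d"
| "mat_power R d N (Suc c) = mat_comp R N (mat_power R d N c)"

lemma (in cring) mats_power: "N \<in> mats d d \<Longrightarrow> mat_power R d N c \<in> mats d d"
  by (induction c) (auto intro: mats_id mats_comp)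

lemma (in cring) mat_power_zero_mono:
  assumes "N \<in> mats d d" "mat_power R d N c = mat_zero R d d" "c \<le> e"
  shows "mat_power R d N e = mat_zero R d d"
  using assms(3,2)
  by (induction e rule: dec_induct) (simp_all add: comp_zero_right[OF assms(1)])

text \<open>If \<open>N\<^sup>d v \<noteq> 0\<close>, a linear relation between \<open>v, N v, \<dots>, N\<^sup>d v\<close> multiplied by a suitable power of \<open>N\<close>
  leaves only its lowest term, and that with the last nonvanishing \<open>N\<^sup>e v\<close>.\<close>

lemma (in field) nilpotent_power_dim:
  assumes N: "N \<in> mats d d" and nil: "mat_power R d N e = mat_zero R d d"
  shows "mat_power R d N d = mat_zero R d d"
proof (rule ccontr)
  assume nz: "mat_power R d N d \<noteq> mat_zero R d d"
  \<comment> \<open>\<open>v t c\<close> is the vector obtained by applying \<open>N\<close> to the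
    basis vector \<open>t\<close> exactly \<open>c\<close> times.\<close>
  define v where "v t c i = mat_power R d N c $$ (i, t)" for t c i
  note P = matsD[OF mats_power[OF N]]
  have vc: "v t c i \<in> carrier R" if "t < d" "i < d" for t c i using P(4) that by (simp add: v_def)
  have "\<exists>t<d. \<exists>i<d. v t d i \<noteq> \<zero>"
  proof (rule ccontr)
    assume "\<not> ?thesis"
    then have "mat_power R d N d = mat_zero R d d"
      by (intro mats_eqI[OF mats_power[OF N] mats_zero]) (auto simp: v_def)
    then show False using nz by simp
  qed
  then obtain t i0 where t: "t < d" "i0 < d" "v t d i0 \<noteq> \<zero>" by blast
  obtain l where l: "\<And>c. c \<le> d \<Longrightarrow> l c \<in> carrier R" "\<exists>c\<le>d. l c \<noteq> \<zero>"
      "\<And>i. i < d \<Longrightarrow> finsum R (\<lambda>c. l c \<otimes> v t c i) {..d} = \<zero>"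
    using linear_dependence[of "{..d}" d "v t"] vc[OF t(1)] by auto
  have v_Suc: "v t (Suc c) i = finsum R (\<lambda>k. N $$ (i, k) \<otimes> v t c k) {..<d}" if "i < d" for c i
    using that t(1) P matsD[OF N] by (simp add: v_def)
  have shifted: "finsum R (\<lambda>c. l c \<otimes> v t (c + k) i) {..d} = \<zero>" if "i < d" for k i
    using that
  proof (induction k arbitrary: i)
    case 0
    then show ?case using l(3) by simp
  next
    case (Suc k)
    have "finsum R (\<lambda>c. l c \<otimes> v t (c + Suc k) i) {..d} =
        finsum R (\<lambda>c. finsum R (\<lambda>j. N $$ (i, j) \<otimes> (l c \<otimes> v t (c + k) j)) {..<d}) {..d}"
    proof (rule finsum_cong')
      fix c assume "c \<in> {..d}"
      then have c: "l c \<in> carrier R" using l(1) by simp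
      then have "l c \<otimes> v t (c + Suc k) i = finsum R (\<lambda>j. l c \<otimes> (N $$ (i, j) \<otimes> v t (c + k) j)) {..<d}"
        using Suc.prems vc t(1) matsD[OF N] by (simp add: v_Suc finsum_rdistr Pi_def)
      also have "\<dots> = finsum R (\<lambda>j. N $$ (i, j) \<otimes> (l c \<otimes> v t (c + k) j)) {..<d}"
        using c Suc.prems vc t(1) matsD[OF N] by (intro finsum_cong') (auto simp: m_lcomm)
      finally show "l c \<otimes> v t (c + Suc k) i = finsum R (\<lambda>j. N $$ (i, j) \<otimes> (l c \<otimes> v t (c + k) j)) {..<d}" .
    qed (use l(1) Suc.prems vc t(1) matsD[OF N] in \<open>auto intro!: finsum_closed\<close>)
    also have "\<dots> = finsum R (\<lambda>j. finsum R (\<lambda>c. N $$ (i, j) \<otimes> (l c \<otimes> v t (c + k) j)) {..d}) {..<d}"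
      using l(1) Suc.prems vc t(1) matsD[OF N] by (intro finsum_swap) auto
    also have "\<dots> = finsum R (\<lambda>j. N $$ (i, j) \<otimes> finsum R (\<lambda>c. l c \<otimes> v t (c + k) j) {..d}) {..<d}"
      using l(1) Suc.prems vc t(1) matsD[OF N]
      by (intro finsum_cong') (auto intro!: finsum_rdistr[symmetric] finsum_closed)
    also have "\<dots> = \<zero>"
      using Suc matsD[OF N] by (intro finsum_all_zero) simp
    finally show ?case .
  qed
  define f where "f = (LEAST f. \<forall>i<d. v t f i = \<zero>)"
  have zero_e: "\<forall>i<d. v t e i = \<zero>" using nil t(1) by (simp add: v_def)
  have f: "\<forall>i<d. v t f i = \<zero>" unfolding f_def by (rule LeastI, rule zero_e)
  have f_min: "\<not> (\<forall>i<d. v t g i = \<zero>)" if "g < f" for g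
    using that unfolding f_def by (rule not_less_Least)
  have beyond: "v t g i = \<zero>" if "f \<le> g" "i < d" for g i
    using that
  proof (induction g arbitrary: i rule: dec_induct)
    case base
    then show ?case using f by simp
  next
    case (step g)
    then show ?case using matsD[OF N] \<open>i < d\<close>
      by (subst v_Suc, simp, intro finsum_all_zero) simp
  qed
  have df: "d < f"
  proof (rule ccontr)
    assume "\<not> d < f"
    then show False using beyond[of d i0] t by simp
  qed
  define c0 where "c0 = (LEAST c. l c \<noteq> \<zero>)"
  obtain c1 where c1: "c1 \<le> d" "l c1 \<noteq> \<zero>" using l(2) by blast
  have c0: "l c0 \<noteq> \<zero>" "c0 \<le> d"
    unfolding c0_def using LeastI[of "\<lambda>c. l c \<noteq> \<zero>" c1] Least_le[of "\<lambda>c. l c \<noteq> \<zero>" c1] c1 by auto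
  have below: "l c = \<zero>" if "c < c0" for c
    using that not_less_Least[of c "\<lambda>c. l c \<noteq> \<zero>"] unfolding c0_def by blast
  obtain i where i: "i < d" "v t (f - 1) i \<noteq> \<zero>" using f_min[of "f - 1"] df by auto
  \<comment> \<open>The shift by \<open>f - 1 - c0\<close> moves the term of \<open>c0\<close> to
    the last nonvanishing power \<open>f - 1\<close> and every higher term to a vanishing one. The
    subtraction of natural numbers is exact because \<open>c0 \<le> d < f\<close>.\<close>
  have "finsum R (\<lambda>c. l c \<otimes> v t (c + (f - 1 - c0)) i) {..d} =
      (\<lambda>c. l c \<otimes> v t (c + (f - 1 - c0)) i) c0"
  proof (rule finsum_single)
    fix c assume c: "c \<in> {..d}" "c \<noteq> c0"
    show "l c \<otimes> v t (c + (f - 1 - c0)) i = \<zero>"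
    proof (cases "c < c0")
      case True
      then show ?thesis using below vc[OF t(1) i(1)] by simp
    next
      case False
      then have "f \<le> c + (f - 1 - c0)" using c c0(2) df by simp
      then show ?thesis using beyond[OF _ i(1)] l(1) c(1) by simp
    qed
  qed (use c0 l(1) vc[OF t(1) i(1)] in auto)
  then have "l c0 \<otimes> v t (f - 1) i = \<zero>"
    using shifted[OF i(1), of "f - 1 - c0"] c0(2) df by simp
  then show False
    using integral c0 l(1)[OF c0(2)] i vc[OF t(1) i(1)] by blast
qed

text \<open>Adding \<open>s\<close> and \<open>p ^ j * q\<close> in base \<open>p\<close> produces
  no carry, so this is a case of Kummer's theorem. It allows the low digits of an exponent to be
  split off with an invertible binomial coefficient.\<close>

lemma choose_add_prime_power_not_dvd:
  fixes p :: nat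
  assumes p: "Factorial_Ring.prime p" and "s < p ^ j"
  shows "\<not> p dvd (s + p ^ j * q choose s)"
  using assms(2)
proof (induction s)
  case 0
  then show ?case using p by (auto dest: prime_gt_1_nat)
next
  case (Suc s)
  let ?C = "s + p ^ j * q choose s" and ?C' = "Suc s + p ^ j * q choose Suc s"
  have eq: "Suc s * ?C' = (Suc s + p ^ j * q) * ?C"
    using Suc_times_binomial[of s "s + p ^ j * q"] by simp
  \<comment> \<open>Both \<open>Suc s\<close> and \<open>Suc s + p ^ j * q\<close> contain exactly
    the factor \<open>p ^ e\<close>, since \<open>Suc s < p ^ j\<close> forces \<open>e < j\<close>.
    Cancelling it leaves factors prime to \<open>p\<close>.\<close>
  obtain e u where u: "Suc s = p ^ e * u" "\<not> p dvd u"
    using multiplicity_decompose'[of "Suc s" p] p by (metis Suc_neq_Zero not_prime_unit)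
  have pe: "p ^ e > 0" using p prime_gt_0_nat by simp
  have "p ^ e \<le> Suc s" using u by (cases u) auto
  then have "p ^ e < p ^ j" using Suc.prems by simp
  then have "e < j" using p prime_gt_1_nat power_less_imp_less_exp by blast
  then have split: "p ^ j = p ^ e * p ^ (j - e)" "p dvd p ^ (j - e) * q"
    by (simp_all flip: power_add)
  have "p ^ e * (u * ?C') = p ^ e * ((u + p ^ (j - e) * q) * ?C)"
    using eq unfolding u(1) split(1) by (simp add: algebra_simps)
  then have eq': "u * ?C' = (u + p ^ (j - e) * q) * ?C"
    by (simp only: nat_mult_eq_cancel1[OF pe])
  have "\<not> p dvd u + p ^ (j - e) * q"
    using u(2) split(2) by (simp add: dvd_add_left_iff)
  moreover have "\<not> p dvd ?C" using Suc by simp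
  ultimately have "\<not> p dvd u * ?C'" unfolding eq' using p prime_dvd_mult_iff by blast
  then show ?case by auto
qed

text \<open>By absorption the coefficient is \<open>Suc c\<close> times a binomial coefficient with
  lower entry \<open>p ^ j - 1\<close>, and the latter is prime to \<open>p\<close> by
  \<open>choose_add_prime_power_not_dvd\<close>.\<close>

lemma choose_prime_power_dvd_iff:
  fixes p :: nat
  assumes p: "Factorial_Ring.prime p"
  shows "p dvd (Suc c * p ^ j choose p ^ j) \<longleftrightarrow> p dvd Suc c"
proof -
  have pj: "p ^ j > 0" using p prime_gt_0_nat by simp
  then obtain k where k: "p ^ j = Suc k" using gr0_implies_Suc by blast
  let ?C = "k + p ^ j * c choose k"
  have e: "Suc (k + p ^ j * c) = Suc c * p ^ j" by (simp add: k)
  have "p ^ j * (Suc c * p ^ j choose p ^ j) = Suc c * p ^ j * ?C"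
    using Suc_times_binomial[of k "k + p ^ j * c"] unfolding e k[symmetric] .
  then have "p ^ j * (Suc c * p ^ j choose p ^ j) = p ^ j * (Suc c * ?C)"
    by (simp only: mult_ac)
  then have "(Suc c * p ^ j choose p ^ j) = Suc c * ?C"
    by (simp only: nat_mult_eq_cancel1[OF pj])
  moreover have "\<not> p dvd ?C"
    using k by (intro choose_add_prime_power_not_dvd p) simp
  ultimately show ?thesis using p prime_dvd_mult_iff by metis
qed

text \<open>The multiplication rule of the divided powers \<open>x^r / r!\<close>. The coefficient
  matrices of the powers of a coordinate whose axis is additive satisfy it.\<close>

locale divided_powers = field R for R (structure) +
  fixes p d :: nat and A :: "nat \<Rightarrow> 'a mat"
  assumes prime_p: "Factorial_Ring.prime p"
    and char: "add_pow R (n :: nat) \<one> = \<zero> \<longleftrightarrow> p dvd n"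
    and A_mats: "A r \<in> mats d d"
    and A_mult: "mat_comp R (A r) (A s) = mat_scl R d d (add_pow R (r + s choose r) \<one>) (A (r + s))"
begin

lemma mat_scl_eq_zero:
  assumes "c \<in> carrier R" "c \<noteq> \<zero>" "B \<in> mats d d" "mat_scl R d d c B = mat_zero R d d"
  shows "B = mat_zero R d d"
proof (rule mats_eqI[OF assms(3) mats_zero])
  fix i j assume ij: "i < d" "j < d"
  have "mat_scl R d d c B $$ (i, j) = \<zero>" using ij by (simp add: assms(4))
  then have "c \<otimes> B $$ (i, j) = \<zero>" using ij by simp
  then show "B $$ (i, j) = mat_zero R d d $$ (i, j)"
    using ij assms(1,2) matsD(4)[OF assms(3) ij] integral by simp blast
qed

text \<open>An invertible binomial coefficient makes \<open>A (r + s)\<close> a multiple of the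
  product of \<open>A r\<close> and \<open>A s\<close>, so nonvanishing passes from the sum to both
  parts.\<close>

lemma add_zero:
  assumes "\<not> p dvd (r + s choose r)" "A r = mat_zero R d d \<or> A s = mat_zero R d d"
  shows "A (r + s) = mat_zero R d d"
proof (rule mat_scl_eq_zero)
  show "mat_scl R d d (add_pow R (r + s choose r) \<one>) (A (r + s)) = mat_zero R d d"
    unfolding A_mult[symmetric] using assms(2) comp_zero_left[OF A_mats] comp_zero_right[OF A_mats] by auto
qed (use assms(1) char A_mats in auto)

text \<open>Passing from \<open>c\<close> to \<open>Suc c\<close> introduces the factor
  \<open>Suc c * p ^ j choose p ^ j\<close>, which is invertible as long as
  \<open>Suc c < p\<close>. The range starts at \<open>1\<close> because \<open>A 0\<close> is not
  assumed to be the identity.\<close>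

lemma power_eq:
  assumes "1 \<le> c" "c < p"
  shows "\<exists>n\<in>carrier R. n \<noteq> \<zero> \<and> mat_power R d (A (p ^ j)) c = mat_scl R d d n (A (c * p ^ j))"
  using assms
proof (induction c rule: dec_induct)
  case base
  have "mat_comp R (A (p ^ j)) (mat_id R d) = A (p ^ j)"
    using matsD[OF A_mats] by (simp add: mat_comp_id_right)
  also have "\<dots> = mat_scl R d d \<one> (A (p ^ j))"
    using matsD[OF A_mats] by (intro mats_eqI[OF A_mats mats_scl[OF _ A_mats]]) auto
  finally show ?case by (intro bexI[of _ \<one>]) auto
next
  case (step c)
  then obtain n where n: "n \<in> carrier R" "n \<noteq> \<zero>" "mat_power R d (A (p ^ j)) c = mat_scl R d d n (A (c * p ^ j))"
    by auto
  let ?m = "add_pow R (Suc c * p ^ j choose p ^ j) \<one>"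
  have "\<not> p dvd Suc c" using step.prems by (auto dest: dvd_imp_le)
  then have m: "?m \<noteq> \<zero>" "?m \<in> carrier R"
    using char choose_prime_power_dvd_iff[OF prime_p] by auto
  have "mat_power R d (A (p ^ j)) (Suc c) = mat_scl R d d n (mat_scl R d d ?m (A (Suc c * p ^ j)))"
    using comp_scl_right[OF n(1) A_mats A_mats] A_mult[of "p ^ j" "c * p ^ j"] by (simp add: n(3))
  also have "\<dots> = mat_scl R d d (n \<otimes> ?m) (A (Suc c * p ^ j))"
    using n(1) m matsD[OF A_mats]
    by (intro mats_eqI[OF mats_scl[OF _ mats_scl[OF _ A_mats]] mats_scl[OF _ A_mats]]) (auto simp: m_assoc)
  finally show ?case using n m integral by (intro bexI[of _ "n \<otimes> ?m"]) auto
qed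

text \<open>The factor that follows those of \<open>power_eq\<close> is divisible by
  \<open>p\<close>. The resulting order of nilpotency grows with the characteristic; it serves only
  to make \<open>nilpotent_power_dim\<close> applicable.\<close>

lemma power_prime_zero: "mat_power R d (A (p ^ j)) p = mat_zero R d d"
proof -
  have p: "1 < p" using prime_p prime_gt_1_nat by blast
  define c where "c = p - 1"
  have c: "1 \<le> c" "c < p" "Suc c = p" using p by (auto simp: c_def)
  obtain n where n: "n \<in> carrier R" "mat_power R d (A (p ^ j)) c = mat_scl R d d n (A (c * p ^ j))"
    using power_eq[OF c(1,2)] by blast
  have z: "add_pow R (Suc c * p ^ j choose p ^ j) \<one> = \<zero>"
    using char choose_prime_power_dvd_iff[OF prime_p] c(3) by auto
  have "mat_power R d (A (p ^ j)) (Suc c) = mat_scl R d d n (mat_scl R d d \<zero> (A (Suc c * p ^ j)))"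
    using comp_scl_right[OF n(1) A_mats A_mats] A_mult[of "p ^ j" "c * p ^ j"] z by (simp add: n(2))
  also have "\<dots> = mat_zero R d d"
    using n(1) matsD[OF A_mats]
    by (intro mats_eqI[OF mats_scl[OF _ mats_scl[OF _ A_mats]] mats_zero]) auto
  finally show ?thesis by (simp add: c(3))
qed

text \<open>Write \<open>r\<close> as \<open>s + p ^ j * (c + p * q)\<close>. Both the lower digits
  \<open>s\<close> and the higher digits \<open>q\<close> split off with invertible binomial
  coefficients, so \<open>A (c * p ^ j)\<close> is nonzero. Up to a unit it is the
  \<open>c\<close>-th power of \<open>A (p ^ j)\<close>, which vanishes for
  \<open>c \<ge> d\<close>.\<close>

lemma digit_bound:
  assumes nz: "A r \<noteq> mat_zero R d d" and c: "c = r div p ^ j mod p" "c \<noteq> 0"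
  shows "c < d" "A (p ^ j) \<noteq> mat_zero R d d"
proof -
  have p: "1 < p" using prime_p prime_gt_1_nat by blast
  have cp: "1 \<le> c" "c < p" using c p by simp_all
  define s q where "s = r mod p ^ j" and "q = r div p ^ j div p"
  have 1: "r div p ^ j = c + p * q" by (simp add: c(1) q_def)
  have 2: "r = s + p ^ j * (r div p ^ j)" by (simp add: s_def)
  have "s < p ^ j" using p by (simp add: s_def)
  then have "\<not> p dvd (s + p ^ j * (r div p ^ j) choose s)"
    by (rule choose_add_prime_power_not_dvd[OF prime_p])
  then have 3: "A (p ^ j * (r div p ^ j)) \<noteq> mat_zero R d d"
    using add_zero nz 2 by metis
  have 4: "p ^ j * (r div p ^ j) = c * p ^ j + p ^ Suc j * q"
    by (simp add: 1 algebra_simps)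
  have "c * p ^ j < p ^ Suc j" using cp p by simp
  then have "\<not> p dvd (c * p ^ j + p ^ Suc j * q choose c * p ^ j)"
    by (rule choose_add_prime_power_not_dvd[OF prime_p])
  then have 5: "A (c * p ^ j) \<noteq> mat_zero R d d"
    using add_zero 3 unfolding 4 by metis
  obtain n where n: "n \<in> carrier R" "n \<noteq> \<zero>" "mat_power R d (A (p ^ j)) c = mat_scl R d d n (A (c * p ^ j))"
    using power_eq[OF cp] by blast
  have 6: "mat_power R d (A (p ^ j)) c \<noteq> mat_zero R d d"
    using mat_scl_eq_zero[OF n(1,2) A_mats] 5 n(3) by metis
  have "mat_power R d (A (p ^ j)) d = mat_zero R d d"
    using nilpotent_power_dim[OF A_mats power_prime_zero] .
  then show "c < d" using 6 mat_power_zero_mono[OF A_mats] not_le by blast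
  show "A (p ^ j) \<noteq> mat_zero R d d"
  proof
    assume "A (p ^ j) = mat_zero R d d"
    then have "mat_power R d (A (p ^ j)) (Suc 0) = mat_zero R d d"
      using mats_id by (simp add: comp_zero_left)
    then show False using 6 mat_power_zero_mono[OF A_mats, of _ "Suc 0" c] cp by simp
  qed
qed

end

lemma ring_char_prime:
  assumes "field K" "0 < ring_char K"
  shows "Factorial_Ring.prime (ring_char K)" "add_pow K (n :: nat) \<one>\<^bsub>K\<^esub> = \<zero>\<^bsub>K\<^esub> \<longleftrightarrow> ring_char K dvd n"
proof -
  interpret field K by fact
  have iff: "add_pow K (n :: nat) \<one>\<^bsub>K\<^esub> = \<zero>\<^bsub>K\<^esub> \<longleftrightarrow> ring_char K dvd n" for n
    using group.pow_eq_id[OF a_group, of "\<one>\<^bsub>K\<^esub>" n] by (simp add: ring_char_def add_pow_def)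
  then show "add_pow K n \<one>\<^bsub>K\<^esub> = \<zero>\<^bsub>K\<^esub> \<longleftrightarrow> ring_char K dvd n" .
  show "Factorial_Ring.prime (ring_char K)"
  proof (rule prime_natI)
    have "ring_char K \<noteq> 1" using iff[of 1] one_not_zero by auto
    then show "2 \<le> ring_char K" using assms(2) by simp
    fix a b assume "ring_char K dvd a * b"
    then have "add_pow K (a * b) \<one>\<^bsub>K\<^esub> = \<zero>\<^bsub>K\<^esub>" by (simp add: iff)
    then have "add_pow K b \<one>\<^bsub>K\<^esub> \<otimes>\<^bsub>K\<^esub> add_pow K a \<one>\<^bsub>K\<^esub> = \<zero>\<^bsub>K\<^esub>"
      using add_pow_one_mult[of "add_pow K a \<one>\<^bsub>K\<^esub>" b] add.nat_pow_pow[of "\<one>\<^bsub>K\<^esub>" b a] by (simp add: mult.commute)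
    then show "ring_char K dvd a \<or> ring_char K dvd b"
      using integral iff by (metis add.nat_pow_closed one_closed)
  qed
qed

section \<open>Coefficients of representations\<close>

lemma count_image_mset_inj: "inj f \<Longrightarrow> count (image_mset f m) (f x) = count m x"
  by (induction m) (auto simp: inj_eq)

lemma image_mset_Inl_Inr_eq:
  assumes "image_mset Inl x + image_mset Inr y = image_mset Inl x' + image_mset Inr y'"
  shows "x = x' \<and> y = y'"
proof -
  have z: "count (image_mset Inr n) (Inl v) = 0" "count (image_mset Inl m) (Inr w) = 0" for n m v w
    by (auto simp: count_eq_zero_iff)
  have "count x v = count x' v" for v
    using arg_cong[OF assms, of "\<lambda>M. count M (Inl v)"] by (simp add: z count_image_mset_inj)
  moreover have "count y v = count y' v" for v
    using arg_cong[OF assms, of "\<lambda>M. count M (Inr v)"] by (simp add: z count_image_mset_inj)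
  ultimately show ?thesis by (simp add: multiset_eq_iff)
qed

context rep_category
begin

lemma coord_coeff: "p \<in> carrier A \<Longrightarrow> p m \<in> carrier K"
  by (rule K.mpoly_coeff)

definition coeff_mat :: "('v multiset \<Rightarrow> 'a) mat \<Rightarrow> 'v multiset \<Rightarrow> 'a mat" where
  "coeff_mat a m = map_mat (\<lambda>p. p m) a"

lemma coeff_mat_mats: "is_rep H a \<Longrightarrow> coeff_mat a m \<in> K.mats (rep_dim a) (rep_dim a)"
  using A.matsD[OF rep_mats] by (intro K.matsI) (auto simp: coeff_mat_def coord_coeff)

text \<open>A monomial of the tensor square splits uniquely into a left and a right part, so a
  single term of the convolution survives.\<close>

lemma pure_tensor_coeff:
  assumes p: "p \<in> carrier A" and q: "q \<in> carrier A"
  shows "pure_tensor H p q (image_mset Inl m + image_mset Inr n) = p m \<otimes>\<^bsub>K\<^esub> q n"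
proof -
  let ?M = "image_mset Inl m + image_mset Inr n"
  have pq: "K.is_mpoly (gens H) p" "K.is_mpoly (gens H) q"
    using p q by (simp_all add: K.mpoly_carrier)
  have left: "left_incl p (image_mset Inl x) = p x" "l \<notin> range (image_mset Inl) \<Longrightarrow> left_incl p l = \<zero>\<^bsub>K\<^esub>" for x l
    unfolding left_incl_def by (rule K.poly_subst_rename[OF pq(1)], auto)+
  have right: "right_incl q (image_mset Inr x) = q x" "l \<notin> range (image_mset Inr) \<Longrightarrow> right_incl q l = \<zero>\<^bsub>K\<^esub>" for x l
    unfolding right_incl_def by (rule K.poly_subst_rename[OF pq(2)], auto)+
  have cl: "left_incl p l \<in> carrier K" "right_incl q l \<in> carrier K" for l
    using Ring.ring_hom_closed[OF left_incl_hom p] Ring.ring_hom_closed[OF right_incl_hom q]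
    by (simp_all add: K.mpoly_coeff)
  have "finsum K (\<lambda>l. left_incl p l \<otimes>\<^bsub>K\<^esub> right_incl q (?M - l)) {l. l \<subseteq># ?M} =
      (\<lambda>l. left_incl p l \<otimes>\<^bsub>K\<^esub> right_incl q (?M - l)) (image_mset Inl m)"
  proof (rule K.finsum_single)
    fix l assume l: "l \<in> {l. l \<subseteq># ?M}" "l \<noteq> image_mset Inl m"
    show "left_incl p l \<otimes>\<^bsub>K\<^esub> right_incl q (?M - l) = \<zero>\<^bsub>K\<^esub>"
    proof (cases "l \<in> range (image_mset Inl) \<and> ?M - l \<in> range (image_mset Inr)")
      case True
      then obtain x y where xy: "l = image_mset Inl x" "?M - l = image_mset Inr y" by blast
      then have "image_mset Inl x + image_mset Inr y = ?M"
        using l(1) subset_mset.add_diff_inverse[of l ?M] by simp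
      then have "x = m" using image_mset_Inl_Inr_eq by blast
      then show ?thesis using l(2) xy(1) by simp
    next
      case False
      then show ?thesis using left(2) right(2) cl by auto
    qed
  qed (use cl in \<open>simp_all add: K.finite_submultisets\<close>)
  then show ?thesis by (simp add: pure_tensor_eq K.mpoly_mult left(1) right(1))
qed

text \<open>The comodule equation read off at one monomial of the tensor square. All further
  relations between coefficient matrices arise by choosing \<open>m\<close> and \<open>n\<close>
  such that the right-hand side can be evaluated.\<close>

lemma coeff_mat_comp:
  assumes a: "is_rep H a" and ij: "i < rep_dim a" "j < rep_dim a"
  shows "mat_comp K (coeff_mat a m) (coeff_mat a n) $$ (i, j) =
    coproduct H (a $$ (i, j)) (image_mset Inl m + image_mset Inr n)"
proof -
  note d = A.matsD[OF rep_mats[OF a]]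
  have "coproduct H (a $$ (i, j)) =
      finsum A2 (\<lambda>l. pure_tensor H (a $$ (i, l)) (a $$ (l, j))) {..<rep_dim a}"
    using a ij by (simp add: is_rep_def)
  then have "coproduct H (a $$ (i, j)) (image_mset Inl m + image_mset Inr n) =
      finsum K (\<lambda>l. pure_tensor H (a $$ (i, l)) (a $$ (l, j)) (image_mset Inl m + image_mset Inr n)) {..<rep_dim a}"
    using d ij Ring.ring_hom_closed[OF left_incl_hom] Ring.ring_hom_closed[OF right_incl_hom]
    by (simp add: pure_tensor_eq K.finsum_mpoly_apply)
  also have "\<dots> = finsum K (\<lambda>l. (a $$ (i, l)) m \<otimes>\<^bsub>K\<^esub> (a $$ (l, j)) n) {..<rep_dim a}"
    using d ij by (intro K.finsum_cong') (auto simp: pure_tensor_coeff coord_coeff)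
  finally show ?thesis
    using d ij by (auto simp: coeff_mat_def coord_coeff intro!: K.finsum_cong')
qed

text \<open>A coefficient at a monomial in the variables \<open>T\<close> depends only on the
  comultiplication modulo the other variables. A suitable \<open>T\<close> makes the mixed term of
  the Heisenberg group disappear before anything is expanded.\<close>

lemma coproduct_coeff:
  assumes p: "p \<in> carrier A" and M: "set_mset M \<subseteq> T"
    and S: "finite S" "\<And>m. p m \<noteq> \<zero>\<^bsub>K\<^esub> \<Longrightarrow> m \<in> S" "\<And>m. m \<in> S \<Longrightarrow> set_mset m \<subseteq> gens H"
  shows "coproduct H p M = finsum K (\<lambda>m. p m \<otimes>\<^bsub>K\<^esub>
    K.subst_monom (gens H <+> gens H) (\<lambda>v. K.mpoly_trunc T (delta H v)) m M) S"
proof -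
  have pm: "K.is_mpoly (gens H) p" using p by (simp add: K.mpoly_carrier)
  have dl: "delta H \<in> gens H \<rightarrow> carrier A2" using delta_closed by blast
  have "coproduct H p M = finsum K (\<lambda>m. p m \<otimes>\<^bsub>K\<^esub> K.subst_monom (gens H <+> gens H) (delta H) m M) S"
    unfolding coproduct_def using pm dl S by (rule K.poly_subst_apply)
  also have "\<dots> = finsum K (\<lambda>m. p m \<otimes>\<^bsub>K\<^esub>
    K.subst_monom (gens H <+> gens H) (\<lambda>v. K.mpoly_trunc T (delta H v)) m M) S"
  proof (rule K.finsum_cong')
    fix m assume "m \<in> S"
    then have dm: "delta H \<in> set_mset m \<rightarrow> carrier A2" using S(3) dl by blast
    have eq: "K.subst_monom (gens H <+> gens H) (delta H) m M =
        K.subst_monom (gens H <+> gens H) (\<lambda>v. K.mpoly_trunc T (delta H v)) m M"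
    proof -
      have "K.mpoly_trunc T q M = q M" for q using M by (simp add: K.mpoly_trunc_def)
      then show ?thesis
        by (subst K.mpoly_trunc_subst_monom[OF dm, symmetric]) (rule sym)
    qed
    then show "p m \<otimes>\<^bsub>K\<^esub> K.subst_monom (gens H <+> gens H) (delta H) m M =
        p m \<otimes>\<^bsub>K\<^esub> K.subst_monom (gens H <+> gens H) (\<lambda>v. K.mpoly_trunc T (delta H v)) m M" by simp
  next
    have "K.subst_monom (gens H <+> gens H) (\<lambda>v. K.mpoly_trunc T (delta H v)) m \<in> carrier A2" if "m \<in> S" for m
    proof (rule K.subst_monom_closed)
      show "(\<lambda>v. K.mpoly_trunc T (delta H v)) \<in> set_mset m \<rightarrow> carrier A2"
        using S(3)[OF that] delta_closed Ring.ring_hom_closed[OF K.mpoly_trunc_hom[of T "gens H <+> gens H"]]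
        by blast
    qed
    then show "(\<lambda>m. p m \<otimes>\<^bsub>K\<^esub> K.subst_monom (gens H <+> gens H) (\<lambda>v. K.mpoly_trunc T (delta H v)) m M) \<in> S \<rightarrow> carrier K"
      by (intro Pi_I K.m_closed K.mpoly_coeff[OF p] K.mpoly_coeff[where V = "gens H <+> gens H"])
  qed simp
  finally show ?thesis .
qed

text \<open>The hypothesis says that the restriction of the comultiplication to the product of two coordinate
  subspaces is given by \<open>v \<mapsto> s v\<close>.\<close>

lemma coeff_mat_split:
  assumes a: "is_rep H a" and s: "\<And>v. s v = Inl v \<or> s v = Inr v"
    and tr: "\<And>v. K.mpoly_trunc (range s) (delta H v) = ring.indexed_var K (s v)"
    and m: "set_mset m \<subseteq> gens H"
  shows "coeff_mat a m = mat_comp K (coeff_mat a (filter_mset (\<lambda>v. s v = Inl v) m))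
    (coeff_mat a (filter_mset (\<lambda>v. s v = Inr v) m))"
proof -
  let ?l = "filter_mset (\<lambda>v. s v = Inl v) m" and ?r = "filter_mset (\<lambda>v. s v = Inr v) m"
  have inj: "inj s"
  proof (rule injI)
    fix x y assume "s x = s y"
    then show "x = y" using s[of x] s[of y] by auto
  qed
  have eq: "image_mset s m = image_mset Inl ?l + image_mset Inr ?r"
  proof (induction m)
    case (add v m)
    then show ?case using s[of v] by auto
  qed simp
  \<comment> \<open>After truncation every variable is merely renamed by the injective
    \<open>s\<close>, so only the term of \<open>m\<close> itself reaches the monomial
    \<open>image_mset s m\<close>.\<close>
  have "coproduct H p (image_mset s m) = p m" if p: "p \<in> carrier A" for p
  proof -
    let ?S = "insert m {m. p m \<noteq> \<zero>\<^bsub>K\<^esub>}"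
    have pm: "K.is_mpoly (gens H) p" using p by (simp add: K.mpoly_carrier)
    have S: "finite ?S" "\<And>n. n \<in> ?S \<Longrightarrow> set_mset n \<subseteq> gens H"
      using pm m by (auto simp: K.is_mpoly_def)
    have mon: "K.subst_monom (gens H <+> gens H) (\<lambda>v. K.mpoly_trunc (range s) (delta H v)) n =
        K.indexed_monom \<one>\<^bsub>K\<^esub> (image_mset s n)" if "n \<in> ?S" for n
      unfolding tr
    proof (rule K.subst_monom_vars, rule image_subsetI)
      fix v assume "v \<in># n"
      then show "s v \<in> gens H <+> gens H" using S(2)[OF that] s[of v] by auto
    qed
    have pc: "p n \<in> carrier K" for n using p by (rule K.mpoly_coeff)
    have "coproduct H p (image_mset s m) = finsum K (\<lambda>n. p n \<otimes>\<^bsub>K\<^esub>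
        K.subst_monom (gens H <+> gens H) (\<lambda>v. K.mpoly_trunc (range s) (delta H v)) n (image_mset s m)) ?S"
      using S by (intro coproduct_coeff p) auto
    also have "\<dots> = (\<lambda>n. p n \<otimes>\<^bsub>K\<^esub>
        K.subst_monom (gens H <+> gens H) (\<lambda>v. K.mpoly_trunc (range s) (delta H v)) n (image_mset s m)) m"
    proof (rule K.finsum_single)
      fix n assume n: "n \<in> ?S" "n \<noteq> m"
      then have "image_mset s m \<noteq> image_mset s n" using multiset.inj_map[OF inj] by (auto dest: injD)
      then show "p n \<otimes>\<^bsub>K\<^esub> K.subst_monom (gens H <+> gens H) (\<lambda>v. K.mpoly_trunc (range s) (delta H v)) n (image_mset s m) = \<zero>\<^bsub>K\<^esub>"
        using pc by (simp add: mon[OF n(1)] K.indexed_monom_def)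
    qed (use S(1) pc mon[of m] in \<open>simp_all add: K.indexed_monom_def\<close>)
    also have "\<dots> = p m" using pc mon[of m] by (simp add: K.indexed_monom_def)
    finally show ?thesis .
  qed
  then have "coproduct H (a $$ (i, j)) (image_mset Inl ?l + image_mset Inr ?r) = (a $$ (i, j)) m"
    if "i < rep_dim a" "j < rep_dim a" for i j
    using A.matsD(4)[OF rep_mats[OF a] that] unfolding eq by blast
  then show ?thesis
    using A.matsD(2,3)[OF rep_mats[OF a]]
    by (intro K.mats_eqI[OF coeff_mat_mats[OF a] K.mats_comp[OF coeff_mat_mats[OF a] coeff_mat_mats[OF a]]])
      (simp add: coeff_mat_comp[OF a] del: mat_comp_index, simp add: coeff_mat_def)
qed

lemma coeff_mat_split_nonzero:
  assumes a: "is_rep H a" and s: "\<And>v. s v = Inl v \<or> s v = Inr v"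
    and tr: "\<And>v. K.mpoly_trunc (range s) (delta H v) = ring.indexed_var K (s v)"
    and m: "set_mset m \<subseteq> gens H" "coeff_mat a m \<noteq> mat_zero K (rep_dim a) (rep_dim a)"
  shows "coeff_mat a (filter_mset (\<lambda>v. s v = Inl v) m) \<noteq> mat_zero K (rep_dim a) (rep_dim a)"
    "coeff_mat a (filter_mset (\<lambda>v. s v = Inr v) m) \<noteq> mat_zero K (rep_dim a) (rep_dim a)"
  using m(2) unfolding coeff_mat_split[OF a s tr m(1)]
  using K.comp_zero_left[OF coeff_mat_mats[OF a]] K.comp_zero_right[OF coeff_mat_mats[OF a]] by auto

text \<open>The axis of \<open>v\<close>, where all other coordinates vanish, is a subgroup
  isomorphic to the additive group with coordinate \<open>v\<close>. The condition expresses this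
  through the comultiplication restricted to two copies of the axis.\<close>

definition primitive_axis :: "'v \<Rightarrow> bool" where
  "primitive_axis v \<longleftrightarrow> (\<forall>w. K.mpoly_trunc {Inl v, Inr v} (delta H w) =
    (if w = v then ring.indexed_var K (Inl v) \<oplus>\<^bsub>A2\<^esub> ring.indexed_var K (Inr v) else \<zero>\<^bsub>A2\<^esub>))"

text \<open>On the axis, \<open>v^k\<close> is sent to the \<open>k\<close>-th power of
  \<open>v \<otimes> 1 + 1 \<otimes> v\<close>, and monomials with another variable are sent to
  zero. Only \<open>v^(r + t)\<close> can therefore contribute, and it does so with a binomial
  coefficient.\<close>

lemma coeff_mat_axis:
  assumes a: "is_rep H a" and v: "v \<in> gens H" "primitive_axis v"
  shows "mat_comp K (coeff_mat a (replicate_mset r v)) (coeff_mat a (replicate_mset t v)) =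
    mat_scl K (rep_dim a) (rep_dim a) (add_pow K (r + t choose r) \<one>\<^bsub>K\<^esub>) (coeff_mat a (replicate_mset (r + t) v))"
proof -
  let ?M = "replicate_mset r (Inl v) + replicate_mset t (Inr v)"
  let ?T = "{Inl v, Inr v}"
  let ?\<sigma> = "\<lambda>w. K.mpoly_trunc ?T (delta H w)"
  let ?x = "ring.indexed_var K (Inl v) \<oplus>\<^bsub>A2\<^esub> ring.indexed_var K (Inr v)"
  let ?n = "add_pow K (r + t choose r) \<one>\<^bsub>K\<^esub>"
  have \<sigma>: "?\<sigma> w = (if w = v then ?x else \<zero>\<^bsub>A2\<^esub>)" for w
    using v(2) by (simp add: primitive_axis_def)
  have x: "?x \<in> carrier A2" using v(1) by (simp add: K.var_closed InlI InrI)
  have \<sigma>c: "?\<sigma> w \<in> carrier A2" for w using x by (simp add: \<sigma>)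
  have mon_rep: "K.subst_monom (gens H <+> gens H) ?\<sigma> (replicate_mset k v) ?M =
      (if r + t = k then add_pow K (k choose r) \<one>\<^bsub>K\<^esub> else \<zero>\<^bsub>K\<^esub>)" for k
  proof -
    have "K.subst_monom (gens H <+> gens H) ?\<sigma> (replicate_mset k v) = ?x [^]\<^bsub>A2\<^esub> k"
      using K.subst_monom_replicate[of ?\<sigma> v "gens H <+> gens H" k] \<sigma>c[of v] by (simp add: \<sigma>)
    then show ?thesis
      using K.two_var_power_coeff[of "Inl v" "gens H <+> gens H" "Inr v" k r t] v(1) by (simp add: InlI InrI)
  qed
  have mon_other: "K.subst_monom (gens H <+> gens H) ?\<sigma> m ?M = \<zero>\<^bsub>K\<^esub>" if w: "w \<in># m" "w \<noteq> v" for m w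
  proof -
    obtain m' where m': "m = add_mset w m'" using w(1) by (rule mset_add)
    have "K.subst_monom (gens H <+> gens H) ?\<sigma> m = ?\<sigma> w \<otimes>\<^bsub>A2\<^esub> K.subst_monom (gens H <+> gens H) ?\<sigma> m'"
      unfolding m' using \<sigma>c by (intro K.subst_monom_add_mset) auto
    also have "\<dots> = \<zero>\<^bsub>A2\<^esub>"
      using w(2) K.subst_monom_closed[of ?\<sigma> m' "gens H <+> gens H"] \<sigma>c by (simp add: \<sigma>)
    finally show ?thesis by simp
  qed
  have coprod: "coproduct H p ?M = ?n \<otimes>\<^bsub>K\<^esub> p (replicate_mset (r + t) v)" if p: "p \<in> carrier A" for p
  proof -
    let ?S = "insert (replicate_mset (r + t) v) {m. p m \<noteq> \<zero>\<^bsub>K\<^esub>}"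
    have pm: "K.is_mpoly (gens H) p" using p by (simp add: K.mpoly_carrier)
    have S: "finite ?S" "\<And>n. n \<in> ?S \<Longrightarrow> set_mset n \<subseteq> gens H"
      using pm v(1) by (auto simp: K.is_mpoly_def split: if_splits)
    have pc: "p n \<in> carrier K" for n using p by (rule K.mpoly_coeff)
    have "coproduct H p ?M = finsum K (\<lambda>m. p m \<otimes>\<^bsub>K\<^esub> K.subst_monom (gens H <+> gens H) ?\<sigma> m ?M) ?S"
      using S by (intro coproduct_coeff p) auto
    also have "\<dots> = (\<lambda>m. p m \<otimes>\<^bsub>K\<^esub> K.subst_monom (gens H <+> gens H) ?\<sigma> m ?M) (replicate_mset (r + t) v)"
    proof (rule K.finsum_single)
      fix m assume m: "m \<in> ?S" "m \<noteq> replicate_mset (r + t) v"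
      have "K.subst_monom (gens H <+> gens H) ?\<sigma> m ?M = \<zero>\<^bsub>K\<^esub>"
      proof (cases "set_mset m \<subseteq> {v}")
        case True
        then obtain k where k: "m = replicate_mset k v" using set_mset_subset_singletonD by metis
        then show ?thesis using m(2) mon_rep[of k] by auto
      qed (use mon_other in blast)
      then show "p m \<otimes>\<^bsub>K\<^esub> K.subst_monom (gens H <+> gens H) ?\<sigma> m ?M = \<zero>\<^bsub>K\<^esub>" using pc by simp
    qed (use S(1) pc mon_rep in simp_all)
    also have "\<dots> = ?n \<otimes>\<^bsub>K\<^esub> p (replicate_mset (r + t) v)"
      using pc by (simp add: mon_rep K.m_comm)
    finally show ?thesis .
  qed
  show ?thesis
  proof (rule K.mats_eqI[OF K.mats_comp[OF coeff_mat_mats[OF a] coeff_mat_mats[OF a]] K.mats_scl[OF _ coeff_mat_mats[OF a]]])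
    fix i j assume ij: "i < rep_dim a" "j < rep_dim a"
    have "mat_comp K (coeff_mat a (replicate_mset r v)) (coeff_mat a (replicate_mset t v)) $$ (i, j) =
        coproduct H (a $$ (i, j)) ?M"
      using coeff_mat_comp[OF a ij, of "replicate_mset r v" "replicate_mset t v"] by simp
    also have "\<dots> = ?n \<otimes>\<^bsub>K\<^esub> (a $$ (i, j)) (replicate_mset (r + t) v)"
      using A.matsD(4)[OF rep_mats[OF a] ij] by (rule coprod)
    finally show "mat_comp K (coeff_mat a (replicate_mset r v)) (coeff_mat a (replicate_mset t v)) $$ (i, j) =
        mat_scl K (rep_dim a) (rep_dim a) ?n (coeff_mat a (replicate_mset (r + t) v)) $$ (i, j)"
      using ij A.matsD(2,3)[OF rep_mats[OF a]] by (simp add: coeff_mat_def)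
  qed simp
qed

lemma axis_digit_bound:
  assumes K: "field K" "0 < ring_char K" and a: "is_rep H a" and v: "v \<in> gens H" "primitive_axis v"
    and nz: "coeff_mat a (replicate_mset r v) \<noteq> mat_zero K (rep_dim a) (rep_dim a)"
    and c: "c = r div ring_char K ^ j mod ring_char K" "c \<noteq> 0"
  shows "c < rep_dim a" "coeff_mat a (replicate_mset (ring_char K ^ j) v) \<noteq> mat_zero K (rep_dim a) (rep_dim a)"
proof -
  interpret field K by (rule K)
  have "divided_powers K (ring_char K) (rep_dim a) (\<lambda>r. coeff_mat a (replicate_mset r v))"
    by (intro divided_powers.intro divided_powers_axioms.intro K(1))
      (simp_all only: ring_char_prime[OF K] coeff_mat_mats[OF a] coeff_mat_axis[OF a v])
  from divided_powers.digit_bound[OF this nz c]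
  show "c < rep_dim a" "coeff_mat a (replicate_mset (ring_char K ^ j) v) \<noteq> mat_zero K (rep_dim a) (rep_dim a)"
    by simp_all
qed

end

section \<open>The additive and the Heisenberg group\<close>

lemma hopf_of_fields [simp]: "base (hopf_of G K) = K"
  by (cases G) (simp_all add: Ga_def H1_def Let_def)

lemma gens_hopf_of: "gens (hopf_of G K) = (case G of Additive \<Rightarrow> {CX} | Heisenberg \<Rightarrow> {CX, CY, CZ})"
  by (cases G) (simp_all add: Ga_def H1_def Let_def)

lemma UNIV_coord: "(UNIV :: coord set) = {CX, CY, CZ}"
  using coord.exhaust by auto

lemma filter_mset_single: "(\<And>v. P v \<longleftrightarrow> v = x) \<Longrightarrow> filter_mset P m = replicate_mset (count m x) x"
  by (rule multiset_eqI) auto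

context coeff_ring
begin

lemma delta_Ga: "delta (hopf_of Additive K) v = indexed_var (Inr v) \<oplus>\<^bsub>mpoly_ring K S\<^esub> indexed_var (Inl v)"
  by (simp add: Ga_def mpoly_ring_def)

lemma delta_H1:
  "delta (hopf_of Heisenberg K) CX = indexed_var (Inr CX) \<oplus>\<^bsub>mpoly_ring K S\<^esub> indexed_var (Inl CX)"
  "delta (hopf_of Heisenberg K) CY = indexed_var (Inr CY) \<oplus>\<^bsub>mpoly_ring K S\<^esub> indexed_var (Inl CY)"
  "delta (hopf_of Heisenberg K) CZ = indexed_var (Inr CZ) \<oplus>\<^bsub>mpoly_ring K S\<^esub>
    indexed_var (Inl CX) \<otimes>\<^bsub>mpoly_ring K S\<^esub> indexed_var (Inr CY) \<oplus>\<^bsub>mpoly_ring K S\<^esub> indexed_var (Inl CZ)"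
  by (simp_all add: H1_def Let_def mpoly_ring_def)

lemma rep_category_hopf_of: "rep_category (hopf_of G K)"
proof (rule rep_category.intro)
  show "cring (base (hopf_of G K))" by (simp add: is_cring)
  fix v assume v: "v \<in> gens (hopf_of G K)"
  let ?S = "gens (hopf_of G K) <+> gens (hopf_of G K)"
  interpret S: cring "mpoly_ring K ?S" by (rule cring_mpoly)
  have var: "indexed_var (Inl w) \<in> carrier (mpoly_ring K ?S)" "indexed_var (Inr w) \<in> carrier (mpoly_ring K ?S)"
    if "w \<in> gens (hopf_of G K)" for w
    using that by (auto intro!: var_closed)
  show "delta (hopf_of G K) v \<in> carrier (coord_ring2 (hopf_of G K))"
  proof (cases G)
    case Additive
    have "delta (hopf_of G K) v = indexed_var (Inr v) \<oplus>\<^bsub>mpoly_ring K ?S\<^esub> indexed_var (Inl v)"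
      unfolding Additive by (rule delta_Ga)
    then show ?thesis using var[OF v] by (simp only: hopf_of_fields S.a_closed)
  next
    case Heisenberg
    have g: "w \<in> gens (hopf_of G K)" for w
      unfolding gens_hopf_of Heisenberg using UNIV_coord by auto
    show ?thesis
      unfolding hopf_of_fields Heisenberg
      by (cases v) (use var[OF g] in \<open>simp_all only: delta_H1[where S = "gens (hopf_of Heisenberg K) <+> gens (hopf_of Heisenberg K)"]
          S.a_closed[unfolded Heisenberg] S.m_closed[unfolded Heisenberg] Heisenberg\<close>)
  qed
qed

lemma indexed_var_coeff: "indexed_var v m \<in> carrier K"
  by (simp add: indexed_var_monom indexed_monom_def)

lemma mpoly_trunc_add: "mpoly_trunc T (p \<oplus>\<^bsub>mpoly_ring K S\<^esub> q) = mpoly_trunc T p \<oplus>\<^bsub>mpoly_ring K S\<^esub> mpoly_trunc T q"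
  by (auto simp: mpoly_trunc_def fun_eq_iff)

lemma mpoly_trunc_var:
  "mpoly_trunc T (indexed_var v) = (if v \<in> T then indexed_var v else (\<lambda>_. \<zero>))"
  by (simp add: indexed_var_monom mpoly_trunc_monom)

lemma mpoly_trunc_var_mult:
  "mpoly_trunc T (indexed_var v \<otimes>\<^bsub>mpoly_ring K S\<^esub> indexed_var w) =
    (if v \<in> T \<and> w \<in> T then indexed_var v \<otimes>\<^bsub>mpoly_ring K S\<^esub> indexed_var w else (\<lambda>_. \<zero>))"
  by (simp add: indexed_var_monom monom_mult mpoly_trunc_monom)

lemma indexed_var_add_zero:
  "indexed_var v \<oplus>\<^bsub>mpoly_ring K S\<^esub> (\<lambda>_. \<zero>) = indexed_var v" "(\<lambda>_. \<zero>) \<oplus>\<^bsub>mpoly_ring K S\<^esub> indexed_var v = indexed_var v"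
  "(\<lambda>_. \<zero>) \<oplus>\<^bsub>mpoly_ring K S\<^esub> (\<lambda>_. \<zero>) = (\<lambda>_. \<zero>)"
  by (simp_all add: fun_eq_iff indexed_var_coeff)

lemma indexed_var_add_comm:
  "indexed_var v \<oplus>\<^bsub>mpoly_ring K S\<^esub> indexed_var w = indexed_var w \<oplus>\<^bsub>mpoly_ring K S\<^esub> indexed_var v"
  by (simp add: fun_eq_iff a_comm indexed_var_coeff)

lemmas trunc_simps = mpoly_trunc_add mpoly_trunc_var mpoly_trunc_var_mult indexed_var_add_zero mpoly_zero

text \<open>The mixed term of the Heisenberg comultiplication involves two different coordinates, so
  it vanishes on each single axis, including that of \<open>CZ\<close>.\<close>

lemma primitive_axis_hopf_of:
  assumes "v \<in> gens (hopf_of G K)"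
  shows "rep_category.primitive_axis (hopf_of G K) v"
proof -
  interpret rep: rep_category "hopf_of G K" by (rule rep_category_hopf_of)
  let ?S = "gens (hopf_of G K) <+> gens (hopf_of G K)"
  show ?thesis unfolding rep.primitive_axis_def hopf_of_fields
  proof (intro allI)
    fix w
    show "mpoly_trunc {Inl v, Inr v} (delta (hopf_of G K) w) =
      (if w = v then indexed_var (Inl v) \<oplus>\<^bsub>mpoly_ring K ?S\<^esub> indexed_var (Inr v) else \<zero>\<^bsub>mpoly_ring K ?S\<^esub>)"
    proof (cases G)
      case Additive
      then show ?thesis
        by (simp add: delta_Ga[where S = ?S] trunc_simps indexed_var_add_comm[where v = "Inr v"] del: hopf_of.simps)
    next
      case Heisenberg
      then show ?thesis
        by (cases w; cases v)
          (simp_all add: delta_H1[where S = ?S] trunc_simps indexed_var_add_comm[where v = "Inr CX"]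
            indexed_var_add_comm[where v = "Inr CY"] indexed_var_add_comm[where v = "Inr CZ"] del: hopf_of.simps)
    qed
  qed
qed

end

text \<open>A nonzero coefficient at \<open>m\<close> forces a nonzero coefficient at the pure power
  of each coordinate in \<open>m\<close>, and on that axis the digit bound applies. The first
  conclusion bounds digits by the dimension, the second ties the positions of nonzero digits to the
  height.\<close>

lemma rep_support:
  assumes K: "field K" "0 < ring_char K" and a: "is_rep (hopf_of G K) a"
    and ij: "i < rep_dim a" "j < rep_dim a" "(a $$ (i, j)) m \<noteq> \<zero>\<^bsub>K\<^esub>"
    and v: "v \<in> gens (hopf_of G K)"
    and c: "c = count m v div ring_char K ^ l mod ring_char K" "c \<noteq> 0"
  shows "c < rep_dim a"
    "\<exists>i<rep_dim a. \<exists>j<rep_dim a. (a $$ (i, j)) (replicate_mset (ring_char K ^ l) v) \<noteq> \<zero>\<^bsub>K\<^esub>"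
proof -
  interpret coeff_ring K
    using K(1) by (simp add: coeff_ring_def fieldE)
  interpret rep: rep_category "hopf_of G K" by (rule rep_category_hopf_of)
  let ?Z = "mat_zero K (rep_dim a) (rep_dim a)"
  note ad = rep.A.matsD[OF rep.rep_mats[OF a]]
  have m: "set_mset m \<subseteq> gens (hopf_of G K)"
    using ad(4)[OF ij(1,2)] ij(3) unfolding hopf_of_fields mpoly_carrier is_mpoly_def by blast
  have nonzero_iff: "rep.coeff_mat a n \<noteq> ?Z \<longleftrightarrow>
      (\<exists>i<rep_dim a. \<exists>j<rep_dim a. (a $$ (i, j)) n \<noteq> \<zero>\<^bsub>K\<^esub>)" for n
    using ad(2,3) by (auto simp: rep.coeff_mat_def mat_eq_iff)
  have nz: "rep.coeff_mat a m \<noteq> ?Z" using ij nonzero_iff by blast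
  have axis: "rep.coeff_mat a (replicate_mset (count m v) v) \<noteq> ?Z"
  proof (cases G)
    case Additive
    then have "set_mset m \<subseteq> {v}" "v = CX" using m v by (auto simp: gens_hopf_of simp del: hopf_of.simps)
    then have "m = replicate_mset (count m v) v"
      by (metis set_mset_subset_singletonD count_replicate_mset)
    then show ?thesis using nz by simp
  next
    case Heisenberg
    let ?G = "hopf_of Heisenberg K"
    let ?S = "gens ?G <+> gens ?G"
    \<comment> \<open>The mixed term needs \<open>CX\<close> on the left, so with \<open>CX\<close>
      on the right every coordinate is simply sent to the chosen side. The choice \<open>s1\<close>
      splits off \<open>CY\<close>, and \<open>s2\<close> then separates \<open>CZ\<close> from
      \<open>CX\<close>.\<close>
    define s1 s2 where "s1 = (\<lambda>v. case v of CX \<Rightarrow> Inr CX | CY \<Rightarrow> Inl CY | CZ \<Rightarrow> Inr CZ)"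
      and "s2 = (\<lambda>v. case v of CX \<Rightarrow> Inr CX | CY \<Rightarrow> Inl CY | CZ \<Rightarrow> Inl CZ)"
    have r: "range s1 = {Inr CX, Inl CY, Inr CZ}" "range s2 = {Inr CX, Inl CY, Inl CZ}"
      by (simp_all add: UNIV_coord s1_def s2_def)
    have s: "s1 v = Inl v \<or> s1 v = Inr v" "s2 v = Inl v \<or> s2 v = Inr v" for v
      by (cases v; simp add: s1_def s2_def)+
    have tr: "mpoly_trunc (range s1) (delta (hopf_of G K) v) = indexed_var (s1 v)"
      "mpoly_trunc (range s2) (delta (hopf_of G K) v) = indexed_var (s2 v)" for v
      unfolding r Heisenberg
      by (cases v; simp add: delta_H1[where S = ?S] trunc_simps s1_def s2_def del: hopf_of.simps)+
    note split1 = rep.coeff_mat_split_nonzero[OF a s(1), unfolded hopf_of_fields, OF tr(1)]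
    note split2 = rep.coeff_mat_split_nonzero[OF a s(2), unfolded hopf_of_fields, OF tr(2)]
    let ?m = "filter_mset (\<lambda>v. s1 v = Inr v) m"
    have m': "set_mset ?m \<subseteq> gens (hopf_of G K)" using m by auto
    have "rep.coeff_mat a (filter_mset (\<lambda>v. s1 v = Inl v) m) \<noteq> ?Z" and nz': "rep.coeff_mat a ?m \<noteq> ?Z"
      by (rule split1[OF m nz])+
    moreover have "filter_mset (\<lambda>v. s1 v = Inl v) m = replicate_mset (count m CY) CY"
      by (rule filter_mset_single) (auto simp: s1_def split: coord.splits)
    moreover have "rep.coeff_mat a (filter_mset (\<lambda>v. s2 v = Inl v) ?m) \<noteq> ?Z"
      "rep.coeff_mat a (filter_mset (\<lambda>v. s2 v = Inr v) ?m) \<noteq> ?Z"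
      by (rule split2[OF m' nz'])+
    moreover have "filter_mset (\<lambda>v. s2 v = Inl v) ?m = replicate_mset (count m CZ) CZ"
      unfolding filter_filter_mset by (rule filter_mset_single) (auto simp: s1_def s2_def split: coord.splits)
    moreover have "filter_mset (\<lambda>v. s2 v = Inr v) ?m = replicate_mset (count m CX) CX"
      unfolding filter_filter_mset by (rule filter_mset_single) (auto simp: s1_def s2_def split: coord.splits)
    ultimately show ?thesis by (cases v) simp_all
  qed
  note bound = rep.axis_digit_bound[unfolded hopf_of_fields, OF K a v primitive_axis_hopf_of[OF v] axis c]
  show "c < rep_dim a" by (rule bound(1))
  show "\<exists>i<rep_dim a. \<exists>j<rep_dim a. (a $$ (i, j)) (replicate_mset (ring_char K ^ l) v) \<noteq> \<zero>\<^bsub>K\<^esub>"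
    using bound(2) nonzero_iff by blast
qed

section \<open>Transfer of representations along the Frobenius correspondence\<close>

text \<open>Each occurrence of \<open>w\<close> is replaced by the power \<open>p ^ lev w\<close> of
  the variable \<open>\<pi> w\<close>. Keeping \<open>lev\<close> and \<open>\<pi>\<close> general
  covers the coordinate ring and its tensor square at once.\<close>

definition frob :: "nat \<Rightarrow> ('w \<Rightarrow> nat) \<Rightarrow> ('w \<Rightarrow> 'v) \<Rightarrow> 'w multiset \<Rightarrow> 'v multiset" where
  "frob p lev \<pi> M = sum_mset (image_mset (\<lambda>w. replicate_mset (p ^ lev w) (\<pi> w)) M)"

lemma frob_empty: "frob p lev \<pi> {#} = {#}"
  by (simp add: frob_def)

lemma frob_add: "frob p lev \<pi> (M + N) = frob p lev \<pi> M + frob p lev \<pi> N"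
  by (simp add: frob_def)

lemma frob_single: "frob p lev \<pi> {#w#} = replicate_mset (p ^ lev w) (\<pi> w)"
  by (simp add: frob_def)

lemma frob_add_mset: "frob p lev \<pi> (add_mset w M) = replicate_mset (p ^ lev w) (\<pi> w) + frob p lev \<pi> M"
  by (simp add: frob_def)

lemma set_frob: "set_mset (frob p lev \<pi> M) \<subseteq> \<pi> ` set_mset M"
  by (induction M) (auto simp: frob_empty frob_add_mset)

text \<open>Here \<open>mk\<close> is inverse to the pair of \<open>lev\<close> and
  \<open>\<pi>\<close>: a variable is the same as a level together with a source variable. The
  exponents of the variables over \<open>v\<close> become coefficients of an expansion in powers of
  \<open>p\<close>, and these are its digits once they are less than \<open>p\<close>.\<close>

lemma count_frob:
  assumes mk: "\<And>j v. lev (mk j v) = j" "\<And>j v. \<pi> (mk j v) = v" "\<And>w. mk (lev w) (\<pi> w) = w"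
    and L: "\<And>w. w \<in># M \<Longrightarrow> lev w < L"
  shows "count (frob p lev \<pi> M) v = (\<Sum>j<L. count M (mk j v) * p ^ j)"
  using L
proof (induction M)
  case empty
  then show ?case by (simp add: frob_empty)
next
  case (add w M)
  have eq: "w = mk j v \<longleftrightarrow> v = \<pi> w \<and> j = lev w" for j
    using mk(3)[of w] by (auto simp: mk)
  have "(\<Sum>j<L. count (add_mset w M) (mk j v) * p ^ j) =
      (\<Sum>j<L. (if v = \<pi> w \<and> j = lev w then p ^ j else 0) + count M (mk j v) * p ^ j)"
    by (intro sum.cong) (auto simp: eq)
  also have "\<dots> = (if v = \<pi> w then p ^ lev w else 0) + (\<Sum>j<L. count M (mk j v) * p ^ j)"
    using add.prems[of w] by (auto simp: sum.distrib)
  finally show ?case using add by (auto simp: frob_add_mset)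
qed

section \<open>Base \<open>p\<close> digits and injectivity of the correspondence\<close>

lemma digits_unique:
  fixes a b :: "nat \<Rightarrow> nat"
  assumes "\<And>j. j < L \<Longrightarrow> a j < p" "\<And>j. j < L \<Longrightarrow> b j < p" "(\<Sum>j<L. a j * p ^ j) = (\<Sum>j<L. b j * p ^ j)" "j < L"
  shows "a j = b j"
  using assms
proof (induction L arbitrary: a b j)
  case (Suc L)
  have shift: "(\<Sum>j<Suc L. c j * p ^ j) = c 0 + p * (\<Sum>j<L. c (Suc j) * p ^ j)" for c :: "nat \<Rightarrow> nat"
    by (simp add: sum.lessThan_Suc_shift sum_distrib_left algebra_simps del: sum.lessThan_Suc)
  have 0: "a 0 < p" "b 0 < p" using Suc.prems(1,2) by auto
  have eq: "a 0 + p * (\<Sum>j<L. a (Suc j) * p ^ j) = b 0 + p * (\<Sum>j<L. b (Suc j) * p ^ j)"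
    using Suc.prems(3) by (simp only: shift)
  have a0: "a 0 = b 0" using arg_cong[OF eq, of "\<lambda>x. x mod p"] 0 by simp
  then have "(\<Sum>j<L. a (Suc j) * p ^ j) = (\<Sum>j<L. b (Suc j) * p ^ j)"
    using eq 0 by simp
  then have "a (Suc j) = b (Suc j)" if "j < L" for j
    using Suc.IH[of "\<lambda>j. a (Suc j)" "\<lambda>j. b (Suc j)" j] Suc.prems(1,2) that by simp
  then show ?case using a0 Suc.prems(4) by (cases j) auto
qed simp

lemma digit_sum_less:
  fixes a :: "nat \<Rightarrow> nat"
  assumes "\<And>j. j < L \<Longrightarrow> a j < p"
  shows "(\<Sum>j<L. a j * p ^ j) < p ^ L"
  using assms
proof (induction L)
  case (Suc L)
  have "(\<Sum>j<Suc L. a j * p ^ j) < p ^ L + a L * p ^ L" using Suc by simp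
  also have "\<dots> = Suc (a L) * p ^ L" by simp
  also have "\<dots> \<le> p * p ^ L" using Suc.prems[of L] by (intro mult_le_mono1) simp
  finally show ?case by simp
qed simp

lemma zero_digits:
  assumes "2 \<le> (p :: nat)" "\<And>j. q div p ^ j mod p = 0"
  shows "q = 0"
  using assms(2)
proof (induction q rule: less_induct)
  case (less q)
  have "q mod p = 0" using less.prems[of 0] by simp
  moreover have "q div p div p ^ j mod p = 0" for j
    using less.prems[of "Suc j"] by (simp add: div_mult2_eq)
  then have "q div p = 0" if "q > 0"
    using less.IH[of "q div p"] that assms(1) by simp
  ultimately show ?case using div_mult_mod_eq[of q p] by (cases "q = 0") auto
qed

text \<open>What remains after the first \<open>L\<close> digits is \<open>r div p ^ L\<close>,
  whose digits are all zero; hence it is zero itself.\<close>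

lemma digit_expansion:
  assumes p: "2 \<le> (p :: nat)" and "\<And>j. L \<le> j \<Longrightarrow> r div p ^ j mod p = 0"
  shows "(\<Sum>j<L. r div p ^ j mod p * p ^ j) = r"
proof -
  have "(\<Sum>j<L. r div p ^ j mod p * p ^ j) + p ^ L * (r div p ^ L) = r"
  proof (induction L)
    case (Suc L)
    define X Y D where "X = r div p ^ Suc L" and "Y = r div p ^ L" and "D = r div p ^ L mod p"
    have "X = Y div p" by (simp add: X_def Y_def div_mult2_eq[symmetric] mult.commute)
    then have Y: "Y = p * X + D" by (simp add: D_def Y_def)
    have "(\<Sum>j<L. r div p ^ j mod p * p ^ j) + p ^ L * Y = r" using Suc by (simp add: Y_def)
    then have "(\<Sum>j<L. r div p ^ j mod p * p ^ j) + D * p ^ L + p ^ Suc L * X = r"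
      by (simp add: Y algebra_simps)
    then show ?case by (simp only: sum.lessThan_Suc D_def X_def)
  qed simp
  moreover have "r div p ^ L = 0"
  proof (rule zero_digits[OF p])
    fix j show "r div p ^ L div p ^ j mod p = 0"
      using assms(2)[of "L + j"] by (simp add: power_add div_mult2_eq)
  qed
  ultimately show ?thesis by simp
qed

text \<open>A monomial of size less than \<open>p\<close> has all exponents less than
  \<open>p\<close>, so they are genuine digits and can be recovered from its image.\<close>

lemma frob_inj:
  assumes mk: "\<And>j v. lev (mk j v) = j" "\<And>j v. \<pi> (mk j v) = v" "\<And>w. mk (lev w) (\<pi> w) = w"
    and eq: "frob p lev \<pi> M = frob p lev \<pi> N" and p: "size M < p" "size N < p"
  shows "M = N"
proof (rule multiset_eqI)
  fix w
  obtain L where "lev ` set_mset (M + N) \<subseteq> {..<L}"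
    using finite_nat_bounded[of "lev ` set_mset (M + N)"] by auto
  \<comment> \<open>The number of digits must exceed \<open>lev w\<close> as well as all occurring
    levels, since \<open>w\<close> itself may occur in neither monomial.\<close>
  then have lt: "lev x < Suc (L + lev w)" if "x \<in># M \<or> x \<in># N" for x
    using that by (fastforce simp: image_subset_iff)
  have "count M (mk (lev w) (\<pi> w)) = count N (mk (lev w) (\<pi> w))"
  proof (rule digits_unique[where a = "\<lambda>j. count M (mk j (\<pi> w))" and b = "\<lambda>j. count N (mk j (\<pi> w))"
        and p = p and L = "Suc (L + lev w)" and j = "lev w"])
    show "(\<Sum>j<Suc (L + lev w). count M (mk j (\<pi> w)) * p ^ j) = (\<Sum>j<Suc (L + lev w). count N (mk j (\<pi> w)) * p ^ j)"
      using count_frob[OF mk, of M "Suc (L + lev w)" p "\<pi> w"] count_frob[OF mk, of N "Suc (L + lev w)" p "\<pi> w"] lt eq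
      by auto
    show "count M (mk j (\<pi> w)) < p" "count N (mk j (\<pi> w)) < p" for j
      using p count_le_size[of M "mk j (\<pi> w)"] count_le_size[of N "mk j (\<pi> w)"] by simp_all
  qed simp
  then show "count M w = count N w" by (simp add: mk)
qed

section \<open>The correspondence for a direct power of the group\<close>

definition group_gens :: "group_scheme \<Rightarrow> coord set" where
  "group_gens G = (case G of Additive \<Rightarrow> {CX} | Heisenberg \<Rightarrow> {CX, CY, CZ})"

lemma gens_group_gens: "gens (hopf_of G K) = group_gens G"
  by (simp add: gens_hopf_of group_gens_def)

lemma finite_group_gens: "finite (group_gens G)"
  by (cases G) (simp_all add: group_gens_def)

text \<open>A variable of the direct power is a pair of a factor index and a coordinate, and the
  factor index is its Frobenius level. On the tensor square the level forgets the side
  \<open>Inl\<close> or \<open>Inr\<close>, whereas the projection keeps it.\<close>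

abbreviation lev1 :: "nat \<times> 'c \<Rightarrow> nat" where "lev1 \<equiv> fst"
abbreviation lev2 :: "(nat \<times> 'c) + (nat \<times> 'c) \<Rightarrow> nat" where "lev2 \<equiv> case_sum fst fst"
abbreviation proj1 :: "nat \<times> 'c \<Rightarrow> 'c" where "proj1 \<equiv> snd"
abbreviation proj2 :: "(nat \<times> 'c) + (nat \<times> 'c) \<Rightarrow> 'c + 'c" where "proj2 \<equiv> map_sum snd snd"

lemma mk1: "lev1 (Pair j v) = j" "proj1 (Pair j v) = v" "Pair (lev1 w) (proj1 w) = w"
  by simp_all

lemma mk2: "lev2 (map_sum (Pair j) (Pair j) v) = j" "proj2 (map_sum (Pair j) (Pair j) v) = v"
  "map_sum (Pair (lev2 w)) (Pair (lev2 w)) (proj2 w) = w"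
proof -
  show "lev2 (map_sum (Pair j) (Pair j) v) = j" "proj2 (map_sum (Pair j) (Pair j) v) = v"
    by (cases v; simp)+
  show "map_sum (Pair (lev2 w)) (Pair (lev2 w)) (proj2 w) = w"
    by (cases w) auto
qed

text \<open>The sizes of finitely many monomials have a common bound, which \<open>p i\<close>
  exceeds almost everywhere; at those indices \<open>frob_inj\<close> applies.\<close>

lemma frobenius_corr_frob:
  fixes K :: "'i \<Rightarrow> 'a ring" and lev :: "'w \<Rightarrow> nat" and \<pi> :: "'w \<Rightarrow> 'v"
  assumes "U \<noteq> bot" "\<And>i. cring (K i)"
    and mk: "\<And>j v. lev (mk j v) = j" "\<And>j v. \<pi> (mk j v) = v" "\<And>w. mk (lev w) (\<pi> w) = w"
    and \<pi>: "\<pi> ` W \<subseteq> V" and large: "\<And>N. eventually (\<lambda>i. N < (p i :: nat)) U"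
  shows "frobenius_corr U K W V (\<lambda>i. frob (p i) lev \<pi>)"
proof (rule frobenius_corr.intro)
  fix B :: "'w multiset set" assume B: "finite B"
  obtain N where N: "\<And>M. M \<in> B \<Longrightarrow> size M < N"
    using finite_nat_bounded[of "size ` B"] B by auto
  show "eventually (\<lambda>i. inj_on (frob (p i) lev \<pi>) B) U"
    using large[of N]
  proof eventually_elim
    case (elim i)
    show ?case
    proof (rule inj_onI)
      fix M M' assume "M \<in> B" "M' \<in> B" and eq: "frob (p i) lev \<pi> M = frob (p i) lev \<pi> M'"
      then have "size M < p i" "size M' < p i" using N[of M] N[of M'] elim by simp_all
      with eq show "M = M'" by (intro frob_inj[OF mk])
    qed
  qed
next
  fix M i assume "set_mset M \<subseteq> W"
  then show "set_mset (frob (p i) lev \<pi> M) \<subseteq> V"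
    using set_frob[of "p i" lev \<pi> M] \<pi> by blast
qed (use assms in \<open>simp_all add: frob_empty frob_add\<close>)

text \<open>The index set \<open>I\<close> of the factors is left open, so that both claims become
  instances: \<open>UNIV\<close> belongs to finite height and \<open>{..<n}\<close> to height at
  most \<open>n\<close>.\<close>

locale rep_ultraproduct =
  fixes K :: "'i \<Rightarrow> 'a ring" and U :: "'i filter" and G :: group_scheme and I :: "nat set"
  assumes K_field: "\<And>i. field (K i)" and char_pos: "\<And>i. 0 < ring_char (K i)"
    and char_large: "\<And>N. eventually (\<lambda>i. N < ring_char (K i)) U"
    and U_proper: "U \<noteq> bot"
begin

abbreviation "k \<equiv> uprod_ring U K"
abbreviation "W \<equiv> I \<times> group_gens G"
abbreviation "V \<equiv> group_gens G"
abbreviation "fr i \<equiv> frob (ring_char (K i)) lev1 proj1"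
abbreviation "fr2 i \<equiv> frob (ring_char (K i)) lev2 proj2"
abbreviation "Hi i \<equiv> hopf_of G (K i)"
abbreviation "HI \<equiv> hopf_power I (hopf_of G k)"

lemma K_cring: "cring (K i)"
  using K_field by (simp add: fieldE)

lemma K_coeff: "coeff_ring (K i)"
  by (simp add: coeff_ring_def K_cring)

lemma corr1: "frobenius_corr U K W V fr"
  by (rule frobenius_corr_frob[OF U_proper K_cring mk1]) (auto simp: char_large)

lemma corr2: "frobenius_corr U K (W <+> W) (V <+> V) fr2"
  by (rule frobenius_corr_frob[OF U_proper K_cring mk2]) (auto simp: char_large)

sublocale c1: frobenius_corr U K W V fr by (rule corr1)
sublocale c2: frobenius_corr U K "W <+> W" "V <+> V" fr2 by (rule corr2)
sublocale r0: ultra_ring U K k "srel U K" by (rule ultra_ring_scalars[OF U_proper K_cring])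
sublocale r1: ultra_ring U "\<lambda>i. mpoly_ring (K i) V" "mpoly_ring k W" c1.prel by (rule c1.ultra_ring_poly)
sublocale r2: ultra_ring U "\<lambda>i. mpoly_ring (K i) (V <+> V)" "mpoly_ring k (W <+> W)" c2.prel by (rule c2.ultra_ring_poly)

lemma HI_fields [simp]: "base HI = k" "gens HI = W"
  by (simp_all add: hopf_power_def gens_group_gens)

lemma Hi_gens [simp]: "gens (Hi i) = V"
  by (rule gens_group_gens)

lemma rep_Hi: "rep_category (Hi i)"
  by (rule coeff_ring.rep_category_hopf_of[OF K_coeff])

text \<open>The characteristic passes from \<open>K i\<close> to polynomials because the unit
  polynomial is a constant.\<close>

lemma frobenius_add':
  assumes "a \<in> carrier (mpoly_ring (K i) S)" "b \<in> carrier (mpoly_ring (K i) S)"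
  shows "(a \<oplus>\<^bsub>mpoly_ring (K i) S\<^esub> b) [^]\<^bsub>mpoly_ring (K i) S\<^esub> (ring_char (K i) ^ j) =
    a [^]\<^bsub>mpoly_ring (K i) S\<^esub> (ring_char (K i) ^ j) \<oplus>\<^bsub>mpoly_ring (K i) S\<^esub> b [^]\<^bsub>mpoly_ring (K i) S\<^esub> (ring_char (K i) ^ j)"
proof -
  interpret coeff_ring "K i" by (rule K_coeff)
  interpret S: cring "mpoly_ring (K i) S" by (rule cring_mpoly)
  have "add_pow (K i) (ring_char (K i)) \<one>\<^bsub>K i\<^esub> = \<zero>\<^bsub>K i\<^esub>"
    using ring_char_prime(2)[OF K_field char_pos] by simp
  then have "add_pow (mpoly_ring (K i) S) (ring_char (K i)) \<one>\<^bsub>mpoly_ring (K i) S\<^esub> = \<zero>\<^bsub>mpoly_ring (K i) S\<^esub>"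
    using add_pow_mpoly_apply[OF S.one_closed, of "ring_char (K i)"]
    by (intro ext) (auto simp: mpoly_one indexed_monom_def)
  then show ?thesis
    using assms by (intro S.frobenius_add ring_char_prime(1) K_field char_pos)
qed

lemma prel2_var:
  assumes "w \<in> W <+> W"
  shows "c2.prel (\<lambda>i. ring.indexed_var (K i) (proj2 w) [^]\<^bsub>mpoly_ring (K i) (V <+> V)\<^esub> (ring_char (K i) ^ lev2 w))
    (ring.indexed_var k w)"
proof -
  have "c2.prel (\<lambda>i. coeff_ring.indexed_monom (K i) \<one>\<^bsub>K i\<^esub> (fr2 i {#w#})) (c1.k.indexed_monom \<one>\<^bsub>k\<^esub> {#w#})"
    using assms by (intro c2.prel_monom r0.rel_one) simp
  then show ?thesis
    by (simp add: coeff_ring.indexed_var_monom[OF K_coeff] coeff_ring.monom_pow[OF K_coeff]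
        c1.k.indexed_var_monom frob_single)
qed

text \<open>The comultiplications are defined over the prime field, so they commute with the Frobenius map.\<close>

lemma prel2_delta:
  assumes j: "j \<in> I" and v: "v \<in> V"
  shows "c2.prel (\<lambda>i. delta (Hi i) v [^]\<^bsub>mpoly_ring (K i) (V <+> V)\<^esub> (ring_char (K i) ^ j)) (delta HI (j, v))"
proof -
  let ?\<tau> = "\<lambda>w. ring.indexed_var k (map_sum (Pair j) (Pair j) w)"
  let ?x = "\<lambda>i. ring.indexed_var (K i)" and ?y = "\<lambda>w. ring.indexed_var k (map_sum (Pair j) (Pair j) w)"
  let ?P = "\<lambda>i. mpoly_ring (K i) (V <+> V)" and ?Q = "mpoly_ring k (W <+> W)"
  let ?q = "\<lambda>i. ring_char (K i) ^ j"
  have var: "c2.prel (\<lambda>i. ?x i w [^]\<^bsub>?P i\<^esub> ?q i) (?y w)" if "w \<in> V <+> V" for w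
    using prel2_var[of "map_sum (Pair j) (Pair j) w"] that j by (cases w) auto
  have xc: "?x i w \<in> carrier (?P i)" if "w \<in> V <+> V" for i w
    using that by (rule coeff_ring.var_closed[OF K_coeff])
  have \<tau>: "?\<tau> \<in> (V <+> V) \<rightarrow> carrier ?Q"
    using j by (auto intro: c1.k.var_closed)
  have \<tau>_hom: "poly_subst k (W <+> W) ?\<tau> \<in> Ring.ring_hom (mpoly_ring k (V <+> V)) ?Q"
    by (rule c1.k.poly_subst_hom[OF \<tau>])
  have \<tau>_var: "poly_subst k (W <+> W) ?\<tau> (ring.indexed_var k w) = ?y w" if "w \<in> V <+> V" for w
    using \<tau> that by (intro c1.k.poly_subst_var) auto
  have yc: "ring.indexed_var k w \<in> carrier (mpoly_ring k (V <+> V))" if "w \<in> V <+> V" for w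
    using that by (rule c1.k.var_closed)
  interpret Q': cring "mpoly_ring k (V <+> V)" by (rule c1.k.cring_mpoly)
  have delta_HI: "delta HI (j, v) = poly_subst k (W <+> W) ?\<tau> (delta (hopf_of G k) v)"
    by (simp add: hopf_power_def gens_group_gens)
  \<comment> \<open>Serves every primitive variable: the coordinate of the additive group and
    \<open>CX\<close> and \<open>CY\<close> of the Heisenberg group.\<close>
  have linear: ?thesis
    if d: "\<And>i. delta (Hi i) v = ?x i (Inr v) \<oplus>\<^bsub>?P i\<^esub> ?x i (Inl v)"
      "delta (hopf_of G k) v = ring.indexed_var k (Inr v) \<oplus>\<^bsub>mpoly_ring k (V <+> V)\<^esub> ring.indexed_var k (Inl v)"
  proof -
    have m: "Inl v \<in> V <+> V" "Inr v \<in> V <+> V" using v by auto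
    show ?thesis
      unfolding delta_HI d frobenius_add'[OF xc[OF m(2)] xc[OF m(1)]] Ring.ring_hom_add[OF \<tau>_hom yc[OF m(2)] yc[OF m(1)]]
        \<tau>_var[OF m(1)] \<tau>_var[OF m(2)]
      by (intro r2.rel_add var m)
  qed
  show ?thesis
  proof (cases G)
    case Additive
    show ?thesis
      by (rule linear) (simp_all only: Additive coeff_ring.delta_Ga[OF K_coeff] c1.k.delta_Ga)
  next
    case Heisenberg
    show ?thesis
    proof (cases v)
      case CX
      show ?thesis
        by (rule linear) (simp_all only: Heisenberg CX coeff_ring.delta_H1(1)[OF K_coeff] c1.k.delta_H1(1))
    next
      case CY
      show ?thesis
        by (rule linear) (simp_all only: Heisenberg CY coeff_ring.delta_H1(2)[OF K_coeff] c1.k.delta_H1(2))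
    next
      case CZ
      have m: "Inr CX \<in> V <+> V" "Inl CX \<in> V <+> V" "Inr CY \<in> V <+> V" "Inr CZ \<in> V <+> V" "Inl CZ \<in> V <+> V"
        by (auto simp: Heisenberg group_gens_def)
      \<comment> \<open>The mixed term is a product, so in addition to additivity of the Frobenius
        power its multiplicativity in a commutative ring enters.\<close>
      have "delta (Hi i) v [^]\<^bsub>?P i\<^esub> ?q i = ?x i (Inr CZ) [^]\<^bsub>?P i\<^esub> ?q i \<oplus>\<^bsub>?P i\<^esub>
          ?x i (Inl CX) [^]\<^bsub>?P i\<^esub> ?q i \<otimes>\<^bsub>?P i\<^esub> ?x i (Inr CY) [^]\<^bsub>?P i\<^esub> ?q i \<oplus>\<^bsub>?P i\<^esub> ?x i (Inl CZ) [^]\<^bsub>?P i\<^esub> ?q i" for i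
      proof -
        interpret P: cring "?P i" by (rule coeff_ring.cring_mpoly[OF K_coeff])
        have d: "delta (Hi i) v = ?x i (Inr CZ) \<oplus>\<^bsub>?P i\<^esub> ?x i (Inl CX) \<otimes>\<^bsub>?P i\<^esub> ?x i (Inr CY) \<oplus>\<^bsub>?P i\<^esub> ?x i (Inl CZ)"
          unfolding Heisenberg CZ by (rule coeff_ring.delta_H1(3)[OF K_coeff])
        show ?thesis
          unfolding d using xc[OF m(1)] xc[OF m(2)] xc[OF m(3)] xc[OF m(4)] xc[OF m(5)]
          by (simp add: frobenius_add' P.nat_pow_distrib)
      qed
      moreover have "delta HI (j, v) = ?y (Inr CZ) \<oplus>\<^bsub>?Q\<^esub> ?y (Inl CX) \<otimes>\<^bsub>?Q\<^esub> ?y (Inr CY) \<oplus>\<^bsub>?Q\<^esub> ?y (Inl CZ)"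
      proof -
        have d: "delta (hopf_of G k) v = ring.indexed_var k (Inr CZ) \<oplus>\<^bsub>mpoly_ring k (V <+> V)\<^esub>
            ring.indexed_var k (Inl CX) \<otimes>\<^bsub>mpoly_ring k (V <+> V)\<^esub> ring.indexed_var k (Inr CY) \<oplus>\<^bsub>mpoly_ring k (V <+> V)\<^esub>
            ring.indexed_var k (Inl CZ)"
          unfolding Heisenberg CZ by (rule c1.k.delta_H1(3))
        note y = yc[OF m(1)] yc[OF m(2)] yc[OF m(3)] yc[OF m(4)] yc[OF m(5)]
        show ?thesis
          unfolding delta_HI d using y
          by (simp only: Ring.ring_hom_add[OF \<tau>_hom] Ring.ring_hom_mult[OF \<tau>_hom] Q'.m_closed Q'.a_closed \<tau>_var m)
      qed
      ultimately show ?thesis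
        using m by (simp only:) (intro r2.rel_add r2.rel_mult var)
    qed
  qed
qed

text \<open>By \<open>prel2_delta\<close> the comultiplication of each variable is a limit of
  tuples, and limits lie in the polynomial ring.\<close>

lemma rep_HI: "rep_category HI"
proof (rule rep_category.intro)
  show "cring (base HI)" using c1.k_cring by simp
  fix w assume "w \<in> gens HI"
  then show "delta HI w \<in> carrier (coord_ring2 HI)"
    using prel2_delta c2.prel_closed by auto
qed

sublocale rk: rep_category HI by (rule rep_HI)

lemma prel_coproduct: "c1.prel P p \<Longrightarrow> c2.prel (\<lambda>i. coproduct (Hi i) (P i)) (coproduct HI p)"
  unfolding coproduct_def HI_fields Hi_gens hopf_of_fields
proof (rule c1.prel_poly_subst[OF corr2, where q = "\<lambda>i w. ring_char (K i) ^ lev1 w" and \<pi> = proj1])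
  show "delta (Hi i) v \<in> carrier (mpoly_ring (K i) (V <+> V))" if "v \<in> V" for i v
    using rep_category.delta_closed[OF rep_Hi, of v i] that by simp
  show "c2.prel (\<lambda>i. delta (Hi i) (proj1 w) [^]\<^bsub>mpoly_ring (K i) (V <+> V)\<^esub> (ring_char (K i) ^ lev1 w)) (delta HI w)"
    if "w \<in> W" for w
    using prel2_delta[of "fst w" "snd w"] that by auto
qed (auto simp: frob_single)

lemma prel_left: "c1.prel P p \<Longrightarrow> c2.prel (\<lambda>i. rep_category.left_incl (Hi i) (P i)) (rk.left_incl p)"
  unfolding rep_category.left_incl_def[OF rep_Hi] rk.left_incl_def HI_fields Hi_gens hopf_of_fields
proof (rule c1.prel_poly_subst[OF corr2, where q = "\<lambda>i w. ring_char (K i) ^ lev1 w" and \<pi> = proj1])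
  show "ring.indexed_var (K i) (Inl v) \<in> carrier (mpoly_ring (K i) (V <+> V))" if "v \<in> V" for i v
    using that by (intro coeff_ring.var_closed[OF K_coeff]) auto
  show "c2.prel (\<lambda>i. ring.indexed_var (K i) (Inl (proj1 w)) [^]\<^bsub>mpoly_ring (K i) (V <+> V)\<^esub> (ring_char (K i) ^ lev1 w))
      (ring.indexed_var k (Inl w))" if "w \<in> W" for w
    using prel2_var[of "Inl w"] that by (simp add: InlI)
qed (auto simp: frob_single)

lemma prel_right: "c1.prel P p \<Longrightarrow> c2.prel (\<lambda>i. rep_category.right_incl (Hi i) (P i)) (rk.right_incl p)"
  unfolding rep_category.right_incl_def[OF rep_Hi] rk.right_incl_def HI_fields Hi_gens hopf_of_fields
proof (rule c1.prel_poly_subst[OF corr2, where q = "\<lambda>i w. ring_char (K i) ^ lev1 w" and \<pi> = proj1])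
  show "ring.indexed_var (K i) (Inr v) \<in> carrier (mpoly_ring (K i) (V <+> V))" if "v \<in> V" for i v
    using that by (intro coeff_ring.var_closed[OF K_coeff]) auto
  show "c2.prel (\<lambda>i. ring.indexed_var (K i) (Inr (proj1 w)) [^]\<^bsub>mpoly_ring (K i) (V <+> V)\<^esub> (ring_char (K i) ^ lev1 w))
      (ring.indexed_var k (Inr w))" if "w \<in> W" for w
    using prel2_var[of "Inr w"] that by (simp add: InrI)
qed (auto simp: frob_single)

lemma srel_counit: "c1.prel P p \<Longrightarrow> srel U K (\<lambda>i. counit (Hi i) (P i)) (counit HI p)"
proof -
  assume P: "c1.prel P p"
  then obtain B where B: "c1.supported P B" by (auto simp: c1.prel_def)
  have "eventually (\<lambda>i. P i {#} \<in> carrier (K i)) U"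
    using c1.supportedD(3)[OF B] by eventually_elim simp
  then show ?thesis using c1.prel_apply[OF P, of "{#}"] by (simp add: counit_def srel_def frob_empty)
qed

text \<open>Compared with \<open>is_rep_iff\<close> the quantified size is replaced by
  \<open>dim_row a\<close>, so that each conjunct can be compared with its counterparts over the
  \<open>K i\<close> separately.\<close>

lemma is_rep_alt:
  assumes "rep_category H"
  shows "is_rep H a \<longleftrightarrow> mat_over (coord_ring H) a \<and> dim_col a = dim_row a \<and>
    map_mat (coproduct H) a = mat_comp (coord_ring2 H) (map_mat (rep_category.left_incl H) a) (map_mat (rep_category.right_incl H) a) \<and>
    map_mat (counit H) a = mat_id (base H) (dim_row a)"
proof -
  interpret rep_category H by fact
  show ?thesis unfolding is_rep_iff A.mats_def by auto
qed

text \<open>Each defining equation is an equation between limits of matrices, since coproduct,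
  inclusions and counit commute with limits. Equality of limits is equality almost everywhere, in
  both directions.\<close>

lemma is_rep_transfer:
  assumes A: "r1.mrel A a"
  shows "is_rep HI a \<longleftrightarrow> eventually (\<lambda>i. is_rep (Hi i) (A i)) U"
proof -
  have m1: "r2.mrel (\<lambda>i. map_mat (coproduct (Hi i)) (A i)) (map_mat (coproduct HI) a)"
    by (rule mrel_map[OF r1.ultra_ring_axioms r2.ultra_ring_axioms _ A, where h = "\<lambda>i. coproduct (Hi i)"]) (rule prel_coproduct)
  have m2: "r2.mrel (\<lambda>i. map_mat (rep_category.left_incl (Hi i)) (A i)) (map_mat (rk.left_incl) a)"
    by (rule mrel_map[OF r1.ultra_ring_axioms r2.ultra_ring_axioms _ A, where h = "\<lambda>i. rep_category.left_incl (Hi i)"]) (rule prel_left)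
  have m3: "r2.mrel (\<lambda>i. map_mat (rep_category.right_incl (Hi i)) (A i)) (map_mat (rk.right_incl) a)"
    by (rule mrel_map[OF r1.ultra_ring_axioms r2.ultra_ring_axioms _ A, where h = "\<lambda>i. rep_category.right_incl (Hi i)"]) (rule prel_right)
  note map2 = m1 m2 m3
  have map0: "r0.mrel (\<lambda>i. map_mat (counit (Hi i)) (A i)) (map_mat (counit HI) a)"
    by (rule mrel_map[OF r1.ultra_ring_axioms r0.ultra_ring_axioms _ A, where h = "\<lambda>i. counit (Hi i)"]) (rule srel_counit)
  note dim = r1.mrel_dim[OF A]
  have 1: "mat_over (coord_ring HI) a" "eventually (\<lambda>i. mat_over (coord_ring (Hi i)) (A i)) U"
    using r1.mrel_over[OF A] by (simp_all add: hopf_of_fields)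
  have 2: "dim_col a = dim_row a \<longleftrightarrow> eventually (\<lambda>i. dim_col (A i) = dim_row (A i)) U"
  proof
    assume "eventually (\<lambda>i. dim_col (A i) = dim_row (A i)) U"
    then have "eventually (\<lambda>i. dim_col a = dim_row a) U" using dim by eventually_elim simp
    then show "dim_col a = dim_row a" using U_proper by (simp add: eventually_const)
  next
    assume "dim_col a = dim_row a"
    then show "eventually (\<lambda>i. dim_col (A i) = dim_row (A i)) U" using dim by (auto elim: eventually_mono)
  qed
  have 3: "map_mat (coproduct HI) a = mat_comp (coord_ring2 HI) (map_mat rk.left_incl a) (map_mat rk.right_incl a) \<longleftrightarrow>
    eventually (\<lambda>i. map_mat (coproduct (Hi i)) (A i) = mat_comp (coord_ring2 (Hi i))
      (map_mat (rep_category.left_incl (Hi i)) (A i)) (map_mat (rep_category.right_incl (Hi i)) (A i))) U"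
    if d: "dim_col a = dim_row a"
    using r2.mrel_eq_iff[OF map2(1) r2.mrel_comp[OF map2(2,3)]] d
    by simp
  have 4: "map_mat (counit HI) a = mat_id (base HI) (dim_row a) \<longleftrightarrow>
    eventually (\<lambda>i. map_mat (counit (Hi i)) (A i) = mat_id (base (Hi i)) (dim_row (A i))) U"
  proof -
    have "r0.mrel (\<lambda>i. mat_id (K i) (dim_row (A i))) (mat_id k (dim_row a))"
    proof (rule r0.mrel_cong[OF r0.mrel_id])
      show "eventually (\<lambda>i. mat_id (K i) (dim_row (A i)) = mat_id (K i) (dim_row a)) U"
        using dim by eventually_elim simp
    qed
    then show ?thesis
      using r0.mrel_eq_iff[OF map0] by simp
  qed
  \<comment> \<open>The matrix product in the third conjunct is known to be a limit only for square
    matrices, so its equivalence is available only under the second conjunct.\<close>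
  have conj: "(a1 \<and> a2 \<and> a3 \<and> a4) \<longleftrightarrow> (b1 \<and> b2 \<and> b3 \<and> b4)"
    if "a1" "b1" "a2 \<longleftrightarrow> b2" "a2 \<Longrightarrow> a3 \<longleftrightarrow> b3" "a4 \<longleftrightarrow> b4" for a1 a2 a3 a4 b1 b2 b3 b4
    using that by blast
  show ?thesis
    unfolding is_rep_alt[OF rep_HI] is_rep_alt[OF rep_Hi] eventually_conj_iff
    by (rule conj[OF 1 2 3 4])
qed

lemma cmat_transfer:
  assumes "r0.mrel \<Phi> \<phi>"
  shows "r1.mrel (\<lambda>i. rep_category.cmat (Hi i) (\<Phi> i)) (rk.cmat \<phi>)"
  unfolding rep_category.cmat_def[OF rep_Hi] rk.cmat_def HI_fields hopf_of_fields
  by (rule mrel_map[OF r0.ultra_ring_axioms r1.ultra_ring_axioms _ assms, where h = "\<lambda>i. ring.indexed_const (K i)"])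
    (rule c1.prel_const)

lemma is_rep_map_alt:
  assumes "rep_category H" "is_rep H a" "is_rep H b"
  shows "is_rep_map H a b \<phi> \<longleftrightarrow> mat_over (base H) \<phi> \<and> dim_row \<phi> = dim_row b \<and> dim_col \<phi> = dim_row a \<and>
    mat_comp (coord_ring H) b (rep_category.cmat H \<phi>) = mat_comp (coord_ring H) (rep_category.cmat H \<phi>) a"
proof -
  interpret rep_category H by fact
  show ?thesis using is_rep_map_iff[OF rep_mats[OF assms(2)] rep_mats[OF assms(3)]] unfolding K.mats_def by auto
qed

lemma is_rep_map_transfer:
  assumes A: "r1.mrel A a" "is_rep HI a" and B: "r1.mrel B b" "is_rep HI b" and \<Phi>: "r0.mrel \<Phi> \<phi>"
  shows "is_rep_map HI a b \<phi> \<longleftrightarrow> eventually (\<lambda>i. is_rep_map (Hi i) (A i) (B i) (\<Phi> i)) U"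
proof -
  have reps: "eventually (\<lambda>i. is_rep (Hi i) (A i) \<and> is_rep (Hi i) (B i)) U"
    using A B is_rep_transfer by (simp add: eventually_conj_iff)
  note dims = r1.mrel_dim[OF A(1)] r1.mrel_dim[OF B(1)] r0.mrel_dim[OF \<Phi>]
  note sq = rk.A.matsD[OF rk.rep_mats[OF A(2)]] rk.A.matsD[OF rk.rep_mats[OF B(2)]]
  let ?d = "\<lambda>i. dim_row (\<Phi> i) = dim_row (B i) \<and> dim_col (\<Phi> i) = dim_row (A i)"
  let ?e = "\<lambda>i. mat_comp (mpoly_ring (K i) V) (B i) (rep_category.cmat (Hi i) (\<Phi> i)) =
      mat_comp (mpoly_ring (K i) V) (rep_category.cmat (Hi i) (\<Phi> i)) (A i)"
  have 1: "dim_row \<phi> = dim_row b \<and> dim_col \<phi> = dim_row a \<longleftrightarrow> eventually ?d U"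
  proof
    assume "eventually ?d U"
    then have "eventually (\<lambda>i. dim_row \<phi> = dim_row b \<and> dim_col \<phi> = dim_row a) U"
      using dims by eventually_elim simp
    then show "dim_row \<phi> = dim_row b \<and> dim_col \<phi> = dim_row a" using U_proper by (simp add: eventually_const)
  next
    assume d: "dim_row \<phi> = dim_row b \<and> dim_col \<phi> = dim_row a"
    show "eventually ?d U" using dims by eventually_elim (use d in simp)
  qed
  have 2: "mat_comp (mpoly_ring k W) b (rk.cmat \<phi>) = mat_comp (mpoly_ring k W) (rk.cmat \<phi>) a \<longleftrightarrow> eventually ?e U"
    if "dim_row \<phi> = dim_row b \<and> dim_col \<phi> = dim_row a"
  proof (rule r1.mrel_eq_iff)
    show "r1.mrel (\<lambda>i. mat_comp (mpoly_ring (K i) V) (B i) (rep_category.cmat (Hi i) (\<Phi> i)))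
        (mat_comp (mpoly_ring k W) b (rk.cmat \<phi>))"
      using that sq by (intro r1.mrel_comp B(1) cmat_transfer[OF \<Phi>]) (simp add: rk.cmat_def)
    show "r1.mrel (\<lambda>i. mat_comp (mpoly_ring (K i) V) (rep_category.cmat (Hi i) (\<Phi> i)) (A i))
        (mat_comp (mpoly_ring k W) (rk.cmat \<phi>) a)"
      using that sq by (intro r1.mrel_comp A(1) cmat_transfer[OF \<Phi>]) (simp add: rk.cmat_def)
  qed
  \<comment> \<open>\<open>is_rep_map_alt\<close> presupposes that both ends are representations,
    which holds only almost everywhere; the two conditions are therefore compared on a member of
    \<open>U\<close>.\<close>
  have "eventually (\<lambda>i. is_rep_map (Hi i) (A i) (B i) (\<Phi> i) \<longleftrightarrow> ?d i \<and> ?e i) U"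
    using reps r0.mrel_over(2)[OF \<Phi>]
    by eventually_elim (auto simp: is_rep_map_alt[OF rep_Hi])
  then have "eventually (\<lambda>i. is_rep_map (Hi i) (A i) (B i) (\<Phi> i)) U \<longleftrightarrow> eventually (\<lambda>i. ?d i \<and> ?e i) U"
    by (auto elim: eventually_elim2)
  moreover have "is_rep_map HI a b \<phi> \<longleftrightarrow> (dim_row \<phi> = dim_row b \<and> dim_col \<phi> = dim_row a) \<and>
      mat_comp (mpoly_ring k W) b (rk.cmat \<phi>) = mat_comp (mpoly_ring k W) (rk.cmat \<phi>) a"
    using r0.mrel_over(1)[OF \<Phi>] by (auto simp: is_rep_map_alt[OF rep_HI A(2) B(2)])
  moreover have "(a1 \<and> a2) \<longleftrightarrow> (b1 \<and> b2)" if "a1 \<longleftrightarrow> b1" "a1 \<Longrightarrow> a2 \<longleftrightarrow> b2" for a1 a2 b1 b2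
    using that by blast
  from this[OF 1 2] have "((dim_row \<phi> = dim_row b \<and> dim_col \<phi> = dim_row a) \<and>
      mat_comp (mpoly_ring k W) b (rk.cmat \<phi>) = mat_comp (mpoly_ring k W) (rk.cmat \<phi>) a) \<longleftrightarrow>
      eventually (\<lambda>i. ?d i \<and> ?e i) U"
    unfolding eventually_conj_iff .
  ultimately show ?thesis by (simp only:)
qed

end

section \<open>Heights\<close>

text \<open>\<open>Max\<close> of an infinite set carries no information. Each of the finitely many
  entries has finitely many monomials, and \<open>ring_char K ^ l\<close> determines
  \<open>l\<close> because the characteristic exceeds \<open>1\<close>.\<close>

lemma finite_height_set:
  assumes K: "field K" "0 < ring_char K" and a: "is_rep (hopf_of G K) a"
  shows "finite {m. m \<ge> 1 \<and> (\<exists>v\<in>gens (hopf_of G K). \<exists>i<rep_dim a. \<exists>j<rep_dim a.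
      (a $$ (i, j)) (replicate_mset (ring_char (base (hopf_of G K)) ^ (m - 1)) v) \<noteq> \<zero>\<^bsub>base (hopf_of G K)\<^esub>)}"
    (is "finite ?S")
proof -
  interpret coeff_ring K
    using K(1) by (simp add: coeff_ring_def fieldE)
  interpret rep: rep_category "hopf_of G K" by (rule rep_category_hopf_of)
  note ad = rep.A.matsD[OF rep.rep_mats[OF a]]
  have p: "1 < ring_char K" by (rule prime_gt_1_nat[OF ring_char_prime(1)[OF K]])
  have fin: "finite {l. (a $$ (i, j)) (replicate_mset (ring_char K ^ l) v) \<noteq> \<zero>\<^bsub>K\<^esub>}"
    if "i < rep_dim a" "j < rep_dim a" for i j v
  proof -
    have "finite {m. (a $$ (i, j)) m \<noteq> \<zero>\<^bsub>K\<^esub>}"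
      using ad(4)[OF that] unfolding hopf_of_fields mpoly_carrier is_mpoly_def by blast
    moreover have "inj (\<lambda>l. replicate_mset (ring_char K ^ l) v)"
    proof (rule injI)
      fix l l' assume "replicate_mset (ring_char K ^ l) v = replicate_mset (ring_char K ^ l') v"
      then have "ring_char K ^ l = ring_char K ^ l'" by (metis size_replicate_mset)
      then show "l = l'" using p by simp
    qed
    ultimately have "finite ((\<lambda>l. replicate_mset (ring_char K ^ l) v) -` {m. (a $$ (i, j)) m \<noteq> \<zero>\<^bsub>K\<^esub>})"
      by (rule finite_vimageI)
    then show ?thesis by (simp add: vimage_def)
  qed
  have "?S \<subseteq> Suc ` (\<Union>v\<in>gens (hopf_of G K). \<Union>i<rep_dim a. \<Union>j<rep_dim a.
      {l. (a $$ (i, j)) (replicate_mset (ring_char K ^ l) v) \<noteq> \<zero>\<^bsub>K\<^esub>})" (is "_ \<subseteq> Suc ` ?T")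
  proof
    fix m assume m: "m \<in> ?S"
    then have "m - 1 \<in> ?T" by auto
    moreover have "m = Suc (m - 1)" using m by auto
    ultimately show "m \<in> Suc ` ?T" by (rule rev_image_eqI)
  qed
  moreover have "finite ?T"
    by (intro finite_UN_I) (auto simp: gens_group_gens finite_group_gens fin)
  ultimately show ?thesis by (rule finite_subset[OF _ finite_imageI])
qed

lemma rep_height_ge:
  assumes K: "field K" "0 < ring_char K" and a: "is_rep (hopf_of G K) a"
    and "v \<in> gens (hopf_of G K)" "i < rep_dim a" "j < rep_dim a"
      "(a $$ (i, j)) (replicate_mset (ring_char K ^ l) v) \<noteq> \<zero>\<^bsub>K\<^esub>"
  shows "l < rep_height (hopf_of G K) a"
proof -
  have "Suc l \<le> rep_height (hopf_of G K) a"
    unfolding rep_height_def using assms finite_height_set[OF K a] by (intro Max_ge) auto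
  then show ?thesis by simp
qed

lemma rep_height_le:
  assumes "\<And>v i j l. v \<in> gens (hopf_of G K) \<Longrightarrow> i < rep_dim a \<Longrightarrow> j < rep_dim a \<Longrightarrow>
      (a $$ (i, j)) (replicate_mset (ring_char K ^ l) v) \<noteq> \<zero>\<^bsub>K\<^esub> \<Longrightarrow> l < L"
  shows "rep_height (hopf_of G K) a \<le> L"
proof -
  let ?S = "{m. m \<ge> 1 \<and> (\<exists>v\<in>gens (hopf_of G K). \<exists>i<rep_dim a. \<exists>j<rep_dim a.
      (a $$ (i, j)) (replicate_mset (ring_char (base (hopf_of G K)) ^ (m - 1)) v) \<noteq> \<zero>\<^bsub>base (hopf_of G K)\<^esub>)}"
  have le: "m \<le> L" if "m \<in> ?S" for m
  proof -
    from that have "m - 1 < L" "m \<ge> 1" using assms by auto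
    then show ?thesis by simp
  qed
  then have "?S \<subseteq> {..L}" by auto
  then have "finite ?S" by (rule finite_subset) simp
  then show ?thesis unfolding rep_height_def using le by (intro Max.boundedI) auto
qed

text \<open>An ultrafilter selects one of finitely many values. This turns a bound on the dimensions
  into the single size that a limit matrix must have.\<close>

lemma ultrafilter_pigeonhole:
  assumes U: "ultrafilter U" and "eventually (\<lambda>i. f i \<le> (d :: nat)) U"
  shows "\<exists>d0. eventually (\<lambda>i. f i = d0) U"
  using assms(2)
proof (induction d)
  case (Suc d)
  consider "eventually (\<lambda>i. f i = Suc d) U" | "eventually (\<lambda>i. f i \<noteq> Suc d) U"
    using U by (auto simp: ultrafilter_def)
  then show ?case
  proof cases
    case 2
    then have "eventually (\<lambda>i. f i \<le> d) U" using Suc.prems by eventually_elim simp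
    then show ?thesis by (rule Suc.IH)
  qed blast
qed auto

context rep_ultraproduct
begin

text \<open>\<open>J\<close> is the set of levels of the variables in a finite set of monomials
  supporting all entries. A pure power of \<open>v\<close> with exponent
  \<open>ring_char (K i) ^ l\<close> in the tuple has an exponent with digits only at levels from
  \<open>J\<close>, so it is less than \<open>ring_char (K i) ^ L\<close>.\<close>

lemma mrel_height_bounded:
  assumes A: "r1.mrel A a" and rep: "is_rep HI a"
  shows "\<exists>J. finite J \<and> J \<subseteq> I \<and> (\<forall>L. J \<subseteq> {..<L} \<longrightarrow> eventually (\<lambda>i. rep_height (Hi i) (A i) \<le> L) U)"
proof -
  let ?n = "rep_dim a"
  have sq: "dim_col a = ?n" using rep by (simp add: is_rep_def)
  have "\<exists>B. c1.supported (\<lambda>i. A i $$ (r, c)) B" if "r < ?n" "c < ?n" for r c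
    using r1.mrel_index[OF A, of r c] that sq by (auto simp: c1.prel_def)
  then obtain B where B: "\<And>r c. r < ?n \<Longrightarrow> c < ?n \<Longrightarrow> c1.supported (\<lambda>i. A i $$ (r, c)) (B r c)"
    by metis
  define BB where "BB = (\<Union>r<?n. \<Union>c<?n. B r c)"
  have BB: "finite BB" "\<And>M. M \<in> BB \<Longrightarrow> set_mset M \<subseteq> W"
    using c1.supportedD(1,2)[OF B] by (fastforce simp: BB_def)+
  define J where "J = fst ` (\<Union>M\<in>BB. set_mset M)"
  \<comment> \<open>Once the characteristic exceeds this bound on the sizes, all exponents of the
    monomials in \<open>BB\<close> are smaller than the characteristic.\<close>
  obtain N where N: "\<And>M. M \<in> BB \<Longrightarrow> size M < N"
    using finite_nat_bounded[of "size ` BB"] BB(1) by auto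
  have supp: "eventually (\<lambda>i. \<forall>r\<in>{..<?n}. \<forall>c\<in>{..<?n}. \<forall>m. (A i $$ (r, c)) m \<noteq> \<zero>\<^bsub>K i\<^esub> \<longrightarrow> m \<in> fr i ` BB) U"
  proof (intro eventually_ball_finite ballI)
    fix r c assume rc: "r \<in> {..<?n}" "c \<in> {..<?n}"
    then have "c1.supported (\<lambda>i. A i $$ (r, c)) (B r c)" using B by simp
    from c1.supportedD(3)[OF this]
    show "eventually (\<lambda>i. \<forall>m. (A i $$ (r, c)) m \<noteq> \<zero>\<^bsub>K i\<^esub> \<longrightarrow> m \<in> fr i ` BB) U"
      by eventually_elim (use rc in \<open>fastforce simp: BB_def\<close>)
  qed auto
  have "eventually (\<lambda>i. rep_height (Hi i) (A i) \<le> L) U" if L: "J \<subseteq> {..<L}" for L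
    using supp r1.mrel_dim[OF A] char_large[of N]
  proof eventually_elim
    case (elim i)
    show ?case
    proof (rule rep_height_le)
      fix v r c l
      assume "r < rep_dim (A i)" "c < rep_dim (A i)"
        "(A i $$ (r, c)) (replicate_mset (ring_char (K i) ^ l) v) \<noteq> \<zero>\<^bsub>K i\<^esub>"
      then have "replicate_mset (ring_char (K i) ^ l) v \<in> fr i ` BB" using elim(1,2) by auto
      then obtain M where M: "M \<in> BB" "replicate_mset (ring_char (K i) ^ l) v = fr i M" by blast
      have "lev1 w < L" if "w \<in># M" for w
        using that M(1) L by (force simp: J_def)
      then have "count (fr i M) v = (\<Sum>j<L. count M (j, v) * ring_char (K i) ^ j)"
        by (rule count_frob[OF mk1])
      also have "\<dots> < ring_char (K i) ^ L"
      proof (rule digit_sum_less)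
        show "count M (j, v) < ring_char (K i)" for j
          using count_le_size[of M "(j, v)"] N[OF M(1)] elim(3) by simp
      qed
      finally have "ring_char (K i) ^ l < ring_char (K i) ^ L"
        unfolding M(2)[symmetric] by simp
      then show "l < L"
        using prime_gt_1_nat[OF ring_char_prime(1)[OF K_field char_pos]] by (simp add: power_strict_increasing_iff)
    qed
  qed
  moreover have "finite J" "J \<subseteq> I"
    using BB by (fastforce simp: J_def)+
  ultimately show ?thesis by blast
qed

text \<open>The candidate for a preimage of \<open>m\<close> under \<open>fr i\<close>: the digit of
  the exponent of \<open>v\<close> at position \<open>j\<close> becomes the exponent of the variable
  \<open>(j, v)\<close>, for positions below \<open>L\<close>.\<close>

definition digit_monomial :: "'i \<Rightarrow> nat \<Rightarrow> coord multiset \<Rightarrow> (nat \<times> coord) multiset" where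
  "digit_monomial i L m = (\<Sum>(j, v)\<in>{..<L} \<times> V.
    replicate_mset (count m v div ring_char (K i) ^ j mod ring_char (K i)) (j, v))"

lemma count_digit_monomial:
  "count (digit_monomial i L m) (j, v) =
    (if j < L \<and> v \<in> V then count m v div ring_char (K i) ^ j mod ring_char (K i) else 0)"
proof -
  have "count (digit_monomial i L m) (j, v) = (\<Sum>w\<in>{..<L} \<times> V.
      if w = (j, v) then count m v div ring_char (K i) ^ j mod ring_char (K i) else 0)"
    unfolding digit_monomial_def count_sum by (intro sum.cong) (auto split: if_splits)
  then show ?thesis using finite_group_gens[of G] by (simp add: sum.delta)
qed

lemma fr_digit_monomial:
  assumes "set_mset m \<subseteq> V"
    and "\<And>v j. v \<in> V \<Longrightarrow> L \<le> j \<Longrightarrow> count m v div ring_char (K i) ^ j mod ring_char (K i) = 0"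
  shows "fr i (digit_monomial i L m) = m"
proof (rule multiset_eqI)
  fix v
  have lev: "lev1 w < L" if "w \<in># digit_monomial i L m" for w
    using that count_digit_monomial[of i L m "fst w" "snd w"]
    by (auto simp: count_greater_zero_iff[symmetric] simp del: count_greater_zero_iff split: if_splits)
  have c: "count (fr i (digit_monomial i L m)) v =
      (\<Sum>j<L. count (digit_monomial i L m) (j, v) * ring_char (K i) ^ j)"
    by (rule count_frob[OF mk1 lev])
  show "count (fr i (digit_monomial i L m)) v = count m v"
  proof (cases "v \<in> V")
    case True
    have "(\<Sum>j<L. count m v div ring_char (K i) ^ j mod ring_char (K i) * ring_char (K i) ^ j) = count m v"
      using prime_ge_2_nat[OF ring_char_prime(1)[OF K_field char_pos]] assms(2)[OF True] by (rule digit_expansion)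
    then show ?thesis unfolding c using True by (simp add: count_digit_monomial)
  next
    case False
    then have "count m v = 0" using assms(1) by (meson not_in_iff subsetD)
    then show ?thesis unfolding c using False by (simp add: count_digit_monomial)
  qed
qed

text \<open>The dimension bounds the digits and the height bounds their positions, both
  independently of \<open>i\<close>. A single finite set of monomials over \<open>k\<close> thus
  supports the entries in almost all components, which is all that a limit requires.\<close>

lemma mrel_of_height_bounded:
  assumes rep: "eventually (\<lambda>i. is_rep (Hi i) (A i)) U"
    and dim: "eventually (\<lambda>i. rep_dim (A i) = d) U"
    and height: "eventually (\<lambda>i. rep_height (Hi i) (A i) \<le> L) U" and L: "{..<L} \<subseteq> I"
  shows "\<exists>a. r1.mrel A a"
proof -
  \<comment> \<open>The monomials with exponents at most \<open>d\<close> in the variables of level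
    below \<open>L\<close>; written as submultisets of one multiset, they visibly form a finite
    set.\<close>
  define B where "B = {M. M \<subseteq># repeat_mset d (mset_set ({..<L} \<times> V))}"
  have B_W: "set_mset M \<subseteq> W" if "M \<in> B" for M
  proof -
    have "w \<in> {..<L} \<times> V" if "w \<in># M" for w
    proof -
      have "0 < count M w" using that by simp
      also have "\<dots> \<le> d * count (mset_set ({..<L} \<times> V)) w"
        using mset_subset_eq_count[of M "repeat_mset d (mset_set ({..<L} \<times> V))" w] \<open>M \<in> B\<close>
        unfolding B_def count_repeat_mset by blast
      finally show ?thesis using count_mset_set(3)[of w "{..<L} \<times> V"] by (cases "w \<in> {..<L} \<times> V") simp_all
    qed
    then have "set_mset M \<subseteq> {..<L} \<times> V" by blast
    then show ?thesis using L by auto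
  qed
  have supp: "eventually (\<lambda>i. (\<forall>m. (A i $$ (r, c)) m \<noteq> \<zero>\<^bsub>K i\<^esub> \<longrightarrow> m \<in> fr i ` B) \<and>
      (\<forall>m. (A i $$ (r, c)) m \<in> carrier (K i))) U"
    if rc: "r < d" "c < d" for r c
    using rep dim height
  proof eventually_elim
    case (elim i)
    interpret rc: rep_category "Hi i" by (rule rep_Hi)
    note ad = rc.A.matsD[OF rc.rep_mats[OF elim(1)]]
    have rc': "r < rep_dim (A i)" "c < rep_dim (A i)" using rc elim(2) by simp_all
    have mp: "coeff_ring.is_mpoly (K i) V (A i $$ (r, c))"
      using ad(4)[OF rc'] by (simp add: hopf_of_fields coeff_ring.mpoly_carrier[OF K_coeff])
    have "m \<in> fr i ` B" if m: "(A i $$ (r, c)) m \<noteq> \<zero>\<^bsub>K i\<^esub>" for m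
    proof (rule image_eqI)
      have digit: "count m v div ring_char (K i) ^ j mod ring_char (K i) < d"
        "count m v div ring_char (K i) ^ j mod ring_char (K i) \<noteq> 0 \<Longrightarrow> j < L" if v: "v \<in> V" for j v
      proof -
        have v': "v \<in> gens (Hi i)" using v by simp
        note supp = rep_support[OF K_field char_pos elim(1) rc' m v' refl]
        \<comment> \<open>\<open>rep_support\<close> speaks of nonzero digits only; a zero digit is
          less than \<open>d\<close> because \<open>r < d\<close> makes \<open>d\<close>
          positive.\<close>
        show "count m v div ring_char (K i) ^ j mod ring_char (K i) < d"
          using supp(1)[of j] elim(2) rc by (cases "count m v div ring_char (K i) ^ j mod ring_char (K i) = 0") auto
        assume "count m v div ring_char (K i) ^ j mod ring_char (K i) \<noteq> 0"
        then have "j < rep_height (Hi i) (A i)"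
          using supp(2)[of j] rep_height_ge[OF K_field char_pos elim(1) v'] by blast
        then show "j < L" using elim(3) by simp
      qed
      show "digit_monomial i L m \<in> B"
        unfolding B_def mem_Collect_eq subseteq_mset_def
      proof
        fix w
        show "count (digit_monomial i L m) w \<le> count (repeat_mset d (mset_set ({..<L} \<times> V))) w"
          using digit(1)[of "snd w" "fst w"] finite_group_gens[of G]
          by (cases w) (auto simp: count_digit_monomial)
      qed
      have "set_mset m \<subseteq> V" using mp m by (auto simp: coeff_ring.is_mpoly_def[OF K_coeff])
      then show "m = fr i (digit_monomial i L m)"
        using digit(2) by (intro fr_digit_monomial[symmetric]) (auto simp: not_less[symmetric])
    qed
    moreover have "(A i $$ (r, c)) m \<in> carrier (K i)" for m
      using mp by (simp add: coeff_ring.is_mpoly_def[OF K_coeff])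
    ultimately show ?case by blast
  qed
  have "c1.supported (\<lambda>i. A i $$ (r, c)) B" if "r < d" "c < d" for r c
    unfolding c1.supported_def using supp[OF that] B_W c1.k.finite_submultisets by (auto simp: B_def)
  then have "r1.mrel A (mat d d (\<lambda>(r, c) M. if set_mset M \<subseteq> W then ucl U (\<lambda>i. (A i $$ (r, c)) (fr i M)) else \<zero>\<^bsub>k\<^esub>))"
  proof (intro r1.mrelI[where B = "\<lambda>r c i. A i $$ (r, c)"], goal_cases)
    case 1
    show ?case using rep dim by eventually_elim (simp add: is_rep_def)
  next
    case (2 r c)
    then show ?case by (intro c1.prelI[where B = B]) auto
  qed
  then show ?thesis by blast
qed

end

section \<open>The strict isomorphism\<close>

lemma full_subcategory_fields [simp]:
  "Ob (full_subcategory C S) = Ob C \<inter> S"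
  "Ar (full_subcategory C S) = {f \<in> Ar C. Dm C f \<in> S \<and> Cd C f \<in> S}"
  "Dm (full_subcategory C S) = Dm C" "Cd (full_subcategory C S) = Cd C"
  "Idt (full_subcategory C S) = Idt C" "Cmp (full_subcategory C S) = Cmp C"
  "Zer (full_subcategory C S) = Zer C" "Pls (full_subcategory C S) = Pls C"
  "Scl (full_subcategory C S) = Scl C" "TnO (full_subcategory C S) = TnO C"
  "TnA (full_subcategory C S) = TnA C" "Unt (full_subcategory C S) = Unt C"
  "Asc (full_subcategory C S) = Asc C" "Com (full_subcategory C S) = Com C"
  "Lun (full_subcategory C S) = Lun C" "Run (full_subcategory C S) = Run C"
  by (simp_all add: full_subcategory_def)

lemma uprod_cat_ops:
  "Ob (uprod_cat U C) = uset U (\<lambda>i. Ob (C i))" "Ar (uprod_cat U C) = uset U (\<lambda>i. Ar (C i))"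
  "Dm (uprod_cat U C) (ucl U f) = ucl U (\<lambda>i. Dm (C i) (f i))"
  "Cd (uprod_cat U C) (ucl U f) = ucl U (\<lambda>i. Cd (C i) (f i))"
  "Idt (uprod_cat U C) (ucl U x) = ucl U (\<lambda>i. Idt (C i) (x i))"
  "Cmp (uprod_cat U C) (ucl U f) (ucl U g) = ucl U (\<lambda>i. Cmp (C i) (f i) (g i))"
  "Zer (uprod_cat U C) (ucl U x) (ucl U y) = ucl U (\<lambda>i. Zer (C i) (x i) (y i))"
  "Pls (uprod_cat U C) (ucl U f) (ucl U g) = ucl U (\<lambda>i. Pls (C i) (f i) (g i))"
  "Scl (uprod_cat U C) (ucl U c) (ucl U f) = ucl U (\<lambda>i. Scl (C i) (c i) (f i))"
  "TnO (uprod_cat U C) (ucl U x) (ucl U y) = ucl U (\<lambda>i. TnO (C i) (x i) (y i))"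
  "TnA (uprod_cat U C) (ucl U f) (ucl U g) = ucl U (\<lambda>i. TnA (C i) (f i) (g i))"
  "Unt (uprod_cat U C) = ucl U (\<lambda>i. Unt (C i))"
  "Asc (uprod_cat U C) (ucl U x) (ucl U y) (ucl U z) = ucl U (\<lambda>i. Asc (C i) (x i) (y i) (z i))"
  "Com (uprod_cat U C) (ucl U x) (ucl U y) = ucl U (\<lambda>i. Com (C i) (x i) (y i))"
  "Lun (uprod_cat U C) (ucl U x) = ucl U (\<lambda>i. Lun (C i) (x i))"
  "Run (uprod_cat U C) (ucl U x) = ucl U (\<lambda>i. Run (C i) (x i))"
  by (simp_all add: uprod_cat_def ulift1_ucl ulift2_ucl ulift3_ucl)

context rep_ultraproduct
begin

text \<open>The chosen tuple has the size of \<open>a\<close> at every index, not merely at almost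
  every one, so dimensions inside the structure maps can be rewritten without passing to a member of
  \<open>U\<close>.\<close>

definition tuple_rep :: "((nat \<times> coord) multiset \<Rightarrow> ('i \<Rightarrow> 'a) set) mat \<Rightarrow> 'i \<Rightarrow> (coord multiset \<Rightarrow> 'a) mat" where
  "tuple_rep a = (SOME A. r1.mrel A a \<and> (\<forall>i. dim_row (A i) = dim_row a \<and> dim_col (A i) = dim_col a))"

definition tuple_map :: "('i \<Rightarrow> 'a) set mat \<Rightarrow> 'i \<Rightarrow> 'a mat" where
  "tuple_map \<phi> = (SOME \<Phi>. r0.mrel \<Phi> \<phi> \<and> (\<forall>i. dim_row (\<Phi> i) = dim_row \<phi> \<and> dim_col (\<Phi> i) = dim_col \<phi>))"

lemma tuple_rep:
  assumes "mat_over (mpoly_ring k W) a"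
  shows "r1.mrel (tuple_rep a) a" "dim_row (tuple_rep a i) = dim_row a" "dim_col (tuple_rep a i) = dim_col a"
  using someI_ex[OF r1.mrel_total[OF assms], folded tuple_rep_def] by blast+

lemma tuple_map:
  assumes "mat_over k \<phi>"
  shows "r0.mrel (tuple_map \<phi>) \<phi>" "dim_row (tuple_map \<phi> i) = dim_row \<phi>" "dim_col (tuple_map \<phi> i) = dim_col \<phi>"
  using someI_ex[OF r0.mrel_total[OF assms], folded tuple_map_def] by blast+

lemma rep_over: "is_rep HI a \<Longrightarrow> mat_over (mpoly_ring k W) a"
  unfolding is_rep_alt[OF rep_HI] HI_fields by blast

lemma rep_map_over: "is_rep HI a \<Longrightarrow> is_rep HI b \<Longrightarrow> is_rep_map HI a b \<phi> \<Longrightarrow> mat_over k \<phi>"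
  unfolding is_rep_map_alt[OF rep_HI] HI_fields by blast

definition obj_class :: "((nat \<times> coord) multiset \<Rightarrow> ('i \<Rightarrow> 'a) set) mat \<Rightarrow> ('i \<Rightarrow> (coord multiset \<Rightarrow> 'a) mat) set" where
  "obj_class a = ucl U (tuple_rep a)"

fun arr_class where
  "arr_class (a, b, \<phi>) = ucl U (\<lambda>i. (tuple_rep a i, tuple_rep b i, tuple_map \<phi> i))"

lemma tuple_rep_eq: "r1.mrel A a \<Longrightarrow> eventually (\<lambda>i. tuple_rep a i = A i) U"
  using r1.mrel_eq_iff[OF tuple_rep(1)[OF r1.mrel_over(1)], of A a A a] by simp

lemma tuple_map_eq: "r0.mrel \<Phi> \<phi> \<Longrightarrow> eventually (\<lambda>i. tuple_map \<phi> i = \<Phi> i) U"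
  using r0.mrel_eq_iff[OF tuple_map(1)[OF r0.mrel_over(1)], of \<Phi> \<phi> \<Phi> \<phi>] by simp

lemma obj_class_eq: "r1.mrel A a \<Longrightarrow> obj_class a = ucl U A"
  unfolding obj_class_def ucl_eq_iff by (rule tuple_rep_eq)

lemma arr_class_eq:
  assumes "r1.mrel A a" "r1.mrel B b" "r0.mrel \<Phi> \<phi>"
  shows "arr_class (a, b, \<phi>) = ucl U (\<lambda>i. (A i, B i, \<Phi> i))"
  unfolding arr_class.simps ucl_eq_iff
  using tuple_rep_eq[OF assms(1)] tuple_rep_eq[OF assms(2)] tuple_map_eq[OF assms(3)]
  by eventually_elim simp

lemma obj_class_inj:
  assumes "is_rep HI a" "is_rep HI b" "obj_class a = obj_class b"
  shows "a = b"
  using assms r1.mrel_eq_iff[OF tuple_rep(1) tuple_rep(1)] by (simp add: obj_class_def ucl_eq_iff rep_over)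

text \<open>Unlike matrices over the coordinate rings, scalar matrices of a fixed size always have a
  limit. Fullness of the comparison therefore needs no bound beyond those on the two ends of a
  morphism.\<close>

lemma mrel_scalars_exists:
  assumes "eventually (\<lambda>i. dim_row (\<Phi> i) = n \<and> dim_col (\<Phi> i) = m \<and> mat_over (K i) (\<Phi> i)) U"
  shows "\<exists>\<phi>. r0.mrel \<Phi> \<phi>"
proof -
  have "srel U K (\<lambda>i. \<Phi> i $$ (r, c)) (ucl U (\<lambda>i. \<Phi> i $$ (r, c)))" if "r < n" "c < m" for r c
  proof -
    have "eventually (\<lambda>i. \<Phi> i $$ (r, c) \<in> carrier (K i)) U"
      using assms by eventually_elim (use that in \<open>auto simp: mat_over_def\<close>)
    then show ?thesis by (simp add: srel_def)
  qed
  then have "r0.mrel \<Phi> (mat n m (\<lambda>(r, c). ucl U (\<lambda>i. \<Phi> i $$ (r, c))))"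
  proof (intro r0.mrelI[where B = "\<lambda>r c i. \<Phi> i $$ (r, c)"], goal_cases)
    case 1
    show ?case using assms by eventually_elim simp
  qed auto
  then show ?thesis by blast
qed

lemma Rep_nonempty: "Ob (Rep (Hi i)) \<noteq> {}" "Ar (Rep (Hi i)) \<noteq> {}"
proof -
  interpret linear_tensor_category "base (Hi i)" "Rep (Hi i)"
    by (rule rep_category.rep_linear_tensor_category[OF rep_Hi])
  show "Ob (Rep (Hi i)) \<noteq> {}" using Unt_closed by blast
  show "Ar (Rep (Hi i)) \<noteq> {}" using Idt_closed[OF Unt_closed] by (auto simp: Hom_def)
qed

text \<open>\<open>S1\<close> and \<open>S2\<close> stand for the conditions on dimension and
  height. The comparison works for any two conditions that together single out exactly the tuples of
  representations having a limit.\<close>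

lemma tensor_equivalent_full_subcategory:
  assumes S: "\<And>A. eventually (\<lambda>i. is_rep (Hi i) (A i)) U \<Longrightarrow>
      ucl U A \<in> S1 \<and> ucl U A \<in> S2 \<longleftrightarrow> (\<exists>a. r1.mrel A a)"
  shows "tensor_equivalent k
    (full_subcategory (full_subcategory (uprod_cat U (\<lambda>i. Rep (Hi i))) S1) S2) (Rep HI)"
proof -
  let ?C = "full_subcategory (full_subcategory (uprod_cat U (\<lambda>i. Rep (Hi i))) S1) S2"
  note in_Ob = ucl_in_uset[of "\<lambda>i. Ob (Rep (Hi i))", OF Rep_nonempty(1)]
    and in_Ar = ucl_in_uset[of "\<lambda>i. Ar (Rep (Hi i))", OF Rep_nonempty(2)]
  note Hi_fields = rep_category.Rep_fields[OF rep_Hi, unfolded hopf_of_fields Hi_gens]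
    and HI_Rep = rk.Rep_fields[unfolded HI_fields]
  note rel = r1.mrel_kron r1.mrel_id r0.mrel_kron r0.mrel_id r0.mrel_swap r0.mrel_comp r0.mrel_zero
    tuple_rep(1) tuple_map(1) rep_over rep_map_over
  have reps: "eventually (\<lambda>i. is_rep (Hi i) (tuple_rep a i)) U" if "is_rep HI a" for a
    using is_rep_transfer[OF tuple_rep(1)[OF rep_over[OF that]]] that by simp
  have inS: "obj_class a \<in> S1" "obj_class a \<in> S2" if "is_rep HI a" for a
    using S[OF reps[OF that]] tuple_rep(1)[OF rep_over[OF that]] by (auto simp: obj_class_def)
  have arr: "eventually (\<lambda>i. is_rep_map (Hi i) (tuple_rep a i) (tuple_rep b i) (tuple_map \<phi> i)) U"
    if "is_rep HI a" "is_rep HI b" "is_rep_map HI a b \<phi>" for a b \<phi>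
    using is_rep_map_transfer[OF tuple_rep(1)[OF rep_over[OF that(1)]] that(1)
        tuple_rep(1)[OF rep_over[OF that(2)]] that(2) tuple_map(1)[OF rep_map_over[OF that]]] that(3) by simp
  have dims: "rep_dim (tuple_rep a i) = rep_dim a" if "is_rep HI a" for a i
    using tuple_rep(2)[OF rep_over[OF that]] .
  have map_dims: "dim_row \<phi> = rep_dim b \<and> dim_col \<phi> = rep_dim a"
    if "is_rep HI a" "is_rep HI b" "is_rep_map HI a b \<phi>" for a b \<phi>
    using that(3) is_rep_map_alt[OF rep_HI that(1,2)] by blast
  have "tcat_iso k (Rep HI) ?C obj_class arr_class"
  proof (rule tcat_iso.intro)
    show "linear_tensor_category k (Rep HI)"
      using rk.rep_linear_tensor_category by simp
    show "tcat_iso_axioms k (Rep HI) ?C obj_class arr_class"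
    proof (rule tcat_iso_axioms.intro, goal_cases)
      \<comment> \<open>The numbered cases follow the assumptions of \<open>tcat_iso\<close>, from
        the bijections on objects and arrows to the unit constraints.\<close>
      case 1
      show ?case
      proof
        show "obj_class ` Ob (Rep HI) \<subseteq> Ob ?C"
          using inS reps by (auto simp: rk.Ob_Rep uprod_cat_ops obj_class_def in_Ob rep_category.Ob_Rep[OF rep_Hi])
        show "Ob ?C \<subseteq> obj_class ` Ob (Rep HI)"
        proof
          fix X assume "X \<in> Ob ?C"
          then have X: "X \<in> uset U (\<lambda>i. Ob (Rep (Hi i)))" "X \<in> S1" "X \<in> S2"
            by (simp_all add: uprod_cat_ops)
          from X(1) obtain A where A: "X = ucl U A" "\<And>i. is_rep (Hi i) (A i)"
            by (auto elim!: usetE simp: rep_category.Ob_Rep[OF rep_Hi])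
          then obtain a where a: "r1.mrel A a" using S[of A] X(2,3) by auto
          moreover have "is_rep HI a" using is_rep_transfer[OF a] A(2) by simp
          ultimately show "X \<in> obj_class ` Ob (Rep HI)"
            unfolding A(1) obj_class_eq[OF a, symmetric] by (auto simp: rk.Ob_Rep)
        qed
      qed
    next
      case 2
      show ?case by (rule inj_onI) (use obj_class_inj in \<open>auto simp: rk.Ob_Rep\<close>)
    next
      case 3
      show ?case
      proof
        show "arr_class ` Ar (Rep HI) \<subseteq> Ar ?C"
        proof
          fix F assume "F \<in> arr_class ` Ar (Rep HI)"
          then obtain a b \<phi> where F: "F = arr_class (a, b, \<phi>)" and r: "is_rep HI a" "is_rep HI b" "is_rep_map HI a b \<phi>"
            by (auto simp: rk.Ar_Rep)
          have "eventually (\<lambda>i. (tuple_rep a i, tuple_rep b i, tuple_map \<phi> i) \<in> Ar (Rep (Hi i))) U"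
            using reps[OF r(1)] reps[OF r(2)] arr[OF r]
            by eventually_elim (auto simp: rep_category.Ar_Rep[OF rep_Hi])
          then show "F \<in> Ar ?C"
            using inS[OF r(1)] inS[OF r(2)] by (simp add: F uprod_cat_ops in_Ar Hi_fields obj_class_def)
        qed
        \<comment> \<open>The ends of the morphism have limits because they satisfy
          \<open>S1\<close> and \<open>S2\<close>; these fix the size of its matrix, which then has
          a limit as well.\<close>
        show "Ar ?C \<subseteq> arr_class ` Ar (Rep HI)"
        proof
          fix F assume "F \<in> Ar ?C"
          then have F: "F \<in> uset U (\<lambda>i. Ar (Rep (Hi i)))"
            "Dm (uprod_cat U (\<lambda>i. Rep (Hi i))) F \<in> S1" "Dm (uprod_cat U (\<lambda>i. Rep (Hi i))) F \<in> S2"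
            "Cd (uprod_cat U (\<lambda>i. Rep (Hi i))) F \<in> S1" "Cd (uprod_cat U (\<lambda>i. Rep (Hi i))) F \<in> S2"
            by (simp_all add: uprod_cat_ops)
          from F(1) obtain T where T: "F = ucl U T" "\<And>i. T i \<in> Ar (Rep (Hi i))"
            by (auto elim: usetE)
          define A B \<Phi> where "A i = fst (T i)" and "B i = fst (snd (T i))" and "\<Phi> i = snd (snd (T i))" for i
          have T': "T i = (A i, B i, \<Phi> i)" for i by (simp add: A_def B_def \<Phi>_def)
          have r: "is_rep (Hi i) (A i)" "is_rep (Hi i) (B i)" "is_rep_map (Hi i) (A i) (B i) (\<Phi> i)" for i
            using T(2)[of i] unfolding T' rep_category.Ar_Rep[OF rep_Hi] by auto
          have F': "F = ucl U (\<lambda>i. (A i, B i, \<Phi> i))" unfolding T(1) T'[symmetric] by simp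
          have "ucl U A \<in> S1 \<and> ucl U A \<in> S2" "ucl U B \<in> S1 \<and> ucl U B \<in> S2"
            using F(2-5) unfolding F' uprod_cat_ops Hi_fields by simp_all
          then obtain a b where ab: "r1.mrel A a" "r1.mrel B b"
            using S[of A] S[of B] r by auto
          have rab: "is_rep HI a" "is_rep HI b"
            using is_rep_transfer[OF ab(1)] is_rep_transfer[OF ab(2)] r by simp_all
          have "eventually (\<lambda>i. dim_row (\<Phi> i) = rep_dim b \<and> dim_col (\<Phi> i) = rep_dim a \<and> mat_over (K i) (\<Phi> i)) U"
            using r1.mrel_dim[OF ab(1)] r1.mrel_dim[OF ab(2)]
          proof eventually_elim
            case (elim i)
            then show ?case
              using r(3)[of i] unfolding is_rep_map_alt[OF rep_Hi r(1,2)] hopf_of_fields by simp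
          qed
          then obtain \<phi> where \<phi>: "r0.mrel \<Phi> \<phi>" using mrel_scalars_exists by blast
          have "is_rep_map HI a b \<phi>"
            using is_rep_map_transfer[OF ab(1) rab(1) ab(2) rab(2) \<phi>] r(3) by simp
          then have "(a, b, \<phi>) \<in> Ar (Rep HI)" using rab by (simp add: rk.Ar_Rep)
          moreover have "F = arr_class (a, b, \<phi>)" unfolding F' by (rule arr_class_eq[OF ab \<phi>, symmetric])
          ultimately show "F \<in> arr_class ` Ar (Rep HI)" by blast
        qed
      qed
    next
      case 4
      show ?case
      proof (rule inj_onI)
        fix f g assume "f \<in> Ar (Rep HI)" "g \<in> Ar (Rep HI)" and eq: "arr_class f = arr_class g"
        then obtain a b \<phi> a' b' \<psi> where f: "f = (a, b, \<phi>)" "is_rep HI a" "is_rep HI b" "is_rep_map HI a b \<phi>"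
          and g: "g = (a', b', \<psi>)" "is_rep HI a'" "is_rep HI b'" "is_rep_map HI a' b' \<psi>"
          by (auto simp: rk.Ar_Rep)
        have e: "eventually (\<lambda>i. tuple_rep a i = tuple_rep a' i \<and> tuple_rep b i = tuple_rep b' i \<and>
            tuple_map \<phi> i = tuple_map \<psi> i) U"
          using eq unfolding f g arr_class.simps ucl_eq_iff by simp
        have "a = a'" "b = b'"
          using obj_class_inj[OF f(2) g(2)] obj_class_inj[OF f(3) g(3)] e
          unfolding obj_class_def ucl_eq_iff eventually_conj_iff by simp_all
        moreover have "\<phi> = \<psi>"
          using r0.mrel_eq_iff[OF tuple_map(1)[OF rep_map_over[OF f(2-4)]] tuple_map(1)[OF rep_map_over[OF g(2-4)]]] e
          by (auto elim: eventually_mono)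
        ultimately show "f = g" using f(1) g(1) by simp
      qed
    next
      case (5 f)
      then show ?case by (auto simp: rk.Ar_Rep uprod_cat_ops Hi_fields obj_class_def)
    next
      case (6 f)
      then show ?case by (auto simp: rk.Ar_Rep uprod_cat_ops Hi_fields obj_class_def)
    next
      case (7 x)
      then show ?case
        by (simp add: rk.Ob_Rep obj_class_def uprod_cat_ops Hi_fields HI_Rep dims
            arr_class_eq[OF tuple_rep(1) tuple_rep(1) r0.mrel_id] rep_over del: arr_class.simps)
    next
      case (8 f g)
      then obtain a b c \<phi> \<psi> where f: "f = (a, b, \<phi>)" "is_rep HI a" "is_rep HI b" "is_rep_map HI a b \<phi>"
        and g: "g = (b, c, \<psi>)" "is_rep HI c" "is_rep_map HI b c \<psi>"
        by (auto simp: rk.Ar_Rep)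
      note over = rep_map_over[OF f(2-4)] rep_map_over[OF f(3) g(2,3)]
      have "arr_class (a, c, mat_comp k \<psi> \<phi>) = ucl U (\<lambda>i. (tuple_rep a i, tuple_rep c i, mat_comp (K i) (tuple_map \<psi> i) (tuple_map \<phi> i)))"
        using map_dims[OF f(2-4)] map_dims[OF f(3) g(2,3)] f g over
        by (intro arr_class_eq r0.mrel_comp rel) auto
      then show ?case by (simp add: f g uprod_cat_ops Hi_fields HI_Rep)
    next
      case (9 x y)
      then show ?case
        by (simp add: rk.Ob_Rep obj_class_def uprod_cat_ops Hi_fields HI_Rep dims
            arr_class_eq[OF tuple_rep(1) tuple_rep(1) r0.mrel_zero] rep_over del: arr_class.simps)
    next
      case (10 f g)
      then obtain a b \<phi> \<psi> where f: "f = (a, b, \<phi>)" "is_rep HI a" "is_rep HI b" "is_rep_map HI a b \<phi>"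
        and g: "g = (a, b, \<psi>)" "is_rep_map HI a b \<psi>"
        by (auto simp: rk.Ar_Rep)
      note over = rep_map_over[OF f(2-4)] rep_map_over[OF f(2,3) g(2)]
      have "arr_class (a, b, mat_add k (rep_dim b) (rep_dim a) \<phi> \<psi>) =
          ucl U (\<lambda>i. (tuple_rep a i, tuple_rep b i, mat_add (K i) (rep_dim b) (rep_dim a) (tuple_map \<phi> i) (tuple_map \<psi> i)))"
        using map_dims[OF f(2-4)] map_dims[OF f(2,3) g(2)] f over
        by (intro arr_class_eq r0.mrel_add tuple_rep(1) tuple_map(1) rep_over) auto
      then show ?case using f by (simp add: f g uprod_cat_ops Hi_fields HI_Rep dims)
    next
      case (11 c f)
      then obtain a b \<phi> where f: "f = (a, b, \<phi>)" "is_rep HI a" "is_rep HI b" "is_rep_map HI a b \<phi>"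
        by (auto simp: rk.Ar_Rep)
      obtain s where s: "srel U K s c" using r0.rel_total[OF 11(1)] by blast
      then have c: "c = ucl U s" by (simp add: srel_def)
      have "arr_class (a, b, mat_scl k (rep_dim b) (rep_dim a) c \<phi>) =
          ucl U (\<lambda>i. (tuple_rep a i, tuple_rep b i, mat_scl (K i) (rep_dim b) (rep_dim a) (s i) (tuple_map \<phi> i)))"
        using map_dims[OF f(2-4)] f rep_map_over[OF f(2-4)] s
        by (intro arr_class_eq r0.mrel_scl rel) auto
      then show ?case using f(2,3) by (simp add: f(1) c uprod_cat_ops Hi_fields HI_Rep dims)
    next
      case (12 x y)
      then have "obj_class (mat_kron (mpoly_ring k W) x y) = ucl U (\<lambda>i. mat_kron (mpoly_ring (K i) V) (tuple_rep x i) (tuple_rep y i))"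
        by (intro obj_class_eq rel) (simp_all add: rk.Ob_Rep)
      then show ?case by (simp add: uprod_cat_ops Hi_fields HI_Rep obj_class_def)
    next
      case (13 f g)
      then obtain a b \<phi> a' b' \<psi> where f: "f = (a, b, \<phi>)" "is_rep HI a" "is_rep HI b" "is_rep_map HI a b \<phi>"
        and g: "g = (a', b', \<psi>)" "is_rep HI a'" "is_rep HI b'" "is_rep_map HI a' b' \<psi>"
        by (auto simp: rk.Ar_Rep)
      have "arr_class (mat_kron (mpoly_ring k W) a a', mat_kron (mpoly_ring k W) b b', mat_kron k \<phi> \<psi>) =
          ucl U (\<lambda>i. (mat_kron (mpoly_ring (K i) V) (tuple_rep a i) (tuple_rep a' i),
            mat_kron (mpoly_ring (K i) V) (tuple_rep b i) (tuple_rep b' i), mat_kron (K i) (tuple_map \<phi> i) (tuple_map \<psi> i)))"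
        using f g rep_map_over[OF f(2-4)] rep_map_over[OF g(2-4)] by (intro arr_class_eq rel) auto
      then show ?case by (simp add: f(1) g(1) uprod_cat_ops Hi_fields HI_Rep)
    next
      case 14
      show ?case using obj_class_eq[OF r1.mrel_id] by (simp add: uprod_cat_ops Hi_fields HI_Rep)
    next
      case (15 x y z)
      let ?t = "mat_kron (mpoly_ring k W)" and ?T = "\<lambda>i. mat_kron (mpoly_ring (K i) V)"
      have "arr_class (?t (?t x y) z, ?t x (?t y z), mat_id k (rep_dim x * rep_dim y * rep_dim z)) =
          ucl U (\<lambda>i. (?T i (?T i (tuple_rep x i) (tuple_rep y i)) (tuple_rep z i),
            ?T i (tuple_rep x i) (?T i (tuple_rep y i) (tuple_rep z i)), mat_id (K i) (rep_dim x * rep_dim y * rep_dim z)))"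
        using 15 by (intro arr_class_eq rel) (simp_all add: rk.Ob_Rep)
      then show ?case using 15 by (simp add: uprod_cat_ops Hi_fields HI_Rep obj_class_def dims rk.Ob_Rep)
    next
      case (16 x y)
      let ?t = "mat_kron (mpoly_ring k W)" and ?T = "\<lambda>i. mat_kron (mpoly_ring (K i) V)"
      have "arr_class (?t x y, ?t y x, mat_swap k (rep_dim x) (rep_dim y)) =
          ucl U (\<lambda>i. (?T i (tuple_rep x i) (tuple_rep y i), ?T i (tuple_rep y i) (tuple_rep x i),
            mat_swap (K i) (rep_dim x) (rep_dim y)))"
        using 16 by (intro arr_class_eq rel) (simp_all add: rk.Ob_Rep)
      then show ?case using 16 by (simp add: uprod_cat_ops Hi_fields HI_Rep obj_class_def dims rk.Ob_Rep)
    next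
      case (17 x)
      have "arr_class (mat_kron (mpoly_ring k W) (mat_id (mpoly_ring k W) 1) x, x, mat_id k (rep_dim x)) =
          ucl U (\<lambda>i. (mat_kron (mpoly_ring (K i) V) (mat_id (mpoly_ring (K i) V) 1) (tuple_rep x i), tuple_rep x i,
            mat_id (K i) (rep_dim x)))"
        using 17 by (intro arr_class_eq rel) (simp_all add: rk.Ob_Rep)
      then show ?case using 17 by (simp add: uprod_cat_ops Hi_fields HI_Rep obj_class_def dims rk.Ob_Rep)
    next
      case (18 x)
      have "arr_class (mat_kron (mpoly_ring k W) x (mat_id (mpoly_ring k W) 1), x, mat_id k (rep_dim x)) =
          ucl U (\<lambda>i. (mat_kron (mpoly_ring (K i) V) (tuple_rep x i) (mat_id (mpoly_ring (K i) V) 1), tuple_rep x i,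
            mat_id (K i) (rep_dim x)))"
        using 18 by (intro arr_class_eq rel) (simp_all add: rk.Ob_Rep)
      then show ?case using 18 by (simp add: uprod_cat_ops Hi_fields HI_Rep obj_class_def dims rk.Ob_Rep)
    qed
  qed
  then show ?thesis by (rule tcat_iso.tensor_equivalent_iso)
qed


text \<open>A limit involves a finite set of levels in \<open>I\<close>, whereas the height only
  bounds the largest level. The hypothesis on \<open>I\<close> bridges the two by enclosing a finite
  set of levels in an initial segment that still lies in \<open>I\<close>.\<close>

lemma mrel_iff_bounded:
  assumes U: "ultrafilter U" and rep: "eventually (\<lambda>i. is_rep (Hi i) (A i)) U"
    and I: "\<And>J. finite J \<Longrightarrow> J \<subseteq> I \<Longrightarrow> \<exists>L. J \<subseteq> {..<L} \<and> {..<L} \<subseteq> I"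
  shows "(\<exists>a. r1.mrel A a) \<longleftrightarrow> (\<exists>d. eventually (\<lambda>i. rep_dim (A i) \<le> d) U) \<and>
    (\<exists>L. {..<L} \<subseteq> I \<and> eventually (\<lambda>i. rep_height (Hi i) (A i) \<le> L) U)"
proof
  assume "\<exists>a. r1.mrel A a"
  then obtain a where a: "r1.mrel A a" by blast
  have "is_rep HI a" using is_rep_transfer[OF a] rep by simp
  then obtain J where J: "finite J" "J \<subseteq> I"
    "\<And>L. J \<subseteq> {..<L} \<Longrightarrow> eventually (\<lambda>i. rep_height (Hi i) (A i) \<le> L) U"
    using mrel_height_bounded[OF a] by blast
  moreover have "eventually (\<lambda>i. rep_dim (A i) \<le> rep_dim a) U"
    using r1.mrel_dim[OF a] by eventually_elim simp
  ultimately show "(\<exists>d. eventually (\<lambda>i. rep_dim (A i) \<le> d) U) \<and>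
      (\<exists>L. {..<L} \<subseteq> I \<and> eventually (\<lambda>i. rep_height (Hi i) (A i) \<le> L) U)"
    using I[OF J(1,2)] by blast
next
  assume "(\<exists>d. eventually (\<lambda>i. rep_dim (A i) \<le> d) U) \<and>
      (\<exists>L. {..<L} \<subseteq> I \<and> eventually (\<lambda>i. rep_height (Hi i) (A i) \<le> L) U)"
  then obtain d L where d: "eventually (\<lambda>i. rep_dim (A i) \<le> d) U"
    and L: "{..<L} \<subseteq> I" "eventually (\<lambda>i. rep_height (Hi i) (A i) \<le> L) U" by blast
  obtain d0 where "eventually (\<lambda>i. rep_dim (A i) = d0) U"
    using ultrafilter_pigeonhole[OF U d] by blast
  then show "\<exists>a. r1.mrel A a" by (rule mrel_of_height_bounded[OF rep _ L(2,1)])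
qed

lemma bounded_dim_ucl:
  "ucl U A \<in> {X. \<exists>d. eventually (\<lambda>i. rep_dim (urep X i) \<le> d) U} \<longleftrightarrow>
    (\<exists>d. eventually (\<lambda>i. rep_dim (A i) \<le> d) U)"
proof -
  have "eventually (\<lambda>i. rep_dim (urep (ucl U A) i) \<le> d) U \<longleftrightarrow> eventually (\<lambda>i. rep_dim (A i) \<le> d) U" for d
    using urep_ucl[of U A] by (auto elim: eventually_elim2)
  then show ?thesis by simp
qed

lemma uheight_ucl_le: "uheight U Hi (ucl U A) \<le> enat n \<longleftrightarrow> eventually (\<lambda>i. rep_height (Hi i) (A i) \<le> n) U"
proof
  assume "uheight U Hi (ucl U A) \<le> enat n"
  \<comment> \<open>The essential supremum need not be related to values directly below it, but a
    strict upper bound holds almost everywhere; since heights are integers, \<open>n\<close> may be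
    replaced by the strict bound \<open>Suc n\<close>.\<close>
  also have "enat n < enat (Suc n)" by simp
  finally have "eventually (\<lambda>i. enat (rep_height (Hi i) (urep (ucl U A) i)) < enat (Suc n)) U"
    unfolding uheight_def by (rule Limsup_lessD)
  then show "eventually (\<lambda>i. rep_height (Hi i) (A i) \<le> n) U"
    using urep_ucl[of U A] by eventually_elim simp
next
  assume "eventually (\<lambda>i. rep_height (Hi i) (A i) \<le> n) U"
  then have "eventually (\<lambda>i. enat (rep_height (Hi i) (urep (ucl U A) i)) \<le> enat n) U"
    using urep_ucl[of U A] by eventually_elim simp
  then show "uheight U Hi (ucl U A) \<le> enat n"
    unfolding uheight_def by (rule Limsup_bounded)
qed

lemma uheight_ucl_finite: "uheight U Hi (ucl U A) < \<infinity> \<longleftrightarrow> (\<exists>n. eventually (\<lambda>i. rep_height (Hi i) (A i) \<le> n) U)"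
proof -
  have "uheight U Hi (ucl U A) < \<infinity> \<longleftrightarrow> (\<exists>n. uheight U Hi (ucl U A) \<le> enat n)"
    by (cases "uheight U Hi (ucl U A)") auto
  then show ?thesis by (simp only: uheight_ucl_le)
qed

end

text \<open>The complement of each point belongs to a nonprincipal ultrafilter, hence so does the
  complement of \<open>{..N}\<close>, and a strictly increasing sequence of naturals dominates its
  index.\<close>

lemma ring_char_unbounded:
  assumes "strict_mono (\<lambda>i. ring_char (K i))" "ultrafilter U" "nonprincipal U"
  shows "eventually (\<lambda>i. N < ring_char (K i)) (U :: nat filter)"
proof -
  have ne: "eventually (\<lambda>i. i \<noteq> j) U" for j
  proof (rule ccontr)
    assume "\<not> eventually (\<lambda>i. i \<noteq> j) U"
    then have j: "eventually (\<lambda>i. i = j) U" using assms(2) by (auto simp: ultrafilter_def)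
    \<comment> \<open>An ultrafilter containing the singleton of \<open>j\<close> consists of all
      sets containing \<open>j\<close>, so it is principal.\<close>
    have "eventually P U \<longleftrightarrow> P j" for P
    proof
      assume "eventually P U"
      then have "eventually (\<lambda>i. P j) U" using j by eventually_elim simp
      then show "P j" using assms(2) by (simp add: ultrafilter_def eventually_const)
    next
      assume "P j"
      then show "eventually P U" using j by (auto elim: eventually_mono)
    qed
    then have "U = principal {j}" by (intro filter_eqI) (simp add: eventually_principal)
    then show False using assms(3) by (simp add: nonprincipal_def)
  qed
  have "eventually (\<lambda>i. \<forall>j\<in>{..N}. i \<noteq> j) U" by (intro eventually_ball_finite ballI ne) simp
  then show ?thesis
  proof eventually_elim
    case (elim i)
    then have "N < i" by (metis atMost_iff not_le)
    also have "i \<le> ring_char (K i)" using strict_mono_imp_increasing[OF assms(1)] .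
    finally show ?case .
  qed
qed

theorem theorem1p5p1:
  fixes K :: "nat \<Rightarrow> 'a ring" and U :: "nat filter" and G :: group_scheme
  assumes "\<And>i. field (K i)"
    and "\<And>i. 0 < ring_char (K i)"
    and "strict_mono (\<lambda>i. ring_char (K i))"
    and "ultrafilter U" and "nonprincipal U"
  shows "tensor_equivalent (uprod_ring U K)
      (uprod_H U (\<lambda>i. hopf_of G (K i)))
      (Rep (hopf_power (UNIV :: nat set) (hopf_of G (uprod_ring U K))))
    \<and> (\<forall>n. tensor_equivalent (uprod_ring U K)
      (uprod_H_le n U (\<lambda>i. hopf_of G (K i)))
      (Rep (hopf_power {..<n} (hopf_of G (uprod_ring U K)))))"
proof (intro conjI allI)
  have rep: "rep_ultraproduct K U"
    using assms ring_char_unbounded[OF assms(3-5)] by (intro rep_ultraproduct.intro) (simp_all add: ultrafilter_def)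
  show "tensor_equivalent (uprod_ring U K) (uprod_H U (\<lambda>i. hopf_of G (K i)))
      (Rep (hopf_power (UNIV :: nat set) (hopf_of G (uprod_ring U K))))"
    unfolding uprod_H_def uprod_R_def
  proof (rule rep_ultraproduct.tensor_equivalent_full_subcategory[OF rep], goal_cases)
    case (1 A)
    have I: "\<exists>L. J \<subseteq> {..<L} \<and> {..<L} \<subseteq> UNIV" if "finite J" for J :: "nat set"
      using finite_nat_bounded[OF that] by blast
    show ?case
      using rep_ultraproduct.mrel_iff_bounded[OF rep assms(4) 1 I] rep_ultraproduct.bounded_dim_ucl[OF rep, of A]
        rep_ultraproduct.uheight_ucl_finite[OF rep, of G A]
      by simp
  qed
  fix n
  show "tensor_equivalent (uprod_ring U K) (uprod_H_le n U (\<lambda>i. hopf_of G (K i)))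
      (Rep (hopf_power {..<n} (hopf_of G (uprod_ring U K))))"
    unfolding uprod_H_le_def uprod_R_def
  proof (rule rep_ultraproduct.tensor_equivalent_full_subcategory[OF rep], goal_cases)
    case (1 A)
    have I: "\<exists>L. J \<subseteq> {..<L} \<and> {..<L} \<subseteq> {..<n}" if "J \<subseteq> {..<n}" for J :: "nat set"
      using that by blast
    \<comment> \<open>The inclusion says that \<open>L\<close> is at most \<open>n\<close>, and
      every such bound on the height implies the bound \<open>n\<close>, which is itself
      admissible.\<close>
    have "(\<exists>L. {..<L} \<subseteq> {..<n} \<and> eventually (\<lambda>i. rep_height (hopf_of G (K i)) (A i) \<le> L) U) \<longleftrightarrow>
        eventually (\<lambda>i. rep_height (hopf_of G (K i)) (A i) \<le> n) U"
      by (auto simp: lessThan_subset_iff elim!: eventually_mono)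
    then show ?case
      using rep_ultraproduct.mrel_iff_bounded[OF rep assms(4) 1 I] rep_ultraproduct.bounded_dim_ucl[OF rep, of A]
        rep_ultraproduct.uheight_ucl_le[OF rep, of G A n]
      by simp
  qed
qed

end
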